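(* Let $p$ be a prime, $X$ a nonempty totally ordered set, $S$ the free profinite group on $X$, and $n\geq2$. (a) The cohomology elements $\alpha_{w,n}$, where $w$ ranges over the Lyndon words in $X$ of length $\leq n$, form a $\mathbb{Z}/p$-linear basis of $H^2(S^{[n,p]},\mathbb{Z}/p)$. (b) When $X$ is finite, the cosets of the powers $\tau_w^{p^{n-|w|}}$, where $w$ ranges over the Lyndon words in $X$ of length $\leq n$, form a basis of the $\mathbb{Z}/p$-module $S^{(n,p)}/S^{(n+1,p)}$.
   Context: For a profinite group $G$: $G^{(1,p)}=G$, $G^{(n+1,p)}=(G^{(n,p)})^p[G,G^{(n,p)}]$ (closed subgroup generated by all $h^p$ and $[g,h]=g^{-1}h^{-1}gh$, $g\in G$, $h\in G^{(n,p)}$), and $G^{[n,p]}=G/G^{(n,p)}$. Cohomology is profinite cohomology with trivial action on $\mathbb{Z}/p$. The free profinite group $S=S_X$ on basis $X$: $X\subseteq S$ generates $S$ topologically, the inclusion converges to $1$ (every open normal subgroup contains all but finitely many elements of $X$), and every map $X\to G$ to a profinite group converging to $1$ extends uniquely to a continuous homomorphism $S\to G$. $X^*$ is the free monoid of words in $X$; $|w|$ is the length of $w$. $w_1\leq_{\rm alp}w_2$ iff $w_2=w_1v$ for some $v\in X^*$, or $w_1=vx_1u_1$, $w_2=vx_2u_2$ with $v,u_1,u_2\in X^*$ and letters $x_1<x_2$. A nonempty word is Lyndon if it is strictly smaller in $\leq_{\rm alp}$ than all its nontrivial proper suffixes. For a Lyndon word $w$ define $\tau_w\in S$ inductively: $\tau_{(x)}=x$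 for $x\in X$; if $|w|>1$, let $w=w'w''$ be the standard factorization of $w$, i.e. $w''$ is the longest proper suffix of $w$ that is a Lyndon word (then $w'$ is Lyndon too), and $\tau_w=[\tau_{w'},\tau_{w''}]$. For a profinite commutative ring $R$, $\Lambda_R\colon S\to R\langle\langle X\rangle\rangle^\times$ is the continuous (Magnus) homomorphism into the units of the ring of non-commuting formal power series with $\Lambda_R(x)=1+x$, $x\in X$; $\epsilon_{w,R}(\sigma)$ is the coefficient of $w$ in $\Lambda_R(\sigma)$. For $1\leq s\leq n$ let $\mathbb{U}=\mathbb{U}_{s+1}(\mathbb{Z}/p^{n-s+1})$ be the group of unipotent upper-triangular $(s+1)\times(s+1)$ matrices over $\mathbb{Z}/p^{n-s+1}$. It is known that $\mathbb{U}^{(n,p)}=I_{s+1}+\mathbb{Z}p^{n-s}E_{1,s+1}$ is central in $\mathbb{U}$; identify it with $\mathbb{Z}/p$ via $I_{s+1}+ap^{n-s}E_{1,s+1}\mapsto a\pmod p$. Let $\gamma_{n,s}\in H^2(\mathbb{U}^{[n,p]},\mathbb{Z}/p)$ be the class of the central extension $0\to\mathbb{Z}/p\to\mathbb{U}\to\mathbb{U}^{[n,p]}\to1$. For a word $w=(x_1\cdots x_s)$, let $\rho^w\colon S\to\mathbb{U}$ be the continuous homomorphism with $(i,j)$ entry $\epsilon_{(x_i\cdots x_{j-1}),\mathbb{Z}/p^{n-s+1}}(\sigma)$ for $i<j$, let $\bar\rho^w\colon S^{[n,p]}\to\mathbb{U}^{[n,p]}$ be the induced map, and set $\alpha_{w,n}=(\bar\rho^w)^*\gamma_{n,s}\in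 H^2(S^{[n,p]},\mathbb{Z}/p)$. *)

theory Defs
  imports
    "HOL-Analysis.Analysis"
    "HOL-Algebra.Elementary_Groups"
    "HOL-Algebra.Module"
    "HOL-Algebra.Weak_Morphisms"
    "HOL-Number_Theory.Residues"
begin

text \<open>The infix \<open>closure_of\<close> is the topological closure.\<close>

no_notation eq_closure_of (\<open>closure'_of\<index>\<close>)

section \<open>Quotient topologies\<close>

definition quotient_topology :: "'a topology \<Rightarrow> ('a \<Rightarrow> 'c) \<Rightarrow> 'c topology" where
  "quotient_topology T f =
     topology (\<lambda>U. U \<subseteq> f ` topspace T \<and> openin T {x \<in> topspace T. f x \<in> U})"

lemma openin_quotient_topology:
  "openin (quotient_topology T f) U \<longleftrightarrow>
     U \<subseteq> f ` topspace T \<and> openin T {x \<in> topspace T. f x \<in> U}"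
proof -
  have "istopology (\<lambda>U. U \<subseteq> f ` topspace T \<and> openin T {x \<in> topspace T. f x \<in> U})"
    unfolding istopology_def
  proof (intro conjI allI impI; (elim conjE)?)
    fix U V
    assume "openin T {x \<in> topspace T. f x \<in> U}" "openin T {x \<in> topspace T. f x \<in> V}"
    then have "openin T ({x \<in> topspace T. f x \<in> U} \<inter> {x \<in> topspace T. f x \<in> V})"
      by (rule openin_Int)
    also have "{x \<in> topspace T. f x \<in> U} \<inter> {x \<in> topspace T. f x \<in> V} =
        {x \<in> topspace T. f x \<in> U \<inter> V}"
      by auto
    finally show "openin T {x \<in> topspace T. f x \<in> U \<inter> V}" .
  next
    fix \<K>
    assume "\<forall>K\<in>\<K>. K \<subseteq> f ` topspace T \<and> openin T {x \<in> topspace T. f x \<in> K}"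
    then have "openin T (\<Union>K\<in>\<K>. {x \<in> topspace T. f x \<in> K})"
      by (intro openin_Union) auto
    also have "(\<Union>K\<in>\<K>. {x \<in> topspace T. f x \<in> K}) = {x \<in> topspace T. f x \<in> \<Union>\<K>}"
      by auto
    finally show "openin T {x \<in> topspace T. f x \<in> \<Union>\<K>}" .
  qed auto
  then show ?thesis
    by (simp add: quotient_topology_def topology_inverse')
qed

lemma quotient_map_quotient_topology: "quotient_map T (quotient_topology T f) f"
proof -
  have "openin (quotient_topology T f) (f ` topspace T)"
    proof -
    have "{x \<in> topspace T. f x \<in> f ` topspace T} = topspace T"
      by auto
    then show ?thesis
      by (simp add: openin_quotient_topology)
  qed
  then have "topspace (quotient_topology T f) = f ` topspace T"
    by (meson openin_quotient_topology openin_subset openin_topspace subset_antisym)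
  then show ?thesis
    by (auto simp: quotient_map_def openin_quotient_topology)
qed


section \<open>Profinite groups\<close>

locale topological_group = group G for G (structure) +
  fixes T :: "'a topology"
  assumes topspace_eq: "topspace T = carrier G"
    and continuous_mult: "continuous_map (prod_topology T T) T (\<lambda>(x, y). x \<otimes> y)"
    and continuous_inv: "continuous_map T T (\<lambda>x. inv x)"

text \<open>The open subgroups form a base of neighbourhoods of 1; equivalently, the group is compact,
  Hausdorff and totally disconnected, or an inverse limit of finite discrete groups.\<close>

locale profinite_group = topological_group +
  assumes compact: "compact_space T"
    and Hausdorff: "Hausdorff_space T"
    and open_subgroup_base:
      "openin T U \<Longrightarrow> \<one> \<in> U \<Longrightarrow> \<exists>H. subgroup H G \<and> openin T H \<and> H \<subseteq> U"

definition closed_subgroup_generated ::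
    "('a, 'b) monoid_scheme \<Rightarrow> 'a topology \<Rightarrow> 'a set \<Rightarrow> 'a set" where
  "closed_subgroup_generated G T A = T closure_of (generate G A)"

definition converges_to_one ::
    "'x set \<Rightarrow> ('a, 'b) monoid_scheme \<Rightarrow> 'a topology \<Rightarrow> ('x \<Rightarrow> 'a) \<Rightarrow> bool" where
  "converges_to_one X G T f \<longleftrightarrow>
     (\<forall>N. N \<lhd> G \<and> openin T N \<longrightarrow> finite {x \<in> X. f x \<notin> N})"

text \<open>Homomorphisms are taken to be \<open>undefined\<close> outside \<open>carrier S\<close>, so that uniqueness makes
  sense.\<close>

definition is_continuous_extension ::
    "('a, 'b) monoid_scheme \<Rightarrow> 'a topology \<Rightarrow> 'a set \<Rightarrow> ('c, 'd) monoid_scheme \<Rightarrow> 'c topology \<Rightarrow>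
     ('a \<Rightarrow> 'c) \<Rightarrow> ('a \<Rightarrow> 'c) \<Rightarrow> bool" where
  "is_continuous_extension S T X G TG f \<Phi> \<longleftrightarrow>
     \<Phi> \<in> hom S G \<and> \<Phi> \<in> extensional (carrier S) \<and> continuous_map T TG \<Phi> \<and> (\<forall>x\<in>X. \<Phi> x = f x)"

text \<open>An HOL formula cannot quantify over types, so the universal property below is stated for the
  profinite groups whose elements belong to one type depending on the type of \<open>S\<close>. That type is
  large enough for the property to hold for the profinite groups over every type, which is
  proved as \<open>free_profinite_universal\<close> at the end of this section: the closed subgroup generated
  by the image of \<open>X\<close> embeds into it.\<close>

type_synonym 'a test_type = "(bool \<times> 'a) list set set"

definition free_profinite :: "('a, 'b) monoid_scheme \<Rightarrow> 'a topology \<Rightarrow> 'a set \<Rightarrow> bool" where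
  "free_profinite S T X \<longleftrightarrow>
     profinite_group S T \<and> X \<subseteq> carrier S \<and>
     closed_subgroup_generated S T X = carrier S \<and>
     converges_to_one X S T (\<lambda>x. x) \<and>
     (\<forall>(G :: 'a test_type monoid) TG f.
        profinite_group G TG \<longrightarrow> f \<in> X \<rightarrow> carrier G \<longrightarrow> converges_to_one X G TG f \<longrightarrow>
        (\<exists>!\<Phi>. is_continuous_extension S T X G TG f \<Phi>))"

lemma (in topological_group) subgroup_closure_of:
  assumes "subgroup H G"
  shows "subgroup (T closure_of H) G"
proof (rule subgroupI)
  have H: "H \<subseteq> carrier G"
    using assms by (rule subgroup.subset)
  show "T closure_of H \<subseteq> carrier G"
    using closure_of_subset_topspace topspace_eq by metis
  have "H \<subseteq> T closure_of H"
    using H by (simp add: closure_of_subset topspace_eq)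
  then show "T closure_of H \<noteq> {}"
    using subgroup.one_closed[OF assms] by blast
  show "inv a \<in> T closure_of H" if "a \<in> T closure_of H" for a
  proof -
    have "(\<lambda>x. inv x) ` (T closure_of H) \<subseteq> T closure_of ((\<lambda>x. inv x) ` H)"
      using continuous_inv by (rule continuous_map_image_closure_subset)
    also have "\<dots> \<subseteq> T closure_of H"
      by (rule closure_of_mono) (use subgroup.m_inv_closed[OF assms] in auto)
    finally show ?thesis
      using that by blast
  qed
  show "a \<otimes> b \<in> T closure_of H" if "a \<in> T closure_of H" "b \<in> T closure_of H" for a b
  proof -
    have "(\<lambda>(x, y). x \<otimes> y) ` ((T closure_of H) \<times> (T closure_of H)) \<subseteq>
        T closure_of ((\<lambda>(x, y). x \<otimes> y) ` (H \<times> H))"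
      using continuous_map_image_closure_subset[OF continuous_mult, of "H \<times> H"]
      by (simp add: closure_of_Times)
    also have "\<dots> \<subseteq> T closure_of H"
      by (rule closure_of_mono) (use subgroup.m_closed[OF assms] in auto)
    finally show ?thesis
      using that by blast
  qed
qed

lemma (in topological_group) continuous_conj:
  "continuous_map (prod_topology T T) T (\<lambda>(g, x). inv g \<otimes> x \<otimes> g)"
proof -
  have mult: "continuous_map Z T (\<lambda>z. a z \<otimes> b z)"
    if "continuous_map Z T a" "continuous_map Z T b" for Z :: "'z topology" and a b
    using continuous_map_compose[OF continuous_map_pairedI[OF that] continuous_mult]
    by (simp add: o_def)
  have inv: "continuous_map Z T (\<lambda>z. inv (a z))" if "continuous_map Z T a"
    for Z :: "'z topology" and a
    using continuous_map_compose[OF that continuous_inv] by (simp add: o_def)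
  show ?thesis
    unfolding case_prod_beta
    by (intro mult inv continuous_map_fst continuous_map_snd)
qed

lemma (in profinite_group) open_normal_subgroup_base:
  assumes U: "openin T U" "\<one> \<in> U"
  shows "\<exists>N. N \<lhd> G \<and> openin T N \<and> N \<subseteq> U"
proof -
  obtain H where H: "subgroup H G" "openin T H" "H \<subseteq> U"
    using open_subgroup_base[OF U] by blast
  have HG: "H \<subseteq> carrier G"
    using H(1) by (rule subgroup.subset)
  define N where "N = {x \<in> carrier G. \<forall>g\<in>carrier G. inv g \<otimes> x \<otimes> g \<in> H}"
  define C where "C = {z \<in> carrier G \<times> carrier G. (\<lambda>(g, x). inv g \<otimes> x \<otimes> g) z \<in> carrier G - H}"
  have "closedin T (carrier G - H)"
    using H(2) topspace_eq by (metis closedin_diff closedin_topspace)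
  then have "closedin (prod_topology T T) C"
    using closedin_continuous_map_preimage[OF continuous_conj] unfolding C_def
    by (simp only: topspace_prod_topology topspace_eq)
  then have "closedin T (snd ` C)"
    using closed_map_snd[OF compact, of T] by (simp add: closed_map_def)
  moreover have "N = carrier G - snd ` C"
    by (force simp: N_def C_def image_iff)
  ultimately have "openin T N"
    using topspace_eq by (metis openin_diff openin_topspace)
  moreover have "N \<subseteq> H"
    using HG by (force simp: N_def)
  moreover have "N \<lhd> G"
  proof (rule normal_invI)
    show "subgroup N G"
    proof (rule subgroupI)
      show "N \<subseteq> carrier G"
        by (auto simp: N_def)
      show "N \<noteq> {}"
        using subgroup.one_closed[OF H(1)] by (auto simp: N_def)
      fix a assume a: "a \<in> N"
      have "inv g \<otimes> inv a \<otimes> g \<in> H" if g: "g \<in> carrier G" for g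
      proof -
        have "inv g \<otimes> inv a \<otimes> g = inv (inv g \<otimes> a \<otimes> g)"
          using a g by (simp add: N_def inv_mult_group m_assoc)
        then show ?thesis
          using a g subgroup.m_inv_closed[OF H(1)] by (simp add: N_def)
      qed
      then show "inv a \<in> N"
        using a by (simp add: N_def)
      fix b assume b: "b \<in> N"
      have "inv g \<otimes> (a \<otimes> b) \<otimes> g \<in> H" if g: "g \<in> carrier G" for g
      proof -
        have "inv g \<otimes> (a \<otimes> b) \<otimes> g = (inv g \<otimes> a \<otimes> g) \<otimes> (inv g \<otimes> b \<otimes> g)"
        proof -
          have "g \<otimes> (inv g \<otimes> (b \<otimes> g)) = b \<otimes> g"
            using b g by (simp add: N_def m_assoc[symmetric])
          then show ?thesis
            using a b g by (simp add: N_def m_assoc)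
        qed
        then show ?thesis
          using a b g subgroup.m_closed[OF H(1)] by (simp add: N_def)
      qed
      then show "a \<otimes> b \<in> N"
        using a b by (simp add: N_def)
    qed
  next
    fix x h assume x: "x \<in> carrier G" and h: "h \<in> N"
    have "inv g \<otimes> (x \<otimes> h \<otimes> inv x) \<otimes> g \<in> H" if g: "g \<in> carrier G" for g
    proof -
      have "inv (inv x \<otimes> g) \<otimes> h \<otimes> (inv x \<otimes> g) = inv g \<otimes> (x \<otimes> h \<otimes> inv x) \<otimes> g"
        using x h g by (simp add: N_def inv_mult_group m_assoc)
      moreover have "inv (inv x \<otimes> g) \<otimes> h \<otimes> (inv x \<otimes> g) \<in> H"
        using x h g by (simp add: N_def)
      ultimately show ?thesis
        by simp
    qed
    then show "x \<otimes> h \<otimes> inv x \<in> N"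
      using x h by (simp add: N_def)
  qed
  ultimately show ?thesis
    using H(3) by blast
qed

lemma (in profinite_group) profinite_group_closed_subgroup:
  assumes "subgroup H G" "closedin T H"
  shows "profinite_group (G\<lparr>carrier := H\<rparr>) (subtopology T H)"
proof -
  interpret H: group "G\<lparr>carrier := H\<rparr>"
    using subgroup_imp_group[OF assms(1)] .
  have HG: "H \<subseteq> carrier G"
    using assms(1) by (rule subgroup.subset)
  show ?thesis
  proof unfold_locales
    show "topspace (subtopology T H) = carrier (G\<lparr>carrier := H\<rparr>)"
      using HG topspace_eq by auto
    show "continuous_map (prod_topology (subtopology T H) (subtopology T H)) (subtopology T H)
        (\<lambda>(x, y). x \<otimes>\<^bsub>G\<lparr>carrier := H\<rparr>\<^esub> y)"
      unfolding subtopology_Times[symmetric] continuous_map_in_subtopology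
      using continuous_map_from_subtopology[OF continuous_mult] subgroup.m_closed[OF assms(1)]
      by auto
    have "continuous_map (subtopology T H) (subtopology T H) (\<lambda>x. inv x)"
      unfolding continuous_map_in_subtopology
      using continuous_map_from_subtopology[OF continuous_inv] subgroup.m_inv_closed[OF assms(1)]
      by auto
    then show "continuous_map (subtopology T H) (subtopology T H) (\<lambda>x. inv\<^bsub>G\<lparr>carrier := H\<rparr>\<^esub> x)"
      by (rule continuous_map_eq) (simp add: m_inv_consistent[OF assms(1)])
    show "compact_space (subtopology T H)"
      using closedin_compact_space[OF compact assms(2)] by (rule compact_space_subtopology)
    show "Hausdorff_space (subtopology T H)"
      using Hausdorff by (rule Hausdorff_space_subtopology)
    fix U assume "openin (subtopology T H) U" "\<one>\<^bsub>G\<lparr>carrier := H\<rparr>\<^esub> \<in> U"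
    then obtain V where V: "openin T V" "U = V \<inter> H" "\<one> \<in> V"
      by (auto simp: openin_subtopology)
    then obtain K where K: "subgroup K G" "openin T K" "K \<subseteq> V"
      using open_subgroup_base by blast
    have "subgroup (K \<inter> H) (G\<lparr>carrier := H\<rparr>)"
      using subgroups_Inter_pair[OF K(1) assms(1)] assms(1) subgroup_incl by blast
    moreover have "openin (subtopology T H) (K \<inter> H)"
      using K(2) by (auto simp: openin_subtopology)
    ultimately show "\<exists>K'. subgroup K' (G\<lparr>carrier := H\<rparr>) \<and> openin (subtopology T H) K' \<and> K' \<subseteq> U"
      using K(3) V(2) by blast
  qed
qed

lemma (in profinite_group) profinite_group_transport:
  assumes inj: "inj_on e (carrier G)"
  shows "profinite_group (image_group e G) (quotient_topology T e)"
    and "homeomorphic_map T (quotient_topology T e) e"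
    and "e \<in> iso G (image_group e G)"
proof -
  let ?G' = "image_group e G" and ?T' = "quotient_topology T e"
  interpret G': group ?G'
    using inj by (rule inj_imp_image_group_is_group)
  show iso: "e \<in> iso G ?G'"
    using inj by (rule inj_imp_image_group_iso)
  interpret e: group_hom G ?G' e
    using iso by unfold_locales (simp add: iso_def)
  show homeo: "homeomorphic_map T ?T' e"
    using inj quotient_map_quotient_topology[of T e] by (simp add: homeomorphic_map_def topspace_eq)
  obtain d where d: "homeomorphic_maps T ?T' e d"
    using homeo by (auto simp: homeomorphic_map_maps)
  have ce: "continuous_map T ?T' e" and cd: "continuous_map ?T' T d"
    and de: "\<And>x. x \<in> carrier G \<Longrightarrow> d (e x) = x"
    and ed: "\<And>y. y \<in> topspace ?T' \<Longrightarrow> e (d y) = y"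
    using d by (auto simp: homeomorphic_maps_def topspace_eq)
  have hs: "T homeomorphic_space ?T'"
    using d by (auto simp: homeomorphic_space_def)
  have top: "topspace ?T' = carrier ?G'"
    using homeomorphic_imp_surjective_map[OF homeo] by (simp add: image_group_carrier topspace_eq)
  have dG: "d y \<in> carrier G" if "y \<in> carrier ?G'" for y
    using that de by (auto simp: image_group_carrier)
  show "profinite_group ?G' ?T'"
  proof unfold_locales
    show "topspace ?T' = carrier ?G'"
      by (rule top)
    have "continuous_map (prod_topology ?T' ?T') ?T' (\<lambda>z. e (d (fst z) \<otimes> d (snd z)))"
    proof -
      have "continuous_map (prod_topology ?T' ?T') T (\<lambda>z. d (fst z))"
        "continuous_map (prod_topology ?T' ?T') T (\<lambda>z. d (snd z))"
        using continuous_map_compose[OF continuous_map_fst cd]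
          continuous_map_compose[OF continuous_map_snd cd] by (simp_all add: o_def)
      from continuous_map_compose[OF continuous_map_compose[OF continuous_map_pairedI[OF this]
            continuous_mult] ce]
      show ?thesis
        by (simp add: o_def)
    qed
    then show "continuous_map (prod_topology ?T' ?T') ?T' (\<lambda>(x, y). x \<otimes>\<^bsub>?G'\<^esub> y)"
      by (rule continuous_map_eq) (auto simp: dG top ed)
    have "continuous_map ?T' ?T' (\<lambda>y. e (inv (d y)))"
      using continuous_map_compose[OF continuous_map_compose[OF cd continuous_inv] ce]
      by (simp add: o_def)
    then show "continuous_map ?T' ?T' (\<lambda>y. inv\<^bsub>?G'\<^esub> y)"
      by (rule continuous_map_eq) (auto simp: dG top ed)
    show "compact_space ?T'"
      using compact homeomorphic_compact_space[OF hs] by simp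
    show "Hausdorff_space ?T'"
      using Hausdorff homeomorphic_Hausdorff_space[OF hs] by simp
    fix U assume U: "openin ?T' U" "\<one>\<^bsub>?G'\<^esub> \<in> U"
    then have "openin T {x \<in> carrier G. e x \<in> U}" "\<one> \<in> {x \<in> carrier G. e x \<in> U}"
      using openin_continuous_map_preimage[OF ce U(1)] U(2)
      by (simp_all only: topspace_eq image_group_one mem_Collect_eq one_closed simp_thms)
    then obtain H where H: "subgroup H G" "openin T H" "H \<subseteq> {x \<in> carrier G. e x \<in> U}"
      using open_subgroup_base by blast
    have "openin ?T' (e ` H)"
      using H(2) homeomorphic_imp_open_map[OF homeo] by (simp add: open_map_def)
    moreover have "subgroup (e ` H) ?G'"
      using H(1) by (rule e.subgroup_img_is_subgroup)
    ultimately show "\<exists>H'. subgroup H' ?G' \<and> openin ?T' H' \<and> H' \<subseteq> U"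
      using H(3) by blast
  qed
qed

lemma continuous_extension_unique:
  assumes S: "profinite_group S T" "X \<subseteq> carrier S" "closed_subgroup_generated S T X = carrier S"
    and G: "profinite_group G TG"
    and \<Phi>: "is_continuous_extension S T X G TG f \<Phi>"
    and \<Psi>: "is_continuous_extension S T X G TG f \<Psi>"
  shows "\<Phi> = \<Psi>"
proof (rule extensionalityI)
  interpret S: profinite_group S T by (rule S)
  interpret G: profinite_group G TG by (rule G)
  interpret \<Phi>: group_hom S G \<Phi>
    using \<Phi> by unfold_locales (simp add: is_continuous_extension_def)
  interpret \<Psi>: group_hom S G \<Psi>
    using \<Psi> by unfold_locales (simp add: is_continuous_extension_def)
  show "\<Phi> \<in> extensional (carrier S)" "\<Psi> \<in> extensional (carrier S)"
    using \<Phi> \<Psi> by (auto simp: is_continuous_extension_def)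
  have sub: "generate S X \<subseteq> carrier S"
    using S(2) by (rule S.generate_incl)
  have "\<Phi> x = \<Psi> x" if "x \<in> generate S X" for x
    using that
  proof induction
    case (incl h)
    then show ?case
      using \<Phi> \<Psi> by (auto simp: is_continuous_extension_def)
  next
    case (inv h)
    then have "h \<in> carrier S" "\<Phi> h = \<Psi> h"
      using \<Phi> \<Psi> S(2) by (auto simp: is_continuous_extension_def)
    then show ?case
      by simp
  next
    case (eng h1 h2)
    then have "h1 \<in> carrier S" "h2 \<in> carrier S"
      using sub by auto
    then show ?case
      using eng by simp
  qed simp
  then show "\<Phi> x = \<Psi> x" if "x \<in> carrier S" for x
    using that forall_in_closure_of_eq[of x T "generate S X" TG \<Phi> \<Psi>] G.Hausdorff \<Phi> \<Psi> S(3)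
    by (simp add: closed_subgroup_generated_def is_continuous_extension_def)
qed

theorem free_profinite_universal:
  fixes S :: "('a, 'b) monoid_scheme" and G :: "('c, 'd) monoid_scheme"
  assumes S: "free_profinite S T X"
    and G: "profinite_group G TG" and f: "f \<in> X \<rightarrow> carrier G" and conv: "converges_to_one X G TG f"
  shows "\<exists>!\<Phi>. is_continuous_extension S T X G TG f \<Phi>"
proof (rule ex_ex1I)
  interpret G: profinite_group G TG by (rule G)
  define D where "D = generate G (f ` X)"
  have fX: "f ` X \<subseteq> carrier G"
    using f by auto
  have D: "subgroup D G"
    unfolding D_def using fX by (rule G.generate_is_subgroup)
  have DG: "D \<subseteq> carrier G"
    using D by (rule subgroup.subset)
  define H where "H = TG closure_of D"
  have H: "subgroup H G" "closedin TG H"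
    unfolding H_def using D by (auto intro: G.subgroup_closure_of)
  have HG: "H \<subseteq> carrier G"
    using H(1) by (rule subgroup.subset)
  have DH: "D \<subseteq> H"
    unfolding H_def using DG by (simp add: closure_of_subset G.topspace_eq)
  have fH: "f x \<in> H" if "x \<in> X" for x
    using that DH generate.incl[of "f x" "f ` X" G] by (auto simp: D_def)
  interpret H: profinite_group "G\<lparr>carrier := H\<rparr>" "subtopology TG H"
    using H by (rule G.profinite_group_closed_subgroup)

  text \<open>The elements of \<open>D\<close> are values of words, which yields an injection of \<open>H\<close> into the
    test type.\<close>

  define ev :: "(bool \<times> 'a) list \<Rightarrow> 'c" where
    "ev ws = foldr (\<lambda>(b, x) g. (if b then f x else inv\<^bsub>G\<^esub> (f x)) \<otimes>\<^bsub>G\<^esub> g) ws \<one>\<^bsub>G\<^esub>" for ws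
  have ev_closed: "ev ws \<in> carrier G" if "snd ` set ws \<subseteq> X" for ws
    using that
  proof (induction ws)
    case (Cons a ws)
    then have "f (snd a) \<in> carrier G" "ev ws \<in> carrier G"
      using f by auto
    then show ?case
      by (cases a) (simp add: ev_def)
  qed (simp add: ev_def)
  have ev_append: "ev (us @ ws) = ev us \<otimes>\<^bsub>G\<^esub> ev ws"
    if "snd ` set us \<subseteq> X" "snd ` set ws \<subseteq> X" for us ws
    using that(1)
  proof (induction us)
    case Nil
    then show ?case
      using ev_closed[OF that(2)] by (simp add: ev_def)
  next
    case (Cons a us)
    obtain b x where a: "a = (b, x)" by fastforce
    let ?g = "if b then f x else inv\<^bsub>G\<^esub> (f x)"
    have "?g \<in> carrier G"
      using Cons.prems f by (auto simp: a)
    moreover have "ev us \<in> carrier G" "ev ws \<in> carrier G"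
      using Cons.prems ev_closed that(2) by auto
    moreover have "ev (a # vs) = ?g \<otimes>\<^bsub>G\<^esub> ev vs" for vs
      by (simp add: ev_def a)
    ultimately show ?case
      using Cons by (simp add: G.m_assoc)
  qed
  have "\<exists>ws. snd ` set ws \<subseteq> X \<and> d = ev ws" if "d \<in> D" for d
    using that unfolding D_def
  proof induction
    case one
    then show ?case
      by (intro exI[of _ "[]"]) (simp add: ev_def)
  next
    case (incl h)
    then obtain x where "x \<in> X" "h = f x" "f x \<in> carrier G"
      using f by auto
    then show ?case
      by (intro exI[of _ "[(True, x)]"]) (simp add: ev_def)
  next
    case (inv h)
    then obtain x where "x \<in> X" "h = f x" "f x \<in> carrier G"
      using f by auto
    then show ?case
      by (intro exI[of _ "[(False, x)]"]) (simp add: ev_def)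
  next
    case (eng h1 h2)
    then obtain us ws where "snd ` set us \<subseteq> X" "h1 = ev us" "snd ` set ws \<subseteq> X" "h2 = ev ws"
      by blast
    then show ?case
      by (intro exI[of _ "us @ ws"]) (auto simp: ev_append)
  qed
  then have D_ev: "\<exists>ws. d = ev ws" if "d \<in> D" for d
    using that by blast
  define e :: "'c \<Rightarrow> 'a test_type" where "e h = {A. h \<in> TG closure_of (ev ` A)}" for h
  have "inj_on e H"
  proof (rule inj_onI, rule ccontr)
    fix h k assume hk: "h \<in> H" "k \<in> H" "e h = e k" "h \<noteq> k"
    then obtain U V where UV: "openin TG U" "openin TG V" "h \<in> U" "k \<in> V" "disjnt U V"
      using G.Hausdorff HG unfolding Hausdorff_space_def G.topspace_eq by (meson subsetD)
    define A where "A = {ws. ev ws \<in> U}"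
    have "h \<in> TG closure_of (ev ` A)"
      unfolding in_closure_of
    proof (intro conjI allI impI)
      show "h \<in> topspace TG"
        using hk HG G.topspace_eq by auto
      fix W assume W: "h \<in> W \<and> openin TG W"
      then have "openin TG (W \<inter> U)" "h \<in> W \<inter> U"
        using UV by auto
      then obtain d where "d \<in> D" "d \<in> W \<inter> U"
        using hk(1) unfolding H_def in_closure_of by blast
      moreover obtain ws where "d = ev ws"
        using D_ev[OF \<open>d \<in> D\<close>] by blast
      ultimately show "\<exists>y. y \<in> ev ` A \<and> y \<in> W"
        unfolding A_def by blast
    qed
    moreover have "k \<notin> TG closure_of (ev ` A)"
    proof
      assume "k \<in> TG closure_of (ev ` A)"
      then obtain y where "y \<in> ev ` A" "y \<in> V"
        using UV(2,4) unfolding in_closure_of by blast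
      then show False
        using UV(5) unfolding A_def disjnt_iff by blast
    qed
    ultimately show False
      using hk(3) by (auto simp: e_def)
  qed
  then have inj: "inj_on e (carrier (G\<lparr>carrier := H\<rparr>))"
    by simp

  let ?G' = "image_group e (G\<lparr>carrier := H\<rparr>)" and ?T' = "quotient_topology (subtopology TG H) e"
  note transport = H.profinite_group_transport[OF inj]
  obtain d where d: "homeomorphic_maps (subtopology TG H) ?T' e d"
    using transport(2) by (auto simp: homeomorphic_map_maps)
  have topH: "topspace (subtopology TG H) = H"
    using H.topspace_eq by simp
  have cd: "continuous_map ?T' (subtopology TG H) d" and ce: "continuous_map (subtopology TG H) ?T' e"
    and de: "\<And>x. x \<in> H \<Longrightarrow> d (e x) = x"
    using d topH by (auto simp: homeomorphic_maps_def)
  have carr: "carrier ?G' = e ` H"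
    by (simp add: image_group_carrier)
  have e_hom: "e \<in> hom (G\<lparr>carrier := H\<rparr>) ?G'"
    using transport(3) by (simp add: iso_def)
  have d_hom: "d (x \<otimes>\<^bsub>?G'\<^esub> y) = d x \<otimes>\<^bsub>G\<^esub> d y" if xy: "x \<in> carrier ?G'" "y \<in> carrier ?G'" for x y
  proof -
    obtain a b where ab: "a \<in> H" "x = e a" "b \<in> H" "y = e b"
      using xy by (auto simp: carr)
    then have "x \<otimes>\<^bsub>?G'\<^esub> y = e (a \<otimes>\<^bsub>G\<^esub> b)"
      using hom_mult[OF e_hom, of a b] by simp
    then show ?thesis
      using ab de subgroup.m_closed[OF H(1)] by simp
  qed
  have "converges_to_one X ?G' ?T' (\<lambda>x. e (f x))"
    unfolding converges_to_one_def
  proof (intro allI impI, elim conjE)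
    fix N assume N: "N \<lhd> ?G'" "openin ?T' N"
    have "openin (subtopology TG H) {h \<in> H. e h \<in> N}"
      using openin_continuous_map_preimage[OF ce N(2)] by (simp only: topH)
    then obtain V where V: "openin TG V" "{h \<in> H. e h \<in> N} = V \<inter> H"
      by (auto simp: openin_subtopology)
    have "\<one>\<^bsub>?G'\<^esub> \<in> N"
      using N(1) by (simp add: normal_def subgroup.one_closed)
    then have "\<one>\<^bsub>G\<^esub> \<in> {h \<in> H. e h \<in> N}"
      using subgroup.one_closed[OF H(1)] by (simp add: image_group_one)
    then obtain M where M: "M \<lhd> G" "openin TG M" "M \<subseteq> V"
      using G.open_normal_subgroup_base V by blast
    have "{x \<in> X. e (f x) \<notin> N} \<subseteq> {x \<in> X. f x \<notin> M}"
      using M(3) V(2) fH by blast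
    then show "finite {x \<in> X. e (f x) \<notin> N}"
      using conv M finite_subset unfolding converges_to_one_def by blast
  qed
  moreover have "(\<lambda>x. e (f x)) \<in> X \<rightarrow> carrier ?G'"
    using fH by (auto simp: carr)
  ultimately obtain \<Psi> where \<Psi>: "is_continuous_extension S T X ?G' ?T' (\<lambda>x. e (f x)) \<Psi>"
    using S transport(1) unfolding free_profinite_def by blast
  interpret S: profinite_group S T
    using S by (simp add: free_profinite_def)
  have dH: "d y \<in> H" if "y \<in> carrier ?G'" for y
    using that de by (auto simp: carr)
  have \<Psi>_hom: "\<Psi> \<in> hom S ?G'"
    using \<Psi> by (simp add: is_continuous_extension_def)
  have \<Psi>_closed: "\<Psi> x \<in> carrier ?G'" if "x \<in> carrier S" for x
    using hom_in_carrier[OF \<Psi>_hom that] .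
  show "\<exists>\<Phi>. is_continuous_extension S T X G TG f \<Phi>"
  proof (intro exI)
    show "is_continuous_extension S T X G TG f (\<lambda>x\<in>carrier S. d (\<Psi> x))"
      unfolding is_continuous_extension_def
    proof (intro conjI ballI)
      show "(\<lambda>x\<in>carrier S. d (\<Psi> x)) \<in> hom S G"
      proof (rule homI)
        fix x y assume xy: "x \<in> carrier S" "y \<in> carrier S"
        show "(\<lambda>x\<in>carrier S. d (\<Psi> x)) x \<in> carrier G"
          using xy dH[OF \<Psi>_closed] HG by auto
        show "(\<lambda>x\<in>carrier S. d (\<Psi> x)) (x \<otimes>\<^bsub>S\<^esub> y) =
            (\<lambda>x\<in>carrier S. d (\<Psi> x)) x \<otimes>\<^bsub>G\<^esub> (\<lambda>x\<in>carrier S. d (\<Psi> x)) y"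
          using xy \<Psi>_closed d_hom hom_mult[OF \<Psi>_hom xy] by simp
      qed
      have "continuous_map T ?T' \<Psi>"
        using \<Psi> by (simp add: is_continuous_extension_def)
      then have "continuous_map T (subtopology TG H) (d \<circ> \<Psi>)"
        using cd by (rule continuous_map_compose)
      then have "continuous_map T TG (d \<circ> \<Psi>)"
        by (simp add: continuous_map_in_subtopology)
      then show "continuous_map T TG (\<lambda>x\<in>carrier S. d (\<Psi> x))"
        by (rule continuous_map_eq) (simp add: S.topspace_eq)
      fix x assume x: "x \<in> X"
      then have "\<Psi> x = e (f x)" "x \<in> carrier S"
        using \<Psi> S by (auto simp: is_continuous_extension_def free_profinite_def)
      then show "(\<lambda>x\<in>carrier S. d (\<Psi> x)) x = f x"
        using de fH x by simp
    qed simp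
  qed
next
  fix \<Phi> \<Psi>
  assume "is_continuous_extension S T X G TG f \<Phi>" "is_continuous_extension S T X G TG f \<Psi>"
  then show "\<Phi> = \<Psi>"
    using continuous_extension_unique S G unfolding free_profinite_def by blast
qed

section \<open>The lower \<open>p\<close>-central series\<close>

definition gcommutator :: "('a, 'b) monoid_scheme \<Rightarrow> 'a \<Rightarrow> 'a \<Rightarrow> 'a" where
  "gcommutator G g h = inv\<^bsub>G\<^esub> g \<otimes>\<^bsub>G\<^esub> inv\<^bsub>G\<^esub> h \<otimes>\<^bsub>G\<^esub> g \<otimes>\<^bsub>G\<^esub> h"

text \<open>The series is indexed from 1; the value at 0 is a dummy.\<close>

fun lower_p_central ::
    "('a, 'b) monoid_scheme \<Rightarrow> 'a topology \<Rightarrow> nat \<Rightarrow> nat \<Rightarrow> 'a set" where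
  "lower_p_central G T p 0 = carrier G"
| "lower_p_central G T p (Suc 0) = carrier G"
| "lower_p_central G T p (Suc (Suc n)) =
     closed_subgroup_generated G T
       ({h [^]\<^bsub>G\<^esub> p | h. h \<in> lower_p_central G T p (Suc n)} \<union>
        {gcommutator G g h | g h. g \<in> carrier G \<and> h \<in> lower_p_central G T p (Suc n)})"

definition p_quotient :: "('a, 'b) monoid_scheme \<Rightarrow> 'a topology \<Rightarrow> nat \<Rightarrow> nat \<Rightarrow> 'a set monoid" where
  "p_quotient G T p n = G Mod lower_p_central G T p n"

definition p_quotient_map ::
    "('a, 'b) monoid_scheme \<Rightarrow> 'a topology \<Rightarrow> nat \<Rightarrow> nat \<Rightarrow> 'a \<Rightarrow> 'a set" where
  "p_quotient_map G T p n g = lower_p_central G T p n #>\<^bsub>G\<^esub> g"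

definition p_quotient_topology ::
    "('a, 'b) monoid_scheme \<Rightarrow> 'a topology \<Rightarrow> nat \<Rightarrow> nat \<Rightarrow> 'a set topology" where
  "p_quotient_topology G T p n = quotient_topology T (p_quotient_map G T p n)"


section \<open>Continuous cohomology in degree 2, with trivial action on a discrete abelian group\<close>

text \<open>Coefficient groups are written multiplicatively, as in \<open>integer_mod_group\<close>.\<close>

definition cochain_add ::
    "'g set \<Rightarrow> ('c, 'd) monoid_scheme \<Rightarrow> ('g \<Rightarrow> 'c) \<Rightarrow> ('g \<Rightarrow> 'c) \<Rightarrow> ('g \<Rightarrow> 'c)" where
  "cochain_add D A c d = (\<lambda>x\<in>D. c x \<otimes>\<^bsub>A\<^esub> d x)"

definition cocycles2 ::
    "('a, 'b) monoid_scheme \<Rightarrow> 'a topology \<Rightarrow> ('c, 'd) monoid_scheme \<Rightarrow> ('a \<times> 'a \<Rightarrow> 'c) set" where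
  "cocycles2 G T A =
     {c \<in> carrier G \<times> carrier G \<rightarrow>\<^sub>E carrier A.
        continuous_map (prod_topology T T) (discrete_topology (carrier A)) c \<and>
        (\<forall>g\<in>carrier G. \<forall>h\<in>carrier G. \<forall>k\<in>carrier G.
           c (h, k) \<otimes>\<^bsub>A\<^esub> c (g, h \<otimes>\<^bsub>G\<^esub> k) = c (g \<otimes>\<^bsub>G\<^esub> h, k) \<otimes>\<^bsub>A\<^esub> c (g, h))}"

definition coboundary ::
    "('a, 'b) monoid_scheme \<Rightarrow> ('c, 'd) monoid_scheme \<Rightarrow> ('a \<Rightarrow> 'c) \<Rightarrow> ('a \<times> 'a \<Rightarrow> 'c)" where
  "coboundary G A b =
     (\<lambda>(g, h)\<in>carrier G \<times> carrier G. b h \<otimes>\<^bsub>A\<^esub> inv\<^bsub>A\<^esub> (b (g \<otimes>\<^bsub>G\<^esub> h)) \<otimes>\<^bsub>A\<^esub> b g)"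

definition coboundaries2 ::
    "('a, 'b) monoid_scheme \<Rightarrow> 'a topology \<Rightarrow> ('c, 'd) monoid_scheme \<Rightarrow> ('a \<times> 'a \<Rightarrow> 'c) set" where
  "coboundaries2 G T A =
     {coboundary G A b | b. continuous_map T (discrete_topology (carrier A)) b}"

definition cocycle_group ::
    "('a, 'b) monoid_scheme \<Rightarrow> 'a topology \<Rightarrow> ('c, 'd) monoid_scheme \<Rightarrow> ('a \<times> 'a \<Rightarrow> 'c) monoid" where
  "cocycle_group G T A =
     \<lparr>carrier = cocycles2 G T A,
      mult = cochain_add (carrier G \<times> carrier G) A,
      one = (\<lambda>x\<in>carrier G \<times> carrier G. \<one>\<^bsub>A\<^esub>)\<rparr>"

definition H2 ::
    "('a, 'b) monoid_scheme \<Rightarrow> 'a topology \<Rightarrow> ('c, 'd) monoid_scheme \<Rightarrow> ('a \<times> 'a \<Rightarrow> 'c) set monoid" where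
  "H2 G T A = cocycle_group G T A Mod coboundaries2 G T A"

definition H2_class ::
    "('a, 'b) monoid_scheme \<Rightarrow> 'a topology \<Rightarrow> ('c, 'd) monoid_scheme \<Rightarrow> ('a \<times> 'a \<Rightarrow> 'c) \<Rightarrow>
     ('a \<times> 'a \<Rightarrow> 'c) set" where
  "H2_class G T A c = coboundaries2 G T A #>\<^bsub>cocycle_group G T A\<^esub> c"

definition H2_pullback ::
    "('a, 'b) monoid_scheme \<Rightarrow> 'a topology \<Rightarrow> ('c, 'd) monoid_scheme \<Rightarrow> ('a \<Rightarrow> 'g) \<Rightarrow>
     ('g \<times> 'g \<Rightarrow> 'c) set \<Rightarrow> ('a \<times> 'a \<Rightarrow> 'c) set" where
  "H2_pullback G T A f \<gamma> =
     the_elem ((\<lambda>c. H2_class G T A (\<lambda>(g, h)\<in>carrier G \<times> carrier G. c (f g, f h))) ` \<gamma>)"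

text \<open>For a central extension \<open>1 \<rightarrow> A \<rightarrow> E \<rightarrow> G \<rightarrow> 1\<close> with maps \<open>\<iota>\<close> and \<open>\<pi>\<close>, the factor set of a
  continuous section \<open>\<sigma>\<close> of \<open>\<pi>\<close> is \<open>(g, h) \<mapsto> \<iota>\<^sup>-\<^sup>1 (\<sigma> g \<cdot> \<sigma> h \<cdot> (\<sigma> (g \<cdot> h))\<^sup>-\<^sup>1)\<close>. Its cohomology
  class does not depend on the choice of the section.\<close>

definition factor_set ::
    "('c, 'd) monoid_scheme \<Rightarrow> ('c \<Rightarrow> 'e) \<Rightarrow> ('e, 'f) monoid_scheme \<Rightarrow> ('a, 'b) monoid_scheme \<Rightarrow>
     ('a \<Rightarrow> 'e) \<Rightarrow> ('a \<times> 'a \<Rightarrow> 'c)" where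
  "factor_set A \<iota> E G \<sigma> =
     (\<lambda>(g, h)\<in>carrier G \<times> carrier G.
        THE a. a \<in> carrier A \<and> \<iota> a = \<sigma> g \<otimes>\<^bsub>E\<^esub> \<sigma> h \<otimes>\<^bsub>E\<^esub> inv\<^bsub>E\<^esub> (\<sigma> (g \<otimes>\<^bsub>G\<^esub> h)))"

definition extension_class ::
    "('c, 'd) monoid_scheme \<Rightarrow> ('c \<Rightarrow> 'e) \<Rightarrow> ('e, 'f) monoid_scheme \<Rightarrow> 'e topology \<Rightarrow>
     ('e \<Rightarrow> 'a) \<Rightarrow> ('a, 'b) monoid_scheme \<Rightarrow> 'a topology \<Rightarrow> ('a \<times> 'a \<Rightarrow> 'c) set" where
  "extension_class A \<iota> E TE \<pi> G TG =
     H2_class G TG A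
       (factor_set A \<iota> E G (SOME \<sigma>. continuous_map TG TE \<sigma> \<and> (\<forall>g\<in>carrier G. \<pi> (\<sigma> g) = g)))"


section \<open>Bases of modules\<close>

text \<open>Bases are indexed families, so the members of a basis are in particular distinct.\<close>

definition module_basis ::
    "('r, 'q) ring_scheme \<Rightarrow> ('r, 'm, 'q') module_scheme \<Rightarrow> 'i set \<Rightarrow> ('i \<Rightarrow> 'm) \<Rightarrow> bool" where
  "module_basis R M I b \<longleftrightarrow>
     module R M \<and> b \<in> I \<rightarrow> carrier M \<and>
     (\<forall>F a. finite F \<and> F \<subseteq> I \<and> a \<in> F \<rightarrow> carrier R \<and>
        (\<Oplus>\<^bsub>M\<^esub>i\<in>F. a i \<odot>\<^bsub>M\<^esub> b i) = \<zero>\<^bsub>M\<^esub> \<longrightarrow> (\<forall>i\<in>F. a i = \<zero>\<^bsub>R\<^esub>)) \<and>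
     (\<forall>m\<in>carrier M. \<exists>F a. finite F \<and> F \<subseteq> I \<and> a \<in> F \<rightarrow> carrier R \<and>
        m = (\<Oplus>\<^bsub>M\<^esub>i\<in>F. a i \<odot>\<^bsub>M\<^esub> b i))"

text \<open>A multiplicatively written abelian group \<open>G\<close> of exponent dividing \<open>p\<close>, with its unique
  structure of a module over \<open>residue_ring p\<close>; the fields \<open>mult\<close> and \<open>one\<close> of the record play no
  role in a module.\<close>

definition zmod_module :: "('a, 'b) monoid_scheme \<Rightarrow> (int, 'a) module" where
  "zmod_module G =
     \<lparr>carrier = carrier G, mult = undefined, one = undefined,
      zero = \<one>\<^bsub>G\<^esub>, add = mult G, smult = (\<lambda>a x. x [^]\<^bsub>G\<^esub> a)\<rparr>"


section \<open>Lyndon words\<close>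

text \<open>\<open>r\<close> is the non-strict total order on the alphabet; \<open>lexord (r - Id)\<close> is the strict
  alphabetical order on words, in which proper prefixes are smaller.\<close>

definition lyndon :: "'a set \<Rightarrow> 'a rel \<Rightarrow> 'a list \<Rightarrow> bool" where
  "lyndon X r w \<longleftrightarrow> w \<in> lists X \<and> w \<noteq> [] \<and>
     (\<forall>u v. w = u @ v \<and> u \<noteq> [] \<and> v \<noteq> [] \<longrightarrow> (w, v) \<in> lexord (r - Id))"

text \<open>The start of the longest proper suffix that is a Lyndon word.\<close>

definition std_split :: "'a set \<Rightarrow> 'a rel \<Rightarrow> 'a list \<Rightarrow> nat" where
  "std_split X r w = (LEAST k. 0 < k \<and> lyndon X r (drop k w))"

lemma std_split_bounds:
  assumes "w \<in> lists X" "1 < length w"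
  shows "0 < std_split X r w" "std_split X r w < length w"
    "lyndon X r (drop (std_split X r w) w)"
proof -
  have "drop (length w - 1) w = [last w]"
    using assms(2) by (metis append_butlast_last_id append_eq_conv_conj length_butlast
        list.size(3) not_less_zero)
  moreover have "last w \<in> X"
    using assms by (metis in_listsD last_in_set list.size(3) not_less_zero)
  ultimately have "0 < length w - 1 \<and> lyndon X r (drop (length w - 1) w)"
    using assms(2) by (auto simp: lyndon_def append_eq_Cons_conv Cons_eq_append_conv)
  then have *: "0 < std_split X r w \<and> lyndon X r (drop (std_split X r w) w)"
    unfolding std_split_def by (rule LeastI)
  then show "0 < std_split X r w" "lyndon X r (drop (std_split X r w) w)"
    by auto
  then show "std_split X r w < length w"
    by (metis drop_all linorder_not_less lyndon_def)
qed

text \<open>Outside the nonempty words over \<open>X\<close> the value is a dummy.\<close>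

function lyndon_commutator ::
    "('a, 'b) monoid_scheme \<Rightarrow> 'a set \<Rightarrow> 'a rel \<Rightarrow> 'a list \<Rightarrow> 'a" where
  "lyndon_commutator S X r w =
     (if w \<notin> lists X \<or> w = [] then \<one>\<^bsub>S\<^esub>
      else if length w = 1 then hd w
      else gcommutator S (lyndon_commutator S X r (take (std_split X r w) w))
                         (lyndon_commutator S X r (drop (std_split X r w) w)))"
  by pat_completeness auto
termination
  by (relation "Wellfounded.measure (\<lambda>(S, X, r, w). length w)")
    (auto simp: Suc_lessI std_split_bounds dest!: std_split_bounds)

declare lyndon_commutator.simps [simp del]


section \<open>The Magnus homomorphism\<close>

definition nc_power_series :: "('r, 'q) ring_scheme \<Rightarrow> 'x set \<Rightarrow> ('x list \<Rightarrow> 'r) ring" where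
  "nc_power_series R X =
     \<lparr>carrier = lists X \<rightarrow>\<^sub>E carrier R,
      mult = (\<lambda>f g. \<lambda>w\<in>lists X. \<Oplus>\<^bsub>R\<^esub>k\<in>{..length w}. f (take k w) \<otimes>\<^bsub>R\<^esub> g (drop k w)),
      one = (\<lambda>w\<in>lists X. if w = [] then \<one>\<^bsub>R\<^esub> else \<zero>\<^bsub>R\<^esub>),
      zero = (\<lambda>w\<in>lists X. \<zero>\<^bsub>R\<^esub>),
      add = (\<lambda>f g. \<lambda>w\<in>lists X. f w \<oplus>\<^bsub>R\<^esub> g w)\<rparr>"

definition nc_variable :: "('r, 'q) ring_scheme \<Rightarrow> 'x set \<Rightarrow> 'x \<Rightarrow> ('x list \<Rightarrow> 'r)" where
  "nc_variable R X x = (\<lambda>w\<in>lists X. if w = [x] then \<one>\<^bsub>R\<^esub> else \<zero>\<^bsub>R\<^esub>)"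

text \<open>Only finite discrete coefficient rings are needed, so that the topology on the power series
  is the product of discrete topologies.\<close>

definition nc_units_topology :: "('r, 'q) ring_scheme \<Rightarrow> 'x set \<Rightarrow> ('x list \<Rightarrow> 'r) topology" where
  "nc_units_topology R X =
     subtopology (product_topology (\<lambda>_. discrete_topology (carrier R)) (lists X))
       (Units (nc_power_series R X))"

definition magnus ::
    "('r, 'q) ring_scheme \<Rightarrow> ('a, 'b) monoid_scheme \<Rightarrow> 'a topology \<Rightarrow> 'a set \<Rightarrow>
     'a \<Rightarrow> ('a list \<Rightarrow> 'r)" where
  "magnus R S T X =
     (THE \<Lambda>. is_continuous_extension S T X
        (units_of (nc_power_series R X)) (nc_units_topology R X)
        (\<lambda>x. \<one>\<^bsub>nc_power_series R X\<^esub> \<oplus>\<^bsub>nc_power_series R X\<^esub> nc_variable R X x) \<Lambda>)"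

definition magnus_coeff ::
    "('r, 'q) ring_scheme \<Rightarrow> ('a, 'b) monoid_scheme \<Rightarrow> 'a topology \<Rightarrow> 'a set \<Rightarrow>
     'a list \<Rightarrow> 'a \<Rightarrow> 'r" where
  "magnus_coeff R S T X w \<sigma> = magnus R S T X \<sigma> w"


section \<open>Unipotent matrices and the cohomology classes of words\<close>

text \<open>A \<open>d \<times> d\<close> matrix is a function on \<open>{1..d} \<times> {1..d}\<close>.\<close>

definition unipotent_group :: "nat \<Rightarrow> ('r, 'q) ring_scheme \<Rightarrow> (nat \<times> nat \<Rightarrow> 'r) monoid" where
  "unipotent_group d R =
     \<lparr>carrier = {M \<in> {1..d} \<times> {1..d} \<rightarrow>\<^sub>E carrier R.
        \<forall>i\<in>{1..d}. \<forall>j\<in>{1..d}. (i = j \<longrightarrow> M (i, j) = \<one>\<^bsub>R\<^esub>) \<and> (j < i \<longrightarrow> M (i, j) = \<zero>\<^bsub>R\<^esub>)},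
      mult = (\<lambda>M N. \<lambda>(i, j)\<in>{1..d} \<times> {1..d}. \<Oplus>\<^bsub>R\<^esub>k\<in>{1..d}. M (i, k) \<otimes>\<^bsub>R\<^esub> N (k, j)),
      one = (\<lambda>(i, j)\<in>{1..d} \<times> {1..d}. if i = j then \<one>\<^bsub>R\<^esub> else \<zero>\<^bsub>R\<^esub>)\<rparr>"

context
  fixes p n s :: nat
begin

definition word_ring :: "int ring" where
  "word_ring = residue_ring (int (p ^ (n - s + 1)))"

definition word_unipotent :: "(nat \<times> nat \<Rightarrow> int) monoid" where
  "word_unipotent = unipotent_group (s + 1) word_ring"

abbreviation word_unipotent_topology :: "(nat \<times> nat \<Rightarrow> int) topology" where
  "word_unipotent_topology \<equiv> discrete_topology (carrier word_unipotent)"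

text \<open>\<open>a \<mapsto> I + a p\<^sup>n\<^sup>-\<^sup>s E\<^sub>1\<^sub>,\<^sub>s\<^sub>+\<^sub>1\<close>, for \<open>0 \<le> a < p\<close>.\<close>

definition word_kernel_embedding :: "int \<Rightarrow> (nat \<times> nat \<Rightarrow> int)" where
  "word_kernel_embedding a =
     (\<lambda>(i, j)\<in>{1..s + 1} \<times> {1..s + 1}.
        if i = j then 1 else if i = 1 \<and> j = s + 1 then a * int (p ^ (n - s)) else 0)"

definition word_extension_class ::
    "((nat \<times> nat \<Rightarrow> int) set \<times> (nat \<times> nat \<Rightarrow> int) set \<Rightarrow> int) set" where
  "word_extension_class =
     extension_class (integer_mod_group p) word_kernel_embedding
       word_unipotent word_unipotent_topology
       (p_quotient_map word_unipotent word_unipotent_topology p n)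
       (p_quotient word_unipotent word_unipotent_topology p n)
       (p_quotient_topology word_unipotent word_unipotent_topology p n)"

end

definition word_rep ::
    "nat \<Rightarrow> nat \<Rightarrow> ('a, 'b) monoid_scheme \<Rightarrow> 'a topology \<Rightarrow> 'a set \<Rightarrow> 'a list \<Rightarrow>
     'a \<Rightarrow> (nat \<times> nat \<Rightarrow> int)" where
  "word_rep p n S T X w \<sigma> =
     (\<lambda>(i, j)\<in>{1..length w + 1} \<times> {1..length w + 1}.
        if i < j then magnus_coeff (word_ring p n (length w)) S T X (take (j - i) (drop (i - 1) w)) \<sigma>
        else if i = j then 1 else 0)"

definition word_rep_bar ::
    "nat \<Rightarrow> nat \<Rightarrow> ('a, 'b) monoid_scheme \<Rightarrow> 'a topology \<Rightarrow> 'a set \<Rightarrow> 'a list \<Rightarrow>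
     'a set \<Rightarrow> (nat \<times> nat \<Rightarrow> int) set" where
  "word_rep_bar p n S T X w C =
     the_elem
       ((\<lambda>\<sigma>. p_quotient_map (word_unipotent p n (length w)) (word_unipotent_topology p n (length w)) p n
                (word_rep p n S T X w \<sigma>)) ` C)"

definition word_class ::
    "nat \<Rightarrow> nat \<Rightarrow> ('a, 'b) monoid_scheme \<Rightarrow> 'a topology \<Rightarrow> 'a set \<Rightarrow> 'a list \<Rightarrow>
     ('a set \<times> 'a set \<Rightarrow> int) set" where
  "word_class p n S T X w =
     H2_pullback (p_quotient S T p n) (p_quotient_topology S T p n) (integer_mod_group p)
       (word_rep_bar p n S T X w) (word_extension_class p n (length w))"

end

theory Submission
  imports Defs
begin

text \<open>Let \<open>L n\<close> be the lower p-central series. Commutation is bilinear on the quotients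
  \<open>L n / L (n + 1)\<close> and satisfies the Jacobi identity there, so the rewriting of brackets of Lyndon
  words shows that the powers \<open>\<tau> w [^] p ^ (n - length w)\<close> generate \<open>L n\<close> topologically modulo
  \<open>L (n + 1)\<close>. Since the Magnus series of \<open>\<tau> w\<close> is \<open>1 + w + \<dots>\<close> with all the other terms longer or
  of the same length and alphabetically larger, the functionals
  \<open>\<sigma> \<mapsto> \<epsilon>\<^sub>w(\<sigma>) / p ^ (n - length w)\<close> on \<open>L n / L (n + 1)\<close> form a unitriangular matrix with these
  powers, and both families are bases.

  As the cohomology of \<open>S\<close> vanishes in degree 2, the transgression identifies the classes of the
  quotient with the continuous homomorphisms \<open>L n / L (n + 1) \<rightarrow> Z / p\<close>, and it takes the class of
  \<open>w\<close> to the functional of \<open>w\<close> up to sign.\<close>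

section \<open>Commutators\<close>

text \<open>Computations in the quotients are replaced by inclusions into a closed subgroup
  \<open>K\<close> above \<open>L (Suc n)\<close>. Commutation with a fixed element pulls such a
  \<open>K\<close> back to a subgroup of the same kind in lower degree, so multilinear arguments
  become inductions in which \<open>K\<close> varies. The obstacle is low degree. Taking p-th powers
  is not additive from \<open>L 1\<close> to \<open>L 2\<close> modulo \<open>L 3\<close> when p =
  2, and for k of degree 1 the bracket [k^p, x] may differ from [k, x]^p in degree 3. Both defects
  are brackets of letters, so these are put into \<open>K\<close> before any powers are treated. The
  divisor p^(n - length w) comes from matrices: on \<open>L n\<close> the entry (i, j) is divisible
  by p^(n - (j - i)), up to the modulus, so only the corner survives modulo p^(n - length w + 1).
  For infinite \<open>X\<close> a continuous functional sees only words in finitely many letters,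
  and Magnus coefficients respect this restriction. The inverse transgression is given by cochains
  on \<open>S\<close> whose coboundary is the inflated cocycle. They restrict to \<open>L n\<close>
  uniquely up to constants because homomorphisms from \<open>S\<close> to Z/p vanish on
  \<open>L 2\<close>, which contains \<open>L n\<close> as n is at least 2.\<close>

lemma (in group) inv_mult_cancel [simp]:
  "x \<in> carrier G \<Longrightarrow> y \<in> carrier G \<Longrightarrow> inv x \<otimes> (x \<otimes> y) = y"
  by (simp add: m_assoc[symmetric])

lemma (in group) mult_inv_cancel [simp]:
  "x \<in> carrier G \<Longrightarrow> y \<in> carrier G \<Longrightarrow> x \<otimes> (inv x \<otimes> y) = y"
  by (simp add: m_assoc[symmetric])

lemma (in group) gcommutator_closed [simp]:
  "x \<in> carrier G \<Longrightarrow> y \<in> carrier G \<Longrightarrow> gcommutator G x y \<in> carrier G"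
  by (simp add: gcommutator_def)

lemma (in group) inv_gcommutator:
  "x \<in> carrier G \<Longrightarrow> y \<in> carrier G \<Longrightarrow> inv (gcommutator G x y) = gcommutator G y x"
  by (simp add: gcommutator_def inv_mult_group m_assoc)

lemma (in group) gcommutator_mult_left:
  assumes "a \<in> carrier G" "b \<in> carrier G" "c \<in> carrier G"
  shows "gcommutator G (a \<otimes> b) c =
    gcommutator G a c \<otimes> gcommutator G (gcommutator G a c) b \<otimes> gcommutator G b c"
  using assms by (simp add: gcommutator_def inv_mult_group m_assoc)

lemma (in group) mult_swap_gcommutator:
  assumes "a \<in> carrier G" "b \<in> carrier G"
  shows "b \<otimes> a \<otimes> gcommutator G a b = a \<otimes> b"
  using assms by (simp add: gcommutator_def m_assoc)

lemma (in group) conj_eq_mult_gcommutator: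
  assumes "x \<in> carrier G" "g \<in> carrier G"
  shows "inv g \<otimes> x \<otimes> g = x \<otimes> gcommutator G x g"
  using assms by (simp add: gcommutator_def m_assoc)

lemma (in group) conj_gcommutator:
  assumes "x \<in> carrier G" "y \<in> carrier G" "g \<in> carrier G"
  shows "g \<otimes> gcommutator G x y \<otimes> inv g = gcommutator G (g \<otimes> x \<otimes> inv g) (g \<otimes> y \<otimes> inv g)"
  using assms by (simp add: gcommutator_def inv_mult_group m_assoc)

lemma (in group) conj_pow:
  assumes "x \<in> carrier G" "g \<in> carrier G"
  shows "g \<otimes> x [^] (k::nat) \<otimes> inv g = (g \<otimes> x \<otimes> inv g) [^] k"
proof (induction k)
  case 0
  then show ?case using assms by simp
next
  case (Suc k)
  have "g \<otimes> x [^] Suc k \<otimes> inv g = (g \<otimes> x [^] k \<otimes> inv g) \<otimes> (g \<otimes> x \<otimes> inv g)"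
    using assms by (simp add: m_assoc)
  then show ?case
    using Suc by simp
qed

lemma (in group) hall_witt:
  assumes "a \<in> carrier G" "b \<in> carrier G" "c \<in> carrier G"
  shows "(inv b \<otimes> gcommutator G (gcommutator G a (inv b)) c \<otimes> b)
    \<otimes> (inv c \<otimes> gcommutator G (gcommutator G b (inv c)) a \<otimes> c)
    \<otimes> (inv a \<otimes> gcommutator G (gcommutator G c (inv a)) b \<otimes> a) = \<one>"
  using assms by (simp add: gcommutator_def inv_mult_group m_assoc)

lemma (in normal) rcos_eq_iff:
  assumes "a \<in> carrier G" "b \<in> carrier G"
  shows "H #> a = H #> b \<longleftrightarrow> a \<otimes> inv b \<in> H"
  by (metis assms coset_join1 coset_mult_assoc coset_mult_inv1 coset_mult_inv2 inv_closed is_subgroup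
      m_closed subset coset_join2)

lemma (in normal) rcos_mult_cong:
  assumes "a \<in> carrier G" "b \<in> carrier G" "a' \<in> carrier G" "b' \<in> carrier G"
    "H #> a = H #> a'" "H #> b = H #> b'"
  shows "H #> (a \<otimes> b) = H #> (a' \<otimes> b')"
  using assms by (metis rcos_sum)

lemma (in normal) rcos_eq_self_iff: "a \<in> carrier G \<Longrightarrow> H #> a = H \<longleftrightarrow> a \<in> H"
  using coset_join1 coset_join2 is_subgroup subset by metis

lemma (in normal) mem_rcos_cong: "a \<in> carrier G \<Longrightarrow> b \<in> carrier G \<Longrightarrow> H #> a = H #> b \<Longrightarrow> a \<in> H \<longleftrightarrow> b \<in> H"
  using rcos_eq_self_iff by metis

lemma (in normal) gcommutator_mem:
  assumes "x \<in> carrier G" "y \<in> carrier G" "x \<in> H \<or> y \<in> H"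
  shows "gcommutator G x y \<in> H"
proof -
  have *: "gcommutator G x y \<in> H" if "x \<in> H" "x \<in> carrier G" "y \<in> carrier G" for x y
  proof -
    have "gcommutator G x y = inv x \<otimes> (inv y \<otimes> x \<otimes> y)"
      using that by (simp add: gcommutator_def m_assoc)
    then show ?thesis
      using that inv_op_closed1[of y x] by simp
  qed
  show ?thesis
  proof (cases "x \<in> H")
    case False
    then have "y \<in> H"
      using assms by blast
    then have "inv (gcommutator G y x) \<in> H"
      using * assms by blast
    then show ?thesis
      using assms by (simp add: inv_gcommutator)
  qed (use * assms in blast)
qed

lemma (in normal) rcos_pow_mult_distrib:
  assumes "a \<in> carrier G" "b \<in> carrier G" "gcommutator G a b \<in> H"
  shows "H #> ((a \<otimes> b) [^] (k::nat)) = H #> (a [^] k \<otimes> b [^] k)"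
proof -
  interpret Q: group "G Mod H" by (rule factorgroup_is_group)
  interpret h: group_hom G "G Mod H" "\<lambda>a. H #> a"
    by unfold_locales (rule r_coset_hom_Mod)
  have "H #> (a \<otimes> b) = H #> (b \<otimes> a)"
  proof -
    have "H #> (b \<otimes> a \<otimes> gcommutator G a b) = H #> (b \<otimes> a \<otimes> \<one>)"
      by (rule rcos_mult_cong) (use assms in \<open>auto simp: rcos_eq_self_iff coset_mult_one subset\<close>)
    then show ?thesis
      using assms by (simp add: mult_swap_gcommutator)
  qed
  then have "(H #> a) \<otimes>\<^bsub>G Mod H\<^esub> (H #> b) = (H #> b) \<otimes>\<^bsub>G Mod H\<^esub> (H #> a)"
    using assms h.hom_mult[of a b] h.hom_mult[of b a] by simp
  then have "((H #> a) \<otimes>\<^bsub>G Mod H\<^esub> (H #> b)) [^]\<^bsub>G Mod H\<^esub> k =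
      (H #> a) [^]\<^bsub>G Mod H\<^esub> k \<otimes>\<^bsub>G Mod H\<^esub> (H #> b) [^]\<^bsub>G Mod H\<^esub> k"
    using assms by (intro Q.pow_mult_distrib) auto
  then show ?thesis
    using assms h.hom_mult[of a b] h.hom_mult[of "a [^] k" "b [^] k"] h.hom_nat_pow[of "a \<otimes> b" k]
      h.hom_nat_pow[of a k] h.hom_nat_pow[of b k] by simp
qed

text \<open>Modulo \<open>H\<close> the elements of \<open>A\<close> commute, so taking k-th powers
  is multiplicative on \<open>A\<close> up to an error in \<open>H\<close>, which \<open>K\<close>
  absorbs. This extends a statement about p-th powers from generators to a whole term of the
  series.\<close>

lemma (in normal) subgroup_pow_preimage:
  assumes A: "subgroup A G" "\<And>x y. x \<in> A \<Longrightarrow> y \<in> A \<Longrightarrow> gcommutator G x y \<in> H"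
    and K: "subgroup K G" "H \<subseteq> K"
  shows "subgroup {h \<in> A. h [^] (k::nat) \<in> K} G"
proof (rule subgroupI)
  note AG = subgroup.mem_carrier[OF A(1)]
  note KG = subgroup.mem_carrier[OF K(1)]
  show "{h \<in> A. h [^] k \<in> K} \<subseteq> carrier G"
    using AG by auto
  show "{h \<in> A. h [^] k \<in> K} \<noteq> {}"
    using subgroup.one_closed[OF A(1)] subgroup.one_closed[OF K(1)] by force
  show "inv a \<in> {h \<in> A. h [^] k \<in> K}" if "a \<in> {h \<in> A. h [^] k \<in> K}" for a
    using that AG subgroup.m_inv_closed[OF A(1)] subgroup.m_inv_closed[OF K(1)]
    by (auto simp: nat_pow_inv)
  fix a b assume ab: "a \<in> {h \<in> A. h [^] k \<in> K}" "b \<in> {h \<in> A. h [^] k \<in> K}"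
  then have G: "a \<in> carrier G" "b \<in> carrier G"
    using AG by auto
  have "H #> ((a \<otimes> b) [^] k) = H #> (a [^] k \<otimes> b [^] k)"
    using G A(2) ab by (intro rcos_pow_mult_distrib) auto
  then have "(a \<otimes> b) [^] k \<otimes> inv (a [^] k \<otimes> b [^] k) \<in> K"
    using rcos_eq_iff G K(2) by auto
  then have "(a \<otimes> b) [^] k \<otimes> inv (a [^] k \<otimes> b [^] k) \<otimes> (a [^] k \<otimes> b [^] k) \<in> K"
    using ab subgroup.m_closed[OF K(1)] by auto
  then have "(a \<otimes> b) [^] k \<in> K"
    using G by (simp add: m_assoc)
  then show "a \<otimes> b \<in> {h \<in> A. h [^] k \<in> K}"
    using ab subgroup.m_closed[OF A(1)] by auto
qed


section \<open>Closed subgroups of topological groups\<close>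

context topological_group
begin

lemma continuous_map_mult:
  assumes "continuous_map Z T a" "continuous_map Z T b"
  shows "continuous_map Z T (\<lambda>z. a z \<otimes> b z)"
  using continuous_map_compose[OF continuous_map_pairedI[OF assms] continuous_mult]
  by (simp add: o_def)

lemma continuous_map_inv: "continuous_map Z T a \<Longrightarrow> continuous_map Z T (\<lambda>z. inv (a z))"
  using continuous_map_compose[OF _ continuous_inv] by (simp add: o_def)

lemma continuous_map_pow:
  assumes "continuous_map Z T a"
  shows "continuous_map Z T (\<lambda>z. a z [^] (k::nat))"
proof (induction k)
  case (Suc k)
  then show ?case
    using continuous_map_mult[OF Suc assms] by simp
qed (simp add: topspace_eq)

lemma continuous_map_gcommutator:
  assumes "continuous_map Z T a" "continuous_map Z T b"
  shows "continuous_map Z T (\<lambda>z. gcommutator G (a z) (b z))"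
  unfolding gcommutator_def using assms by (intro continuous_map_mult continuous_map_inv)

lemma closedin_preimage:
  "continuous_map T T f \<Longrightarrow> closedin T K \<Longrightarrow> closedin T {x \<in> carrier G. f x \<in> K}"
  using closedin_continuous_map_preimage[of T T f K] by (simp add: topspace_eq)

lemma closedin_preimage_Int:
  assumes "continuous_map T T f" "closedin T K" "closedin T A"
  shows "closedin T {x \<in> A. f x \<in> K}"
proof -
  have "{x \<in> A. f x \<in> K} = A \<inter> {x \<in> carrier G. f x \<in> K}"
    using closedin_subset[OF assms(3)] by (auto simp: topspace_eq)
  then show ?thesis
    using closedin_preimage[OF assms(1,2)] assms(3) by auto
qed

lemma continuous_map_const_id:
  "c \<in> carrier G \<Longrightarrow> continuous_map T T (\<lambda>_. c)" "continuous_map T T (\<lambda>x. x)"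
  by (auto simp: topspace_eq)

lemma closed_subgroup_generated_subgroup:
  assumes "A \<subseteq> carrier G"
  shows "subgroup (closed_subgroup_generated G T A) G"
    and "closedin T (closed_subgroup_generated G T A)"
    and "A \<subseteq> closed_subgroup_generated G T A"
proof -
  have gen: "subgroup (generate G A) G"
    using assms by (rule generate_is_subgroup)
  then show "subgroup (closed_subgroup_generated G T A) G"
    unfolding closed_subgroup_generated_def by (rule subgroup_closure_of)
  show "closedin T (closed_subgroup_generated G T A)"
    by (simp add: closed_subgroup_generated_def)
  have "generate G A \<subseteq> T closure_of generate G A"
    using subgroup.subset[OF gen] by (simp add: closure_of_subset topspace_eq)
  then show "A \<subseteq> closed_subgroup_generated G T A"
    unfolding closed_subgroup_generated_def using generate.incl[of _ A G] by (meson subset_iff)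
qed

lemma closed_subgroup_generated_minimal:
  assumes "subgroup H G" "closedin T H" "A \<subseteq> H"
  shows "closed_subgroup_generated G T A \<subseteq> H"
  unfolding closed_subgroup_generated_def
  using generate_subgroup_incl[OF assms(3,1)] assms(2) by (rule closure_of_minimal)

end


section \<open>The lower p-central series of a topological group\<close>

text \<open>The generality is that of the applications: the free profinite group, the finite
  discrete matrix groups, and once the value 0 for \<open>p\<close>, where only commutators of
  Lyndon words matter.\<close>

locale lower_p_series = topological_group +
  fixes p :: nat
begin

abbreviation L :: "nat \<Rightarrow> 'a set" where "L n \<equiv> lower_p_central G T p n"

abbreviation comm :: "'a \<Rightarrow> 'a \<Rightarrow> 'a" where "comm \<equiv> gcommutator G"

definition L_gens :: "nat \<Rightarrow> 'a set" where
  "L_gens n = {h [^] p | h. h \<in> L n} \<union> {comm g h | g h. g \<in> carrier G \<and> h \<in> L n}"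

lemma L_Suc: "1 \<le> n \<Longrightarrow> L (Suc n) = closed_subgroup_generated G T (L_gens n)"
  by (cases n) (simp_all add: L_gens_def)

lemma L_1 [simp]: "L 1 = carrier G" "L (Suc 0) = carrier G"
  by simp_all

lemma L_subgroup: "subgroup (L n) G" and L_closed: "closedin T (L n)"
proof -
  have "subgroup (L n) G \<and> closedin T (L n)"
  proof (induction n)
    case 0
    then show ?case
      using subgroup_self closedin_topspace[of T] by (simp add: topspace_eq)
  next
    case (Suc n)
    show ?case
    proof (cases "n = 0")
      case True
      then show ?thesis
        using subgroup_self closedin_topspace[of T] by (simp add: topspace_eq)
    next
      case False
      have "L_gens n \<subseteq> carrier G"
        using subgroup.mem_carrier[OF conjunct1[OF Suc]] by (auto simp: L_gens_def)
      from closed_subgroup_generated_subgroup(1,2)[OF this] show ?thesis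
        using False L_Suc[of n] by simp
    qed
  qed
  then show "subgroup (L n) G" "closedin T (L n)"
    by (rule conjunct1, rule conjunct2)
qed

lemma L_mem [simp]: "x \<in> L n \<Longrightarrow> x \<in> carrier G"
  using L_subgroup by (rule subgroup.mem_carrier)

lemma L_subset: "L n \<subseteq> carrier G"
  by (auto)

lemma one_L [simp]: "\<one> \<in> L n"
  using L_subgroup by (rule subgroup.one_closed)

lemma mult_L: "x \<in> L n \<Longrightarrow> y \<in> L n \<Longrightarrow> x \<otimes> y \<in> L n"
  using L_subgroup by (rule subgroup.m_closed)

lemma inv_L: "x \<in> L n \<Longrightarrow> inv x \<in> L n"
  using L_subgroup by (rule subgroup.m_inv_closed)

lemma pow_L: "x \<in> L n \<Longrightarrow> x [^] (k::nat) \<in> L n"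
  by (induction k) (auto intro: mult_L)

lemma L_gens_subset: "L_gens n \<subseteq> carrier G"
  by (auto simp: L_gens_def)

lemma L_gens_incl: "1 \<le> n \<Longrightarrow> L_gens n \<subseteq> L (Suc n)"
  using closed_subgroup_generated_subgroup(3)[OF L_gens_subset] by (simp add: L_Suc)

text \<open>The induction principle of the series: an inclusion into a closed subgroup is tested on
  p-th powers and commutators only.\<close>

lemma L_Suc_minimal:
  assumes "1 \<le> n" "subgroup K G" "closedin T K"
    "\<And>h. h \<in> L n \<Longrightarrow> h [^] p \<in> K" "\<And>g h. g \<in> carrier G \<Longrightarrow> h \<in> L n \<Longrightarrow> comm g h \<in> K"
  shows "L (Suc n) \<subseteq> K"
  unfolding L_Suc[OF assms(1)]
  by (rule closed_subgroup_generated_minimal) (use assms in \<open>auto simp: L_gens_def\<close>)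

lemma pow_p_L: "1 \<le> n \<Longrightarrow> h \<in> L n \<Longrightarrow> h [^] p \<in> L (Suc n)"
  using L_gens_incl[of n] by (auto simp: L_gens_def)

lemma comm_L_right: "1 \<le> n \<Longrightarrow> g \<in> carrier G \<Longrightarrow> h \<in> L n \<Longrightarrow> comm g h \<in> L (Suc n)"
  using L_gens_incl[of n] by (auto simp: L_gens_def)

lemma comm_L_left: "1 \<le> n \<Longrightarrow> g \<in> carrier G \<Longrightarrow> h \<in> L n \<Longrightarrow> comm h g \<in> L (Suc n)"
  using comm_L_right[of n g h] inv_L[of "comm g h"] by (simp add: inv_gcommutator)

text \<open>Conjugation respects powers and commutators, so it sends generators of a term to
  elements of the term; the elements conjugated into the term by \<open>g\<close> form a closed
  subgroup.\<close>

lemma L_conj: "g \<in> carrier G \<Longrightarrow> x \<in> L n \<Longrightarrow> g \<otimes> x \<otimes> inv g \<in> L n"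
proof (induction n arbitrary: x g)
  case (Suc n)
  show ?case
  proof (cases "n = 0")
    case False
    define K where "K = {x \<in> carrier G. g \<otimes> x \<otimes> inv g \<in> L (Suc n)}"
    have "L (Suc n) \<subseteq> K"
    proof (rule L_Suc_minimal)
      show "closedin T K"
        unfolding K_def using Suc.prems(1)
        by (intro closedin_preimage continuous_map_mult continuous_map_const_id L_closed) auto
      show "subgroup K G"
      proof (rule subgroupI)
        fix a assume a: "a \<in> K"
        have "g \<otimes> inv a \<otimes> inv g = inv (g \<otimes> a \<otimes> inv g)"
          using a Suc.prems(1) by (simp add: K_def inv_mult_group m_assoc)
        then show "inv a \<in> K"
          using a Suc.prems(1) inv_L by (simp add: K_def)
        fix b assume b: "b \<in> K"
        have "g \<otimes> (a \<otimes> b) \<otimes> inv g = (g \<otimes> a \<otimes> inv g) \<otimes> (g \<otimes> b \<otimes> inv g)"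
          using a b Suc.prems(1) by (simp add: K_def m_assoc)
        then show "a \<otimes> b \<in> K"
          using a b Suc.prems(1) mult_L by (simp add: K_def)
      next
        have "\<one> \<in> K"
          using Suc.prems(1) by (simp add: K_def)
        then show "K \<noteq> {}"
          by auto
      qed (auto simp: K_def)
      show "h [^] p \<in> K" if "h \<in> L n" for h
        using that Suc.IH[OF Suc.prems(1)] Suc.prems(1) pow_p_L[of n] False
        by (simp add: K_def conj_pow)
      show "comm g' h \<in> K" if "g' \<in> carrier G" "h \<in> L n" for g' h
        using that Suc.IH[OF Suc.prems(1)] Suc.prems(1) comm_L_right[of n] False
        by (simp add: K_def conj_gcommutator)
    qed (use False in simp)
    then show ?thesis
      using Suc.prems by (auto simp: K_def)
  qed (use Suc.prems in simp)
qed simp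

lemma L_normal: "L n \<lhd> G"
  using L_subgroup L_conj by (intro normal_invI)

lemma L_Suc_subset: "L (Suc n) \<subseteq> L n"
proof (cases "n = 0")
  case False
  interpret N: normal "L n" G by (rule L_normal)
  show ?thesis
    using False by (intro L_Suc_minimal L_subgroup L_closed pow_L N.gcommutator_mem) auto
qed (use L_subset in simp)

lemma L_antimono: "m \<le> n \<Longrightarrow> L n \<subseteq> L m"
  by (rule lift_Suc_antimono_le[of L]) (rule L_Suc_subset)

text \<open>This is the preimage of the centralizer of the coset of \<open>u\<close> in the quotient
  by \<open>N\<close>.\<close>

lemma subgroup_centralizer_mod:
  assumes "N \<lhd> G" "u \<in> carrier G"
  shows "subgroup {y \<in> carrier G. comm y u \<in> N} G"
proof -
  interpret N: normal N G by (rule assms)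
  show ?thesis
  proof (rule subgroupI)
    have "\<one> \<in> {y \<in> carrier G. comm y u \<in> N}"
      using assms by (simp add: gcommutator_def)
    then show "{y \<in> carrier G. comm y u \<in> N} \<noteq> {}"
      by blast
    have mult: "comm (a \<otimes> b) u \<in> N \<longleftrightarrow> comm b u \<in> N"
      if "a \<in> carrier G" "b \<in> carrier G" "comm a u \<in> N" for a b
    proof -
      have *: "comm (comm a u) b \<in> N"
        using that assms by (intro N.gcommutator_mem) auto
      show ?thesis
        using that assms * N.subgroup_in_rcosets N.m_closed N.m_inv_closed
        apply (simp add: gcommutator_mult_left m_assoc)
        by (metis N.m_closed N.m_inv_closed N.mem_carrier gcommutator_closed inv_mult_cancel m_closed)
    qed
    fix a assume a: "a \<in> {y \<in> carrier G. comm y u \<in> N}"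
    show "inv a \<in> {y \<in> carrier G. comm y u \<in> N}"
      using mult[of a "inv a"] a assms by (simp add: gcommutator_def)
    fix b assume "b \<in> {y \<in> carrier G. comm y u \<in> N}"
    then show "a \<otimes> b \<in> {y \<in> carrier G. comm y u \<in> N}"
      using mult[of a b] a by simp
  qed auto
qed

text \<open>Induction on \<open>i\<close> with \<open>j\<close> free: commutator generators of
  \<open>L (Suc i)\<close> are treated as in the three subgroups lemma, which needs the bound for
  \<open>i\<close> together with \<open>Suc j\<close>.\<close>

lemma comm_L_add: "1 \<le> i \<Longrightarrow> 1 \<le> j \<Longrightarrow> g \<in> L i \<Longrightarrow> u \<in> L j \<Longrightarrow> comm g u \<in> L (i + j)"
proof (induction i arbitrary: j g u)
  case (Suc i)
  show ?case
  proof (cases "i = 0")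
    case True
    then show ?thesis
      using Suc.prems comm_L_right[of j g u] by simp
  next
    case False
    then have i: "1 \<le> i" by simp
    note IH = Suc.IH[OF i]
    define N where "N = L (Suc i + j)"
    have N: "N \<lhd> G"
      unfolding N_def by (rule L_normal)
    interpret N: normal N G by (rule N)
    have uG: "u \<in> carrier G" using Suc.prems by simp
    have "L (Suc i) \<subseteq> {y \<in> carrier G. comm y u \<in> N}"
    proof (rule L_Suc_minimal)
      show "subgroup {y \<in> carrier G. comm y u \<in> N} G"
        using N uG by (rule subgroup_centralizer_mod)
      show "closedin T {y \<in> carrier G. comm y u \<in> N}"
        unfolding N_def using uG
        by (intro closedin_preimage continuous_map_gcommutator continuous_map_const_id L_closed)
      fix h assume h: "h \<in> L i"
      \<comment> \<open>Every further factor \<open>h\<close> contributes one factor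
        \<open>comm h u\<close>, because the correction [[h^k, u], h] has degree i + j + 1 and
        vanishes modulo \<open>N\<close>.\<close>
      have "N #> comm (h [^] k) u = N #> (comm h u [^] k)" for k :: nat
      proof (induction k)
        case 0
        then show ?case
          using uG by (simp add: gcommutator_def)
      next
        case (Suc k)
        let ?c = "comm (h [^] k) u"
        have c: "?c \<in> L (i + j)"
          using Suc.prems h \<open>u \<in> L j\<close> \<open>1 \<le> j\<close> by (intro IH pow_L)
        have "comm ?c h \<in> N"
          using comm_L_left[OF _ _ c, of h] i h by (simp add: N_def)
        then have "N #> (?c \<otimes> comm ?c h \<otimes> comm h u) = N #> (?c \<otimes> \<one> \<otimes> comm h u)"
          using h uG by (intro N.rcos_mult_cong) (auto simp: N.rcos_eq_self_iff coset_mult_one N.subset)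
        also have "\<dots> = N #> (comm h u [^] k \<otimes> comm h u)"
          using h uG Suc by (intro N.rcos_mult_cong) auto
        finally show ?case
          using h uG by (simp add: gcommutator_mult_left)
      qed
      moreover have "comm h u [^] p \<in> N"
        using pow_p_L[OF _ IH[OF _ h]] Suc.prems i by (auto simp: N_def)
      ultimately have "comm (h [^] p) u \<in> N"
        using N.mem_rcos_cong h uG by (metis L_mem gcommutator_closed nat_pow_closed)
      then show "h [^] p \<in> {y \<in> carrier G. comm y u \<in> N}"
        using h by simp
    next
      fix g h assume g: "g \<in> carrier G" and h: "h \<in> L i"
      have hG: "h \<in> carrier G" using h by simp
      \<comment> \<open>The Hall-Witt identity is used for \<open>g\<close>, the inverse of
        \<open>h\<close>, and \<open>u\<close>, so that its first factor is a conjugate of [[g, h],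
        u]. The other two factors lie in \<open>N\<close> by the induction hypothesis, for
        \<open>j\<close> and for \<open>Suc j\<close>.\<close>
      let ?A = "comm (comm g h) u"
        and ?B = "comm (comm (inv h) (inv u)) g" and ?C = "comm (comm u (inv g)) (inv h)"
      have "?B \<in> N"
        using IH[OF \<open>1 \<le> j\<close>, of "inv h" "inv u"] h Suc.prems g inv_L
          comm_L_left[of "i + j" g "comm (inv h) (inv u)"] by (simp add: N_def)
      moreover have "?C \<in> N"
      proof -
        have "comm u (inv g) \<in> L (Suc j)"
          using Suc.prems g by (intro comm_L_left) auto
        then have "comm (inv h) (comm u (inv g)) \<in> L (i + Suc j)"
          using h inv_L by (intro IH) auto
        then have "inv (comm (inv h) (comm u (inv g))) \<in> N"
          unfolding N_def using inv_L by simp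
        then show ?thesis
          using g hG uG by (simp add: inv_gcommutator)
      qed
      ultimately have BC: "inv u \<otimes> ?B \<otimes> u \<in> N" "inv g \<otimes> ?C \<otimes> g \<in> N"
        using uG g N.inv_op_closed1 by auto
      have "h \<otimes> ?A \<otimes> inv h \<otimes> (inv u \<otimes> ?B \<otimes> u) \<otimes> (inv g \<otimes> ?C \<otimes> g) = \<one>"
        using hall_witt[OF g inv_closed[OF hG] uG] hG by simp
      then have "h \<otimes> ?A \<otimes> inv h \<otimes> ((inv u \<otimes> ?B \<otimes> u) \<otimes> (inv g \<otimes> ?C \<otimes> g)) = \<one>"
        using g hG uG by (simp add: m_assoc)
      then have "h \<otimes> ?A \<otimes> inv h = inv ((inv u \<otimes> ?B \<otimes> u) \<otimes> (inv g \<otimes> ?C \<otimes> g))"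
        using g hG uG by (intro inv_equality[symmetric]) auto
      then have "h \<otimes> ?A \<otimes> inv h \<in> N"
        using BC by simp
      then have "inv h \<otimes> (h \<otimes> ?A \<otimes> inv h) \<otimes> h \<in> N"
        using hG N.inv_op_closed1 by blast
      then have "?A \<in> N"
        using g hG uG by (simp add: m_assoc)
      then show "comm g h \<in> {y \<in> carrier G. comm y u \<in> N}"
        using g hG by simp
    qed (use i in simp)
    then show ?thesis
      using Suc.prems by (auto simp: N_def)
  qed
qed simp

text \<open>Commutation is bilinear modulo the next term of the series, so that the following
  preimages are subgroups.\<close>

lemma subgroup_comm_preimage:
  assumes ab: "1 \<le> a" "1 \<le> b" and u: "u \<in> L b" and K: "subgroup K G" "L (Suc (a + b)) \<subseteq> K"
  shows "subgroup {g \<in> L a. comm g u \<in> K} G"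
    and "L (Suc a) \<subseteq> {g \<in> L a. comm g u \<in> K}"
proof -
  have uG: "u \<in> carrier G" using u by simp
  note KG = subgroup.mem_carrier[OF K(1)]
  have mult: "comm (g \<otimes> h) u \<in> K \<longleftrightarrow> comm h u \<in> K"
    if g: "g \<in> L a" "h \<in> L a" "comm g u \<in> K" for g h
  proof -
    have "comm g u \<in> L (a + b)"
      using comm_L_add ab g u by blast
    then have "comm (comm g u) h \<in> K"
      using comm_L_left[of "a + b" h "comm g u"] K(2) ab g by auto
    then have c: "comm g u \<otimes> comm (comm g u) h \<in> K"
      using g subgroup.m_closed[OF K(1)] by blast
    have e: "comm (g \<otimes> h) u = comm g u \<otimes> comm (comm g u) h \<otimes> comm h u"
      using g uG by (simp add: gcommutator_mult_left)
    show ?thesis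
    proof
      assume "comm (g \<otimes> h) u \<in> K"
      then have "inv (comm g u \<otimes> comm (comm g u) h) \<otimes> comm (g \<otimes> h) u \<in> K"
        using c subgroup.m_closed[OF K(1)] subgroup.m_inv_closed[OF K(1)] by blast
      moreover have "inv (comm g u \<otimes> comm (comm g u) h) \<otimes> comm (g \<otimes> h) u = comm h u"
        unfolding e by (rule inv_mult_cancel) (use g uG in auto)
      ultimately show "comm h u \<in> K"
        by simp
    qed (use c e subgroup.m_closed[OF K(1)] in simp)
  qed
  show "subgroup {g \<in> L a. comm g u \<in> K} G"
  proof (rule subgroupI)
    have "\<one> \<in> {g \<in> L a. comm g u \<in> K}"
      using uG subgroup.one_closed[OF K(1)] by (simp add: gcommutator_def)
    then show "{g \<in> L a. comm g u \<in> K} \<noteq> {}"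
      by blast
    fix g assume g: "g \<in> {g \<in> L a. comm g u \<in> K}"
    have gG: "g \<in> carrier G"
      using g by auto
    have "comm \<one> u = \<one>"
      using uG by (simp add: gcommutator_def)
    then show "inv g \<in> {g \<in> L a. comm g u \<in> K}"
      using mult[of g "inv g"] g gG inv_L subgroup.one_closed[OF K(1)] by simp
    fix h assume "h \<in> {g \<in> L a. comm g u \<in> K}"
    then show "g \<otimes> h \<in> {g \<in> L a. comm g u \<in> K}"
      using mult[of g h] g mult_L by simp
  qed auto
  have "comm g u \<in> K" if "g \<in> L (Suc a)" for g
    using comm_L_add[of "Suc a" b g u] that ab u K(2) by auto
  then show "L (Suc a) \<subseteq> {g \<in> L a. comm g u \<in> K}"
    using L_Suc_subset by auto
qed

lemma comm_swap_mem:
  assumes "subgroup K G" "g \<in> carrier G" "h \<in> carrier G" "comm g h \<in> K"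
  shows "comm h g \<in> K"
  using subgroup.m_inv_closed[OF assms(1,4)] assms by (simp add: inv_gcommutator)

text \<open>\<open>L m\<close> is central modulo \<open>L (Suc m)\<close>, so conjugation changes
  \<open>x\<close> only by an element of \<open>K\<close>.\<close>

lemma conj_mem:
  assumes "1 \<le> m" "x \<in> L m" "g \<in> carrier G" "subgroup K G" "L (Suc m) \<subseteq> K" "x \<in> K"
  shows "inv g \<otimes> x \<otimes> g \<in> K"
proof -
  have "comm x g \<in> K"
    using comm_L_left[of m g x] assms by auto
  then show ?thesis
    using assms subgroup.m_closed[OF assms(4)] by (simp add: conj_eq_mult_gcommutator)
qed

lemma comm_inv_left_mem:
  assumes "1 \<le> a" "1 \<le> b" "g \<in> L a" "u \<in> L b" "subgroup K G" "L (Suc (a + b)) \<subseteq> K"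
    "comm g u \<in> K"
  shows "comm (inv g) u \<in> K"
  using subgroup.m_inv_closed[OF subgroup_comm_preimage(1)[OF assms(1,2,4,5,6)], of g] assms by simp

lemma comm_inv_right_mem:
  assumes "1 \<le> a" "1 \<le> b" "g \<in> L a" "u \<in> L b" "subgroup K G" "L (Suc (a + b)) \<subseteq> K"
    "comm g u \<in> K"
  shows "comm g (inv u) \<in> K"
proof -
  have "comm (inv u) g \<in> K"
    using assms by (intro comm_inv_left_mem[of b a]) (auto simp: add.commute intro: comm_swap_mem)
  then show ?thesis
    using assms by (intro comm_swap_mem[of K "inv u" g]) auto
qed

lemma jacobi_mem:
  assumes ijk: "1 \<le> i" "1 \<le> j" "1 \<le> k" and abc: "a \<in> L i" "b \<in> L j" "c \<in> L k"
    and K: "subgroup K G" "L (Suc (i + j + k)) \<subseteq> K"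
    and ac: "comm (comm a c) b \<in> K" and bc: "comm a (comm b c) \<in> K"
  shows "comm (comm a b) c \<in> K"
proof -
  have G: "a \<in> carrier G" "b \<in> carrier G" "c \<in> carrier G"
    using abc by auto
  let ?A = "comm (comm a b) c"
    and ?B = "comm (comm (inv b) (inv c)) a" and ?C = "comm (comm c (inv a)) (inv b)"
  have B: "?B \<in> K"
  proof -
    \<comment> \<open>The identity contains inverses of \<open>b\<close> and \<open>c\<close>. They
      are introduced inside this subgroup, where [b, c] may be replaced by [inv b, c] and then by
      [inv b, inv c].\<close>
    let ?K = "{y \<in> L (j + k). comm y a \<in> K}"
    have K': "subgroup ?K G" "L (Suc (j + k)) \<subseteq> ?K"
      using ijk abc K by (intro subgroup_comm_preimage[of _ i]; simp add: ac_simps)+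
    have "comm b c \<in> ?K"
      using abc ijk comm_L_add bc K(1) by (auto intro: comm_swap_mem)
    then have "comm (inv b) c \<in> ?K"
      using abc ijk K' by (intro comm_inv_left_mem[of j k])
    then have "comm (inv b) (inv c) \<in> ?K"
      using abc ijk K' inv_L by (intro comm_inv_right_mem[of j k])
    then show ?thesis by simp
  qed
  have C: "?C \<in> K"
  proof -
    let ?K = "{y \<in> L (i + k). comm y b \<in> K}"
    have K': "subgroup ?K G" "L (Suc (i + k)) \<subseteq> ?K"
      using ijk abc K by (intro subgroup_comm_preimage[of _ j]; simp add: ac_simps)+
    have "comm a c \<in> ?K"
      using abc ijk comm_L_add ac by auto
    then have "comm (inv a) c \<in> ?K"
      using abc ijk K' by (intro comm_inv_left_mem[of i k])
    then have "comm c (inv a) \<in> ?K"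
      using K'(1) G by (intro comm_swap_mem[of ?K "inv a" c]) auto
    then show ?thesis
      using comm_inv_right_mem[of "i + k" j "comm c (inv a)" b K] comm_L_add[of k i c "inv a"]
        inv_L abc ijk K by (simp add: ac_simps)
  qed
  have deg: "?B \<in> L (i + j + k)" "?C \<in> L (i + j + k)" "?A \<in> L (i + j + k)"
    using comm_L_add[of "j + k" i "comm (inv b) (inv c)" a] comm_L_add[of j k "inv b" "inv c"]
      comm_L_add[of "k + i" j "comm c (inv a)" "inv b"] comm_L_add[of k i c "inv a"]
      comm_L_add[of "i + j" k "comm a b" c] comm_L_add[of i j a b] abc ijk inv_L
    by (simp_all add: ac_simps)
  have one: "1 \<le> i + j + k" using ijk by simp
  have BC: "inv c \<otimes> ?B \<otimes> c \<in> K" "inv a \<otimes> ?C \<otimes> a \<in> K"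
    using conj_mem[OF one _ _ K] deg B C G by blast+
  have "b \<otimes> ?A \<otimes> inv b \<otimes> ((inv c \<otimes> ?B \<otimes> c) \<otimes> (inv a \<otimes> ?C \<otimes> a)) = \<one>"
    using hall_witt[OF G(1) inv_closed[OF G(2)] G(3)] G by (simp add: m_assoc)
  then have "b \<otimes> ?A \<otimes> inv b = inv ((inv c \<otimes> ?B \<otimes> c) \<otimes> (inv a \<otimes> ?C \<otimes> a))"
    using G by (intro inv_equality[symmetric]) auto
  then have "b \<otimes> ?A \<otimes> inv b \<in> K"
    using BC subgroup.m_closed[OF K(1)] subgroup.m_inv_closed[OF K(1)] by simp
  moreover have "b \<otimes> ?A \<otimes> inv b \<in> L (i + j + k)"
    using L_conj deg(3) G by blast
  ultimately have "inv b \<otimes> (b \<otimes> ?A \<otimes> inv b) \<otimes> b \<in> K"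
    using conj_mem[OF one _ _ K] G by blast
  then show ?thesis
    using G by (simp add: m_assoc)
qed

end


section \<open>Lyndon words\<close>

locale ordered_alphabet =
  fixes X :: "'x set" and r :: "'x rel"
  assumes linear: "linear_order_on X r"
begin

abbreviation word_less :: "'x list \<Rightarrow> 'x list \<Rightarrow> bool" (infix \<open>\<prec>\<^sub>w\<close> 50) where
  "u \<prec>\<^sub>w v \<equiv> (u, v) \<in> lexord (r - Id)"

abbreviation word_le :: "'x list \<Rightarrow> 'x list \<Rightarrow> bool" (infix \<open>\<preceq>\<^sub>w\<close> 50) where
  "u \<preceq>\<^sub>w v \<equiv> u = v \<or> u \<prec>\<^sub>w v"

abbreviation Lyn :: "'x list \<Rightarrow> bool" where "Lyn \<equiv> lyndon X r"

abbreviation std_right :: "'x list \<Rightarrow> 'x list" where "std_right w \<equiv> drop (std_split X r w) w"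

abbreviation std_left :: "'x list \<Rightarrow> 'x list" where "std_left w \<equiv> take (std_split X r w) w"

lemma trans_strict: "trans (r - Id)"
  using linear by (auto simp: order_on_defs intro: trans_diff_Id)

lemma word_less_irrefl [simp]: "\<not> u \<prec>\<^sub>w u"
  by (rule lexord_irreflexive) simp

lemma word_less_trans: "u \<prec>\<^sub>w v \<Longrightarrow> v \<prec>\<^sub>w w \<Longrightarrow> u \<prec>\<^sub>w w"
  using lexord_transI[OF trans_strict] by (meson transD)

lemma word_less_total:
  "u \<in> lists X \<Longrightarrow> v \<in> lists X \<Longrightarrow> u \<prec>\<^sub>w v \<or> u = v \<or> v \<prec>\<^sub>w u"
proof (induction u arbitrary: v)
  case Nil
  then show ?case by (cases v) auto
next
  case (Cons a u)
  then show ?case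
  proof (cases v)
    case (Cons b v')
    have "a = b \<or> (a, b) \<in> r - Id \<or> (b, a) \<in> r - Id"
      using linear Cons.prems \<open>v = b # v'\<close> by (auto simp: order_on_defs total_on_def)
    then show ?thesis
      using Cons.IH[of v'] Cons.prems \<open>v = b # v'\<close> by auto
  qed auto
qed

lemma word_less_same_prefix [simp]: "u @ v \<prec>\<^sub>w u @ w \<longleftrightarrow> v \<prec>\<^sub>w w"
  by (rule lexord_same_pref_if_irrefl) (simp add: irrefl_def)

lemma word_less_appendI: "z \<noteq> [] \<Longrightarrow> u \<prec>\<^sub>w u @ z"
  by (cases z) (auto intro: lexord_append_rightI)

lemma word_le_append: "u \<preceq>\<^sub>w u @ z"
  using word_less_appendI[of z u] by (cases "z = []") auto

text \<open>The two ways of being smaller behave differently under appending: a comparison decided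
  at a differing letter survives all continuations, while for a proper prefix the continuation has
  to be compared with the rest.\<close>

lemma word_less_cases:
  assumes "u \<prec>\<^sub>w v"
  obtains (prefix) a z where "v = u @ a # z" | (differ) "\<And>s t. u @ s \<prec>\<^sub>w v @ t"
proof -
  have "(\<exists>a z. v = u @ a # z) \<or> (\<forall>s t. u @ s \<prec>\<^sub>w v @ t)"
    using assms
  proof (induction u arbitrary: v)
    case Nil
    then show ?case by auto
  next
    case (Cons a u)
    show ?case
    proof (cases v)
      case Nil
      then show ?thesis
        using Cons.prems by simp
    next
      case (Cons b v')
      then consider "(a, b) \<in> r - Id" | "a = b" "u \<prec>\<^sub>w v'"
        using Cons.prems by auto
      then show ?thesis
      proof cases
        case 1
        then show ?thesis
          using Cons by simp
      next
        case 2
        then show ?thesis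
          using Cons.IH[of v'] Cons by auto
      qed
    qed
  qed
  then show ?thesis
    using that by blast
qed

lemma lyndon_suffix_less:
  "Lyn w \<Longrightarrow> w = u @ v \<Longrightarrow> v \<noteq> [] \<Longrightarrow> u \<noteq> [] \<Longrightarrow> w \<prec>\<^sub>w v"
  by (auto simp: lyndon_def)

lemma lyndon_suffix_le: "Lyn w \<Longrightarrow> w = u @ v \<Longrightarrow> v \<noteq> [] \<Longrightarrow> w \<preceq>\<^sub>w v"
  using lyndon_suffix_less by (cases "u = []") auto

lemma lyndon_lists: "Lyn w \<Longrightarrow> w \<in> lists X" and lyndon_nonempty: "Lyn w \<Longrightarrow> w \<noteq> []"
  by (auto simp: lyndon_def)

text \<open>First u @ v is below \<open>v\<close>: if v = u @ z, then \<open>v\<close> is below its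
  suffix z, and \<open>u\<close> can be prepended. Suffixes that start inside \<open>v\<close> are
  at least \<open>v\<close>. A suffix z @ v with z a proper nonempty suffix of \<open>u\<close> is
  handled by comparing \<open>u\<close> with z, which is too short to extend \<open>u\<close>, so
  that the comparison is decided at a letter.\<close>

lemma lyndon_append:
  assumes "Lyn u" "Lyn v" "u \<prec>\<^sub>w v"
  shows "Lyn (u @ v)"
proof -
  have uv: "u @ v \<prec>\<^sub>w v"
    using \<open>u \<prec>\<^sub>w v\<close>
  proof (cases rule: word_less_cases)
    case (prefix a z)
    then have "v \<prec>\<^sub>w a # z"
      using lyndon_suffix_less[of v u "a # z"] assms lyndon_nonempty by blast
    then have "u @ v \<prec>\<^sub>w u @ a # z"
      by simp
    then show ?thesis
      by (simp add: prefix)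
  next
    case differ
    from this[of v "[]"] show ?thesis by simp
  qed
  have "u @ v \<prec>\<^sub>w t" if st: "u @ v = s @ t" "s \<noteq> []" "t \<noteq> []" for s t
  proof -
    consider z where "u = s @ z" "t = z @ v" | z where "s = u @ z" "v = z @ t"
      using st(1) by (auto simp: append_eq_append_conv2)
    then show ?thesis
    proof cases
      case 1
      show ?thesis
      proof (cases "z = []")
        case False
        then have "u \<prec>\<^sub>w z"
          using lyndon_suffix_less[OF assms(1) 1(1)] st(2) by simp
        then show ?thesis
        proof (cases rule: word_less_cases)
          case (prefix a q)
          then show ?thesis
            using arg_cong[OF 1(1), of length] by simp
        next
          case differ
          then show ?thesis using 1 by simp
        qed
      qed (use 1 uv in simp)
    next
      case 2
      then have "v \<preceq>\<^sub>w t"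
        using lyndon_suffix_le[OF assms(2)] st(3) by blast
      then show ?thesis
        using uv word_less_trans by blast
    qed
  qed
  then show ?thesis
    using assms by (auto simp: lyndon_def)
qed

lemma minimal_suffix:
  assumes "w \<in> lists X" "w \<noteq> []"
  shows "\<exists>u t. w = u @ t \<and> t \<noteq> [] \<and> (\<forall>u' t'. w = u' @ t' \<and> t' \<noteq> [] \<longrightarrow> t \<preceq>\<^sub>w t')"
  using assms
proof (induction w rule: list.induct)
  case (Cons a w)
  show ?case
  proof (cases "w = []")
    case True
    then show ?thesis
      by (intro exI[of _ "[]"] exI[of _ "[a]"]) (auto simp: Cons_eq_append_conv)
  next
    case False
    have "w \<in> lists X"
      using Cons.prems by simp
    from Cons.IH[OF this False] obtain u t where ut: "w = u @ t" "t \<noteq> []"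
      "\<And>u' t'. w = u' @ t' \<Longrightarrow> t' \<noteq> [] \<Longrightarrow> t \<preceq>\<^sub>w t'"
      by blast
    have "t \<in> lists X"
      using Cons.prems ut(1) by auto
    then consider "t \<prec>\<^sub>w a # w" | "a # w \<preceq>\<^sub>w t"
      using word_less_total Cons.prems(1) by blast
    then show ?thesis
    proof cases
      case 1
      have "t \<preceq>\<^sub>w t'" if "a # w = u' @ t'" "t' \<noteq> []" for u' t'
        using that 1 ut(3) by (auto simp: Cons_eq_append_conv)
      then show ?thesis
        using ut(1,2) by (intro exI[of _ "a # u"] exI[of _ t]) auto
    next
      case 2
      have "a # w \<preceq>\<^sub>w t'" if "a # w = u' @ t'" "t' \<noteq> []" for u' t'
      proof (cases u')
        case Nil
        then show ?thesis
          using that by simp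
      next
        case (Cons b ys)
        then have "t \<preceq>\<^sub>w t'"
          using that ut(3)[of ys t'] by simp
        then show ?thesis
          using 2 word_less_trans by metis
      qed
      then show ?thesis
        by (intro exI[of _ "[]"] exI[of _ "a # w"]) auto
    qed
  qed
qed simp

text \<open>The proper suffixes of the minimal suffix are suffixes of the whole word as well, hence
  larger.\<close>

lemma minimal_suffix_lyndon:
  assumes "w \<in> lists X" "w \<noteq> []"
  obtains u t where "w = u @ t" "Lyn t" "\<And>u' t'. w = u' @ t' \<Longrightarrow> t' \<noteq> [] \<Longrightarrow> t \<preceq>\<^sub>w t'"
proof -
  obtain u t where ut: "w = u @ t" "t \<noteq> []" and min: "\<And>u' t'. w = u' @ t' \<Longrightarrow> t' \<noteq> [] \<Longrightarrow> t \<preceq>\<^sub>w t'"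
    using minimal_suffix[OF assms] by blast
  have "t \<prec>\<^sub>w v" if v: "t = q @ v" "q \<noteq> []" "v \<noteq> []" for q v
  proof -
    have "w = (u @ q) @ v"
      using ut(1) v(1) by simp
    then have "t \<preceq>\<^sub>w v"
      using min v(3) by blast
    moreover have "t \<noteq> v"
      using v(1,2) by auto
    ultimately show ?thesis by blast
  qed
  then have "Lyn t"
    using ut assms(1) by (auto simp: lyndon_def)
  then show ?thesis
    using that ut(1) min by blast
qed

lemma std_split_least: "0 < j \<Longrightarrow> j < std_split X r w \<Longrightarrow> \<not> Lyn (drop j w)"
  unfolding std_split_def using not_less_Least by blast

lemma std_factorization:
  assumes "Lyn w" "1 < length w"
  shows "Lyn (std_right w)" "Lyn (std_left w)" "std_left w \<prec>\<^sub>w std_right w" "w \<prec>\<^sub>w std_right w"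
    "std_left w @ std_right w = w"
proof -
  note lw = lyndon_lists[OF assms(1)]
  note bounds = std_split_bounds[OF lw assms(2), of r]
  let ?k = "std_split X r w"
  show *: "Lyn (std_right w)"
    by (rule bounds(3))
  show ww: "std_left w @ std_right w = w"
    by simp
  have ne: "std_left w \<noteq> []" "std_right w \<noteq> []"
    using bounds assms(2) by auto
  show "w \<prec>\<^sub>w std_right w"
    using lyndon_suffix_less[OF assms(1) ww[symmetric]] ne by blast
  moreover have "std_left w \<preceq>\<^sub>w w"
    using word_le_append[of "std_left w" "std_right w"] ww by simp
  ultimately show lr: "std_left w \<prec>\<^sub>w std_right w"
    using word_less_trans by metis
  have "std_left w \<in> lists X"
    using lw by (auto dest: in_set_takeD)
  then obtain u t where ut: "std_left w = u @ t" "Lyn t"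
    and min: "\<And>u' t'. std_left w = u' @ t' \<Longrightarrow> t' \<noteq> [] \<Longrightarrow> t \<preceq>\<^sub>w t'"
    using ne minimal_suffix_lyndon by blast
  \<comment> \<open>Otherwise the minimal suffix \<open>t\<close> of the left factor is at most the
    left factor, hence below the right one, and \<open>t\<close> followed by the right factor is a
    Lyndon proper suffix of \<open>w\<close> longer than the standard one.\<close>
  have "u = []"
  proof (rule ccontr)
    assume u: "u \<noteq> []"
    have "t \<preceq>\<^sub>w std_left w"
      using min[of "[]"] ne by simp
    then have tr: "t \<prec>\<^sub>w std_right w"
      using lr word_less_trans by blast
    have "t @ std_right w = drop (length u) w"
      using ut(1) ww by (metis append.assoc append_eq_conv_conj)
    moreover have "Lyn (t @ std_right w)"
      using lyndon_append ut(2) * tr by blast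
    moreover have "length u < ?k"
    proof -
      have "length u + length t = ?k"
        using ut(1) bounds by (metis length_append length_take min.absorb2 min.commute less_imp_le_nat)
      then show ?thesis
        using lyndon_nonempty[OF ut(2)] by (cases t) auto
    qed
    ultimately show False
      using std_split_least[of "length u" w] u by auto
  qed
  then show "Lyn (std_left w)"
    using ut by simp
qed

text \<open>The point is that \<open>std_right u\<close> is the minimal suffix of every longer proper suffix of \<open>u\<close>.\<close>

lemma std_split_append:
  assumes u: "Lyn u" and v: "Lyn v" and uv: "length u = 1 \<or> v \<preceq>\<^sub>w std_right u"
  shows "std_split X r (u @ v) = length u"
  unfolding std_split_def
proof (rule Least_equality)
  show "0 < length u \<and> Lyn (drop (length u) (u @ v))"
    using lyndon_nonempty[OF u] v by simp
  fix j assume j: "0 < j \<and> Lyn (drop j (u @ v))"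
  show "length u \<le> j"
  proof (rule ccontr)
    assume "\<not> length u \<le> j"
    then have ju: "j < length u" by simp
    define z where "z = drop j u"
    have z: "z \<noteq> []" "u = take j u @ z" "take j u \<noteq> []"
      using ju j by (auto simp: z_def)
    have lz: "Lyn (z @ v)"
      using j ju by (simp add: z_def)
    have zv: "z @ v \<prec>\<^sub>w v"
      using lyndon_suffix_less[OF lz, of z v] z lyndon_nonempty[OF v] by simp
    have ge: False if "v \<preceq>\<^sub>w q" "q @ v \<prec>\<^sub>w v" for q
      using that word_le_append[of q v] word_less_trans word_less_irrefl by metis
    have lu: "1 < length u" and vr: "v \<preceq>\<^sub>w std_right u"
      using ju j uv by auto
    let ?k = "std_split X r u" and ?y = "std_right u"
    note bounds = std_split_bounds[OF lyndon_lists[OF u] lu, of r]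
    have suf: "?y \<preceq>\<^sub>w drop i u" if "?k \<le> i" "i < length u" for i
    proof -
      have "?y = take (i - ?k) ?y @ drop i u"
        using that by (metis append_take_drop_id drop_drop le_add_diff_inverse2)
      then show ?thesis
        using lyndon_suffix_le[OF bounds(3), of "take (i - ?k) ?y" "drop i u"] that by simp
    qed
    \<comment> \<open>A suffix that starts inside the right factor \<open>?y\<close> of
      \<open>u\<close> is at least \<open>?y\<close> and so at least \<open>v\<close>. If it starts
      earlier, then \<open>z\<close> is not Lyndon, and its minimal suffix turns out to be
      \<open>?y\<close>.\<close>
    show False
    proof (cases "?k \<le> j")
      case True
      then have "v \<preceq>\<^sub>w z"
        using suf[OF True ju] vr word_less_trans by (auto simp: z_def)
      then show False
        using ge zv by blast
    next
      case False
      have "z \<in> lists X"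
        using lyndon_lists[OF u] by (auto simp: z_def dest: in_set_dropD)
      then obtain q t where t: "z = q @ t" "Lyn t"
        and min: "\<And>u' t'. z = u' @ t' \<Longrightarrow> t' \<noteq> [] \<Longrightarrow> t \<preceq>\<^sub>w t'"
        using z(1) minimal_suffix_lyndon by blast
      have tq: "t = drop (j + length q) u"
      proof -
        have "drop (length q) z = t"
          by (simp add: t(1))
        then show ?thesis
          by (simp add: z_def add.commute)
      qed
      have nz: "\<not> Lyn z"
        using std_split_least[of j u] j False by (simp add: z_def)
      then have "q \<noteq> []"
        using t by auto
      have il: "j + length q < length u"
        using tq lyndon_nonempty[OF t(2)] by (metis drop_all linorder_not_le)
      have "Lyn (drop (j + length q) u)"
        using tq t(2) by simp
      then have "?k \<le> j + length q"
        using std_split_least[of "j + length q" u] j by (metis add_gr_0 not_le)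
      then have "?y \<preceq>\<^sub>w t"
        using suf il tq by simp
      moreover have zy: "z = drop 0 z" "z = take (?k - j) z @ ?y"
        using False by (auto simp: z_def) (metis append_take_drop_id drop_drop
            le_add_diff_inverse2 nat_le_linear)
      then have "t \<preceq>\<^sub>w ?y"
        using min lyndon_nonempty[OF bounds(3)] by blast
      ultimately have ty: "t = ?y"
        using word_less_trans word_less_irrefl by metis
      have "t \<preceq>\<^sub>w z"
        using min[of "[]" z] z by simp
      moreover have "t \<noteq> z"
        using nz t(2) by auto
      ultimately have "t \<prec>\<^sub>w z" by blast
      \<comment> \<open>This contradicts \<open>t\<close> being below \<open>z\<close>: either a
        letter decides, or z = t @ q and cancelling \<open>t\<close> leaves q @ v below
        \<open>v\<close>, although \<open>v\<close> is at most \<open>t\<close> and \<open>t\<close>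
        is at most its competitor q among the suffixes of \<open>z\<close>.\<close>
      have zt: "z @ v \<prec>\<^sub>w t @ v"
        using lyndon_suffix_less[OF lz, of q "t @ v"] t \<open>q \<noteq> []\<close> lyndon_nonempty[OF t(2)] by simp
      from \<open>t \<prec>\<^sub>w z\<close> show False
      proof (cases rule: word_less_cases)
        case (prefix a s)
        then have "(a # s) @ v \<prec>\<^sub>w v"
          using zt word_less_same_prefix[of t "(a # s) @ v" v] by simp
        moreover have "v \<preceq>\<^sub>w a # s"
        proof -
          have "t \<preceq>\<^sub>w a # s"
            using min[of t "a # s"] prefix by simp
          then show ?thesis
            using vr ty word_less_trans by metis
        qed
        ultimately show False
          using ge by blast
      next
        case differ
        then show False
          using zt word_less_trans word_less_irrefl by blast
      qed
    qed
  qed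
qed

end

section \<open>Commutators of Lyndon words\<close>

locale lyndon_series = lower_p_series G T p + ordered_alphabet X r
  for G (structure) and T :: "'a topology" and p :: nat and X :: "'a set" and r :: "'a rel" +
  assumes X_subset: "X \<subseteq> carrier G"
begin

abbreviation \<tau> :: "'a list \<Rightarrow> 'a" where "\<tau> \<equiv> lyndon_commutator G X r"

lemma tau_single [simp]: "x \<in> X \<Longrightarrow> \<tau> [x] = x"
  by (subst lyndon_commutator.simps) simp

lemma tau_std: "w \<in> lists X \<Longrightarrow> 1 < length w \<Longrightarrow> \<tau> w = comm (\<tau> (std_left w)) (\<tau> (std_right w))"
  by (subst lyndon_commutator.simps) auto

lemma tau_L: "w \<in> lists X \<Longrightarrow> w \<noteq> [] \<Longrightarrow> \<tau> w \<in> L (length w)"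
proof (induction w rule: length_induct)
  case (1 w)
  show ?case
  proof (cases "1 < length w")
    case False
    then obtain x where "w = [x]" "x \<in> X"
      using 1 by (cases w) auto
    then show ?thesis
      using X_subset by auto
  next
    case True
    note bounds = std_split_bounds[OF 1(2) True, of r]
    have "std_left w \<in> lists X" "std_right w \<in> lists X"
      using 1(2) by (auto dest: in_set_takeD in_set_dropD)
    then have "\<tau> (std_left w) \<in> L (length (std_left w))" "\<tau> (std_right w) \<in> L (length (std_right w))"
      using 1(1)[rule_format, of "std_left w"] 1(1)[rule_format, of "std_right w"] bounds True 1(3)
      by auto
    then have "comm (\<tau> (std_left w)) (\<tau> (std_right w)) \<in> L (length (std_left w) + length (std_right w))"
      using bounds by (intro comm_L_add) auto
    then show ?thesis
      using tau_std[OF 1(2) True] bounds by simp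
  qed
qed

lemma tau_carrier [simp]: "w \<in> lists X \<Longrightarrow> w \<noteq> [] \<Longrightarrow> \<tau> w \<in> carrier G"
  using L_mem[OF tau_L] .

text \<open>If \<open>(u, v)\<close> is not the standard factorization of \<open>u @ v\<close>, then \<open>u = x @ y\<close> with \<open>y \<prec>\<^sub>w v\<close>, and
  the Jacobi identity leads to brackets in which both words are smaller than \<open>v\<close>. The induction is
  on the total length and then on the larger word. The restriction to a finite
  alphabet makes the order on the words of bounded length well-founded.\<close>

lemma comm_tau_less_mem:
  assumes "finite A" "A \<subseteq> X" "u \<in> lists A" "v \<in> lists A" "Lyn u" "Lyn v" "u \<prec>\<^sub>w v"
    "subgroup K G" "L (Suc (length u + length v)) \<subseteq> K"
    "\<And>w. Lyn w \<Longrightarrow> w \<in> lists A \<Longrightarrow> length w = length u + length v \<Longrightarrow> std_right w \<preceq>\<^sub>w v \<Longrightarrow> \<tau> w \<in> K"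
  shows "comm (\<tau> u) (\<tau> v) \<in> K"
  using assms(3-)
\<comment> \<open>\<open>K\<close> varies because a bracket of fewer letters is rewritten modulo the
  preimage of \<open>K\<close> under commutation with the remaining word.\<close>
proof (induction "length u + length v" arbitrary: u v K rule: less_induct)
  case (less u v K)
  define N where "N = length u + length v"
  note IH_length = less.hyps[folded N_def]
  define rank where "rank v = card {y \<in> lists A. length y \<le> N \<and> y \<prec>\<^sub>w v}" for v
  have fin: "finite {y \<in> lists A. length y \<le> N \<and> y \<prec>\<^sub>w v}" for v
    by (rule finite_subset[OF _ finite_lists_length_le[OF assms(1), of N]]) auto
  have rank: "rank w < rank v" if "w \<prec>\<^sub>w v" "w \<in> lists A" "length w \<le> N" for w v
    unfolding rank_def
  proof (intro psubset_card_mono fin psubsetI)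
    show "{y \<in> lists A. length y \<le> N \<and> y \<prec>\<^sub>w w} \<subseteq> {y \<in> lists A. length y \<le> N \<and> y \<prec>\<^sub>w v}"
      using word_less_trans[OF _ that(1)] by blast
    have "w \<in> {y \<in> lists A. length y \<le> N \<and> y \<prec>\<^sub>w v}" "w \<notin> {y \<in> lists A. length y \<le> N \<and> y \<prec>\<^sub>w w}"
      using that by auto
    then show "{y \<in> lists A. length y \<le> N \<and> y \<prec>\<^sub>w w} \<noteq> {y \<in> lists A. length y \<le> N \<and> y \<prec>\<^sub>w v}"
      by blast
  qed
  have LA: "w \<in> lists X" if "w \<in> lists A" for w
    using that assms(2) by auto
  have "comm (\<tau> u) (\<tau> v) \<in> K"
    if "length u + length v = N" "u \<in> lists A" "v \<in> lists A" "Lyn u" "Lyn v" "u \<prec>\<^sub>w v"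
      "\<And>w. Lyn w \<Longrightarrow> w \<in> lists A \<Longrightarrow> length w = N \<Longrightarrow> std_right w \<preceq>\<^sub>w v \<Longrightarrow> \<tau> w \<in> K" for u v
    using that
  proof (induction "rank v" arbitrary: u v rule: less_induct)
    case (less v u)
    note LK = \<open>subgroup K G\<close>
    have LN: "L (Suc N) \<subseteq> K"
      using \<open>L (Suc (length _ + length _)) \<subseteq> K\<close> N_def by simp
    have uv: "Lyn (u @ v)"
      using less.prems by (intro lyndon_append)
    show ?case
    proof (cases "length u = 1 \<or> v \<preceq>\<^sub>w std_right u")
      case True
      then have sp: "std_split X r (u @ v) = length u"
        using less.prems by (intro std_split_append) auto
      have "1 < length (u @ v)"
        using less.prems lyndon_nonempty by (cases u; cases v) auto
      then have "\<tau> (u @ v) = comm (\<tau> u) (\<tau> v)"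
        using tau_std[OF lyndon_lists[OF uv]] sp by simp
      moreover have "\<tau> (u @ v) \<in> K"
        using less.prems uv sp by (intro less.prems(7)) auto
      ultimately show ?thesis by simp
    next
      case False
      then have lu: "1 < length u"
        using lyndon_nonempty[OF less.prems(4)] by (cases u) auto
      define x y where "x = std_left u" and "y = std_right u"
      note std = std_factorization[OF less.prems(4) lu, folded x_def y_def]
      have ux: "u = x @ y"
        using std(5) by simp
      have xyA: "x \<in> lists A" "y \<in> lists A"
        using less.prems(2) by (auto simp: ux)
      have yv: "y \<prec>\<^sub>w v"
        using False word_less_total LA xyA less.prems(3) by (metis y_def)
      have xv: "x \<prec>\<^sub>w v"
        using std(3) yv word_less_trans by blast
      have ne: "1 \<le> length x" "1 \<le> length y" "1 \<le> length v"
        using std(1,2) less.prems(5) lyndon_nonempty by (auto simp: Suc_le_eq)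
      have N: "N = length x + length y + length v"
        using less.prems(1) ux by simp
      \<comment> \<open>When both words are below \<open>v\<close>, so is the larger one, and the
        inner induction applies after a possible swap.\<close>
      have small: "comm (\<tau> w) (\<tau> z) \<in> K"
        if wz: "Lyn w" "w \<in> lists A" "Lyn z" "z \<in> lists A" "length w + length z = N"
          "w \<prec>\<^sub>w v" "z \<prec>\<^sub>w v" for w z
      proof -
        have *: "comm (\<tau> w) (\<tau> z) \<in> K"
          if wz: "Lyn w" "w \<in> lists A" "Lyn z" "z \<in> lists A" "length w + length z = N"
            "z \<prec>\<^sub>w v" "w \<prec>\<^sub>w z" for w z
        proof (rule less.hyps)
          show "rank z < rank v"
            using wz by (intro rank) auto
          show "\<tau> y \<in> K" if "Lyn y" "y \<in> lists A" "length y = N" "std_right y \<preceq>\<^sub>w z" for y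
            using that less.prems(7) wz(6) word_less_trans by blast
        qed (use wz in auto)
        have G: "\<tau> w \<in> carrier G" "\<tau> z \<in> carrier G"
          using wz LA lyndon_nonempty by auto
        consider "w \<prec>\<^sub>w z" | "w = z" | "z \<prec>\<^sub>w w"
          using word_less_total wz lyndon_lists by blast
        then show ?thesis
        proof cases
          case 2
          then show ?thesis
            using G subgroup.one_closed[OF LK] by (simp add: gcommutator_def m_assoc)
        next
          case 3
          then have "comm (\<tau> z) (\<tau> w) \<in> K"
            using wz by (intro *) auto
          then show ?thesis
            using comm_swap_mem LK G by blast
        qed (use * wz in blast)
      qed
      have tL: "\<tau> x \<in> L (length x)" "\<tau> y \<in> L (length y)" "\<tau> v \<in> L (length v)"
      proof -
        have "x \<noteq> []" "y \<noteq> []" "v \<noteq> []"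
          using ne by auto
        then show "\<tau> x \<in> L (length x)" "\<tau> y \<in> L (length y)" "\<tau> v \<in> L (length v)"
          using tau_L LA xyA less.prems(3) by blast+
      qed
      \<comment> \<open>The bound on the right standard factor is the invariant of the rewriting: it
        makes every word that replaces a shorter bracket with \<open>v\<close> smaller than
        \<open>v\<close>, as required by \<open>small\<close>.\<close>
      have w_less: "w \<prec>\<^sub>w v" if "Lyn w" "std_right w \<preceq>\<^sub>w v" "1 < length w" for w
        using that std_factorization(4)[of w] word_less_trans by blast
      have 1: "comm (comm (\<tau> x) (\<tau> v)) (\<tau> y) \<in> K"
      proof -
        define K1 where "K1 = {g \<in> L (length x + length v). comm g (\<tau> y) \<in> K}"
        have K1: "subgroup K1 G" "L (Suc (length x + length v)) \<subseteq> K1"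
          unfolding K1_def using ne tL LK LN N
          by (intro subgroup_comm_preimage[of _ "length y"]; simp add: ac_simps)+
        have "comm (\<tau> x) (\<tau> v) \<in> K1"
        proof (rule IH_length)
          show "length x + length v < N"
            using N ne by linarith
          show "\<tau> w \<in> K1"
            if w: "Lyn w" "w \<in> lists A" "length w = length x + length v" "std_right w \<preceq>\<^sub>w v" for w
            using small[of w y] tau_L[of w] w_less[of w] w std xyA yv N ne LA lyndon_nonempty
            by (simp add: K1_def)
        qed (use xyA less.prems(3,5) std xv K1 in simp_all)
        then show ?thesis
          by (simp add: K1_def)
      qed
      have 2: "comm (\<tau> x) (comm (\<tau> y) (\<tau> v)) \<in> K"
      proof -
        define K1 where "K1 = {g \<in> L (length y + length v). comm g (\<tau> x) \<in> K}"
        have K1: "subgroup K1 G" "L (Suc (length y + length v)) \<subseteq> K1"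
          unfolding K1_def using ne tL LK LN N
          by (intro subgroup_comm_preimage[of _ "length x"]; simp add: ac_simps)+
        have "comm (\<tau> y) (\<tau> v) \<in> K1"
        proof (rule IH_length)
          show "length y + length v < N"
            using N ne by linarith
          show "\<tau> w \<in> K1"
            if w: "Lyn w" "w \<in> lists A" "length w = length y + length v" "std_right w \<preceq>\<^sub>w v" for w
            using small[of w x] tau_L[of w] w_less[of w] w std xyA xv N ne LA lyndon_nonempty
            by (simp add: K1_def)
        qed (use xyA less.prems(3,5) std yv K1 in simp_all)
        then have "comm (comm (\<tau> y) (\<tau> v)) (\<tau> x) \<in> K"
          by (simp add: K1_def)
        then show ?thesis
          using tL LK by (intro comm_swap_mem[of K "comm (\<tau> y) (\<tau> v)" "\<tau> x"]) auto
      qed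
      have "comm (comm (\<tau> x) (\<tau> y)) (\<tau> v) \<in> K"
        using jacobi_mem[OF ne tL LK _ 1 2] LN N by simp
      then show ?thesis
        using tau_std[OF lyndon_lists[OF less.prems(4)] lu] by (simp add: x_def y_def)
    qed
  qed
  from this[of u v] show ?case
    using less.prems N_def by auto
qed

text \<open>The finite alphabet is chosen as the set of letters of \<open>u\<close> and
  \<open>v\<close>, and inverting the commutator settles the case in which \<open>v\<close> is the
  smaller word.\<close>

lemma comm_tau_mem:
  assumes uv: "Lyn u" "Lyn v"
    and K: "subgroup K G" "L (Suc (length u + length v)) \<subseteq> K"
    and \<tau>: "\<And>w. Lyn w \<Longrightarrow> length w = length u + length v \<Longrightarrow> \<tau> w \<in> K"
  shows "comm (\<tau> u) (\<tau> v) \<in> K"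
proof -
  note uvX = lyndon_lists[OF uv(1)] lyndon_lists[OF uv(2)]
  define A where "A = set u \<union> set v"
  have A: "finite A" "A \<subseteq> X" "u \<in> lists A" "v \<in> lists A"
    using uvX by (auto simp: A_def)
  have G: "\<tau> u \<in> carrier G" "\<tau> v \<in> carrier G"
    using uvX uv lyndon_nonempty by auto
  consider "u \<prec>\<^sub>w v" | "u = v" | "v \<prec>\<^sub>w u"
    using word_less_total uvX by blast
  then show ?thesis
  proof cases
    case 1
    then show ?thesis
      using \<tau> by (rule comm_tau_less_mem[OF A uv _ K])
  next
    case 2
    then show ?thesis
      using G subgroup.one_closed[OF K(1)] by (simp add: gcommutator_def m_assoc)
  next
    case 3
    have "comm (\<tau> v) (\<tau> u) \<in> K"
    proof (rule comm_tau_less_mem[OF A(1,2,4,3) uv(2,1) 3 K(1)])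
      show "L (Suc (length v + length u)) \<subseteq> K"
        using K(2) by (simp add: add.commute)
    qed (use \<tau> in \<open>simp add: add.commute\<close>)
    then show ?thesis
      using comm_swap_mem K(1) G by blast
  qed
qed

end


declare lower_p_central.simps(3) [simp del]

section \<open>Generators of the quotients of the series\<close>

context lower_p_series
begin

lemma normal_between:
  assumes "1 \<le> m" "subgroup K G" "L (Suc m) \<subseteq> K" "K \<subseteq> L m"
  shows "K \<lhd> G"
proof (rule normal_invI[OF assms(2)])
  fix g x assume "g \<in> carrier G" "x \<in> K"
  then show "g \<otimes> x \<otimes> inv g \<in> K"
    using conj_mem[OF assms(1) _ inv_closed assms(2,3), of x g] assms(4) by auto
qed

lemma closedin_comm_preimage:
  "u \<in> carrier G \<Longrightarrow> closedin T K \<Longrightarrow> closedin T {g \<in> L a. comm g u \<in> K}"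
  by (intro closedin_preimage_Int continuous_map_gcommutator continuous_map_const_id L_closed)

text \<open>Conjugation by \<open>x\<close> turns \<open>k\<close> into \<open>k\<close> times d =
  [k, x], so [k^q, x] is the inverse of k^q times (k d)^q. Modulo \<open>K\<close> the elements
  \<open>k\<close> and d commute, and d^q remains.\<close>

lemma comm_pow_mem:
  assumes "K \<lhd> G" "k \<in> carrier G" "x \<in> carrier G"
    and "comm k (comm k x) \<in> K" "comm k x [^] (q::nat) \<in> K"
  shows "comm (k [^] q) x \<in> K"
proof -
  interpret K: normal K G by (rule assms)
  let ?d = "comm k x"
  have "inv x \<otimes> k [^] q \<otimes> x = (inv x \<otimes> k \<otimes> x) [^] q"
    using conj_pow[of k "inv x" q] assms by simp
  also have "\<dots> = (k \<otimes> ?d) [^] q"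
    using assms by (simp add: conj_eq_mult_gcommutator)
  finally have e: "comm (k [^] q) x = inv (k [^] q) \<otimes> (k \<otimes> ?d) [^] q"
    using assms by (simp add: gcommutator_def m_assoc)
  have "K #> (inv (k [^] q) \<otimes> (k \<otimes> ?d) [^] q) = K #> (inv (k [^] q) \<otimes> (k [^] q \<otimes> ?d [^] q))"
    using assms by (intro K.rcos_mult_cong K.rcos_pow_mult_distrib) auto
  then show ?thesis
    using e assms K.mem_rcos_cong[of "inv (k [^] q) \<otimes> (k \<otimes> ?d) [^] q" "?d [^] q"] by simp
qed

end

context lyndon_series
begin

lemma tau_power_L:
  assumes "Lyn w"
  shows "\<tau> w [^] (p ^ k) \<in> L (length w + k)"
proof (induction k)
  case 0
  then show ?case
    using tau_L assms lyndon_lists lyndon_nonempty by simp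
next
  case (Suc k)
  have wG: "\<tau> w \<in> carrier G"
    using assms lyndon_lists lyndon_nonempty by simp
  have "1 \<le> length w + k"
    using assms lyndon_nonempty by (cases w) auto
  then have "(\<tau> w [^] (p ^ k)) [^] p \<in> L (Suc (length w + k))"
    using Suc by (intro pow_p_L)
  then show ?case
    using wG by (simp add: nat_pow_pow mult.commute)
qed

text \<open>For infinite alphabets: an open normal subgroup contains all but finitely many letters,
  hence \<tau> of every word with at least one letter outside a finite set.\<close>

lemma tau_mem_normal:
  assumes "N \<lhd> G" "w \<in> lists X" "x \<in> set w" "x \<in> N"
  shows "\<tau> w \<in> N"
  using assms(2,3)
proof (induction w rule: length_induct)
  case (1 w)
  interpret N: normal N G by (rule assms(1))
  show ?case
  proof (cases "1 < length w")
    case False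
    then have "w = [x]" "x \<in> X"
      using 1(2,3) by (cases w; auto)+
    then show ?thesis
      using assms(4) by simp
  next
    case True
    note bounds = std_split_bounds[OF 1(2) True, of r]
    have lr: "std_left w \<in> lists X" "std_right w \<in> lists X" "std_left w \<noteq> []" "std_right w \<noteq> []"
      "length (std_left w) < length w" "length (std_right w) < length w"
      using bounds True 1(2) by (auto dest: in_set_takeD in_set_dropD)
    have "x \<in> set (std_left w) \<or> x \<in> set (std_right w)"
      using 1(3) by (metis Un_iff append_take_drop_id set_append)
    then have "\<tau> (std_left w) \<in> N \<or> \<tau> (std_right w) \<in> N"
      using 1(1) lr by blast
    then show ?thesis
      unfolding tau_std[OF 1(2) True] using lr by (intro N.gcommutator_mem tau_carrier)
  qed
qed

text \<open>Indexed by the number of letters minus 1.\<close>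

primrec letter_comms :: "nat \<Rightarrow> 'a set" where
  "letter_comms 0 = X"
| "letter_comms (Suc n) = {comm x c | x c. x \<in> X \<and> c \<in> letter_comms n}"

lemma letter_comms_L: "letter_comms n \<subseteq> L (Suc n)"
proof (induction n)
  case (Suc n)
  then show ?case
    using comm_L_right[of "Suc n"] X_subset by auto
qed (use X_subset in simp)

lemma lyndon_single: "x \<in> X \<Longrightarrow> Lyn [x]"
  by (auto simp: lyndon_def Cons_eq_append_conv)

text \<open>A bracket of letters is expanded from the inside: the induction hypothesis is used for
  the preimage of \<open>K\<close> under commutation with the outer letter \<open>x\<close>, and
  \<open>comm_tau_mem\<close> treats the bracket of a Lyndon commutator with
  \<open>x\<close>.\<close>

lemma letter_comms_subset:
  assumes "subgroup K G" "L (Suc (Suc n)) \<subseteq> K" "\<And>w. Lyn w \<Longrightarrow> length w = Suc n \<Longrightarrow> \<tau> w \<in> K"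
  shows "letter_comms n \<subseteq> K"
  using assms
proof (induction n arbitrary: K)
  case 0
  then show ?case
    using lyndon_single tau_single by (metis One_nat_def length_Cons letter_comms.simps(1) list.size(3) subsetI)
next
  case (Suc n)
  have "comm x c \<in> K" if x: "x \<in> X" and c: "c \<in> letter_comms n" for x c
  proof -
    let ?K = "{g \<in> L (Suc n). comm g x \<in> K}"
    have xL: "x \<in> L 1"
      using x X_subset by auto
    have K: "subgroup ?K G" "L (Suc (Suc n)) \<subseteq> ?K"
      using subgroup_comm_preimage[OF _ _ xL Suc.prems(1), of "Suc n"] Suc.prems(2) by auto
    have "\<tau> w \<in> ?K" if w: "Lyn w" "length w = Suc n" for w
    proof -
      have "comm (\<tau> w) (\<tau> [x]) \<in> K"
        using w x lyndon_single Suc.prems by (intro comm_tau_mem) auto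
      then show ?thesis
        using tau_L[of w] w x lyndon_lists lyndon_nonempty by auto
    qed
    then have "letter_comms n \<subseteq> ?K"
      using Suc.IH[OF K] by blast
    then show ?thesis
      using c x X_subset Suc.prems(1) letter_comms_L[of n] by (intro comm_swap_mem[of K c x]) auto
  qed
  then show ?case by auto
qed

end

section \<open>Topological generation of each term modulo the next one\<close>

locale generating_series = lyndon_series +
  assumes X_generates: "closed_subgroup_generated G T X = carrier G"
begin

lemma closed_subgroup_contains:
  "subgroup K G \<Longrightarrow> closedin T K \<Longrightarrow> X \<subseteq> K \<Longrightarrow> carrier G \<subseteq> K"
  using closed_subgroup_generated_minimal[of K X] X_generates by simp

text \<open>Commutation with \<open>h\<close> is additive modulo \<open>K\<close>, so the admissible
  \<open>g\<close> form a closed subgroup, which need only contain the basis.\<close>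

lemma comm_letters_mem:
  assumes "1 \<le> b" "h \<in> L b" "subgroup K G" "closedin T K" "L (Suc (Suc b)) \<subseteq> K"
    and X: "\<And>x. x \<in> X \<Longrightarrow> comm x h \<in> K" and g: "g \<in> carrier G"
  shows "comm g h \<in> K"
proof -
  let ?K = "{g \<in> L 1. comm g h \<in> K}"
  have "subgroup ?K G"
    using assms by (intro subgroup_comm_preimage[of 1 b]) auto
  moreover have "closedin T ?K"
    using assms by (intro closedin_comm_preimage) auto
  ultimately have "carrier G \<subseteq> ?K"
    using X X_subset by (intro closed_subgroup_contains) auto
  then show ?thesis
    using g by blast
qed

lemma comm_L2_mem:
  assumes K: "subgroup K G" "closedin T K" "L 3 \<subseteq> K" and X: "letter_comms 1 \<subseteq> K"
    and gh: "g \<in> carrier G" "h \<in> carrier G"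
  shows "comm g h \<in> K"
proof -
  have K': "L (Suc (Suc 1)) \<subseteq> K"
    using K(3) by (simp add: numeral_3_eq_3)
  have "comm h x \<in> K" if "x \<in> X" "h \<in> carrier G" for x h
  proof -
    have "comm y x \<in> K" if "y \<in> X" for y
      using X that \<open>x \<in> X\<close> by auto
    moreover have "x \<in> L 1"
      using \<open>x \<in> X\<close> X_subset by auto
    ultimately show ?thesis
      using comm_letters_mem[OF order_refl _ K(1,2) K' _ that(2)] by blast
  qed
  then have "comm x h \<in> K" if "x \<in> X" for x
    using that gh X_subset K(1) by (intro comm_swap_mem[of K h x]) auto
  then show ?thesis
    using comm_letters_mem[OF order_refl _ K(1,2) K' _ gh(1), of h] gh(2) by simp
qed

text \<open>The p-th power generators are in \<open>K\<close> by assumption. In a commutator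
  generator [g, h] the element \<open>g\<close> is reduced to a letter \<open>x\<close>, and the
  induction hypothesis is applied to the set of \<open>h\<close> with [h, x] in \<open>K\<close>.
  Its condition on p-th powers is the place where [k^p, x] is compared with [k, x]^p.\<close>

lemma L_subset_if_letter_comms:
  assumes "subgroup K G" "closedin T K" "L (Suc (Suc (Suc m))) \<subseteq> K" "K \<subseteq> L (Suc (Suc m))"
    and "\<And>h. h \<in> L (Suc m) \<Longrightarrow> h [^] p \<in> K" and "letter_comms (Suc m) \<subseteq> K"
  shows "L (Suc (Suc m)) \<subseteq> K"
  using assms
proof (induction m arbitrary: K)
  case 0
  have "L (Suc 1) \<subseteq> K"
    using 0 comm_L2_mem[of K] by (intro L_Suc_minimal) (auto simp: numeral_3_eq_3)
  then show ?case by simp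
next
  case (Suc m)
  note K = Suc.prems(1,2)
  have normal: "K \<lhd> G"
    by (rule normal_between[OF _ K(1) Suc.prems(3,4)]) simp
  \<comment> \<open>The degree is 2m + 3, which suffices unless \<open>m = 0\<close>. In that case
    the bracket has degree 3 only, and it is expanded linearly into brackets [y, [z, x]] of letters,
    which are in \<open>K\<close> by hypothesis.\<close>
  have kd: "comm k (comm k x) \<in> K" if k: "k \<in> L (Suc m)" and x: "x \<in> X" for k x
  proof (cases "m = 0")
    case True
    have xL: "x \<in> L 1"
      using x X_subset by auto
    have c: "comm k x \<in> L 2"
      using k comm_L_left[of 1 x k] xL True by (simp add: numeral_2_eq_2)
    have LK: "L (Suc (Suc 2)) \<subseteq> K"
      using Suc.prems(3) True by (simp add: numeral_2_eq_2)
    have "comm y (comm k x) \<in> K" if y: "y \<in> X" for y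
    proof -
      let ?K = "{g \<in> L 2. comm g y \<in> K}"
      have yL: "y \<in> L 1"
        using y X_subset by auto
      have K2: "subgroup ?K G" "L (Suc 2) \<subseteq> ?K" "closedin T ?K"
        using subgroup_comm_preimage[OF _ _ yL K(1), of 2] closedin_comm_preimage[OF L_mem[OF yL] K(2)] LK
        by auto
      have "comm z x \<in> ?K" if z: "z \<in> X" for z
      proof -
        have "comm z x \<in> letter_comms (Suc 0)"
          using x z by auto
        then have "comm y (comm z x) \<in> letter_comms (Suc (Suc 0))"
          using y unfolding letter_comms.simps(2)[of "Suc 0"] by blast
        then have "comm y (comm z x) \<in> K"
          using Suc.prems(6) unfolding True by (rule subsetD[rotated])
        moreover have "comm z x \<in> L 2"
          using comm_L_left[of 1 x z] xL z X_subset by (auto simp: numeral_2_eq_2)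
        ultimately show ?thesis
          using comm_swap_mem[OF K(1), of y "comm z x"] yL by auto
      qed
      then have "comm k x \<in> ?K"
        using comm_letters_mem[OF order_refl xL K2(1,3) _ _ L_mem[OF k]] K2(2)
        by (simp add: numeral_2_eq_2)
      then show ?thesis
        using comm_swap_mem[OF K(1), of "comm k x" y] yL by auto
    qed
    then show ?thesis
      using comm_letters_mem[OF _ c K LK _ L_mem[OF k]] by simp
  next
    case False
    have "comm k x \<in> L (Suc (Suc m))"
      using comm_L_left[of "Suc m" x k] k x X_subset by auto
    then have "comm k (comm k x) \<in> L (Suc m + Suc (Suc m))"
      using k by (intro comm_L_add) auto
    moreover have "L (Suc m + Suc (Suc m)) \<subseteq> L (Suc (Suc (Suc (Suc m))))"
      using False by (intro L_antimono) auto
    ultimately show ?thesis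
      using Suc.prems(3) by blast
  qed
  have "comm x h \<in> K" if x: "x \<in> X" and h: "h \<in> L (Suc (Suc m))" for x h
  proof -
    let ?K = "{h \<in> L (Suc (Suc m)). comm h x \<in> K}"
    have xL: "x \<in> L 1" and xG: "x \<in> carrier G"
      using x X_subset by auto
    have K2: "subgroup ?K G" "L (Suc (Suc (Suc m))) \<subseteq> ?K"
      using subgroup_comm_preimage[OF _ _ xL K(1), of "Suc (Suc m)"] Suc.prems(3) by auto
    have "L (Suc (Suc m)) \<subseteq> ?K"
    proof (rule Suc.IH[OF K2(1) _ K2(2)])
      show "closedin T ?K"
        by (rule closedin_comm_preimage[OF xG K(2)])
      show "letter_comms (Suc m) \<subseteq> ?K"
      proof
        fix c assume c: "c \<in> letter_comms (Suc m)"
        then have "comm x c \<in> K"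
          using Suc.prems(6) x unfolding letter_comms.simps(2)[of "Suc m"] by blast
        moreover have "c \<in> L (Suc (Suc m))"
          using c letter_comms_L by blast
        ultimately show "c \<in> ?K"
          using comm_swap_mem[OF K(1), of x c] xG by auto
      qed
      fix k assume k: "k \<in> L (Suc m)"
      have "comm k x \<in> L (Suc (Suc m))"
        using comm_L_left[of "Suc m" x k] k xG by auto
      then have "comm (k [^] p) x \<in> K"
        using kd[OF k x] Suc.prems(5) k xG by (intro comm_pow_mem[OF normal]) auto
      then show "k [^] p \<in> ?K"
        using pow_p_L[of "Suc m" k] k by simp
    qed auto
    then show ?thesis
      using h xG comm_swap_mem[OF K(1), of h x] by auto
  qed
  then have "comm g h \<in> K" if "g \<in> carrier G" "h \<in> L (Suc (Suc m))" for g h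
    using comm_letters_mem[OF _ that(2) K Suc.prems(3) _ that(1)] that(2) by simp
  then show ?case
    using L_Suc_minimal[OF _ K Suc.prems(5)] by simp
qed

text \<open>Intersecting \<open>K\<close> with \<open>L (Suc n)\<close> gives a subgroup
  \<open>M\<close> between consecutive terms, which is therefore normal. It contains the brackets of
  letters by the rewriting of Lyndon brackets, so only the p-th powers of \<open>L n\<close> remain,
  and these are supplied by the induction hypothesis.\<close>

theorem L_subset_if_tau_powers:
  assumes "1 \<le> n" "subgroup K G" "closedin T K" "L (Suc n) \<subseteq> K"
    and "\<And>w. Lyn w \<Longrightarrow> length w \<le> n \<Longrightarrow> \<tau> w [^] (p ^ (n - length w)) \<in> K"
  shows "L n \<subseteq> K"
  using assms
proof (induction n arbitrary: K rule: dec_induct)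
  case base
  have "x \<in> K" if "x \<in> X" for x
    using base(4)[of "[x]"] that lyndon_single X_subset by auto
  then show ?case
    using closed_subgroup_contains[OF base(1,2)] by auto
next
  case (step n)
  define M where "M = K \<inter> L (Suc n)"
  have M: "subgroup M G" "closedin T M" "L (Suc (Suc n)) \<subseteq> M" "M \<subseteq> L (Suc n)"
    using step.prems L_subgroup L_closed L_Suc_subset by (auto simp: M_def intro: subgroups_Inter_pair)
  have normal: "M \<lhd> G"
    by (rule normal_between[OF _ M(1,3,4)]) simp
  interpret M: normal M G by (rule normal)
  obtain m where m: "n = Suc m"
    using step.hyps by (cases n) auto
  have lc: "letter_comms (Suc m) \<subseteq> M"
  proof (rule letter_comms_subset[OF M(1)])
    fix w assume w: "Lyn w" "length w = Suc (Suc m)"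
    then show "\<tau> w \<in> M"
      using step.prems(4)[of w] tau_L[of w] lyndon_lists lyndon_nonempty m by (auto simp: M_def)
  qed (use M(3) m in simp)
  \<comment> \<open>Degree 2n is at least n + 2 except for n = 1, where the commutators are reduced
    to brackets of two letters. This is what makes p-th powers additive modulo \<open>M\<close>,
    also for p = 2.\<close>
  have comm_M: "comm x y \<in> M" if "x \<in> L n" "y \<in> L n" for x y
  proof (cases "m = 0")
    case True
    then show ?thesis
      using that m lc M by (intro comm_L2_mem) (auto simp: numeral_3_eq_3)
  next
    case False
    have "comm x y \<in> L (n + n)"
      using that m by (intro comm_L_add) auto
    moreover have "L (n + n) \<subseteq> L (Suc (Suc n))"
      using False m by (intro L_antimono) auto
    ultimately show ?thesis
      using M(3) by blast
  qed
  \<comment> \<open>The induction hypothesis is used with this set in place of \<open>K\<close>: the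
    p-th power of a Lyndon power of degree \<open>n\<close> is the Lyndon power of degree
    \<open>Suc n\<close> of the same word.\<close>
  have "L n \<subseteq> {h \<in> L n. h [^] p \<in> M}"
  proof (rule step.IH)
    show "subgroup {h \<in> L n. h [^] p \<in> M} G"
      using M(1) L_subgroup comm_M by (intro M.subgroup_pow_preimage) auto
    show "closedin T {h \<in> L n. h [^] p \<in> M}"
      by (intro closedin_preimage_Int continuous_map_pow continuous_map_const_id(2) M(2) L_closed)
    show "L (Suc n) \<subseteq> {h \<in> L n. h [^] p \<in> M}"
      using M(3) pow_p_L[of "Suc n"] L_Suc_subset by auto
    fix w assume w: "Lyn w" "length w \<le> n"
    have wG: "\<tau> w \<in> carrier G"
      using w lyndon_lists lyndon_nonempty by auto
    have "(\<tau> w [^] (p ^ (n - length w))) [^] p = \<tau> w [^] (p ^ (Suc n - length w))"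
      using w wG by (simp add: nat_pow_pow Suc_diff_le mult.commute)
    moreover have "\<tau> w [^] (p ^ (Suc n - length w)) \<in> K"
      using step.prems(4)[of w] w by simp
    moreover have *: "\<tau> w [^] (p ^ (n - length w)) \<in> L n"
      using tau_power_L[of w "n - length w"] w by simp
    moreover have "(\<tau> w [^] (p ^ (n - length w))) [^] p \<in> L (Suc n)"
      using pow_p_L[OF _ *] m by simp
    ultimately show "\<tau> w [^] (p ^ (n - length w)) \<in> {h \<in> L n. h [^] p \<in> M}"
      by (simp add: M_def)
  qed
  then have "h [^] p \<in> M" if "h \<in> L (Suc m)" for h
    using that m by blast
  from L_subset_if_letter_comms[OF M(1,2) M(3,4)[unfolded m] this lc]
  have "L (Suc (Suc m)) \<subseteq> M" .
  then show ?case
    using m by (simp add: M_def)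
qed

end


section \<open>Unipotent matrices modulo prime powers\<close>

lemma mod_sum_mult_left:
  fixes q :: int
  shows "(\<Sum>k\<in>A. (f k mod q) * g k) mod q = (\<Sum>k\<in>A. f k * g k) mod q"
  by (subst (1 2) mod_sum_eq[symmetric]) (simp add: mod_mult_left_eq)

lemma mod_sum_mult_right:
  fixes q :: int
  shows "(\<Sum>k\<in>A. f k * (g k mod q)) mod q = (\<Sum>k\<in>A. f k * g k) mod q"
  by (subst (1 2) mod_sum_eq[symmetric]) (simp add: mod_mult_right_eq)

lemma discrete_topological_group:
  assumes "group G"
  shows "topological_group G (discrete_topology (carrier G))"
proof -
  interpret group G by (rule assms)
  show ?thesis
    by unfold_locales (auto simp: prod_topology_discrete_topology[symmetric])
qed

locale unipotent_mod =
  fixes p K d :: nat and m :: int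
  assumes p: "2 \<le> p" and K: "1 \<le> K" and m: "m = int p ^ K"
begin

definition idx :: "nat set" where "idx = {1..d}"

lemma finite_idx [simp]: "finite idx"
  by (simp add: idx_def)

abbreviation U :: "(nat \<times> nat \<Rightarrow> int) monoid" where
  "U \<equiv> unipotent_group d (residue_ring m)"

sublocale res: residues m "residue_ring m"
proof unfold_locales
  show "1 < m"
    unfolding m using p K by (intro one_less_power) auto
qed simp

lemma m_gt_1: "1 < m"
  by (rule res.m_gt_one)

lemma U_mem_iff:
  "M \<in> carrier U \<longleftrightarrow> M \<in> idx \<times> idx \<rightarrow>\<^sub>E {0..m - 1} \<and>
     (\<forall>i\<in>idx. \<forall>j\<in>idx. (i = j \<longrightarrow> M (i, j) = 1) \<and> (j < i \<longrightarrow> M (i, j) = 0))"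
  by (simp add: unipotent_group_def idx_def res.res_carrier_eq res.res_one_eq res.res_zero_eq
      del: One_nat_def)

lemma U_entry:
  assumes "M \<in> carrier U" "i \<in> idx" "j \<in> idx"
  shows "0 \<le> M (i, j)" "M (i, j) < m" "i = j \<Longrightarrow> M (i, j) = 1" "j < i \<Longrightarrow> M (i, j) = 0"
    "M (i, j) mod m = M (i, j)"
proof -
  have "M (i, j) \<in> {0..m - 1}"
    using assms by (auto simp: U_mem_iff)
  then show "0 \<le> M (i, j)" "M (i, j) < m" "M (i, j) mod m = M (i, j)"
    by auto
  show "i = j \<Longrightarrow> M (i, j) = 1" "j < i \<Longrightarrow> M (i, j) = 0"
    using assms by (auto simp: U_mem_iff)
qed

lemma U_eqI:
  assumes "M \<in> carrier U" "N \<in> carrier U"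
    "\<And>i j. i \<in> idx \<Longrightarrow> j \<in> idx \<Longrightarrow> i < j \<Longrightarrow> M (i, j) = N (i, j)"
  shows "M = N"
proof (rule PiE_ext)
  show "M \<in> idx \<times> idx \<rightarrow>\<^sub>E {0..m - 1}" "N \<in> idx \<times> idx \<rightarrow>\<^sub>E {0..m - 1}"
    using assms by (auto simp: U_mem_iff)
  fix z assume "z \<in> idx \<times> idx"
  then obtain i j where z: "z = (i, j)" "i \<in> idx" "j \<in> idx"
    by auto
  then show "M z = N z"
    using U_entry[OF assms(1) z(2,3)] U_entry[OF assms(2) z(2,3)] assms(3)
    by (cases i j rule: linorder_cases) auto
qed

lemma U_mult:
  assumes "i \<in> idx" "j \<in> idx"
  shows "(M \<otimes>\<^bsub>U\<^esub> N) (i, j) = (\<Sum>k\<in>idx. M (i, k) * N (k, j)) mod m"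
  using assms res.sum_cong[of "idx" "\<lambda>k. M (i, k) * N (k, j)"]
  by (simp add: unipotent_group_def idx_def res.res_mult_eq del: One_nat_def)

lemma U_one: "i \<in> idx \<Longrightarrow> j \<in> idx \<Longrightarrow> \<one>\<^bsub>U\<^esub> (i, j) = (if i = j then 1 else 0)"
  by (simp add: unipotent_group_def idx_def res.res_one_eq res.res_zero_eq)

lemma U_mult_closed:
  assumes M: "M \<in> carrier U" and N: "N \<in> carrier U"
  shows "M \<otimes>\<^bsub>U\<^esub> N \<in> carrier U"
  unfolding U_mem_iff
proof (intro conjI ballI impI)
  show "M \<otimes>\<^bsub>U\<^esub> N \<in> idx \<times> idx \<rightarrow>\<^sub>E {0..m - 1}"
  proof (rule PiE_I)
    fix z assume "z \<in> idx \<times> idx"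
    then obtain i j where z: "z = (i, j)" "i \<in> idx" "j \<in> idx"
      by auto
    then show "(M \<otimes>\<^bsub>U\<^esub> N) z \<in> {0..m - 1}"
      using m_gt_1 by (simp only: U_mult) simp
  qed (auto simp: unipotent_group_def idx_def)
  fix i j assume ij: "i \<in> idx" "j \<in> idx"
  show "(M \<otimes>\<^bsub>U\<^esub> N) (i, j) = 1" if "i = j"
  proof -
    have "(\<Sum>k\<in>idx. M (i, k) * N (k, i)) = (\<Sum>k\<in>idx. if k = i then 1 else 0)"
    proof (rule sum.cong)
      fix k assume k: "k \<in> idx"
      then show "M (i, k) * N (k, i) = (if k = i then 1 else 0)"
        using U_entry(3,4)[OF M ij(1) k] U_entry(3,4)[OF N k ij(1)]
        by (cases k i rule: linorder_cases) auto
    qed simp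
    then show ?thesis
      using ij that m_gt_1 by (simp only: U_mult) simp
  qed
  show "(M \<otimes>\<^bsub>U\<^esub> N) (i, j) = 0" if "j < i"
  proof -
    have "(\<Sum>k\<in>idx. M (i, k) * N (k, j)) = 0"
    proof (rule sum.neutral, rule ballI)
      fix k assume k: "k \<in> idx"
      then show "M (i, k) * N (k, j) = 0"
        using U_entry(4)[OF M ij(1) k] U_entry(4)[OF N k ij(2)] that
        by (cases "k < i") auto
    qed
    then show ?thesis
      using ij by (simp only: U_mult) simp
  qed
qed

lemma U_one_closed: "\<one>\<^bsub>U\<^esub> \<in> carrier U"
  unfolding U_mem_iff using m_gt_1
  by (auto simp: U_one unipotent_group_def idx_def res.res_one_eq res.res_zero_eq PiE_iff)

lemma U_monoid: "monoid U"
proof (rule monoidI)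
  show "M \<otimes>\<^bsub>U\<^esub> N \<in> carrier U" if "M \<in> carrier U" "N \<in> carrier U" for M N
    using that by (rule U_mult_closed)
  show "\<one>\<^bsub>U\<^esub> \<in> carrier U"
    by (rule U_one_closed)
  show "(M \<otimes>\<^bsub>U\<^esub> N) \<otimes>\<^bsub>U\<^esub> P = M \<otimes>\<^bsub>U\<^esub> (N \<otimes>\<^bsub>U\<^esub> P)"
    if "M \<in> carrier U" "N \<in> carrier U" "P \<in> carrier U" for M N P
  proof (rule U_eqI)
    fix i j assume ij: "i \<in> idx" "j \<in> idx"
    have "((M \<otimes>\<^bsub>U\<^esub> N) \<otimes>\<^bsub>U\<^esub> P) (i, j) =
        (\<Sum>k\<in>idx. ((\<Sum>l\<in>idx. M (i, l) * N (l, k)) mod m) * P (k, j)) mod m"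
      unfolding U_mult[OF ij] using ij by (intro arg_cong2[where f = "(mod)"] sum.cong) (simp_all only: U_mult)
    also have "\<dots> = (\<Sum>k\<in>idx. (\<Sum>l\<in>idx. M (i, l) * N (l, k)) * P (k, j)) mod m"
      by (rule mod_sum_mult_left)
    also have "(\<Sum>k\<in>idx. (\<Sum>l\<in>idx. M (i, l) * N (l, k)) * P (k, j)) =
        (\<Sum>l\<in>idx. M (i, l) * (\<Sum>k\<in>idx. N (l, k) * P (k, j)))"
      unfolding sum_distrib_left sum_distrib_right by (subst sum.swap) (simp add: mult.assoc)
    also have "\<dots> mod m = (\<Sum>l\<in>idx. M (i, l) * ((\<Sum>k\<in>idx. N (l, k) * P (k, j)) mod m)) mod m"
      by (rule mod_sum_mult_right[symmetric])
    also have "\<dots> = (M \<otimes>\<^bsub>U\<^esub> (N \<otimes>\<^bsub>U\<^esub> P)) (i, j)"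
      unfolding U_mult[OF ij] using ij by (intro arg_cong2[where f = "(mod)"] sum.cong) (simp_all only: U_mult)
    finally show "((M \<otimes>\<^bsub>U\<^esub> N) \<otimes>\<^bsub>U\<^esub> P) (i, j) = (M \<otimes>\<^bsub>U\<^esub> (N \<otimes>\<^bsub>U\<^esub> P)) (i, j)" .
  qed (use that U_mult_closed in auto)
  fix M assume M: "M \<in> carrier U"
  show "\<one>\<^bsub>U\<^esub> \<otimes>\<^bsub>U\<^esub> M = M"
  proof (rule U_eqI)
    fix i j assume ij: "i \<in> idx" "j \<in> idx"
    have "(\<Sum>k\<in>idx. \<one>\<^bsub>U\<^esub> (i, k) * M (k, j)) = (\<Sum>k\<in>idx. if k = i then M (k, j) else 0)"
      using ij by (intro sum.cong) (auto simp: U_one)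
    then show "(\<one>\<^bsub>U\<^esub> \<otimes>\<^bsub>U\<^esub> M) (i, j) = M (i, j)"
      using ij U_entry(5)[OF M ij] by (simp only: U_mult) simp
  qed (use M U_mult_closed U_one_closed in auto)
  show "M \<otimes>\<^bsub>U\<^esub> \<one>\<^bsub>U\<^esub> = M"
  proof (rule U_eqI)
    fix i j assume ij: "i \<in> idx" "j \<in> idx"
    have "(\<Sum>k\<in>idx. M (i, k) * \<one>\<^bsub>U\<^esub> (k, j)) = (\<Sum>k\<in>idx. if k = j then M (i, k) else 0)"
      using ij by (intro sum.cong) (auto simp: U_one)
    then show "(M \<otimes>\<^bsub>U\<^esub> \<one>\<^bsub>U\<^esub>) (i, j) = M (i, j)"
      using ij U_entry(5)[OF M ij] by (simp only: U_mult) simp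
  qed (use M U_mult_closed U_one_closed in auto)
qed

sublocale U_mon: monoid U
  by (rule U_monoid)

text \<open>The modulus of the entry \<open>(i, j)\<close> at level \<open>t\<close>: the matrices congruent to 1 at level \<open>t\<close> will
  turn out to contain the \<open>t\<close>-th term of the lower p-central series.\<close>

definition level :: "nat \<Rightarrow> nat \<Rightarrow> nat \<Rightarrow> int" where
  "level t i j = int p ^ min K (t - (j - i))"

definition cg :: "nat \<Rightarrow> (nat \<times> nat \<Rightarrow> int) \<Rightarrow> (nat \<times> nat \<Rightarrow> int) \<Rightarrow> bool" where
  "cg t M N \<longleftrightarrow> (\<forall>i\<in>idx. \<forall>j\<in>idx. i < j \<longrightarrow> [M (i, j) = N (i, j)] (mod level t i j))"

lemma level_dvd_m: "level t i j dvd m"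
  by (simp add: level_def m le_imp_power_dvd)

lemma level_dvd: "t' - (j' - i') \<le> t - (j - i) \<Longrightarrow> level t' i' j' dvd level t i j"
  by (auto simp: level_def intro!: le_imp_power_dvd)

lemma cg_refl [simp]: "cg t M M"
  by (simp add: cg_def)

lemma cg_sym: "cg t M N \<Longrightarrow> cg t N M"
  by (simp add: cg_def cong_sym)

lemma cg_entry:
  assumes "M \<in> carrier U" "N \<in> carrier U" "cg t M N" "i \<in> idx" "j \<in> idx"
  shows "[M (i, j) = N (i, j)] (mod level t i j)"
  using assms U_entry(3,4)[OF assms(1,4,5)] U_entry(3,4)[OF assms(2,4,5)]
  by (cases i j rule: linorder_cases) (auto simp: cg_def)

lemma U_mult_cong:
  assumes "i \<in> idx" "j \<in> idx"
  shows "[(M \<otimes>\<^bsub>U\<^esub> N) (i, j) = (\<Sum>k\<in>idx. M (i, k) * N (k, j))] (mod level t i j)"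
proof -
  have "[(M \<otimes>\<^bsub>U\<^esub> N) (i, j) = (\<Sum>k\<in>idx. M (i, k) * N (k, j))] (mod m)"
    using assms by (simp add: U_mult cong_def)
  then show ?thesis
    using level_dvd_m by (rule cong_dvd_modulus)
qed

lemma cg_mult:
  assumes M: "M \<in> carrier U" "M' \<in> carrier U" "cg t M M'"
    and N: "N \<in> carrier U" "N' \<in> carrier U" "cg t N N'"
  shows "cg t (M \<otimes>\<^bsub>U\<^esub> N) (M' \<otimes>\<^bsub>U\<^esub> N')"
  unfolding cg_def
proof (intro ballI impI)
  fix i j assume ij: "i \<in> idx" "j \<in> idx" "i < j"
  have "[(\<Sum>k\<in>idx. M (i, k) * N (k, j)) = (\<Sum>k\<in>idx. M' (i, k) * N' (k, j))] (mod level t i j)"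
  proof (rule cong_sum)
    fix k assume k: "k \<in> idx"
    consider "k < i" | "i \<le> k" "k \<le> j" | "j < k"
      by linarith
    then show "[M (i, k) * N (k, j) = M' (i, k) * N' (k, j)] (mod level t i j)"
    proof cases
      case 1
      then show ?thesis
        using U_entry(4)[OF M(1) ij(1) k] U_entry(4)[OF M(2) ij(1) k] by simp
    next
      case 2
      have "[M (i, k) = M' (i, k)] (mod level t i j)"
        by (rule cong_dvd_modulus[OF cg_entry[OF M ij(1) k]]) (use 2 in \<open>auto intro!: level_dvd\<close>)
      moreover have "[N (k, j) = N' (k, j)] (mod level t i j)"
        by (rule cong_dvd_modulus[OF cg_entry[OF N k ij(2)]]) (use 2 in \<open>auto intro!: level_dvd\<close>)
      ultimately show ?thesis
        by (rule cong_mult)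
    next
      case 3
      then show ?thesis
        using U_entry(4)[OF N(1) k ij(2)] U_entry(4)[OF N(2) k ij(2)] by simp
    qed
  qed
  then show "[(M \<otimes>\<^bsub>U\<^esub> N) (i, j) = (M' \<otimes>\<^bsub>U\<^esub> N') (i, j)] (mod level t i j)"
    using U_mult_cong[OF ij(1,2)] by (meson cong_sym cong_trans)
qed

text \<open>A cross term with i < k < j involves an entry closer to the diagonal than (i, j), whose
  modulus at level \<open>t\<close> is already divisible by the modulus of (i, j) at level
  \<open>Suc t\<close>.\<close>

lemma mult_entry_add:
  assumes M: "M \<in> carrier U" and N: "N \<in> carrier U" and t: "1 \<le> t"
    and cg: "cg t M \<one>\<^bsub>U\<^esub> \<or> cg t N \<one>\<^bsub>U\<^esub>" and ij: "i \<in> idx" "j \<in> idx" "i < j"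
  shows "[(M \<otimes>\<^bsub>U\<^esub> N) (i, j) = M (i, j) + N (i, j)] (mod level (Suc t) i j)"
proof -
  let ?q = "level (Suc t) i j"
  have "[(\<Sum>k\<in>idx. M (i, k) * N (k, j)) =
      (\<Sum>k\<in>idx. (if k = i then N (i, j) else 0) + (if k = j then M (i, j) else 0))] (mod ?q)"
  proof (rule cong_sum)
    fix k assume k: "k \<in> idx"
    consider "k < i" | "k = i" | "i < k" "k < j" | "k = j" | "j < k"
      by linarith
    then show "[M (i, k) * N (k, j) = (if k = i then N (i, j) else 0) + (if k = j then M (i, j) else 0)]
        (mod ?q)"
    proof cases
      case 3
      have "?q dvd M (i, k) * N (k, j)"
      proof (cases "cg t M \<one>\<^bsub>U\<^esub>")
        case True
        then have "level t i k dvd M (i, k)"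
          using 3 k ij by (auto simp: cg_def U_one cong_0_iff)
        moreover have "?q dvd level t i k"
          using 3 by (intro level_dvd) auto
        ultimately show ?thesis
          by (meson dvd_mult2 dvd_trans)
      next
        case False
        then have "level t k j dvd N (k, j)"
          using cg 3 k ij by (auto simp: cg_def U_one cong_0_iff)
        moreover have "?q dvd level t k j"
          using 3 by (intro level_dvd) auto
        ultimately show ?thesis
          by (meson dvd_mult dvd_trans)
      qed
      then show ?thesis
        using 3 by (simp add: cong_0_iff)
    qed (use U_entry(3,4)[OF M ij(1) k] U_entry(3,4)[OF N k ij(2)] ij in auto)
  qed
  also have "(\<Sum>k\<in>idx. (if k = i then N (i, j) else 0) + (if k = j then M (i, j) else 0)) =
      M (i, j) + N (i, j)"
    using ij by (simp add: sum.distrib)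
  finally show ?thesis
    using U_mult_cong[OF ij(1,2)] by (meson cong_trans)
qed

lemma cg_mult_commute:
  assumes "M \<in> carrier U" "N \<in> carrier U" "1 \<le> t" "cg t N \<one>\<^bsub>U\<^esub>"
  shows "cg (Suc t) (M \<otimes>\<^bsub>U\<^esub> N) (N \<otimes>\<^bsub>U\<^esub> M)"
  unfolding cg_def
proof (intro ballI impI)
  fix i j assume ij: "i \<in> idx" "j \<in> idx" "i < j"
  show "[(M \<otimes>\<^bsub>U\<^esub> N) (i, j) = (N \<otimes>\<^bsub>U\<^esub> M) (i, j)] (mod level (Suc t) i j)"
    using cong_trans[OF mult_entry_add[OF assms(1,2,3) disjI2[OF assms(4)] ij]
        cong_sym[OF mult_entry_add[OF assms(2,1,3) disjI1[OF assms(4)] ij, unfolded add.commute[of "N (i, j)"]]]] .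
qed

text \<open>By \<open>mult_entry_add\<close> the entries of M^q are q times those of
  \<open>M\<close> modulo the next level; for q = p the extra factor p raises the level by
  one.\<close>

lemma cg_pow_p:
  assumes M: "M \<in> carrier U" and t: "1 \<le> t" and cg: "cg t M \<one>\<^bsub>U\<^esub>"
  shows "cg (Suc t) (M [^]\<^bsub>U\<^esub> p) \<one>\<^bsub>U\<^esub>"
proof -
  have pow: "cg t (M [^]\<^bsub>U\<^esub> q) \<one>\<^bsub>U\<^esub>" for q :: nat
  proof (induction q)
    case (Suc q)
    have "cg t (M [^]\<^bsub>U\<^esub> q \<otimes>\<^bsub>U\<^esub> M) (\<one>\<^bsub>U\<^esub> \<otimes>\<^bsub>U\<^esub> \<one>\<^bsub>U\<^esub>)"
      using M Suc cg by (intro cg_mult) auto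
    then show ?case by simp
  qed simp
  have entry: "[(M [^]\<^bsub>U\<^esub> q) (i, j) = int q * M (i, j)] (mod level (Suc t) i j)"
    if ij: "i \<in> idx" "j \<in> idx" "i < j" for i j and q :: nat
  proof (induction q)
    case 0
    then show ?case
      using ij by (simp add: U_one)
  next
    case (Suc q)
    have "[(M [^]\<^bsub>U\<^esub> q \<otimes>\<^bsub>U\<^esub> M) (i, j) = (M [^]\<^bsub>U\<^esub> q) (i, j) + M (i, j)] (mod level (Suc t) i j)"
      using M t cg ij by (intro mult_entry_add) auto
    also have "[(M [^]\<^bsub>U\<^esub> q) (i, j) + M (i, j) = int q * M (i, j) + M (i, j)] (mod level (Suc t) i j)"
      using Suc by (intro cong_add) auto
    finally show ?case
      by (simp add: algebra_simps)
  qed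
  show ?thesis
    unfolding cg_def
  proof (intro ballI impI)
    fix i j assume ij: "i \<in> idx" "j \<in> idx" "i < j"
    have "level t i j dvd M (i, j)"
      using cg ij by (auto simp: cg_def U_one cong_0_iff)
    then have "int p * level t i j dvd int p * M (i, j)"
      by (rule mult_dvd_mono[OF dvd_refl])
    moreover have "level (Suc t) i j dvd int p * level t i j"
      unfolding level_def power_Suc[symmetric] by (rule le_imp_power_dvd) auto
    ultimately have "level (Suc t) i j dvd int p * M (i, j)"
      by (rule dvd_trans[rotated])
    then show "[(M [^]\<^bsub>U\<^esub> p) (i, j) = \<one>\<^bsub>U\<^esub> (i, j)] (mod level (Suc t) i j)"
      using entry[OF ij, of p] ij by (simp add: U_one cong_0_iff cong_dvd_iff)
  qed
qed

lemma cg_eq: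
  assumes "M \<in> carrier U" "N \<in> carrier U" "cg t M N" "K + d \<le> t"
  shows "M = N"
proof (rule U_eqI)
  fix i j assume ij: "i \<in> idx" "j \<in> idx" "i < j"
  have "K \<le> t - (j - i)"
    using assms(4) ij by (auto simp: idx_def)
  then have "level t i j = m"
    by (simp add: level_def m min_def)
  then have "[M (i, j) = N (i, j)] (mod m)"
    using assms(3) ij by (auto simp: cg_def)
  then show "M (i, j) = N (i, j)"
    using U_entry(5)[OF assms(1) ij(1,2)] U_entry(5)[OF assms(2) ij(1,2)] by (simp add: cong_def)
qed (use assms in auto)

text \<open>Inverses are powers, because \<open>M [^] (p ^ t)\<close> is congruent to 1 at level \<open>t + 1\<close>.\<close>

lemma U_group: "group U"
proof (rule groupI)
  fix M assume M: "M \<in> carrier U"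
  have "cg (Suc t) (M [^]\<^bsub>U\<^esub> (p ^ t)) \<one>\<^bsub>U\<^esub>" for t
  proof (induction t)
    case 0
    show ?case
      by (auto simp: cg_def level_def)
  next
    case (Suc t)
    then have "cg (Suc (Suc t)) ((M [^]\<^bsub>U\<^esub> (p ^ t)) [^]\<^bsub>U\<^esub> p) \<one>\<^bsub>U\<^esub>"
      using M by (intro cg_pow_p) auto
    then show ?case
      using M by (simp add: U_mon.nat_pow_pow mult.commute)
  qed
  then have "M [^]\<^bsub>U\<^esub> (p ^ (K + d)) = \<one>\<^bsub>U\<^esub>"
    using M by (intro cg_eq[of _ _ "Suc (K + d)"]) auto
  moreover have "p ^ (K + d) = Suc (p ^ (K + d) - 1)"
    using p by simp
  ultimately have "M [^]\<^bsub>U\<^esub> (p ^ (K + d) - 1) \<otimes>\<^bsub>U\<^esub> M = \<one>\<^bsub>U\<^esub>"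
    by (metis U_mon.nat_pow_Suc)
  then show "\<exists>N\<in>carrier U. N \<otimes>\<^bsub>U\<^esub> M = \<one>\<^bsub>U\<^esub>"
    using M by (intro bexI[of _ "M [^]\<^bsub>U\<^esub> (p ^ (K + d) - 1)"]) auto
qed (use U_mon.m_assoc in auto)

sublocale U: lower_p_series U "discrete_topology (carrier U)" p
  using discrete_topological_group[OF U_group] by (simp add: lower_p_series_def)

lemma subgroup_cg: "subgroup {M \<in> carrier U. cg t M \<one>\<^bsub>U\<^esub>} U"
proof (rule U.subgroupI)
  fix M assume M: "M \<in> {M \<in> carrier U. cg t M \<one>\<^bsub>U\<^esub>}"
  have "cg t (inv\<^bsub>U\<^esub> M \<otimes>\<^bsub>U\<^esub> M) (inv\<^bsub>U\<^esub> M \<otimes>\<^bsub>U\<^esub> \<one>\<^bsub>U\<^esub>)"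
    using M by (intro cg_mult) auto
  then show "inv\<^bsub>U\<^esub> M \<in> {M \<in> carrier U. cg t M \<one>\<^bsub>U\<^esub>}"
    using M cg_sym by auto
  fix N assume N: "N \<in> {M \<in> carrier U. cg t M \<one>\<^bsub>U\<^esub>}"
  have "cg t (M \<otimes>\<^bsub>U\<^esub> N) (\<one>\<^bsub>U\<^esub> \<otimes>\<^bsub>U\<^esub> \<one>\<^bsub>U\<^esub>)"
    using M N by (intro cg_mult) auto
  then show "M \<otimes>\<^bsub>U\<^esub> N \<in> {M \<in> carrier U. cg t M \<one>\<^bsub>U\<^esub>}"
    using M N by auto
next
  have "\<one>\<^bsub>U\<^esub> \<in> {M \<in> carrier U. cg t M \<one>\<^bsub>U\<^esub>}"
    by simp
  then show "{M \<in> carrier U. cg t M \<one>\<^bsub>U\<^esub>} \<noteq> {}"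
    by blast
qed auto

text \<open>Level 1 is no condition, as all exponents are 0 above the diagonal. Powers climb by
  \<open>cg_pow_p\<close>, and commutators because products in the two orders agree one level
  higher.\<close>

lemma U_L_cg: "1 \<le> t \<Longrightarrow> U.L t \<subseteq> {M \<in> carrier U. cg t M \<one>\<^bsub>U\<^esub>}"
proof (induction t rule: dec_induct)
  case base
  show ?case
    by (auto simp: cg_def level_def)
next
  case (step t)
  show ?case
  proof (rule U.L_Suc_minimal[OF step.hyps(1) subgroup_cg])
    show "closedin (discrete_topology (carrier U)) {M \<in> carrier U. cg (Suc t) M \<one>\<^bsub>U\<^esub>}"
      by (auto simp: closedin_discrete_topology)
    fix h assume "h \<in> U.L t"
    then have h: "h \<in> carrier U" "cg t h \<one>\<^bsub>U\<^esub>"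
      using step.IH by auto
    then show "h [^]\<^bsub>U\<^esub> p \<in> {M \<in> carrier U. cg (Suc t) M \<one>\<^bsub>U\<^esub>}"
      using cg_pow_p step.hyps by auto
    fix g assume g: "g \<in> carrier U"
    let ?i = "inv\<^bsub>U\<^esub> (h \<otimes>\<^bsub>U\<^esub> g)"
    have "gcommutator U g h = ?i \<otimes>\<^bsub>U\<^esub> (g \<otimes>\<^bsub>U\<^esub> h)"
      using g h by (simp add: gcommutator_def U.inv_mult_group U_mon.m_assoc)
    moreover have "cg (Suc t) (?i \<otimes>\<^bsub>U\<^esub> (g \<otimes>\<^bsub>U\<^esub> h)) (?i \<otimes>\<^bsub>U\<^esub> (h \<otimes>\<^bsub>U\<^esub> g))"
      using g h step.hyps by (intro cg_mult cg_mult_commute) auto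
    ultimately show "gcommutator U g h \<in> {M \<in> carrier U. cg (Suc t) M \<one>\<^bsub>U\<^esub>}"
      using g h by simp
  qed
qed

end

section \<open>The matrix group of a word of length s\<close>

locale word_matrices =
  fixes p n s :: nat and m :: int
  assumes prime_p: "prime p" and s: "1 \<le> s" "s \<le> n" and m_eq_power: "m = int p ^ Suc (n - s)"
begin

sublocale unipotent_mod p "Suc (n - s)" "Suc s" m
  using prime_p m_eq_power by unfold_locales (auto dest: prime_ge_2_nat)

abbreviation \<iota> :: "int \<Rightarrow> nat \<times> nat \<Rightarrow> int" where "\<iota> \<equiv> word_kernel_embedding p n s"

lemma U_eq: "word_unipotent p n s = U"
  by (simp add: word_unipotent_def word_ring_def m)

lemma m_eq: "m = int p * int p ^ (n - s)"
  by (simp add: m)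

lemma idx_eq: "idx = {1..Suc s}"
  by (rule idx_def)

lemma corner [simp]: "1 \<in> idx" "Suc 0 \<in> idx" "Suc s \<in> idx"
  by (auto simp: idx_eq)

lemma top_mod: "(a * int p ^ (n - s)) mod m = (a mod int p) * int p ^ (n - s)"
  unfolding m_eq by (simp add: mult_mod_left)

lemma embedding_entry:
  assumes "i \<in> idx" "j \<in> idx"
  shows "\<iota> a (i, j) = (if i = j then 1 else if i = 1 \<and> j = Suc s then a * int p ^ (n - s) else 0)"
  using assms by (simp add: word_kernel_embedding_def idx_eq)

lemma embedding_closed:
  assumes "a \<in> {0..<int p}"
  shows "\<iota> a \<in> carrier U"
proof -
  have "a * int p ^ (n - s) mod m = a * int p ^ (n - s)"
    using assms top_mod[of a] by simp
  then have "a * int p ^ (n - s) \<in> {0..m - 1}"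
    using pos_mod_bound[of m "a * int p ^ (n - s)"] pos_mod_sign[of m "a * int p ^ (n - s)"] m_gt_1
    by simp
  then show ?thesis
    unfolding U_mem_iff using m_gt_1
    by (auto simp: word_kernel_embedding_def idx_eq PiE_iff extensional_def)
qed

lemma embedding_mult:
  assumes a: "a \<in> {0..<int p}" and M: "M \<in> carrier U"
    and ij: "i \<in> idx" "j \<in> idx"
  shows "(\<iota> a \<otimes>\<^bsub>U\<^esub> M) (i, j) = (M (i, j) + (if i = 1 \<and> j = Suc s then a * int p ^ (n - s) else 0)) mod m"
    and "(M \<otimes>\<^bsub>U\<^esub> \<iota> a) (i, j) = (M (i, j) + (if i = 1 \<and> j = Suc s then a * int p ^ (n - s) else 0)) mod m"
proof -
  let ?c = "a * int p ^ (n - s)"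
  note top = corner(3,1)
  have j_le: "j \<le> Suc s"
    using ij(2) by (simp add: idx_eq)
  have i_ge: "1 \<le> i"
    using ij(1) by (simp add: idx_eq)
  have "(\<Sum>k\<in>idx. \<iota> a (i, k) * M (k, j)) =
      (\<Sum>k\<in>idx. (if k = i then M (i, j) else 0) +
        (if k = Suc s then (if i = 1 \<and> j = Suc s then ?c else 0) else 0))"
  proof (rule sum.cong)
    fix k assume k: "k \<in> idx"
    show "\<iota> a (i, k) * M (k, j) = (if k = i then M (i, j) else 0) +
        (if k = Suc s then (if i = 1 \<and> j = Suc s then ?c else 0) else 0)"
      using U_entry(3,4)[OF M top(1) ij(2)] s ij k embedding_entry[OF ij(1) k] j_le
      by (cases "j = Suc s") auto
  qed simp
  also have "\<dots> = M (i, j) + (if i = 1 \<and> j = Suc s then ?c else 0)"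
    using ij unfolding sum.distrib by simp
  finally show "(\<iota> a \<otimes>\<^bsub>U\<^esub> M) (i, j) = (M (i, j) + (if i = 1 \<and> j = Suc s then ?c else 0)) mod m"
    using U_mult[OF ij] by simp
  have "(\<Sum>k\<in>idx. M (i, k) * \<iota> a (k, j)) =
      (\<Sum>k\<in>idx. (if k = j then M (i, j) else 0) +
        (if k = 1 then (if i = 1 \<and> j = Suc s then ?c else 0) else 0))"
  proof (rule sum.cong)
    fix k assume k: "k \<in> idx"
    show "M (i, k) * \<iota> a (k, j) = (if k = j then M (i, j) else 0) +
        (if k = 1 then (if i = 1 \<and> j = Suc s then ?c else 0) else 0)"
      using U_entry(3,4)[OF M ij(1) top(2)] s ij k embedding_entry[OF k ij(2)] i_ge
      by (cases "i = 1") auto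
  qed simp
  also have "\<dots> = M (i, j) + (if i = 1 \<and> j = Suc s then ?c else 0)"
    using ij unfolding sum.distrib by simp
  finally show "(M \<otimes>\<^bsub>U\<^esub> \<iota> a) (i, j) = (M (i, j) + (if i = 1 \<and> j = Suc s then ?c else 0)) mod m"
    using U_mult[OF ij] by simp
qed

lemma embedding_central: "a \<in> {0..<int p} \<Longrightarrow> M \<in> carrier U \<Longrightarrow> \<iota> a \<otimes>\<^bsub>U\<^esub> M = M \<otimes>\<^bsub>U\<^esub> \<iota> a"
  using embedding_closed by (intro U_eqI) (auto simp: embedding_mult simp del: One_nat_def)

lemma embedding_add:
  assumes "a \<in> {0..<int p}" "b \<in> {0..<int p}"
  shows "\<iota> a \<otimes>\<^bsub>U\<^esub> \<iota> b = \<iota> ((a + b) mod int p)"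
proof (rule U_eqI)
  have "0 < int p"
    using assms by auto
  then show "\<iota> ((a + b) mod int p) \<in> carrier U"
    by (intro embedding_closed) auto
  show "\<iota> a \<otimes>\<^bsub>U\<^esub> \<iota> b \<in> carrier U"
    using assms embedding_closed by auto
  fix i j assume ij: "i \<in> idx" "j \<in> idx" "i < j"
  show "(\<iota> a \<otimes>\<^bsub>U\<^esub> \<iota> b) (i, j) = \<iota> ((a + b) mod int p) (i, j)"
    unfolding embedding_mult(1)[OF assms(1) embedding_closed[OF assms(2)] ij(1,2)]
      embedding_entry[OF ij(1,2)]
    using ij s top_mod[of "a + b"] by (auto simp: algebra_simps)
qed

lemma embedding_0: "\<iota> 0 = \<one>\<^bsub>U\<^esub>"
  using embedding_closed[of 0] p by (intro U_eqI) (auto simp: embedding_entry U_one)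

lemma embedding_inj:
  assumes "a \<in> {0..<int p}" "b \<in> {0..<int p}" "\<iota> a = \<iota> b"
  shows "a = b"
  using arg_cong[OF assms(3), of "\<lambda>M. M (1, Suc s)"] s p by (simp add: embedding_entry)

text \<open>Away from the corner j - i is at most s - 1, so the level n modulus is the full p^(n - s
  + 1) and the entry vanishes; in the corner it is p^(n - s).\<close>

lemma U_L_n:
  assumes "M \<in> U.L n"
  shows "\<exists>a\<in>{0..<int p}. M = \<iota> a"
proof -
  have M: "M \<in> carrier U" "cg n M \<one>\<^bsub>U\<^esub>"
    using U_L_cg[of n] assms s by auto
  have dvd: "level n i j dvd M (i, j)" if "i \<in> idx" "j \<in> idx" "i < j" for i j
    using M(2) that by (auto simp: cg_def U_one cong_0_iff)
  have zero: "M (i, j) = 0" if ij: "i \<in> idx" "j \<in> idx" "i < j" "\<not> (i = 1 \<and> j = Suc s)" for i j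
  proof -
    have "n - s + 1 \<le> n - (j - i)"
      using ij s by (auto simp: idx_eq)
    then have "level n i j = m"
      by (simp add: level_def min_def m)
    then show ?thesis
      using dvd[OF ij(1-3)] U_entry(5)[OF M(1) ij(1,2)] by simp
  qed
  have top: "1 \<in> idx" "Suc s \<in> idx" "1 < Suc s"
    using s by simp_all
  have "level n 1 (Suc s) = int p ^ (n - s)"
    by (simp add: level_def min_def)
  then obtain a where a: "M (1, Suc s) = a * int p ^ (n - s)"
    using dvd[OF top] by (metis dvdE mult.commute)
  define c where "c = int p ^ (n - s)"
  have "0 < c"
    using p by (simp add: c_def)
  moreover have "0 \<le> a * c" "a * c < int p * c"
    using U_entry(1,2)[OF M(1) top(1,2)] unfolding a m_eq c_def .
  ultimately have "0 \<le> a" "a < int p"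
    by (simp_all add: zero_le_mult_iff)
  then have a': "a \<in> {0..<int p}"
    by simp
  then have "M = \<iota> a"
    using zero a s M(1) embedding_closed by (intro U_eqI) (auto simp: embedding_entry)
  then show ?thesis
    using a' by blast
qed

text \<open>The matrices \<open>\<iota> a\<close> are central and of exponent p. This is the source
  of the vanishing of the coefficient functionals on \<open>L (Suc n)\<close>.\<close>

lemma U_L_Suc_n: "U.L (Suc n) \<subseteq> {\<one>\<^bsub>U\<^esub>}"
proof (rule U.L_Suc_minimal)
  show "subgroup {\<one>\<^bsub>U\<^esub>} U"
    by (rule U.triv_subgroup)
  show "closedin (discrete_topology (carrier U)) {\<one>\<^bsub>U\<^esub>}"
    by (auto simp: closedin_discrete_topology)
  fix h assume "h \<in> U.L n"
  then obtain a where a: "a \<in> {0..<int p}" "h = \<iota> a"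
    using U_L_n by blast
  have "\<iota> a [^]\<^bsub>U\<^esub> q = \<iota> ((int q * a) mod int p)" for q :: nat
  proof (induction q)
    case (Suc q)
    have "(int q * a) mod int p \<in> {0..<int p}"
      using p by simp
    then show ?case
      using Suc a embedding_add by (simp add: algebra_simps mod_add_right_eq)
  qed (simp add: embedding_0)
  then show "h [^]\<^bsub>U\<^esub> p \<in> {\<one>\<^bsub>U\<^esub>}"
    using a embedding_0 by simp
  fix g assume g: "g \<in> carrier U"
  have "gcommutator U g h = inv\<^bsub>U\<^esub> g \<otimes>\<^bsub>U\<^esub> (inv\<^bsub>U\<^esub> h \<otimes>\<^bsub>U\<^esub> (h \<otimes>\<^bsub>U\<^esub> g))"
    using g a embedding_closed[OF a(1)] embedding_central[OF a(1) g]
    by (simp add: gcommutator_def U_mon.m_assoc)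
  then show "gcommutator U g h \<in> {\<one>\<^bsub>U\<^esub>}"
    using g a embedding_closed[OF a(1)] by simp
qed (use s in simp)

end


section \<open>Continuous maps to discrete spaces\<close>

lemma continuous_map_discreteI:
  assumes "\<And>z. z \<in> topspace Z \<Longrightarrow> f z \<in> C"
    and "\<And>c. c \<in> C \<Longrightarrow> openin Z {z \<in> topspace Z. f z = c}"
  shows "continuous_map Z (discrete_topology C) f"
  unfolding continuous_map_def
proof (intro conjI allI impI)
  show "f \<in> topspace Z \<rightarrow> topspace (discrete_topology C)"
    using assms(1) by auto
  fix U assume U: "openin (discrete_topology C) U"
  have "{z \<in> topspace Z. f z \<in> U} = (\<Union>c\<in>U. {z \<in> topspace Z. f z = c})"
    by auto
  moreover have "openin Z (\<Union>c\<in>U. {z \<in> topspace Z. f z = c})"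
    using U assms(2) by (intro openin_Union) auto
  ultimately show "openin Z {z \<in> topspace Z. f z \<in> U}"
    by simp
qed

lemma continuous_map_discreteD:
  assumes "continuous_map Z (discrete_topology C) f"
  shows "openin Z {z \<in> topspace Z. f z = c}"
proof (cases "c \<in> C")
  case True
  then have "openin Z {z \<in> topspace Z. f z \<in> {c}}"
    using assms by (intro openin_continuous_map_preimage) auto
  then show ?thesis by simp
next
  case False
  then have "{z \<in> topspace Z. f z = c} = {}"
    using assms by (auto simp: continuous_map_def)
  then show ?thesis
    by (simp only: openin_empty)
qed

lemma continuous_map_discrete2:
  assumes "continuous_map Z (discrete_topology A) f" "continuous_map Z (discrete_topology B) g"
    and "\<And>z. z \<in> topspace Z \<Longrightarrow> h (f z) (g z) \<in> C"
  shows "continuous_map Z (discrete_topology C) (\<lambda>z. h (f z) (g z))"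
proof (rule continuous_map_discreteI)
  fix c
  have "openin Z {z \<in> topspace Z. h (f z) (g z) = c}"
    unfolding openin_subopen[of Z "{z \<in> topspace Z. h (f z) (g z) = c}"]
  proof
    fix z assume z: "z \<in> {z \<in> topspace Z. h (f z) (g z) = c}"
    have "openin Z ({y \<in> topspace Z. f y = f z} \<inter> {y \<in> topspace Z. g y = g z})"
      using assms by (intro openin_Int continuous_map_discreteD)
    then show "\<exists>V. openin Z V \<and> z \<in> V \<and> V \<subseteq> {z \<in> topspace Z. h (f z) (g z) = c}"
      using z by (intro exI[of _ "{y \<in> topspace Z. f y = f z} \<inter> {y \<in> topspace Z. g y = g z}"]) auto
  qed
  then show "openin Z {z \<in> topspace Z. h (f z) (g z) = c}" .
qed (use assms(3) in blast)

lemma continuous_map_discrete1: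
  assumes "continuous_map Z (discrete_topology A) f" "\<And>z. z \<in> topspace Z \<Longrightarrow> h (f z) \<in> C"
  shows "continuous_map Z (discrete_topology C) (\<lambda>z. h (f z))"
  using continuous_map_discrete2[OF assms(1,1), where h = "\<lambda>a _. h a" and C = C] assms(2) by simp

lemma continuous_map_discrete_sum:
  assumes "\<And>i. i \<in> I \<Longrightarrow> continuous_map Z (discrete_topology UNIV) (f i)"
  shows "continuous_map Z (discrete_topology (UNIV :: int set)) (\<lambda>z. \<Sum>i\<in>I. f i z)"
  using assms
proof (induction I rule: infinite_finite_induct)
  case (insert i I)
  then show ?case
    using continuous_map_discrete2[where h = "(+)" and C = UNIV and Z = Z and f = "f i"
        and g = "\<lambda>z. \<Sum>i\<in>I. f i z" and A = UNIV and B = UNIV] by simp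
qed auto

text \<open>The inverse image of a closed set under inversion is the projection of a closed set of
  pairs with product 1, and projections along compact factors are closed. It serves the unit group
  and the extension group below, where only the multiplication is explicit.\<close>

lemma continuous_inverse_if_compact:
  assumes G: "group G" and top: "topspace T = carrier G"
    and mult: "continuous_map (prod_topology T T) T (\<lambda>(x, y). x \<otimes>\<^bsub>G\<^esub> y)"
    and T: "compact_space T" "Hausdorff_space T"
  shows "continuous_map T T (\<lambda>x. inv\<^bsub>G\<^esub> x)"
  unfolding continuous_map_closedin
proof (intro conjI allI impI)
  interpret group G by (rule G)
  show "(\<lambda>x. inv\<^bsub>G\<^esub> x) \<in> topspace T \<rightarrow> topspace T"
    by (simp add: top)
  fix C assume C: "closedin T C"
  have "closedin T {\<one>\<^bsub>G\<^esub>}"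
    using T(2) by (intro closedin_Hausdorff_singleton) (simp_all add: top)
  then have "closedin (prod_topology T T)
      {z \<in> topspace (prod_topology T T). (\<lambda>(x, y). x \<otimes>\<^bsub>G\<^esub> y) z \<in> {\<one>\<^bsub>G\<^esub>}}"
    by (rule closedin_continuous_map_preimage[OF mult])
  moreover have "closedin (prod_topology T T) (topspace T \<times> C)"
    using C by (simp add: closedin_prod_Times_iff)
  ultimately have "closedin (prod_topology T T)
      ({z \<in> topspace (prod_topology T T). (\<lambda>(x, y). x \<otimes>\<^bsub>G\<^esub> y) z \<in> {\<one>\<^bsub>G\<^esub>}} \<inter> (topspace T \<times> C))"
    by (rule closedin_Int)
  then have "closedin T (fst ` ({z \<in> topspace (prod_topology T T). (\<lambda>(x, y). x \<otimes>\<^bsub>G\<^esub> y) z \<in> {\<one>\<^bsub>G\<^esub>}}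
      \<inter> (topspace T \<times> C)))"
    using closed_map_fst[OF T(1), of T] by (simp add: closed_map_def)
  moreover have "fst ` ({z \<in> topspace (prod_topology T T). (\<lambda>(x, y). x \<otimes>\<^bsub>G\<^esub> y) z \<in> {\<one>\<^bsub>G\<^esub>}}
      \<inter> (topspace T \<times> C)) = {x \<in> topspace T. inv\<^bsub>G\<^esub> x \<in> C}" (is "?L = ?R")
  proof
    show "?L \<subseteq> ?R"
    proof
      fix x assume "x \<in> ?L"
      then obtain y where xy: "x \<in> carrier G" "y \<in> carrier G" "x \<otimes>\<^bsub>G\<^esub> y = \<one>\<^bsub>G\<^esub>" "y \<in> C"
        by (auto simp: top)
      then have "inv\<^bsub>G\<^esub> x = y"
        by (metis inv_equality inv_inv)
      then show "x \<in> ?R"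
        using xy by (simp add: top)
    qed
    show "?R \<subseteq> ?L"
    proof
      fix x assume "x \<in> ?R"
      then show "x \<in> ?L"
        by (intro image_eqI[of _ _ "(x, inv\<^bsub>G\<^esub> x)"]) (auto simp: top)
    qed
  qed
  ultimately show "closedin T {x \<in> topspace T. inv\<^bsub>G\<^esub> x \<in> C}"
    by simp
qed


section \<open>Power series in non-commuting variables\<close>

text \<open>The product is formed over the integers and on all words; reduction modulo m and
  restriction to the alphabet come in later through congruences. Recursion on the first letter then
  gives associativity by induction.\<close>

definition word_conv :: "('x list \<Rightarrow> int) \<Rightarrow> ('x list \<Rightarrow> int) \<Rightarrow> 'x list \<Rightarrow> int" where
  "word_conv f g w = (\<Sum>k\<le>length w. f (take k w) * g (drop k w))"

lemma word_conv_Nil [simp]: "word_conv f g [] = f [] * g []"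
  by (simp add: word_conv_def)

lemma word_conv_Cons [simp]:
  "word_conv f g (x # w) = f [] * g (x # w) + word_conv (\<lambda>v. f (x # v)) g w"
  unfolding word_conv_def length_Cons sum.atMost_Suc_shift by simp

lemma word_conv_snoc:
  "word_conv f g (w @ [x]) = word_conv f (\<lambda>v. g (v @ [x])) w + f (w @ [x]) * g []"
proof -
  have "(\<Sum>k\<le>length w. f (take k (w @ [x])) * g (drop k (w @ [x]))) =
      (\<Sum>k\<le>length w. f (take k w) * g (drop k w @ [x]))"
    by (intro sum.cong) auto
  then show ?thesis
    by (simp add: word_conv_def)
qed

lemma word_conv_linear:
  "word_conv (\<lambda>v. c * f v + g v) h w = c * word_conv f h w + word_conv g h w"
  by (simp add: word_conv_def sum_distrib_left sum.distrib algebra_simps)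

lemma word_conv_assoc: "word_conv (word_conv f g) h w = word_conv f (word_conv g h) w"
proof (induction w arbitrary: f)
  case (Cons x w)
  then show ?case
    by (simp add: word_conv_linear algebra_simps)
qed (simp add: algebra_simps)

lemma word_conv_cong:
  assumes "\<And>k. k \<le> length w \<Longrightarrow> [f (take k w) = f' (take k w)] (mod q)"
    and "\<And>k. k \<le> length w \<Longrightarrow> [g (drop k w) = g' (drop k w)] (mod q)"
  shows "[word_conv f g w = word_conv f' g' w] (mod q)"
  unfolding word_conv_def by (intro cong_sum cong_mult) (use assms in auto)

lemma word_conv_unit_left: "word_conv (\<lambda>v. if v = [] then c else 0) g w = c * g w"
proof (cases w)
  case (Cons x v)
  have "word_conv (\<lambda>v. 0) g v = 0"
    by (simp add: word_conv_def)
  then show ?thesis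
    by (simp add: Cons)
qed simp

lemma word_conv_unit_right: "word_conv f (\<lambda>v. if v = [] then c else 0) w = f w * c"
proof (cases w rule: rev_cases)
  case (snoc v x)
  have "word_conv f (\<lambda>v. 0) v = 0"
    by (simp add: word_conv_def)
  then show ?thesis
    by (simp add: snoc word_conv_snoc)
qed simp

locale nc_series =
  fixes X :: "'x set" and m :: int
  assumes m_gt: "1 < m"
begin

abbreviation N :: "('x list \<Rightarrow> int) ring" where "N \<equiv> nc_power_series (residue_ring m) X"

abbreviation TP :: "('x list \<Rightarrow> int) topology" where
  "TP \<equiv> product_topology (\<lambda>_. discrete_topology (carrier (residue_ring m))) (lists X)"

abbreviation TU :: "('x list \<Rightarrow> int) topology" where "TU \<equiv> nc_units_topology (residue_ring m) X"

abbreviation unit_word :: "'x list \<Rightarrow> int" where "unit_word \<equiv> \<lambda>w. if w = [] then 1 else 0"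

sublocale res: residues m "residue_ring m"
  using m_gt by unfold_locales simp_all

lemma N_carrier: "carrier N = lists X \<rightarrow>\<^sub>E {0..m - 1}"
  by (simp add: nc_power_series_def res.res_carrier_eq)

lemma N_entry: "f \<in> carrier N \<Longrightarrow> w \<in> lists X \<Longrightarrow> 0 \<le> f w \<and> f w < m \<and> f w mod m = f w"
  unfolding N_carrier by (auto dest!: PiE_mem)

lemma N_mult: "w \<in> lists X \<Longrightarrow> (f \<otimes>\<^bsub>N\<^esub> g) w = word_conv f g w mod m"
  using res.sum_cong[of "{..length w}" "\<lambda>k. f (take k w) * g (drop k w)"]
  by (simp add: nc_power_series_def res.res_mult_eq word_conv_def)

lemma N_one: "w \<in> lists X \<Longrightarrow> \<one>\<^bsub>N\<^esub> w = unit_word w"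
  by (simp add: nc_power_series_def res.res_one_eq res.res_zero_eq)

lemma N_eqI:
  assumes "f \<in> carrier N" "g \<in> carrier N" "\<And>w. w \<in> lists X \<Longrightarrow> [f w = g w] (mod m)"
  shows "f = g"
proof (rule PiE_ext)
  show "f \<in> lists X \<rightarrow>\<^sub>E {0..m - 1}" "g \<in> lists X \<rightarrow>\<^sub>E {0..m - 1}"
    using assms by (simp_all only: N_carrier)
  show "f w = g w" if "w \<in> lists X" for w
    using assms(3)[OF that] N_entry[OF assms(1) that] N_entry[OF assms(2) that] by (simp add: cong_def)
qed

lemma N_mult_closed: "f \<otimes>\<^bsub>N\<^esub> g \<in> carrier N"
  unfolding N_carrier
proof (rule PiE_I)
  show "(f \<otimes>\<^bsub>N\<^esub> g) w \<in> {0..m - 1}" if "w \<in> lists X" for w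
    unfolding N_mult[OF that] using m_gt by simp
qed (simp add: nc_power_series_def)

lemma N_one_closed: "\<one>\<^bsub>N\<^esub> \<in> carrier N"
  unfolding N_carrier
proof (rule PiE_I)
  show "\<one>\<^bsub>N\<^esub> w \<in> {0..m - 1}" if "w \<in> lists X" for w
    unfolding N_one[OF that] using m_gt by simp
qed (simp add: nc_power_series_def)

lemma take_drop_lists: "w \<in> lists A \<Longrightarrow> take k w \<in> lists A" "w \<in> lists A \<Longrightarrow> drop k w \<in> lists A"
  by (auto dest: in_set_takeD in_set_dropD)

lemma N_mult_cong: "w \<in> lists X \<Longrightarrow> [(f \<otimes>\<^bsub>N\<^esub> g) w = word_conv f g w] (mod m)"
  by (simp add: N_mult cong_def)

lemma N_monoid: "monoid N"
proof (rule monoidI)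
  fix f g h
  show "(f \<otimes>\<^bsub>N\<^esub> g) \<otimes>\<^bsub>N\<^esub> h = f \<otimes>\<^bsub>N\<^esub> (g \<otimes>\<^bsub>N\<^esub> h)"
  proof (rule N_eqI[OF N_mult_closed N_mult_closed])
    fix w assume w: "w \<in> lists X"
    have "[((f \<otimes>\<^bsub>N\<^esub> g) \<otimes>\<^bsub>N\<^esub> h) w = word_conv (f \<otimes>\<^bsub>N\<^esub> g) h w] (mod m)"
      using w by (rule N_mult_cong)
    also have "[word_conv (f \<otimes>\<^bsub>N\<^esub> g) h w = word_conv (word_conv f g) h w] (mod m)"
      using w by (intro word_conv_cong N_mult_cong take_drop_lists cong_refl)
    also have "word_conv (word_conv f g) h w = word_conv f (word_conv g h) w"
      by (rule word_conv_assoc)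
    also have "[word_conv f (word_conv g h) w = word_conv f (g \<otimes>\<^bsub>N\<^esub> h) w] (mod m)"
      using w by (intro word_conv_cong cong_sym[OF N_mult_cong] take_drop_lists cong_refl)
    also have "[word_conv f (g \<otimes>\<^bsub>N\<^esub> h) w = (f \<otimes>\<^bsub>N\<^esub> (g \<otimes>\<^bsub>N\<^esub> h)) w] (mod m)"
      using w by (intro cong_sym[OF N_mult_cong])
    finally show "[((f \<otimes>\<^bsub>N\<^esub> g) \<otimes>\<^bsub>N\<^esub> h) w = (f \<otimes>\<^bsub>N\<^esub> (g \<otimes>\<^bsub>N\<^esub> h)) w] (mod m)" .
  qed
next
  fix f assume f: "f \<in> carrier N"
  have one: "[\<one>\<^bsub>N\<^esub> v = unit_word v] (mod m)" if "v \<in> lists X" for v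
    using N_one[OF that] by simp
  show "\<one>\<^bsub>N\<^esub> \<otimes>\<^bsub>N\<^esub> f = f"
  proof (rule N_eqI[OF N_mult_closed f])
    fix w assume w: "w \<in> lists X"
    have "[word_conv \<one>\<^bsub>N\<^esub> f w = word_conv unit_word f w] (mod m)"
      using w by (intro word_conv_cong one take_drop_lists cong_refl)
    then show "[(\<one>\<^bsub>N\<^esub> \<otimes>\<^bsub>N\<^esub> f) w = f w] (mod m)"
      using N_mult_cong[OF w, of "\<one>\<^bsub>N\<^esub>" f] word_conv_unit_left[of 1 f w] by (simp add: cong_def)
  qed
  show "f \<otimes>\<^bsub>N\<^esub> \<one>\<^bsub>N\<^esub> = f"
  proof (rule N_eqI[OF N_mult_closed f])
    fix w assume w: "w \<in> lists X"
    have "[word_conv f \<one>\<^bsub>N\<^esub> w = word_conv f unit_word w] (mod m)"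
      using w by (intro word_conv_cong one take_drop_lists cong_refl)
    then show "[(f \<otimes>\<^bsub>N\<^esub> \<one>\<^bsub>N\<^esub>) w = f w] (mod m)"
      using N_mult_cong[OF w, of f "\<one>\<^bsub>N\<^esub>"] word_conv_unit_right[of f 1 w] by (simp add: cong_def)
  qed
qed (use N_mult_closed N_one_closed in auto)

sublocale N: monoid N
  by (rule N_monoid)

lemma units_group: "group (units_of N)"
  by (rule N.units_group)

lemma topspace_TP: "topspace TP = carrier N"
  by (simp add: nc_power_series_def)

lemma Units_carrier: "Units N \<subseteq> carrier N"
  by (auto simp: Units_def)

lemma topspace_TU: "topspace TU = carrier (units_of N)"
  using Units_carrier unfolding nc_units_topology_def topspace_subtopology topspace_TP units_of_carrier
  by blast

lemma continuous_map_entry: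
  assumes "continuous_map Z TP f" "w \<in> lists X"
  shows "continuous_map Z (discrete_topology UNIV) (\<lambda>z. f z w)"
proof -
  have "continuous_map TP (discrete_topology (carrier (residue_ring m))) (\<lambda>f. f w)"
    using assms(2) by (rule continuous_map_product_projection)
  from continuous_map_compose[OF assms(1) this]
  have "continuous_map Z (discrete_topology (carrier (residue_ring m))) (\<lambda>z. f z w)"
    by (simp add: o_def)
  then show ?thesis
    by (rule continuous_map_discrete1[where h = "\<lambda>x. x"]) simp
qed

lemma continuous_N_mult:
  assumes "continuous_map Z TP f" "continuous_map Z TP g"
  shows "continuous_map Z TP (\<lambda>z. f z \<otimes>\<^bsub>N\<^esub> g z)"
  unfolding continuous_map_componentwise
proof (intro conjI ballI)
  show "(\<lambda>z. f z \<otimes>\<^bsub>N\<^esub> g z) ` topspace Z \<subseteq> extensional (lists X)"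
    using N_mult_closed unfolding N_carrier by (auto simp: PiE_iff)
  fix w assume w: "w \<in> lists X"
  have "continuous_map Z (discrete_topology UNIV) (\<lambda>z. f z (take k w) * g z (drop k w))" for k
    using continuous_map_discrete2[OF continuous_map_entry[OF assms(1) take_drop_lists(1)[OF w]]
        continuous_map_entry[OF assms(2) take_drop_lists(2)[OF w]], where h = "(*)" and C = UNIV] by simp
  then have "continuous_map Z (discrete_topology UNIV) (\<lambda>z. word_conv (f z) (g z) w)"
    unfolding word_conv_def by (intro continuous_map_discrete_sum)
  then have "continuous_map Z (discrete_topology (carrier (residue_ring m)))
      (\<lambda>z. word_conv (f z) (g z) w mod m)"
    by (rule continuous_map_discrete1) (use m_gt in \<open>simp add: res.res_carrier_eq\<close>)
  then show "continuous_map Z (discrete_topology (carrier (residue_ring m))) (\<lambda>z. (f z \<otimes>\<^bsub>N\<^esub> g z) w)"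
    using w by (simp only: N_mult)
qed

lemma compact_TP: "compact_space TP" and Hausdorff_TP: "Hausdorff_space TP"
  by (auto simp: compact_space_product_topology compact_space_discrete_topology
      Hausdorff_space_product_topology Hausdorff_space_discrete_topology res.res_carrier_eq)

text \<open>The units are the projection of the closed set of pairs of mutually inverse series,
  along a compact factor.\<close>

lemma closedin_Units: "closedin TP (Units N)"
proof -
  have "closedin TP {\<one>\<^bsub>N\<^esub>}"
    by (rule closedin_Hausdorff_singleton[OF Hausdorff_TP]) (unfold topspace_TP, rule N_one_closed)
  then have "closedin (prod_topology TP TP) {z \<in> topspace (prod_topology TP TP). fst z \<otimes>\<^bsub>N\<^esub> snd z \<in> {\<one>\<^bsub>N\<^esub>}}"
    "closedin (prod_topology TP TP) {z \<in> topspace (prod_topology TP TP). snd z \<otimes>\<^bsub>N\<^esub> fst z \<in> {\<one>\<^bsub>N\<^esub>}}"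
    by (rule closedin_continuous_map_preimage[OF
          continuous_N_mult[OF continuous_map_fst continuous_map_snd]],
        rule closedin_continuous_map_preimage[OF
          continuous_N_mult[OF continuous_map_snd continuous_map_fst]])
  then have "closedin (prod_topology TP TP)
      ({z \<in> topspace (prod_topology TP TP). fst z \<otimes>\<^bsub>N\<^esub> snd z \<in> {\<one>\<^bsub>N\<^esub>}} \<inter>
       {z \<in> topspace (prod_topology TP TP). snd z \<otimes>\<^bsub>N\<^esub> fst z \<in> {\<one>\<^bsub>N\<^esub>}})"
    by (rule closedin_Int)
  then have "closedin TP (fst `
      ({z \<in> topspace (prod_topology TP TP). fst z \<otimes>\<^bsub>N\<^esub> snd z \<in> {\<one>\<^bsub>N\<^esub>}} \<inter>
       {z \<in> topspace (prod_topology TP TP). snd z \<otimes>\<^bsub>N\<^esub> fst z \<in> {\<one>\<^bsub>N\<^esub>}}))"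
    using closed_map_fst[OF compact_TP, of TP] by (simp only: closed_map_def)
  moreover have "fst `
      ({z \<in> topspace (prod_topology TP TP). fst z \<otimes>\<^bsub>N\<^esub> snd z \<in> {\<one>\<^bsub>N\<^esub>}} \<inter>
       {z \<in> topspace (prod_topology TP TP). snd z \<otimes>\<^bsub>N\<^esub> fst z \<in> {\<one>\<^bsub>N\<^esub>}}) = Units N"
    unfolding topspace_prod_topology topspace_TP Units_def by force
  ultimately show ?thesis by simp
qed

text \<open>A basic open set of the product topology restricts finitely many words. They are
  enlarged to all words of bounded length over a finite alphabet: this family is closed under
  prefixes and suffixes, as is needed to obtain subgroups, and it shows that letters outside
  \<open>A\<close> are sent into \<open>V\<close>.\<close>

lemma TU_neighbourhood:
  assumes "openin TU V" "\<one>\<^bsub>N\<^esub> \<in> V"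
  obtains A k where "finite A" "A \<subseteq> X"
    "\<forall>f\<in>Units N. (\<forall>w\<in>lists A. length w \<le> k \<longrightarrow> f w = unit_word w) \<longrightarrow> f \<in> V"
proof -
  obtain W where W: "openin TP W" "V = W \<inter> Units N"
    using assms(1) by (auto simp: nc_units_topology_def openin_subtopology)
  have "\<one>\<^bsub>N\<^esub> \<in> W"
    using assms(2) W(2) by blast
  from W(1)[unfolded openin_product_topology_alt, rule_format, OF this]
  obtain B where B: "finite {i \<in> lists X. B i \<noteq> topspace (discrete_topology (carrier (residue_ring m)))}"
      "\<one>\<^bsub>N\<^esub> \<in> Pi\<^sub>E (lists X) B" "Pi\<^sub>E (lists X) B \<subseteq> W"
    by auto
  define F where "F = {i \<in> lists X. B i \<noteq> carrier (residue_ring m)}"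
  have F: "finite F" "F \<subseteq> lists X"
    using B(1) by (auto simp: F_def)
  define A where "A = \<Union> (set ` F)"
  define k where "k = Max (insert 0 (length ` F))"
  have "f \<in> V"
    if f: "f \<in> Units N" "\<And>w. w \<in> lists A \<Longrightarrow> length w \<le> k \<Longrightarrow> f w = unit_word w" for f
  proof -
    have fN: "f \<in> carrier N"
      using f Units_carrier by blast
    have "f \<in> Pi\<^sub>E (lists X) B"
    proof (rule PiE_I)
      fix w assume w: "w \<in> lists X"
      show "f w \<in> B w"
      proof (cases "w \<in> F")
        case True
        have "length w \<le> k"
          unfolding k_def using F(1) True by (intro Max_ge) auto
        moreover have "w \<in> lists A"
          using True by (auto simp: A_def)
        ultimately have "f w = \<one>\<^bsub>N\<^esub> w"
          using f(2) w by (simp add: N_one)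
        then show ?thesis
          using B(2) w by (auto dest: PiE_mem)
      next
        case False
        then show ?thesis
          using w N_entry[OF fN w] by (auto simp: F_def res.res_carrier_eq)
      qed
    qed (use fN in \<open>auto simp: N_carrier PiE_iff extensional_def\<close>)
    then show ?thesis
      using B(3) W(2) f(1) by auto
  qed
  then have "\<forall>f\<in>Units N. (\<forall>w\<in>lists A. length w \<le> k \<longrightarrow> f w = unit_word w) \<longrightarrow> f \<in> V"
    by simp
  moreover have "finite A" "A \<subseteq> X"
    using F by (auto simp: A_def)
  ultimately show thesis
    by (intro that)
qed

lemma openin_TU_eq: "w \<in> lists X \<Longrightarrow> openin TU {f \<in> Units N. f w = c}"
proof -
  assume w: "w \<in> lists X"
  have "continuous_map TU TP (\<lambda>f. f)"
    unfolding nc_units_topology_def by (rule continuous_map_from_subtopology) simp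
  then have "continuous_map TU (discrete_topology UNIV) (\<lambda>f. f w)"
    using w by (rule continuous_map_entry)
  from continuous_map_discreteD[OF this] show ?thesis
    unfolding topspace_TU units_of_carrier .
qed

lemma profinite_units: "profinite_group (units_of N) TU"
proof -
  interpret UG: group "units_of N" by (rule units_group)
  have compact: "compact_space TU"
    unfolding nc_units_topology_def
    by (intro compact_space_subtopology closedin_compact_space compact_TP closedin_Units)
  have Hausdorff: "Hausdorff_space TU"
    unfolding nc_units_topology_def by (intro Hausdorff_space_subtopology Hausdorff_TP)
  have incl: "continuous_map TU TP (\<lambda>f. f)"
    unfolding nc_units_topology_def by (rule continuous_map_from_subtopology) simp
  have mult: "continuous_map (prod_topology TU TU) TU (\<lambda>(x, y). x \<otimes>\<^bsub>units_of N\<^esub> y)"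
  proof -
    have "continuous_map (prod_topology TU TU) TP (\<lambda>z. fst z \<otimes>\<^bsub>N\<^esub> snd z)"
      using continuous_map_compose[OF continuous_map_fst incl] continuous_map_compose[OF continuous_map_snd incl]
      by (intro continuous_N_mult) (simp_all add: o_def)
    moreover have "(\<lambda>z. fst z \<otimes>\<^bsub>N\<^esub> snd z) ` topspace (prod_topology TU TU) \<subseteq> Units N"
      unfolding topspace_prod_topology topspace_TU units_of_carrier by auto
    ultimately show ?thesis
      unfolding units_of_mult case_prod_beta
      by (subst (3) nc_units_topology_def) (auto simp: continuous_map_in_subtopology)
  qed
  show ?thesis
  proof unfold_locales
    show "continuous_map TU TU (\<lambda>x. inv\<^bsub>units_of N\<^esub> x)"
      by (rule continuous_inverse_if_compact[OF units_group topspace_TU mult compact Hausdorff])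
    fix V assume V: "openin TU V" "\<one>\<^bsub>units_of N\<^esub> \<in> V"
    obtain A k where A: "finite A" "A \<subseteq> X"
      "\<forall>f\<in>Units N. (\<forall>w\<in>lists A. length w \<le> k \<longrightarrow> f w = unit_word w) \<longrightarrow> f \<in> V"
      using TU_neighbourhood[OF V(1) V(2)[unfolded units_of_one]] by metis
    define W where "W = {w \<in> lists A. length w \<le> k}"
    have W: "finite W"
      unfolding W_def using finite_lists_length_le[OF A(1), of k]
      by (rule rev_finite_subset) auto
    have WX: "W \<subseteq> lists X"
      using A(2) by (auto simp: W_def)
    have Wtd: "take i w \<in> W" "drop i w \<in> W" if "w \<in> W" for i w
      using that by (auto simp: W_def take_drop_lists simp del: in_lists_conv_set)
    \<comment> \<open>As \<open>W\<close> is closed under prefixes and suffixes, the conditions on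
      \<open>W\<close> are preserved by products and inverses.\<close>
    define H where "H = {f \<in> Units N. \<forall>w\<in>W. f w = unit_word w}"
    have "subgroup H (units_of N)"
    proof (rule UG.subgroupI)
      show "H \<subseteq> carrier (units_of N)"
        by (auto simp: H_def units_of_carrier)
      have "\<one>\<^bsub>N\<^esub> \<in> H"
        using N_one[OF subsetD[OF WX]] by (simp add: H_def)
      then show "H \<noteq> {}" by blast
      fix f assume f: "f \<in> H"
      then have fU: "f \<in> Units N"
        by (simp add: H_def)
      have inv: "inv\<^bsub>units_of N\<^esub> f = inv\<^bsub>N\<^esub> f"
        using fU by (rule N.units_of_inv)
      let ?g = "inv\<^bsub>N\<^esub> f"
      have gU: "?g \<in> Units N"
        using fU by simp
      have "?g w = unit_word w" if w: "w \<in> W" for w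
      proof -
        have wX: "w \<in> lists X"
          using w WX by blast
        have "[word_conv f ?g w = word_conv unit_word ?g w] (mod m)"
          using f Wtd[OF w] by (intro word_conv_cong) (auto simp: H_def)
        also have "word_conv unit_word ?g w = ?g w"
          using word_conv_unit_left[of 1] by simp
        finally have "[(f \<otimes>\<^bsub>N\<^esub> ?g) w = ?g w] (mod m)"
          using N_mult_cong[OF wX] cong_trans by blast
        moreover have "f \<otimes>\<^bsub>N\<^esub> ?g = \<one>\<^bsub>N\<^esub>"
          using fU by simp
        ultimately have "[unit_word w = ?g w] (mod m)"
          using wX by (simp add: N_one)
        then show ?thesis
          using N_entry[of ?g w] gU Units_carrier wX m_gt by (auto simp: cong_def split: if_splits)
      qed
      then show "inv\<^bsub>units_of N\<^esub> f \<in> H"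
        unfolding inv using gU by (simp add: H_def)
      fix g assume g: "g \<in> H"
      have "(f \<otimes>\<^bsub>N\<^esub> g) w = unit_word w" if w: "w \<in> W" for w
      proof -
        have wX: "w \<in> lists X"
          using w WX by blast
        have "[word_conv f g w = word_conv unit_word unit_word w] (mod m)"
          using f g Wtd[OF w] by (intro word_conv_cong) (auto simp: H_def)
        also have "word_conv unit_word unit_word w = unit_word w"
          using word_conv_unit_left[of 1 unit_word w] by simp
        finally show ?thesis
          unfolding N_mult[OF wX] using m_gt by (auto simp: cong_def)
      qed
      then show "f \<otimes>\<^bsub>units_of N\<^esub> g \<in> H"
        using f g by (auto simp: H_def units_of_mult)
    qed
    moreover have "openin TU H"
    proof -
      have "openin TU (Units N \<inter> (\<Inter>w\<in>W. {f \<in> Units N. f w = unit_word w}))"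
      proof (cases "W = {}")
        case True
        then show ?thesis
          using openin_topspace[of TU] by (simp add: topspace_TU units_of_carrier)
      next
        case False
        have "openin TU (Units N)"
          using openin_topspace[of TU] by (simp add: topspace_TU units_of_carrier)
        moreover have "openin TU (\<Inter>w\<in>W. {f \<in> Units N. f w = unit_word w})"
          using W False openin_TU_eq WX by (intro openin_INT2) auto
        ultimately show ?thesis
          by (rule openin_Int)
      qed
      moreover have "Units N \<inter> (\<Inter>w\<in>W. {f \<in> Units N. f w = unit_word w}) = H"
        by (auto simp: H_def)
      ultimately show ?thesis by simp
    qed
    moreover have "H \<subseteq> V"
      using A(3) by (auto simp: H_def W_def)
    ultimately show "\<exists>H. subgroup H (units_of N) \<and> openin TU H \<and> H \<subseteq> V"
      by blast
  qed (use topspace_TU mult compact Hausdorff in auto)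
qed

abbreviation one_plus :: "'x \<Rightarrow> 'x list \<Rightarrow> int" where
  "one_plus x \<equiv> \<one>\<^bsub>N\<^esub> \<oplus>\<^bsub>N\<^esub> nc_variable (residue_ring m) X x"

lemma one_plus_entry:
  "w \<in> lists X \<Longrightarrow> one_plus x w = (if w = [] \<or> w = [x] then 1 else 0)"
  using m_gt by (simp add: nc_power_series_def nc_variable_def res.res_add_eq res.res_one_eq res.res_zero_eq)

lemma one_plus_closed: "one_plus x \<in> carrier N"
  unfolding N_carrier
proof (rule PiE_I)
  show "one_plus x w \<in> {0..m - 1}" if "w \<in> lists X" for w
    unfolding one_plus_entry[OF that] using m_gt by simp
qed (simp add: nc_power_series_def)

lemma one_plus_unit:
  assumes x: "x \<in> X"
  shows "one_plus x \<in> Units N"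
proof -
  define e :: "'x list \<Rightarrow> int" where "e w = (if w = [] \<or> w = [x] then 1 else 0)" for w
  \<comment> \<open>The geometric series inverse to 1 + x, with the coefficient of the k-th power of
    x equal to (-1)^k.\<close>
  define h :: "'x list \<Rightarrow> int" where "h w = (if set w \<subseteq> {x} then (-1) ^ length w else 0)" for w
  define g where "g = (\<lambda>w\<in>lists X. h w mod m)"
  have g: "g \<in> carrier N"
    unfolding N_carrier using m_gt by (auto simp: g_def)
  have eh: "word_conv e h w = unit_word w" for w
  proof (cases w)
    case (Cons y v)
    have "word_conv (\<lambda>u. e (y # u)) h v = (if y = x then 1 else 0) * h v"
      using word_conv_unit_left[of 1 h v] word_conv_unit_left[of 0 h v]
      by (cases "y = x") (simp_all add: e_def cong: if_cong)
    then show ?thesis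
      by (simp add: Cons) (simp add: e_def h_def)
  qed (simp add: e_def h_def)
  have he: "word_conv h e w = unit_word w" for w
  proof (cases w rule: rev_cases)
    case (snoc v y)
    have "word_conv h (\<lambda>u. e (u @ [y])) v = h v * (if y = x then 1 else 0)"
      using word_conv_unit_right[of h 1 v] word_conv_unit_right[of h 0 v]
      by (cases "y = x") (simp_all add: e_def cong: if_cong)
    then show ?thesis
      by (simp add: snoc word_conv_snoc) (simp add: e_def h_def)
  qed (simp add: e_def h_def)
  have ce: "[one_plus x v = e v] (mod m)" if "v \<in> lists X" for v
    using that by (simp add: one_plus_entry e_def)
  have cg: "[g v = h v] (mod m)" if "v \<in> lists X" for v
    using that by (simp add: g_def cong_def)
  have "one_plus x \<otimes>\<^bsub>N\<^esub> g = \<one>\<^bsub>N\<^esub>"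
  proof (rule N_eqI[OF N_mult_closed N_one_closed])
    fix w assume w: "w \<in> lists X"
    have "[word_conv (one_plus x) g w = word_conv e h w] (mod m)"
      using w by (intro word_conv_cong ce cg take_drop_lists)
    then show "[(one_plus x \<otimes>\<^bsub>N\<^esub> g) w = \<one>\<^bsub>N\<^esub> w] (mod m)"
      unfolding eh N_one[OF w] by (rule cong_trans[OF N_mult_cong[OF w]])
  qed
  moreover have "g \<otimes>\<^bsub>N\<^esub> one_plus x = \<one>\<^bsub>N\<^esub>"
  proof (rule N_eqI[OF N_mult_closed N_one_closed])
    fix w assume w: "w \<in> lists X"
    have "[word_conv g (one_plus x) w = word_conv h e w] (mod m)"
      using w by (intro word_conv_cong ce cg take_drop_lists)
    then show "[(g \<otimes>\<^bsub>N\<^esub> one_plus x) w = \<one>\<^bsub>N\<^esub> w] (mod m)"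
      unfolding he N_one[OF w] by (rule cong_trans[OF N_mult_cong[OF w]])
  qed
  ultimately show ?thesis
    using g one_plus_closed unfolding Units_def by blast
qed

lemma one_plus_converges: "converges_to_one X (units_of N) TU one_plus"
  unfolding converges_to_one_def
proof (intro allI impI, elim conjE)
  fix V assume V: "V \<lhd> units_of N" "openin TU V"
  have one: "\<one>\<^bsub>N\<^esub> \<in> V"
    using V(1) subgroup.one_closed[of V "units_of N"] by (simp add: normal_def units_of_one)
  obtain A k where A: "finite A" "A \<subseteq> X"
    "\<forall>f\<in>Units N. (\<forall>w\<in>lists A. length w \<le> k \<longrightarrow> f w = unit_word w) \<longrightarrow> f \<in> V"
    using TU_neighbourhood[OF V(2) one] by metis
  have "one_plus x \<in> V" if "x \<in> X" "x \<notin> A" for x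
  proof (rule A(3)[rule_format, OF one_plus_unit[OF that(1)]])
    fix w assume w: "w \<in> lists A"
    then have "w \<noteq> [x]"
      using that(2) by auto
    moreover have "w \<in> lists X"
      using w A(2) by auto
    ultimately show "one_plus x w = unit_word w"
      by (simp add: one_plus_entry)
  qed
  then have "{x \<in> X. one_plus x \<notin> V} \<subseteq> A"
    by blast
  then show "finite {x \<in> X. one_plus x \<notin> V}"
    using A(1) by (rule finite_subset)
qed

end


section \<open>The Magnus coefficients of commutators\<close>

lemma lower_p_central_hom:
  assumes G: "lower_p_series G T" and H: "lower_p_series H TH"
    and hom: "f \<in> hom G H" and cont: "continuous_map T TH f"
  shows "f ` lower_p_central G T p t \<subseteq> lower_p_central H TH p t"
proof -
  interpret G: lower_p_series G T p by (rule G)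
  interpret H: lower_p_series H TH p by (rule H)
  interpret f: group_hom G H f
    by unfold_locales (rule hom)
  have "G.L t \<subseteq> {x \<in> carrier G. f x \<in> H.L t}"
  proof (induction t)
    case 0
    then show ?case by auto
  next
    case (Suc t)
    show ?case
    proof (cases "t = 0")
      case False
      show ?thesis
      proof (rule G.L_Suc_minimal)
        show "subgroup {x \<in> carrier G. f x \<in> H.L (Suc t)} G"
        proof (rule G.subgroupI)
          have "\<one>\<^bsub>G\<^esub> \<in> {x \<in> carrier G. f x \<in> H.L (Suc t)}"
            by simp
          then show "{x \<in> carrier G. f x \<in> H.L (Suc t)} \<noteq> {}"
            by blast
        qed (auto intro: H.inv_L H.mult_L)
        show "closedin T {x \<in> carrier G. f x \<in> H.L (Suc t)}"
          using closedin_continuous_map_preimage[OF cont H.L_closed] by (simp add: G.topspace_eq)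
        show "h [^]\<^bsub>G\<^esub> p \<in> {x \<in> carrier G. f x \<in> H.L (Suc t)}" if "h \<in> G.L t" for h
          using that Suc False H.pow_p_L[of t "f h"] by (auto simp: f.hom_nat_pow)
        show "gcommutator G g h \<in> {x \<in> carrier G. f x \<in> H.L (Suc t)}"
          if "g \<in> carrier G" "h \<in> G.L t" for g h
        proof -
          have h: "h \<in> carrier G" "f h \<in> H.L t"
            using that Suc by auto
          then have "f (gcommutator G g h) = gcommutator H (f g) (f h)"
            using that by (simp add: gcommutator_def)
          then show ?thesis
            using that h H.comm_L_right[of t "f g" "f h"] False by simp
        qed
      qed (use False in simp)
    qed auto
  qed
  then show ?thesis by blast
qed

locale free_magnus = nc_series X m for X :: "'a set" and m :: int +
  fixes S :: "'a monoid" (structure) and T :: "'a topology"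
  assumes free: "free_profinite S T X"
begin

sublocale S: profinite_group S T
  using free by (simp add: free_profinite_def)

lemma X_S: "X \<subseteq> carrier S"
  using free by (simp add: free_profinite_def)

lemma letter_S [simp]: "x \<in> X \<Longrightarrow> x \<in> carrier S"
  using X_S by blast

abbreviation \<Lambda> :: "'a \<Rightarrow> 'a list \<Rightarrow> int" where "\<Lambda> \<equiv> magnus (residue_ring m) S T X"

abbreviation E :: "'a list \<Rightarrow> 'a \<Rightarrow> int" where "E w \<sigma> \<equiv> magnus_coeff (residue_ring m) S T X w \<sigma>"

lemma magnus_extension: "is_continuous_extension S T X (units_of N) TU one_plus \<Lambda>"
proof -
  have "one_plus \<in> X \<rightarrow> carrier (units_of N)"
    using one_plus_unit by (auto simp: units_of_carrier)
  from theI'[OF free_profinite_universal[OF free profinite_units this one_plus_converges]]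
  show ?thesis
    unfolding magnus_def .
qed

lemma magnus_Units: "\<sigma> \<in> carrier S \<Longrightarrow> \<Lambda> \<sigma> \<in> Units N"
  using magnus_extension by (auto simp: is_continuous_extension_def hom_def units_of_carrier)

lemma E_range:
  "\<sigma> \<in> carrier S \<Longrightarrow> w \<in> lists X \<Longrightarrow> 0 \<le> E w \<sigma> \<and> E w \<sigma> < m \<and> E w \<sigma> mod m = E w \<sigma>"
  unfolding magnus_coeff_def by (rule N_entry) (use magnus_Units Units_carrier in auto)

lemma E_mult:
  assumes "\<sigma> \<in> carrier S" "\<tau> \<in> carrier S" "w \<in> lists X"
  shows "E w (\<sigma> \<otimes> \<tau>) = word_conv (\<lambda>v. E v \<sigma>) (\<lambda>v. E v \<tau>) w mod m"
proof -
  have "\<Lambda> (\<sigma> \<otimes> \<tau>) = \<Lambda> \<sigma> \<otimes>\<^bsub>N\<^esub> \<Lambda> \<tau>"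
    using magnus_extension assms by (simp add: is_continuous_extension_def hom_def units_of_mult)
  then show ?thesis
    by (simp only: magnus_coeff_def N_mult[OF assms(3)])
qed

lemma E_letter:
  "x \<in> X \<Longrightarrow> w \<in> lists X \<Longrightarrow> E w x = (if w = [] \<or> w = [x] then 1 else 0)"
  using magnus_extension by (simp add: is_continuous_extension_def magnus_coeff_def one_plus_entry)

lemma E_one: "w \<in> lists X \<Longrightarrow> E w \<one> = unit_word w"
proof -
  assume w: "w \<in> lists X"
  have "\<Lambda> \<in> hom S (units_of N)"
    using magnus_extension by (simp add: is_continuous_extension_def)
  then have "\<Lambda> \<one> = \<one>\<^bsub>N\<^esub>"
    using hom_one[OF _ S.is_group units_group] by (simp add: units_of_one)
  then show ?thesis
    using w by (simp only: magnus_coeff_def N_one)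
qed

lemma E_continuous: "w \<in> lists X \<Longrightarrow> continuous_map T (discrete_topology UNIV) (E w)"
proof -
  assume w: "w \<in> lists X"
  have "continuous_map T TU \<Lambda>"
    using magnus_extension by (simp add: is_continuous_extension_def)
  then have "continuous_map T TP \<Lambda>"
    by (simp add: nc_units_topology_def continuous_map_in_subtopology)
  then show ?thesis
    unfolding magnus_coeff_def using w by (rule continuous_map_entry)
qed

text \<open>The constant coefficient is multiplicative and 1 on letters, and the elements where it
  is 1 form a closed subgroup.\<close>

lemma E_Nil: "\<sigma> \<in> carrier S \<Longrightarrow> E [] \<sigma> = 1"
proof -
  define H where "H = {\<sigma> \<in> carrier S. E [] \<sigma> \<in> {1}}"
  have "closed_subgroup_generated S T X \<subseteq> H"
  proof (rule S.closed_subgroup_generated_minimal)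
    show "closedin T H"
      using closedin_continuous_map_preimage[OF E_continuous[of "[]"], of "{1}"]
      by (simp add: H_def S.topspace_eq)
    show "X \<subseteq> H"
      using E_letter[of _ "[]"] by (auto simp: H_def)
    show "subgroup H S"
    proof (rule S.subgroupI)
      have "\<one> \<in> H"
        using E_one[of "[]"] by (simp add: H_def)
      then show "H \<noteq> {}"
        by blast
      fix a assume a: "a \<in> H"
      have "E [] (a \<otimes> inv a) = E [] (inv a) mod m"
        using a E_mult[of a "inv a" "[]"] by (simp add: H_def)
      then show "inv a \<in> H"
        using a E_one[of "[]"] E_range[of "inv a" "[]"] by (simp add: H_def)
      fix b assume b: "b \<in> H"
      show "a \<otimes> b \<in> H"
        using a b E_mult[of a b "[]"] m_gt by (simp add: H_def)
    qed (auto simp: H_def)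
  qed
  moreover have "closed_subgroup_generated S T X = carrier S"
    using free by (simp add: free_profinite_def)
  ultimately show "\<sigma> \<in> carrier S \<Longrightarrow> E [] \<sigma> = 1"
    by (auto simp: H_def)
qed

section \<open>Leading terms of Magnus series\<close>

definition low_order :: "nat \<Rightarrow> 'a \<Rightarrow> bool" where
  "low_order a \<sigma> \<longleftrightarrow> \<sigma> \<in> carrier S \<and> (\<forall>u\<in>lists X. u \<noteq> [] \<and> length u < a \<longrightarrow> E u \<sigma> = 0)"

lemma low_order_1: "\<sigma> \<in> carrier S \<Longrightarrow> low_order 1 \<sigma>"
  by (auto simp: low_order_def)

lemma low_order_S: "low_order a \<sigma> \<Longrightarrow> \<sigma> \<in> carrier S"
  by (simp add: low_order_def)

text \<open>In a splitting of \<open>u\<close> into two nonempty parts, the first is shorter than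
  \<open>a\<close> or the second shorter than \<open>b\<close>, except for the splitting at
  \<open>a\<close> when the length is exactly a + b.\<close>

lemma E_mult_low:
  assumes \<sigma>: "low_order a \<sigma>" "1 \<le> a" and \<tau>: "low_order b \<tau>" "1 \<le> b"
    and u: "u \<in> lists X" "u \<noteq> []" "length u \<le> a + b"
  shows "[E u (\<sigma> \<otimes> \<tau>) = E u \<sigma> + E u \<tau> +
    (if length u = a + b then E (take a u) \<sigma> * E (drop a u) \<tau> else 0)] (mod m)"
proof -
  let ?c = "if length u = a + b then E (take a u) \<sigma> * E (drop a u) \<tau> else 0"
  have S: "\<sigma> \<in> carrier S" "\<tau> \<in> carrier S"
    using \<sigma> \<tau> low_order_S by auto
  have "word_conv (\<lambda>v. E v \<sigma>) (\<lambda>v. E v \<tau>) u =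
      (\<Sum>k\<le>length u. (if k = length u then E u \<sigma> else 0) + (if k = 0 then E u \<tau> else 0) +
        (if k = a then ?c else 0))"
    unfolding word_conv_def
  proof (rule sum.cong)
    fix k assume k: "k \<in> {..length u}"
    have td: "take k u \<in> lists X" "drop k u \<in> lists X"
      using u(1) by (rule take_drop_lists)+
    consider "k = 0" | "k = length u" "k \<noteq> 0" | "0 < k" "k < length u" "k < a"
      | "0 < k" "k < length u" "length u - k < b" "a \<le> k"
      | "0 < k" "k < length u" "k = a" "length u = a + b"
      using k u(3) by fastforce
    then show "E (take k u) \<sigma> * E (drop k u) \<tau> =
        (if k = length u then E u \<sigma> else 0) + (if k = 0 then E u \<tau> else 0) + (if k = a then ?c else 0)"
    proof cases
      case 1
      then show ?thesis
        using u \<sigma>(2) E_Nil S by auto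
    next
      case 2
      then show ?thesis
        using u \<tau>(2) E_Nil S by auto
    next
      case 3
      then have "E (take k u) \<sigma> = 0"
        using \<sigma>(1) td u(2) by (auto simp: low_order_def)
      then show ?thesis
        using 3 by simp
    next
      case 4
      then have "E (drop k u) \<tau> = 0"
        using \<tau>(1) td u(2) by (auto simp: low_order_def)
      then show ?thesis
        using 4 by auto
    next
      case 5
      then show ?thesis by simp
    qed
  qed simp
  also have "\<dots> = E u \<sigma> + E u \<tau> + ?c"
    using \<sigma>(2) by (auto simp: sum.distrib)
  finally show ?thesis
    using E_mult[OF S u(1)] by (simp add: cong_def)
qed

text \<open>The leading term of a commutator is the Lie bracket of the leading terms. It is found by
  comparing \<sigma>\<tau> with \<tau>\<sigma>[\<sigma>, \<tau>]: by induction the coefficients of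
  the commutator at shorter words vanish, so at \<open>u\<close> the last factor only adds its own
  coefficient.\<close>

lemma E_gcommutator:
  assumes \<sigma>: "low_order a \<sigma>" "1 \<le> a" and \<tau>: "low_order b \<tau>" "1 \<le> b"
    and u: "u \<in> lists X" "u \<noteq> []" "length u \<le> a + b"
  shows "[E u (gcommutator S \<sigma> \<tau>) =
    (if length u = a + b then E (take a u) \<sigma> * E (drop a u) \<tau> - E (take b u) \<tau> * E (drop b u) \<sigma> else 0)]
    (mod m)"
  using u
proof (induction "length u" arbitrary: u rule: less_induct)
  case less
  note u = less.prems
  let ?c = "gcommutator S \<sigma> \<tau>"
  have S: "\<sigma> \<in> carrier S" "\<tau> \<in> carrier S"
    using \<sigma> \<tau> low_order_S by auto
  have "E v ?c = 0" if v: "v \<in> lists X" "v \<noteq> []" "length v < length u" for v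
  proof -
    have "[E v ?c = 0] (mod m)"
      using less.hyps[OF v(3,1,2)] v(3) u(3) by simp
    then show ?thesis
      using E_range[of ?c v] S v by (simp add: cong_def)
  qed
  then have c: "low_order (length u) ?c"
    using S by (simp add: low_order_def)
  have "[E u (\<tau> \<otimes> \<sigma> \<otimes> ?c) = E u (\<tau> \<otimes> \<sigma>) + E u ?c] (mod m)"
    using E_mult_low[OF low_order_1 _ c _ u(1,2)] S u by (simp add: Suc_le_eq)
  moreover have "\<tau> \<otimes> \<sigma> \<otimes> ?c = \<sigma> \<otimes> \<tau>"
    using S by (rule S.mult_swap_gcommutator)
  ultimately have "[E u (\<sigma> \<otimes> \<tau>) = E u (\<tau> \<otimes> \<sigma>) + E u ?c] (mod m)"
    by simp
  then have "[E u ?c = E u (\<sigma> \<otimes> \<tau>) - E u (\<tau> \<otimes> \<sigma>)] (mod m)"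
    by (metis add_diff_cancel_left' cong_diff cong_refl cong_sym)
  also have "[E u (\<sigma> \<otimes> \<tau>) - E u (\<tau> \<otimes> \<sigma>) =
      (E u \<sigma> + E u \<tau> + (if length u = a + b then E (take a u) \<sigma> * E (drop a u) \<tau> else 0)) -
      (E u \<tau> + E u \<sigma> + (if length u = b + a then E (take b u) \<tau> * E (drop b u) \<sigma> else 0))] (mod m)"
    by (intro cong_diff E_mult_low \<sigma> \<tau> u) (use u in simp)
  finally show ?case
    by (cases "length u = a + b") (simp_all add: add.commute)
qed

lemma E_pow:
  assumes \<sigma>: "low_order a \<sigma>" "1 \<le> a" and u: "u \<in> lists X" "u \<noteq> []" "length u \<le> a"
  shows "[E u (\<sigma> [^] (q::nat)) = int q * E u \<sigma>] (mod m)"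
proof -
  have S: "\<sigma> \<in> carrier S"
    using \<sigma> low_order_S by auto
  have "\<forall>u\<in>lists X. u \<noteq> [] \<and> length u \<le> a \<longrightarrow> [E u (\<sigma> [^] q) = int q * E u \<sigma>] (mod m)"
  proof (induction q)
    case 0
    then show ?case
      by (simp add: E_one)
  next
    case (Suc q)
    have "E v (\<sigma> [^] q) = 0" if v: "v \<in> lists X" "v \<noteq> []" "length v < a" for v
    proof -
      have "[E v (\<sigma> [^] q) = int q * E v \<sigma>] (mod m)"
        using Suc v by auto
      moreover have "E v \<sigma> = 0"
        using \<sigma>(1) v by (auto simp: low_order_def)
      ultimately show ?thesis
        using E_range[of "\<sigma> [^] q" v] S v by (simp add: cong_def)
    qed
    then have q: "low_order a (\<sigma> [^] q)"
      using S by (simp add: low_order_def)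
    show ?case
    proof (intro ballI impI)
      fix u assume u: "u \<in> lists X" "u \<noteq> [] \<and> length u \<le> a"
      have "[E u (\<sigma> [^] q \<otimes> \<sigma>) = E u (\<sigma> [^] q) + E u \<sigma>] (mod m)"
        using E_mult_low[OF q \<sigma>(2) \<sigma> u(1)] u \<sigma>(2) by simp
      also have "[E u (\<sigma> [^] q) + E u \<sigma> = int q * E u \<sigma> + E u \<sigma>] (mod m)"
        using Suc u by (intro cong_add) auto
      finally show "[E u (\<sigma> [^] Suc q) = int (Suc q) * E u \<sigma>] (mod m)"
        by (simp add: algebra_simps)
    qed
  qed
  then show ?thesis
    using u by blast
qed

text \<open>The elements that are killed by the continuous map to the power series in the letters other
  than \<open>x\<close>.\<close>

definition avoid :: "'a \<Rightarrow> 'a set" where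
  "avoid x = {\<sigma> \<in> carrier S. \<forall>u\<in>lists X. x \<notin> set u \<and> u \<noteq> [] \<longrightarrow> E u \<sigma> = 0}"

lemma E_mult_avoid:
  assumes "\<sigma> \<in> carrier S" "\<tau> \<in> carrier S" "u \<in> lists X" "x \<notin> set u"
  shows "\<sigma> \<in> avoid x \<Longrightarrow> E u (\<sigma> \<otimes> \<tau>) = E u \<tau>" and "\<tau> \<in> avoid x \<Longrightarrow> E u (\<sigma> \<otimes> \<tau>) = E u \<sigma>"
proof -
  have td: "take k u \<in> lists X" "drop k u \<in> lists X" "x \<notin> set (take k u)" "x \<notin> set (drop k u)" for k
    using assms(3,4) by (auto dest: in_set_takeD in_set_dropD)
  have "[word_conv (\<lambda>v. E v \<sigma>) (\<lambda>v. E v \<tau>) u = word_conv unit_word (\<lambda>v. E v \<tau>) u] (mod m)"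
    if "\<sigma> \<in> avoid x"
    using that td assms(1) by (intro word_conv_cong) (auto simp: avoid_def E_Nil)
  then show "\<sigma> \<in> avoid x \<Longrightarrow> E u (\<sigma> \<otimes> \<tau>) = E u \<tau>"
    using E_mult[OF assms(1-3)] E_range[OF assms(2,3)] word_conv_unit_left[of 1 "\<lambda>v. E v \<tau>" u]
    by (simp add: cong_def)
  have "[word_conv (\<lambda>v. E v \<sigma>) (\<lambda>v. E v \<tau>) u = word_conv (\<lambda>v. E v \<sigma>) unit_word u] (mod m)"
    if "\<tau> \<in> avoid x"
    using that td assms(2) by (intro word_conv_cong) (auto simp: avoid_def E_Nil)
  then show "\<tau> \<in> avoid x \<Longrightarrow> E u (\<sigma> \<otimes> \<tau>) = E u \<sigma>"
    using E_mult[OF assms(1-3)] E_range[OF assms(1,3)] word_conv_unit_right[of "\<lambda>v. E v \<sigma>" 1 u]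
    by (simp add: cong_def)
qed

text \<open>After deleting the words with \<open>x\<close>, one of the two series is 1, so
  \<sigma>\<tau> and \<tau>\<sigma> have equal coefficients. Comparison with
  \<tau>\<sigma>[\<sigma>, \<tau>] by induction on the length leaves no coefficient for the
  commutator.\<close>

lemma avoid_gcommutator:
  assumes "\<sigma> \<in> carrier S" "\<tau> \<in> carrier S" "\<sigma> \<in> avoid x \<or> \<tau> \<in> avoid x"
  shows "gcommutator S \<sigma> \<tau> \<in> avoid x"
proof -
  let ?c = "gcommutator S \<sigma> \<tau>"
  have "E u ?c = 0" if "u \<in> lists X" "x \<notin> set u" "u \<noteq> []" for u
    using that
  proof (induction "length u" arbitrary: u rule: less_induct)
    case less
    have "E v ?c = 0" if "v \<in> lists X" "v \<noteq> []" "length v < length u" "set v \<subseteq> set u" for v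
      using less.hyps[of v] that less.prems by blast
    then have *: "E (drop k u) ?c = (if k = length u then 1 else 0)" if "0 < k" "k \<le> length u" for k
      using that less.prems assms E_Nil[of ?c] set_drop_subset[of k u] take_drop_lists(2)[of u X k] by auto
    have "word_conv (\<lambda>v. E v (\<tau> \<otimes> \<sigma>)) (\<lambda>v. E v ?c) u =
        (\<Sum>k\<le>length u. (if k = 0 then E u ?c else 0) + (if k = length u then E u (\<tau> \<otimes> \<sigma>) else 0))"
      unfolding word_conv_def
    proof (rule sum.cong)
      fix k assume "k \<in> {..length u}"
      then show "E (take k u) (\<tau> \<otimes> \<sigma>) * E (drop k u) ?c =
          (if k = 0 then E u ?c else 0) + (if k = length u then E u (\<tau> \<otimes> \<sigma>) else 0)"
        using * less.prems assms E_Nil by (cases "k = 0") auto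
    qed simp
    also have "\<dots> = E u ?c + E u (\<tau> \<otimes> \<sigma>)"
      by (simp add: sum.distrib)
    finally have "[E u (\<tau> \<otimes> \<sigma> \<otimes> ?c) = E u ?c + E u (\<tau> \<otimes> \<sigma>)] (mod m)"
      using E_mult[of "\<tau> \<otimes> \<sigma>" ?c u] less.prems assms by (simp add: cong_def)
    moreover have "\<tau> \<otimes> \<sigma> \<otimes> ?c = \<sigma> \<otimes> \<tau>"
      using assms(1,2) by (rule S.mult_swap_gcommutator)
    moreover have "E u (\<sigma> \<otimes> \<tau>) = E u (\<tau> \<otimes> \<sigma>)"
      using E_mult_avoid[of _ _ u x] less.prems assms by auto
    ultimately have "[E u ?c = 0] (mod m)"
      by (metis cong_add_rcancel_0 cong_sym)
    then show ?case
      using E_range[of ?c u] less.prems assms by (simp add: cong_def)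
  qed
  then show ?thesis
    using assms by (simp add: avoid_def)
qed

lemma avoid_pow: "\<sigma> \<in> avoid x \<Longrightarrow> \<sigma> [^] (q::nat) \<in> avoid x"
proof (induction q)
  case 0
  then show ?case
    by (simp add: avoid_def E_one)
next
  case (Suc q)
  then have "E u (\<sigma> [^] q \<otimes> \<sigma>) = 0" if "u \<in> lists X" "x \<notin> set u" "u \<noteq> []" for u
    using E_mult_avoid(1)[of "\<sigma> [^] q" \<sigma> u x] that by (auto simp: avoid_def)
  then show ?case
    using Suc by (simp add: avoid_def)
qed

end

locale free_magnus_lyndon = free_magnus X m S T + ordered_alphabet X r
  for X :: "'a set" and m :: int and S :: "'a monoid" (structure) and T :: "'a topology"
    and r :: "'a rel"
begin

abbreviation \<tau> :: "'a list \<Rightarrow> 'a" where "\<tau> \<equiv> lyndon_commutator S X r"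

text \<open>The commutators \<open>\<tau> w\<close> do not depend on the prime, so that any value may be put for it.\<close>

sublocale L: lyndon_series S T "0" X r
  by unfold_locales (rule X_S)

text \<open>Induction along the standard factorization w = x @ y, using that the leading term of
  [\<tau> x, \<tau> y] is a difference of two products.\<close>

lemma tau_low_order:
  assumes "Lyn w"
  shows "low_order (length w) (\<tau> w)" "E w (\<tau> w) = 1"
    "\<And>u. u \<in> lists X \<Longrightarrow> length u = length w \<Longrightarrow> u \<prec>\<^sub>w w \<Longrightarrow> E u (\<tau> w) = 0"
proof -
  have "low_order (length w) (\<tau> w) \<and> E w (\<tau> w) = 1 \<and>
    (\<forall>u\<in>lists X. length u = length w \<and> u \<prec>\<^sub>w w \<longrightarrow> E u (\<tau> w) = 0)"
    using assms
  proof (induction w rule: length_induct)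
    case (1 w)
    show ?case
    proof (cases "1 < length w")
      case False
      then obtain x where w: "w = [x]" "x \<in> X"
        using lyndon_lists[OF 1(2)] lyndon_nonempty[OF 1(2)] by (cases w) auto
      then show ?thesis
        using low_order_1[of x] E_letter[OF w(2)] by auto
    next
      case True
      note std = std_factorization[OF 1(2) True]
      note bounds = std_split_bounds[OF lyndon_lists[OF 1(2)] True, of r]
      define x y where "x = std_left w" and "y = std_right w"
      define a b where "a = length x" and "b = length y"
      have ab: "1 \<le> a" "1 \<le> b" "length w = a + b" "a < length w" "b < length w"
        using bounds by (auto simp: a_def b_def x_def y_def)
      have w: "w = x @ y" "Lyn x" "Lyn y" "w \<prec>\<^sub>w y"
        using std by (auto simp: x_def y_def)
      have tau: "\<tau> w = gcommutator S (\<tau> x) (\<tau> y)"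
        unfolding x_def y_def by (rule L.tau_std[OF lyndon_lists[OF 1(2)] True])
      have IHx: "low_order a (\<tau> x)" "E x (\<tau> x) = 1"
          "\<And>u. u \<in> lists X \<Longrightarrow> length u = a \<Longrightarrow> u \<prec>\<^sub>w x \<Longrightarrow> E u (\<tau> x) = 0"
        using 1(1)[rule_format, of x] w(2) ab by (auto simp: a_def)
      have IHy: "low_order b (\<tau> y)" "E y (\<tau> y) = 1"
          "\<And>u. u \<in> lists X \<Longrightarrow> length u = b \<Longrightarrow> u \<prec>\<^sub>w y \<Longrightarrow> E u (\<tau> y) = 0"
        using 1(1)[rule_format, of y] w(3) ab by (auto simp: b_def)
      have S: "\<tau> w \<in> carrier S"
        using lyndon_lists[OF 1(2)] lyndon_nonempty[OF 1(2)] by (rule L.tau_carrier)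
      note E = E_gcommutator[OF IHx(1) ab(1) IHy(1) ab(2), folded tau ab(3)]
      have "low_order (length w) (\<tau> w)"
        unfolding low_order_def
      proof (intro conjI ballI impI S, elim conjE)
        fix u assume u: "u \<in> lists X" "u \<noteq> []" "length u < length w"
        then have "[E u (\<tau> w) = 0] (mod m)"
          using E[of u] by simp
        then show "E u (\<tau> w) = 0"
          using E_range[OF S u(1)] by (simp add: cong_def)
      qed
      moreover have Eu: "E u (\<tau> w) = (if u = w then 1 else 0)"
        if u: "u \<in> lists X" "length u = length w" "u \<preceq>\<^sub>w w" for u
      proof -
        have td: "take k u \<in> lists X" "drop k u \<in> lists X" for k
          using u(1) by (rule take_drop_lists)+
        \<comment> \<open>Parts of equal length are compared one after the other: a word below
          \<open>w\<close> has its first part below \<open>x\<close>, or the first part equal to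
          \<open>x\<close> and the second part below \<open>y\<close>.\<close>
        have first: "E (take a u) (\<tau> x) * E (drop a u) (\<tau> y) = (if u = w then 1 else 0)"
        proof (cases "u = w")
          case True
          then show ?thesis
            using IHx(2) IHy(2) by (simp add: w(1) a_def)
        next
          case False
          then have "take a u @ drop a u \<prec>\<^sub>w x @ y"
            using u(3) w(1) by simp
          moreover have "length (take a u) = length x"
            using u(2) ab by (simp add: a_def)
          ultimately have "take a u \<prec>\<^sub>w x \<or> take a u = x \<and> drop a u \<prec>\<^sub>w y"
            by (metis append_take_drop_id drop_append length_drop lexord_sufE u(2) w(1) a_def ab(3)
                add_diff_cancel_left' b_def word_less_same_prefix)
          then show ?thesis
            using IHx(3)[OF td(1), of a] IHy(3)[OF td(2), of a] u(2) ab False by auto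
        qed
        \<comment> \<open>The opposite product vanishes because a Lyndon word is below its proper
          suffix \<open>y\<close>: a word that is at most \<open>w\<close> has its prefix of length
          \<open>b\<close> below \<open>y\<close>.\<close>
        have "take b u \<prec>\<^sub>w y"
        proof (rule ccontr)
          assume "\<not> take b u \<prec>\<^sub>w y"
          then have "y \<preceq>\<^sub>w take b u"
            using word_less_total td(1) lyndon_lists[OF w(3)] by blast
          then have "y \<preceq>\<^sub>w u"
            using word_le_append[of "take b u" "drop b u"] word_less_trans by auto
          then show False
            using u(3) w(4) word_less_trans word_less_irrefl by metis
        qed
        then have "E (take b u) (\<tau> y) = 0"
          using IHy(3)[OF td(1)] u(2) ab by simp
        then have "[E u (\<tau> w) = (if u = w then 1 else 0)] (mod m)"
          using E[of u] u ab first by (cases "u = []") auto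
        then show ?thesis
          using E_range[OF S u(1)] m_gt by (simp add: cong_def split: if_splits)
      qed
      moreover have "E w (\<tau> w) = 1"
        using Eu[of w] lyndon_lists[OF 1(2)] by simp
      moreover have "E u (\<tau> w) = 0" if "u \<in> lists X" "length u = length w" "u \<prec>\<^sub>w w" for u
        using Eu[of u] that by auto
      ultimately show ?thesis
        by blast
    qed
  qed
  then show "low_order (length w) (\<tau> w)" "E w (\<tau> w) = 1"
    "\<And>u. u \<in> lists X \<Longrightarrow> length u = length w \<Longrightarrow> u \<prec>\<^sub>w w \<Longrightarrow> E u (\<tau> w) = 0"
    by auto
qed

lemma tau_avoid: "w \<in> lists X \<Longrightarrow> x \<in> set w \<Longrightarrow> \<tau> w \<in> avoid x"
proof (induction w rule: length_induct)
  case (1 w)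
  show ?case
  proof (cases "1 < length w")
    case False
    then have "w = [x]" "x \<in> X"
      using 1(2,3) by (cases w; auto)+
    then show ?thesis
      using E_letter[of x] by (auto simp: avoid_def)
  next
    case True
    note bounds = std_split_bounds[OF 1(2) True, of r]
    have tw: "\<tau> w = gcommutator S (\<tau> (std_left w)) (\<tau> (std_right w))"
      by (rule L.tau_std[OF 1(2) True])
    have lr: "std_left w \<in> lists X" "std_right w \<in> lists X" "std_left w \<noteq> []" "std_right w \<noteq> []"
      "length (std_left w) < length w" "length (std_right w) < length w"
      using bounds True take_drop_lists[OF 1(2)] by auto
    have "x \<in> set (std_left w) \<or> x \<in> set (std_right w)"
      using 1(3) by (metis Un_iff append_take_drop_id set_append)
    then have "\<tau> (std_left w) \<in> avoid x \<or> \<tau> (std_right w) \<in> avoid x"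
      using 1(1) lr by blast
    then show ?thesis
      unfolding tw using lr by (intro avoid_gcommutator L.tau_carrier)
  qed
qed

end


section \<open>The unipotent representation of a word\<close>

locale word_representation = free_magnus X m S T + word_matrices p n s m
  for X :: "'a set" and m :: int and S :: "'a monoid" (structure) and T :: "'a topology"
    and p n s :: nat +
  fixes w :: "'a list"
  assumes w: "w \<in> lists X" "length w = s"
begin

sublocale P: lower_p_series S T p
  by unfold_locales

abbreviation \<rho> :: "'a \<Rightarrow> nat \<times> nat \<Rightarrow> int" where "\<rho> \<equiv> word_rep p n S T X w"

abbreviation factor :: "nat \<Rightarrow> nat \<Rightarrow> 'a list" where
  "factor i j \<equiv> take (j - i) (drop (i - 1) w)"

lemma word_ring_eq: "word_ring p n s = residue_ring m"
  by (simp add: word_ring_def m)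

lemma factor_lists: "factor i j \<in> lists X"
  using w(1) by (intro take_drop_lists)

lemma rho_entry:
  "i \<in> idx \<Longrightarrow> j \<in> idx \<Longrightarrow>
    \<rho> \<sigma> (i, j) = (if i < j then E (factor i j) \<sigma> else if i = j then 1 else 0)"
  by (simp add: word_rep_def idx_eq w(2) word_ring_eq)

lemma rho_closed: "\<sigma> \<in> carrier S \<Longrightarrow> \<rho> \<sigma> \<in> carrier U"
  unfolding U_mem_iff
proof (intro conjI ballI impI)
  assume \<sigma>: "\<sigma> \<in> carrier S"
  show "\<rho> \<sigma> \<in> idx \<times> idx \<rightarrow>\<^sub>E {0..m - 1}"
  proof (rule PiE_I)
    fix z assume "z \<in> idx \<times> idx"
    then obtain i j where "z = (i, j)" "i \<in> idx" "j \<in> idx"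
      by auto
    then show "\<rho> \<sigma> z \<in> {0..m - 1}"
      using E_range[OF \<sigma> factor_lists] m_gt by (simp add: rho_entry)
  qed (auto simp: word_rep_def idx_eq w(2))
qed (simp_all add: rho_entry)

text \<open>Splitting the factor between i and j at a position k gives the factors between i and k
  and between k and j, so the matrix product is the convolution of coefficients; the diagonal ones
  match the constant coefficients. Matrix indices start at 1, hence the shift in
  \<open>factor\<close>.\<close>

lemma rho_mult:
  assumes "\<sigma> \<in> carrier S" "\<tau> \<in> carrier S"
  shows "\<rho> (\<sigma> \<otimes> \<tau>) = \<rho> \<sigma> \<otimes>\<^bsub>U\<^esub> \<rho> \<tau>"
proof (rule U_eqI)
  fix i j assume ij: "i \<in> idx" "j \<in> idx" "i < j"
  have bounds: "1 \<le> i" "j \<le> Suc s"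
    using ij by (auto simp: idx_eq)
  then have len: "length (factor i j) = j - i"
    using w(2) ij(3) by simp
  have "(\<Sum>k\<in>idx. \<rho> \<sigma> (i, k) * \<rho> \<tau> (k, j)) = (\<Sum>k\<in>{i..j}. \<rho> \<sigma> (i, k) * \<rho> \<tau> (k, j))"
  proof (rule sum.mono_neutral_right)
    show "{i..j} \<subseteq> idx"
      using bounds by (auto simp: idx_eq)
    show "\<forall>k\<in>idx - {i..j}. \<rho> \<sigma> (i, k) * \<rho> \<tau> (k, j) = 0"
      using ij by (auto simp: rho_entry)
  qed simp
  also have "\<dots> = (\<Sum>k\<le>length (factor i j). E (take k (factor i j)) \<sigma> * E (drop k (factor i j)) \<tau>)"
  proof (rule sum.reindex_bij_witness[of _ "\<lambda>k. k + i" "\<lambda>k. k - i"])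
    fix k assume k: "k \<in> {i..j}"
    then have kI: "k \<in> idx"
      using bounds by (auto simp: idx_eq)
    have "take (k - i) (factor i j) = factor i k"
      using k diff_le_mono[of k j i] by (simp add: min_def)
    moreover have "drop (k - i) (factor i j) = factor k j"
      using k bounds by (simp add: drop_take add.commute)
    ultimately show "E (take (k - i) (factor i j)) \<sigma> * E (drop (k - i) (factor i j)) \<tau> =
        \<rho> \<sigma> (i, k) * \<rho> \<tau> (k, j)"
      using k ij kI E_Nil[OF assms(1)] E_Nil[OF assms(2)]
      by (cases "k = i"; cases "k = j") (auto simp: rho_entry)
  qed (use len ij(3) in auto)
  finally have "(\<rho> \<sigma> \<otimes>\<^bsub>U\<^esub> \<rho> \<tau>) (i, j) = word_conv (\<lambda>v. E v \<sigma>) (\<lambda>v. E v \<tau>) (factor i j) mod m"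
    using U_mult[OF ij(1,2)] by (simp add: word_conv_def)
  then show "\<rho> (\<sigma> \<otimes> \<tau>) (i, j) = (\<rho> \<sigma> \<otimes>\<^bsub>U\<^esub> \<rho> \<tau>) (i, j)"
    using E_mult[OF assms factor_lists] ij by (simp add: rho_entry)
qed (use assms rho_closed U_mult_closed in auto)

lemma rho_hom: "\<rho> \<in> hom S U"
  using rho_closed rho_mult by (intro homI) auto

lemma idx_nonempty: "idx \<noteq> {}"
  using corner(1) by blast

lemma rho_continuous: "continuous_map T (discrete_topology (carrier U)) \<rho>"
proof (rule continuous_map_discreteI)
  show "\<rho> \<sigma> \<in> carrier U" if "\<sigma> \<in> topspace T" for \<sigma>
    using that rho_closed by (simp add: S.topspace_eq)
  fix M assume M: "M \<in> carrier U"
  have "openin T {\<sigma> \<in> topspace T. \<rho> \<sigma> (i, j) = M (i, j)}" if "i \<in> idx" "j \<in> idx" for i j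
  proof (cases "i < j")
    case True
    then show ?thesis
      using continuous_map_discreteD[OF E_continuous[OF factor_lists]] that by (simp add: rho_entry)
  next
    case False
    then show ?thesis
      using that by (cases "(if i = j then 1 else 0) = M (i, j)") (auto simp: rho_entry)
  qed
  then have "openin T (\<Inter>z\<in>idx \<times> idx. {\<sigma> \<in> topspace T. \<rho> \<sigma> z = M z})"
    using idx_nonempty by (intro openin_INT2) auto
  moreover have "(\<Inter>z\<in>idx \<times> idx. {\<sigma> \<in> topspace T. \<rho> \<sigma> z = M z}) = {\<sigma> \<in> topspace T. \<rho> \<sigma> = M}"
  proof
    show "(\<Inter>z\<in>idx \<times> idx. {\<sigma> \<in> topspace T. \<rho> \<sigma> z = M z}) \<subseteq> {\<sigma> \<in> topspace T. \<rho> \<sigma> = M}"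
    proof
      fix \<sigma> assume \<sigma>: "\<sigma> \<in> (\<Inter>z\<in>idx \<times> idx. {\<sigma> \<in> topspace T. \<rho> \<sigma> z = M z})"
      then have "\<sigma> \<in> topspace T"
        using corner(1) by blast
      moreover from this have "\<rho> \<sigma> = M"
        using \<sigma> M rho_closed by (intro U_eqI) (auto simp: S.topspace_eq)
      ultimately show "\<sigma> \<in> {\<sigma> \<in> topspace T. \<rho> \<sigma> = M}"
        by simp
    qed
  qed auto
  ultimately show "openin T {\<sigma> \<in> topspace T. \<rho> \<sigma> = M}"
    by simp
qed

sublocale \<rho>: group_hom S U \<rho>
  using rho_hom by unfold_locales

lemma rho_L: "\<sigma> \<in> P.L t \<Longrightarrow> \<rho> \<sigma> \<in> U.L t"
  using lower_p_central_hom[OF P.lower_p_series_axioms U.lower_p_series_axioms rho_hom rho_continuous]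
  by blast

text \<open>Meaningful on \<open>P.L n\<close>, where the corner entry is a multiple of p^(n - s);
  dividing by it is the prescribed identification of the central subgroup with Z/p.\<close>

definition coef :: "'a \<Rightarrow> int" where "coef \<sigma> = E w \<sigma> div int p ^ (n - s)"

lemma rho_corner: "\<rho> \<sigma> (1, Suc s) = E w \<sigma>"
  using s w(2) by (simp add: rho_entry)

lemma coef:
  assumes "\<sigma> \<in> P.L n"
  shows "coef \<sigma> \<in> {0..<int p}" "\<rho> \<sigma> = \<iota> (coef \<sigma>)"
proof -
  obtain a where a: "a \<in> {0..<int p}" "\<rho> \<sigma> = \<iota> a"
    using U_L_n[OF rho_L[OF assms]] by blast
  have "E w \<sigma> = \<iota> a (1, Suc s)"
    using rho_corner[of \<sigma>] a(2) by simp
  also have "\<dots> = a * int p ^ (n - s)"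
    using s embedding_entry[OF corner(1,3), of a] by simp
  finally have "coef \<sigma> = a"
    using p by (simp add: coef_def)
  then show "coef \<sigma> \<in> {0..<int p}" "\<rho> \<sigma> = \<iota> (coef \<sigma>)"
    using a by auto
qed

lemma coef_mult:
  assumes "\<sigma> \<in> P.L n" "\<tau> \<in> P.L n"
  shows "coef (\<sigma> \<otimes> \<tau>) = (coef \<sigma> + coef \<tau>) mod int p"
proof (rule embedding_inj)
  show "coef (\<sigma> \<otimes> \<tau>) \<in> {0..<int p}"
    using assms P.mult_L coef by blast
  show "(coef \<sigma> + coef \<tau>) mod int p \<in> {0..<int p}"
    using p by simp
  have "\<iota> (coef (\<sigma> \<otimes> \<tau>)) = \<rho> (\<sigma> \<otimes> \<tau>)"
    using assms P.mult_L coef by metis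
  also have "\<dots> = \<iota> (coef \<sigma>) \<otimes>\<^bsub>U\<^esub> \<iota> (coef \<tau>)"
    using assms coef rho_mult[of \<sigma> \<tau>] by simp
  also have "\<dots> = \<iota> ((coef \<sigma> + coef \<tau>) mod int p)"
    using assms coef(1) by (intro embedding_add)
  finally show "\<iota> (coef (\<sigma> \<otimes> \<tau>)) = \<iota> ((coef \<sigma> + coef \<tau>) mod int p)" .
qed

lemma coef_Suc:
  assumes "\<sigma> \<in> P.L (Suc n)"
  shows "coef \<sigma> = 0"
proof (rule embedding_inj)
  have \<sigma>: "\<sigma> \<in> P.L n"
    using assms P.L_Suc_subset by blast
  then show "coef \<sigma> \<in> {0..<int p}"
    by (rule coef)
  show "\<iota> (coef \<sigma>) = \<iota> 0"
    using coef(2)[OF \<sigma>] U_L_Suc_n rho_L[OF assms] embedding_0 by auto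
qed (use p in simp)

end

locale word_representation_lyndon =
  word_representation X m S T p n s w + free_magnus_lyndon X m S T r
  for X :: "'a set" and m :: int and S :: "'a monoid" (structure) and T :: "'a topology"
    and p n s :: nat and w :: "'a list" and r :: "'a rel"
begin

text \<open>The first two alternatives for vanishing come from the leading term of the Magnus series
  of \<open>\<tau> v\<close>. The third covers shorter words \<open>v\<close> as well and is used to
  cut down infinite alphabets. For v = w the coefficient is p^(n - s) modulo p^(n - s + 1).\<close>

lemma coef_tau_power:
  assumes v: "Lyn v" "length v \<le> n"
  shows "s < length v \<or> s = length v \<and> w \<prec>\<^sub>w v \<or> \<not> set v \<subseteq> set w \<Longrightarrow>
      coef (\<tau> v [^] (p ^ (n - length v))) = 0"
    and "v = w \<Longrightarrow> coef (\<tau> v [^] (p ^ (n - length v))) = 1"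
proof -
  let ?g = "\<tau> v [^] (p ^ (n - length v))"
  have vX: "v \<in> lists X" "v \<noteq> []"
    using v lyndon_lists lyndon_nonempty by auto
  have g: "?g \<in> carrier S"
    using L.tau_carrier[OF vX] by simp
  have ne: "w \<noteq> []"
    using w(2) s by auto
  note low = tau_low_order[OF v(1)]
  have pow: "[E w ?g = int (p ^ (n - length v)) * E w (\<tau> v)] (mod m)" if "s \<le> length v"
    using that vX(2) w ne by (intro E_pow[OF low(1)]) (auto simp: Suc_le_eq)
  show "coef ?g = 0" if *: "s < length v \<or> s = length v \<and> w \<prec>\<^sub>w v \<or> \<not> set v \<subseteq> set w"
  proof -
    have "E w ?g = 0"
    proof (cases "set v \<subseteq> set w")
      case True
      then have "E w (\<tau> v) = 0"
        using * low w ne by (auto simp: low_order_def)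
      moreover have "s \<le> length v"
        using * True by auto
      ultimately show ?thesis
        using pow E_range[OF g w(1)] by (simp add: cong_def)
    next
      case False
      then obtain x where "x \<in> set v" "x \<notin> set w"
        by blast
      then have "?g \<in> avoid x"
        using vX by (intro avoid_pow tau_avoid)
      then show ?thesis
        using \<open>x \<notin> set w\<close> w ne by (auto simp: avoid_def)
    qed
    then show ?thesis
      by (simp add: coef_def)
  qed
  show "coef ?g = 1" if "v = w"
  proof -
    have "[E w ?g = int p ^ (n - s)] (mod m)"
      using pow low(2) that w by simp
    moreover have "int p ^ (n - s) < m"
      unfolding m using p by (intro power_strict_increasing) auto
    ultimately have "E w ?g = int p ^ (n - s)"
      using E_range[OF g w(1)] p by (simp add: cong_def)
    then show ?thesis
      using p by (simp add: coef_def)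
  qed
qed

end


section \<open>Cohomology of the quotients of a free profinite group\<close>

locale free_quotient =
  fixes S :: "'a monoid" (structure) and T :: "'a topology" and X :: "'a set" and p n :: nat
  assumes free: "free_profinite S T X" and prime_p: "prime p" and n: "2 \<le> n"
begin

sublocale S: profinite_group S T
  using free by (simp add: free_profinite_def)

sublocale S: lower_p_series S T p
  by unfold_locales

abbreviation Ln :: "'a set" where "Ln \<equiv> S.L n"

abbreviation Q :: "'a set monoid" where "Q \<equiv> p_quotient S T p n"

abbreviation TQ :: "'a set topology" where "TQ \<equiv> p_quotient_topology S T p n"

abbreviation \<pi> :: "'a \<Rightarrow> 'a set" where "\<pi> \<equiv> p_quotient_map S T p n"

abbreviation A :: "int monoid" where "A \<equiv> integer_mod_group p"

abbreviation TA :: "int topology" where "TA \<equiv> discrete_topology (carrier A)"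

lemma p_pos: "0 < int p" "p \<noteq> 0"
  using prime_p by (auto simp: prime_gt_0_nat)

lemma A_carrier: "carrier A = {0..<int p}"
  using p_pos by (simp add: carrier_integer_mod_group)

lemma mod_A [simp]: "x mod int p \<in> carrier A"
  using p_pos by (simp add: A_carrier)

lemma A_mod: "x \<in> carrier A \<Longrightarrow> x mod int p = x"
  by (simp add: A_carrier)

lemma A_cong: "x \<in> carrier A \<Longrightarrow> y \<in> carrier A \<Longrightarrow> [x = y] (mod int p) \<Longrightarrow> x = y"
  using A_mod by (simp add: cong_def)

sublocale Ln: normal Ln S
  by (rule S.L_normal)

lemma Q_eq: "Q = S Mod Ln" and \<pi>_eq: "\<pi> g = Ln #> g"
  by (simp_all add: p_quotient_def p_quotient_map_def)

sublocale Q: group Q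
  unfolding Q_eq by (rule Ln.factorgroup_is_group)

lemma Q_carrier: "carrier Q = \<pi> ` carrier S"
  by (auto simp: Q_eq \<pi>_eq carrier_FactGroup)

sublocale \<pi>: group_hom S Q \<pi>
proof unfold_locales
  have "\<pi> = (\<lambda>g. Ln #> g)"
    by (simp add: fun_eq_iff \<pi>_eq)
  then show "\<pi> \<in> hom S Q"
    unfolding Q_eq using Ln.r_coset_hom_Mod by simp
qed

lemma \<pi>_eq_iff: "g \<in> carrier S \<Longrightarrow> h \<in> carrier S \<Longrightarrow> \<pi> g = \<pi> h \<longleftrightarrow> g \<otimes> inv h \<in> Ln"
  unfolding \<pi>_eq by (rule Ln.rcos_eq_iff)

lemma \<pi>_Ln: "g \<in> Ln \<Longrightarrow> \<pi> g = \<pi> \<one>"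
  using \<pi>_eq_iff[of g \<one>] by simp

lemma quotient_map_\<pi>: "quotient_map T TQ \<pi>"
  unfolding p_quotient_topology_def by (rule quotient_map_quotient_topology)

lemma topspace_TQ: "topspace TQ = carrier Q"
  using quotient_imp_surjective_map[OF quotient_map_\<pi>] by (simp add: Q_carrier S.topspace_eq)

lemma continuous_\<pi>: "continuous_map T TQ \<pi>"
  using quotient_map_\<pi> by (rule quotient_imp_continuous_map)

lemma openin_\<pi>_image:
  assumes U: "openin T U"
  shows "openin TQ (\<pi> ` U)"
proof -
  have US: "U \<subseteq> carrier S"
    using openin_subset[OF U] by (simp add: S.topspace_eq)
  have "openin T {x \<in> topspace T. m \<otimes> x \<in> U}" if "m \<in> Ln" for m
    using that U by (intro openin_continuous_map_preimage[OF S.continuous_map_mult] S.continuous_map_const_id) auto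
  then have "openin T (\<Union>m\<in>Ln. {x \<in> topspace T. m \<otimes> x \<in> U})"
    by (intro openin_Union) auto
  also have "(\<Union>m\<in>Ln. {x \<in> topspace T. m \<otimes> x \<in> U}) = {x \<in> topspace T. \<pi> x \<in> \<pi> ` U}"
  proof (intro subset_antisym subsetI)
    fix x assume "x \<in> (\<Union>m\<in>Ln. {x \<in> topspace T. m \<otimes> x \<in> U})"
    then obtain m where m: "m \<in> Ln" "x \<in> carrier S" "m \<otimes> x \<in> U"
      by (auto simp: S.topspace_eq)
    then have "\<pi> (m \<otimes> x) = \<pi> x"
      using \<pi>_eq_iff[of "m \<otimes> x" x] by (simp add: S.m_assoc)
    then show "x \<in> {x \<in> topspace T. \<pi> x \<in> \<pi> ` U}"
      using m by (auto simp: S.topspace_eq intro: rev_image_eqI)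
  next
    fix x assume "x \<in> {x \<in> topspace T. \<pi> x \<in> \<pi> ` U}"
    then obtain y where y: "x \<in> carrier S" "y \<in> U" "\<pi> x = \<pi> y"
      by (auto simp: S.topspace_eq)
    then have "y \<otimes> inv x \<in> Ln"
      using \<pi>_eq_iff[of y x] US by auto
    moreover have "y \<otimes> inv x \<otimes> x = y"
      using y US by (simp add: S.m_assoc subset_iff)
    ultimately show "x \<in> (\<Union>m\<in>Ln. {x \<in> topspace T. m \<otimes> x \<in> U})"
      using y by (auto simp: S.topspace_eq intro!: bexI[of _ "y \<otimes> inv x"])
  qed
  finally have "openin T {x \<in> topspace T. \<pi> x \<in> \<pi> ` U}" .
  moreover have "\<pi> ` U \<subseteq> topspace TQ"
    using US by (auto simp: topspace_TQ Q_carrier)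
  ultimately show ?thesis
    using quotient_map_\<pi> unfolding quotient_map_def by blast
qed

text \<open>A product of quotient maps is not a quotient map in general, but \<pi> is open, so boxes
  of open sets in \<open>S\<close> have open images.\<close>

lemma continuous_prod_TQ:
  assumes "continuous_map (prod_topology T T) (discrete_topology C) (\<lambda>z. f (\<pi> (fst z), \<pi> (snd z)))"
  shows "continuous_map (prod_topology TQ TQ) (discrete_topology C) f"
proof (rule continuous_map_discreteI)
  fix z assume "z \<in> topspace (prod_topology TQ TQ)"
  then obtain g h where "z = (\<pi> g, \<pi> h)" "g \<in> carrier S" "h \<in> carrier S"
    by (auto simp: topspace_TQ Q_carrier)
  then show "f z \<in> C"
    using assms by (auto simp: continuous_map_def S.topspace_eq Pi_iff)
next
  fix c
  have W: "openin (prod_topology T T) {z \<in> topspace (prod_topology T T). f (\<pi> (fst z), \<pi> (snd z)) = c}"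
    by (rule continuous_map_discreteD[OF assms])
  show "openin (prod_topology TQ TQ) {z \<in> topspace (prod_topology TQ TQ). f z = c}"
    unfolding openin_prod_topology_alt
  proof (intro allI impI)
    fix C D assume "(C, D) \<in> {z \<in> topspace (prod_topology TQ TQ). f z = c}"
    then obtain g h where gh: "C = \<pi> g" "D = \<pi> h" "g \<in> carrier S" "h \<in> carrier S" "f (\<pi> g, \<pi> h) = c"
      by (auto simp: topspace_TQ Q_carrier)
    then have "(g, h) \<in> {z \<in> topspace (prod_topology T T). f (\<pi> (fst z), \<pi> (snd z)) = c}"
      by (simp add: S.topspace_eq)
    from W[unfolded openin_prod_topology_alt, rule_format, OF this]
    obtain U V where UV: "openin T U" "openin T V" "g \<in> U" "h \<in> V"
      "U \<times> V \<subseteq> {z \<in> topspace (prod_topology T T). f (\<pi> (fst z), \<pi> (snd z)) = c}"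
      by auto
    have "\<pi> ` U \<times> \<pi> ` V \<subseteq> {z \<in> topspace (prod_topology TQ TQ). f z = c}"
      using UV(5) by (fastforce simp: S.topspace_eq topspace_TQ Q_carrier)
    then show "\<exists>U V. openin TQ U \<and> openin TQ V \<and> C \<in> U \<and> D \<in> V \<and>
        U \<times> V \<subseteq> {z \<in> topspace (prod_topology TQ TQ). f z = c}"
      using openin_\<pi>_image[OF UV(1)] openin_\<pi>_image[OF UV(2)] UV(3,4) gh(1,2)
      by (intro exI[of _ "\<pi> ` U"] exI[of _ "\<pi> ` V"]) simp
  qed
qed

text \<open>\<open>trivializes c b\<close>: the inflation of \<open>c\<close> to \<open>S\<close> is the coboundary of \<open>b\<close>. The restriction of
  \<open>b - b 1\<close> to \<open>Ln\<close> is the image of the class of \<open>c\<close> under the inverse of the transgression.\<close>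

definition trivializes :: "('a set \<times> 'a set \<Rightarrow> int) \<Rightarrow> ('a \<Rightarrow> int) \<Rightarrow> bool" where
  "trivializes c b \<longleftrightarrow> continuous_map T TA b \<and>
     (\<forall>g\<in>carrier S. \<forall>h\<in>carrier S. c (\<pi> g, \<pi> h) = (b h - b (g \<otimes> h) + b g) mod int p)"

definition residual :: "('a \<Rightarrow> int) \<Rightarrow> 'a \<Rightarrow> int" where
  "residual b s = (b s - b \<one>) mod int p"

lemma trivializes_closed: "trivializes c b \<Longrightarrow> g \<in> carrier S \<Longrightarrow> b g \<in> carrier A"
  by (auto simp: trivializes_def continuous_map_def S.topspace_eq)

lemma trivializes_cong:
  "trivializes c b \<Longrightarrow> g \<in> carrier S \<Longrightarrow> h \<in> carrier S \<Longrightarrow>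
    [c (\<pi> g, \<pi> h) = b h - b (g \<otimes> h) + b g] (mod int p)"
  by (simp add: trivializes_def cong_def)

lemma residual_eq_0_iff:
  assumes "trivializes c b" "g \<in> carrier S"
  shows "residual b g = 0 \<longleftrightarrow> b g = b \<one>"
proof
  assume "residual b g = 0"
  then have "[b g = b \<one>] (mod int p)"
    by (simp add: residual_def mod_eq_0_iff_dvd cong_iff_dvd_diff)
  then show "b g = b \<one>"
    using assms trivializes_closed A_cong by auto
qed (simp add: residual_def)

text \<open>Since \<pi> takes the same value at \<open>m\<close> and at 1, so does the inflated
  cocycle, and the two expressions of its value as a coboundary can be compared.\<close>

lemma trivializes_mult_Ln:
  assumes c: "trivializes c b" and g: "g \<in> carrier S" and m: "m \<in> Ln"
  shows "[b (g \<otimes> m) = b g + residual b m] (mod int p)"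
    and "[b (m \<otimes> g) = b g + residual b m] (mod int p)"
proof -
  have mS: "m \<in> carrier S"
    using m by simp
  have r: "[residual b m = b m - b \<one>] (mod int p)"
    by (simp add: residual_def cong_def)
  have "[b m - b (g \<otimes> m) + b g = b \<one> - b (g \<otimes> \<one>) + b g] (mod int p)"
    using trivializes_cong[OF c g mS] trivializes_cong[OF c g, of \<one>] \<pi>_Ln[OF m]
    by (metis S.one_closed cong_sym cong_trans)
  then have "[b (g \<otimes> m) = b g + (b m - b \<one>)] (mod int p)"
    using g by (simp add: cong_iff_dvd_diff algebra_simps dvd_diff_commute)
  then show "[b (g \<otimes> m) = b g + residual b m] (mod int p)"
    using r by (metis cong_add_lcancel cong_sym cong_trans)
  have "[b g - b (m \<otimes> g) + b m = b g - b (\<one> \<otimes> g) + b \<one>] (mod int p)"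
    using trivializes_cong[OF c mS g] trivializes_cong[OF c _ g, of \<one>] \<pi>_Ln[OF m]
    by (metis S.one_closed cong_sym cong_trans)
  then have "[b (m \<otimes> g) = b g + (b m - b \<one>)] (mod int p)"
    using g by (simp add: cong_iff_dvd_diff algebra_simps dvd_diff_commute)
  then show "[b (m \<otimes> g) = b g + residual b m] (mod int p)"
    using r by (metis cong_add_lcancel cong_sym cong_trans)
qed

lemma residual_mult:
  assumes c: "trivializes c b" and m: "m \<in> Ln" "m' \<in> Ln"
  shows "[residual b (m \<otimes> m') = residual b m + residual b m'] (mod int p)"
proof -
  have "[b (m \<otimes> m') - b \<one> = b m + residual b m' - b \<one>] (mod int p)"
    using trivializes_mult_Ln(1)[OF c _ m(2), of m] m by (intro cong_diff) auto
  also have "b m + residual b m' - b \<one> = (b m - b \<one>) + residual b m'"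
    by simp
  also have "[(b m - b \<one>) + residual b m' = residual b m + residual b m'] (mod int p)"
    by (intro cong_add) (auto simp: residual_def cong_def)
  finally show ?thesis
    by (simp add: residual_def cong_def)
qed

lemma residual_one [simp]: "residual b \<one> = 0"
  by (simp add: residual_def)

lemma subgroup_residual:
  assumes c: "trivializes c b"
  shows "subgroup {m \<in> Ln. residual b m = 0} S" "closedin T {m \<in> Ln. residual b m = 0}"
proof -
  have mult: "residual b (x \<otimes> y) = residual b y" if "x \<in> Ln" "residual b x = 0" "y \<in> Ln" for x y
    using residual_mult[OF c that(1,3)] that(2) by (simp add: residual_def cong_def)
  show "subgroup {m \<in> Ln. residual b m = 0} S"
  proof (rule S.subgroupI)
    have "\<one> \<in> {m \<in> Ln. residual b m = 0}"
      by simp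
    then show "{m \<in> Ln. residual b m = 0} \<noteq> {}"
      by blast
    fix x assume x: "x \<in> {m \<in> Ln. residual b m = 0}"
    then have xS: "x \<in> carrier S"
      by auto
    show "inv x \<in> {m \<in> Ln. residual b m = 0}"
      using mult[of x "inv x"] x xS S.inv_L by simp
    fix y assume "y \<in> {m \<in> Ln. residual b m = 0}"
    then show "x \<otimes> y \<in> {m \<in> Ln. residual b m = 0}"
      using mult[of x y] x S.mult_L by simp
  qed auto
  have "{m \<in> Ln. residual b m = 0} = Ln \<inter> {g \<in> topspace T. b g \<in> {b \<one>}}"
    using residual_eq_0_iff[OF c] by (auto simp: S.topspace_eq)
  moreover have "closedin T {g \<in> topspace T. b g \<in> {b \<one>}}"
    using c trivializes_closed[OF c, of \<one>]
    by (intro closedin_continuous_map_preimage[of T TA b]) (auto simp: trivializes_def)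
  ultimately show "closedin T {m \<in> Ln. residual b m = 0}"
    using S.L_closed by auto
qed

text \<open>The value of \<open>b\<close> at g m is computed with \<open>m\<close> on the right and
  with its conjugate on the left.\<close>

lemma residual_conj:
  assumes c: "trivializes c b" and g: "g \<in> carrier S" and m: "m \<in> Ln"
  shows "residual b (g \<otimes> m \<otimes> inv g) = residual b m"
proof -
  have m': "g \<otimes> m \<otimes> inv g \<in> Ln"
    using S.L_conj g m by blast
  have "g \<otimes> m \<otimes> inv g \<otimes> g = g \<otimes> m"
    using g m by (simp add: S.m_assoc)
  then have "[b g + residual b (g \<otimes> m \<otimes> inv g) = b g + residual b m] (mod int p)"
    using trivializes_mult_Ln(1)[OF c g m] trivializes_mult_Ln(2)[OF c g m']
    by (metis cong_sym cong_trans)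
  then have "[residual b (g \<otimes> m \<otimes> inv g) = residual b m] (mod int p)"
    by (simp add: cong_add_lcancel)
  then show ?thesis
    by (simp add: residual_def cong_def)
qed

lemma residual_pow:
  assumes c: "trivializes c b" and m: "m \<in> Ln"
  shows "[residual b (m [^] (q::nat)) = int q * residual b m] (mod int p)"
proof (induction q)
  case (Suc q)
  have "[residual b (m [^] q \<otimes> m) = residual b (m [^] q) + residual b m] (mod int p)"
    using c m S.pow_L by (intro residual_mult) auto
  also have "[residual b (m [^] q) + residual b m = int q * residual b m + residual b m] (mod int p)"
    using Suc by (intro cong_add) auto
  finally show ?case
    by (simp add: algebra_simps)
qed simp

text \<open>A homomorphism on \<open>Ln\<close> to Z/p that is invariant under conjugation by
  \<open>S\<close> kills p-th powers and the commutators [g, h], each being a conjugate of the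
  inverse of \<open>h\<close> times \<open>h\<close>.\<close>

lemma residual_L_Suc:
  assumes c: "trivializes c b"
  shows "S.L (Suc n) \<subseteq> {m \<in> Ln. residual b m = 0}"
proof (rule S.L_Suc_minimal)
  show "1 \<le> n"
    using n by simp
  show "h [^] p \<in> {m \<in> Ln. residual b m = 0}" if "h \<in> Ln" for h
    using residual_pow[OF c that, of p] S.pow_L[OF that] by (simp add: cong_def residual_def)
  show "gcommutator S g h \<in> {m \<in> Ln. residual b m = 0}" if g: "g \<in> carrier S" and h: "h \<in> Ln" for g h
  proof -
    let ?h = "inv g \<otimes> inv h \<otimes> inv (inv g)"
    have hS: "h \<in> carrier S"
      using h by simp
    have h': "?h \<in> Ln"
      using S.L_conj[of "inv g" "inv h"] g h S.inv_L by simp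
    have e: "gcommutator S g h = ?h \<otimes> h"
      using g hS by (simp add: gcommutator_def)
    have "[residual b (?h \<otimes> h) = residual b ?h + residual b h] (mod int p)"
      by (rule residual_mult[OF c h' h])
    moreover have "residual b ?h = residual b (inv h)"
      using residual_conj[OF c, of "inv g" "inv h"] g h S.inv_L by simp
    moreover have "[residual b (inv h \<otimes> h) = residual b (inv h) + residual b h] (mod int p)"
      using c h S.inv_L by (intro residual_mult) auto
    ultimately have "[residual b (?h \<otimes> h) = 0] (mod int p)"
      using hS by (simp add: cong_def)
    then have "residual b (gcommutator S g h) = 0"
      unfolding e by (simp add: residual_def cong_def)
    then show ?thesis
      using S.mult_L[OF h' h] e by simp
  qed
qed (rule subgroup_residual[OF c])+

text \<open>The difference \<open>d\<close> of two trivializations is a continuous homomorphism to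
  Z/p modulo p, so it vanishes on \<open>S.L 2\<close>, and \<open>Ln\<close> is contained in it
  because n is at least 2.\<close>

lemma residual_unique:
  assumes c: "trivializes c b" and c': "trivializes c b'" and m: "m \<in> Ln"
  shows "residual b m = residual b' m"
proof -
  define d where "d g = (b g - b' g) mod int p" for g
  have d_mult: "[d (g \<otimes> h) = d g + d h] (mod int p)" if g: "g \<in> carrier S" "h \<in> carrier S" for g h
  proof -
    have "[b h - b (g \<otimes> h) + b g = b' h - b' (g \<otimes> h) + b' g] (mod int p)"
      using trivializes_cong[OF c g] trivializes_cong[OF c' g] cong_sym cong_trans by blast
    then have "[b (g \<otimes> h) - b' (g \<otimes> h) = (b g - b' g) + (b h - b' h)] (mod int p)"
      by (simp add: cong_iff_dvd_diff algebra_simps dvd_diff_commute)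
    also have "[(b g - b' g) + (b h - b' h) = d g + d h] (mod int p)"
      unfolding d_def by (intro cong_add) (auto simp: cong_def)
    finally show ?thesis
      by (simp add: d_def cong_def)
  qed
  have d0: "d g = 0" if "[d g = 0] (mod int p)" for g
    using that by (simp add: d_def cong_def)
  have d_one: "d \<one> = 0"
    using d_mult[of \<one> \<one>] by (intro d0) (simp add: cong_iff_dvd_diff)
  have d_inv: "[d (inv g) = - d g] (mod int p)" if g: "g \<in> carrier S" for g
  proof -
    have "[0 = d g + d (inv g)] (mod int p)"
      using d_mult[of g "inv g"] g d_one by simp
    then have "[0 - d g = d g + d (inv g) - d g] (mod int p)"
      by (intro cong_diff) auto
    then show ?thesis
      by (simp add: cong_sym)
  qed
  have d_pow: "[d (g [^] (q::nat)) = int q * d g] (mod int p)" if g: "g \<in> carrier S" for g q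
  proof (induction q)
    case 0
    then show ?case
      by (simp add: d_one)
  next
    case (Suc q)
    have "[d (g [^] q \<otimes> g) = d (g [^] q) + d g] (mod int p)"
      using g by (intro d_mult) auto
    also have "[d (g [^] q) + d g = int q * d g + d g] (mod int p)"
      using Suc by (intro cong_add) auto
    finally show ?case
      by (simp add: algebra_simps)
  qed
  define K where "K = {g \<in> carrier S. d g = 0}"
  have K: "subgroup K S"
  proof (rule S.subgroupI)
    have "\<one> \<in> K"
      by (simp add: K_def d_one)
    then show "K \<noteq> {}"
      by blast
    fix x assume x: "x \<in> K"
    then have "d (inv x) = 0"
      using d_inv[of x] by (intro d0) (simp add: K_def)
    then show "inv x \<in> K"
      using x by (simp add: K_def)
    fix y assume y: "y \<in> K"
    then have "d (x \<otimes> y) = 0"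
      using d_mult[of x y] x by (intro d0) (simp add: K_def)
    then show "x \<otimes> y \<in> K"
      using x y by (simp add: K_def)
  qed (auto simp: K_def)
  have "continuous_map T TA d"
    unfolding d_def using c c'
    by (intro continuous_map_discrete2[where h = "\<lambda>x y. (x - y) mod int p"]) (auto simp: trivializes_def)
  then have "closedin T {g \<in> topspace T. d g \<in> {0}}"
    using p_pos by (intro closedin_continuous_map_preimage) auto
  then have Kc: "closedin T K"
    by (simp add: K_def S.topspace_eq)
  have "S.L (Suc 1) \<subseteq> K"
  proof (rule S.L_Suc_minimal[OF _ K Kc])
    show "h [^] p \<in> K" if "h \<in> S.L 1" for h
      using d_pow[of h p] that unfolding K_def by (auto intro!: d0 simp: cong_def)
    show "gcommutator S g h \<in> K" if "g \<in> carrier S" "h \<in> S.L 1" for g h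
    proof -
      have gh: "g \<in> carrier S" "h \<in> carrier S"
        using that by auto
      let ?k = "gcommutator S g h"
      have "[d (h \<otimes> g \<otimes> ?k) = d h + d g + d ?k] (mod int p)"
        using cong_trans[OF d_mult[of "h \<otimes> g" ?k] cong_add[OF d_mult[of h g] cong_refl]] gh
        by simp
      moreover have "[d (g \<otimes> h) = d g + d h] (mod int p)"
        using gh by (rule d_mult)
      ultimately have "[d g + d h = d h + d g + d ?k] (mod int p)"
        using S.mult_swap_gcommutator[OF gh] by (metis cong_sym cong_trans)
      then have "d ?k = 0"
        by (intro d0) (simp add: cong_iff_dvd_diff algebra_simps)
      then show ?thesis
        using gh by (simp add: K_def)
    qed
  qed simp
  moreover have "Ln \<subseteq> S.L (Suc 1)"
    using n by (intro S.L_antimono) auto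
  ultimately have "d m = 0"
    using m by (auto simp: K_def)
  then have "[b m = b' m] (mod int p)" "[b \<one> = b' \<one>] (mod int p)"
    using d_one by (auto simp: d_def cong_iff_dvd_diff mod_eq_0_iff_dvd)
  then have "[b m - b \<one> = b' m - b' \<one>] (mod int p)"
    by (rule cong_diff)
  then show ?thesis
    by (simp add: residual_def cong_def)
qed

lemma trivializes_add:
  assumes "trivializes c b" "trivializes c' b'"
  shows "trivializes (cochain_add (carrier Q \<times> carrier Q) A c c') (\<lambda>g. (b g + b' g) mod int p)"
  unfolding trivializes_def
proof (intro conjI ballI)
  show "continuous_map T TA (\<lambda>g. (b g + b' g) mod int p)"
    using assms by (intro continuous_map_discrete2[where h = "\<lambda>x y. (x + y) mod int p"])
      (auto simp: trivializes_def)
  fix g h assume gh: "g \<in> carrier S" "h \<in> carrier S"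
  have "[c (\<pi> g, \<pi> h) + c' (\<pi> g, \<pi> h) = (b h - b (g \<otimes> h) + b g) + (b' h - b' (g \<otimes> h) + b' g)] (mod int p)"
    using trivializes_cong[OF assms(1) gh] trivializes_cong[OF assms(2) gh] by (rule cong_add)
  also have "(b h - b (g \<otimes> h) + b g) + (b' h - b' (g \<otimes> h) + b' g) =
      (b h + b' h) - (b (g \<otimes> h) + b' (g \<otimes> h)) + (b g + b' g)"
    by simp
  also have "[\<dots> = (b h + b' h) mod int p - (b (g \<otimes> h) + b' (g \<otimes> h)) mod int p + (b g + b' g) mod int p] (mod int p)"
    by (intro cong_add cong_diff) (auto simp: cong_def)
  finally show "cochain_add (carrier Q \<times> carrier Q) A c c' (\<pi> g, \<pi> h) =
      ((b h + b' h) mod int p - (b (g \<otimes> h) + b' (g \<otimes> h)) mod int p + (b g + b' g) mod int p) mod int p"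
    using gh by (simp add: cochain_add_def cong_def)
qed

lemma residual_add:
  "[residual (\<lambda>g. (b g + b' g) mod int p) m = residual b m + residual b' m] (mod int p)"
proof -
  have "[(b m + b' m) mod int p - (b \<one> + b' \<one>) mod int p = (b m + b' m) - (b \<one> + b' \<one>)] (mod int p)"
    by (intro cong_diff) (auto simp: cong_def)
  also have "(b m + b' m) - (b \<one> + b' \<one>) = (b m - b \<one>) + (b' m - b' \<one>)"
    by simp
  also have "[\<dots> = residual b m + residual b' m] (mod int p)"
    by (intro cong_add) (auto simp: residual_def cong_def)
  finally show ?thesis
    by (simp add: residual_def cong_def)
qed

lemma coboundary_eq:
  assumes "C \<in> carrier Q" "D \<in> carrier Q" and \<beta>: "\<And>C. C \<in> carrier Q \<Longrightarrow> \<beta> C \<in> carrier A"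
  shows "coboundary Q A \<beta> (C, D) = (\<beta> D - \<beta> (C \<otimes>\<^bsub>Q\<^esub> D) + \<beta> C) mod int p"
proof -
  have "inv\<^bsub>A\<^esub> (\<beta> (C \<otimes>\<^bsub>Q\<^esub> D)) = (- \<beta> (C \<otimes>\<^bsub>Q\<^esub> D)) mod int p"
    using assms by (intro inv_integer_mod_group \<beta>) auto
  moreover have "[\<beta> D + (- \<beta> (C \<otimes>\<^bsub>Q\<^esub> D)) mod int p + \<beta> C = \<beta> D + - \<beta> (C \<otimes>\<^bsub>Q\<^esub> D) + \<beta> C] (mod int p)"
    by (intro cong_add) (auto simp: cong_def)
  ultimately show ?thesis
    using assms by (simp add: coboundary_def mod_simps cong_def)
qed

lemma trivializes_coboundary:
  assumes "continuous_map TQ TA \<beta>"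
  shows "trivializes (coboundary Q A \<beta>) (\<lambda>g. \<beta> (\<pi> g))"
  unfolding trivializes_def
proof (intro conjI ballI)
  show "continuous_map T TA (\<lambda>g. \<beta> (\<pi> g))"
    using continuous_map_compose[OF continuous_\<pi> assms] by (simp add: o_def)
  fix g h assume gh: "g \<in> carrier S" "h \<in> carrier S"
  have "\<beta> C \<in> carrier A" if "C \<in> carrier Q" for C
    using that assms by (auto simp: continuous_map_def topspace_TQ)
  then show "coboundary Q A \<beta> (\<pi> g, \<pi> h) = (\<beta> (\<pi> h) - \<beta> (\<pi> (g \<otimes> h)) + \<beta> (\<pi> g)) mod int p"
    using gh by (simp add: coboundary_eq)
qed

text \<open>Injectivity of the inverse transgression: with residual 0 the cochain \<open>b\<close>
  is constant on the cosets of \<open>Ln\<close> and descends to a continuous cochain on the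
  quotient.\<close>

lemma coboundary_if_residual_0:
  assumes c: "trivializes c b" "c \<in> extensional (carrier Q \<times> carrier Q)"
    and 0: "\<And>m. m \<in> Ln \<Longrightarrow> residual b m = 0"
  shows "c \<in> coboundaries2 Q TQ A"
proof -
  have const: "b g = b h" if gh: "g \<in> carrier S" "h \<in> carrier S" "\<pi> g = \<pi> h" for g h
  proof -
    have m: "g \<otimes> inv h \<in> Ln"
      using gh \<pi>_eq_iff by blast
    have "[b (g \<otimes> inv h \<otimes> h) = b h + residual b (g \<otimes> inv h)] (mod int p)"
      by (rule trivializes_mult_Ln(2)[OF c(1) gh(2) m])
    then have "[b g = b h] (mod int p)"
      using 0[OF m] gh by (simp add: S.m_assoc)
    then show ?thesis
      using trivializes_closed[OF c(1)] gh A_cong by blast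
  qed
  define \<beta> where "\<beta> C = b (SOME g. g \<in> carrier S \<and> \<pi> g = C)" for C
  have \<beta>: "\<beta> (\<pi> g) = b g" if "g \<in> carrier S" for g
    unfolding \<beta>_def using someI[of "\<lambda>h. h \<in> carrier S \<and> \<pi> h = \<pi> g" g] that const by blast
  have "continuous_map T TA (\<beta> \<circ> \<pi>)"
    using c(1) by (auto simp: trivializes_def \<beta> S.topspace_eq intro: continuous_map_eq)
  then have cont: "continuous_map TQ TA \<beta>"
    by (rule continuous_compose_quotient_map[OF quotient_map_\<pi>])
  have "c = coboundary Q A \<beta>"
  proof (rule extensionalityI[OF c(2)])
    show "coboundary Q A \<beta> \<in> extensional (carrier Q \<times> carrier Q)"
      by (simp add: coboundary_def)
    fix z assume "z \<in> carrier Q \<times> carrier Q"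
    then obtain g h where z: "z = (\<pi> g, \<pi> h)" "g \<in> carrier S" "h \<in> carrier S"
      by (auto simp: Q_carrier)
    have "c (\<pi> g, \<pi> h) = (b h - b (g \<otimes> h) + b g) mod int p"
      using c(1) z by (simp add: trivializes_def)
    also have "\<dots> = coboundary Q A \<beta> (\<pi> g, \<pi> h)"
      using trivializes_coboundary[OF cont] z \<beta>[of g] \<beta>[of h] \<beta>[of "g \<otimes> h"]
      by (simp add: trivializes_def del: \<pi>.hom_mult)
    finally show "c z = coboundary Q A \<beta> z"
      using z by simp
  qed
  then show ?thesis
    using cont by (auto simp: coboundaries2_def)
qed

lemma cocycle_if_trivializes:
  assumes c: "trivializes c b" "c \<in> carrier Q \<times> carrier Q \<rightarrow>\<^sub>E carrier A"
  shows "c \<in> cocycles2 Q TQ A"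
  unfolding cocycles2_def
proof (intro CollectI conjI ballI c(2))
  have b: "continuous_map (prod_topology T T) TA (\<lambda>z. b (f z))"
    if "continuous_map (prod_topology T T) T f" for f
    using continuous_map_compose[OF that] c(1) by (auto simp: trivializes_def o_def)
  have "continuous_map (prod_topology T T) TA (\<lambda>z. (b (snd z) - b (fst z \<otimes> snd z)) mod int p)"
    by (rule continuous_map_discrete2[where h = "\<lambda>x y. (x - y) mod int p"])
      (auto intro!: b S.continuous_map_mult continuous_map_fst continuous_map_snd)
  then have "continuous_map (prod_topology T T) TA
      (\<lambda>z. ((b (snd z) - b (fst z \<otimes> snd z)) mod int p + b (fst z)) mod int p)"
    by (rule continuous_map_discrete2[where h = "\<lambda>x y. (x + y) mod int p"])
      (auto intro!: b continuous_map_fst)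
  then have "continuous_map (prod_topology T T) TA (\<lambda>z. c (\<pi> (fst z), \<pi> (snd z)))"
    by (rule continuous_map_eq) (use c(1) in \<open>auto simp: trivializes_def S.topspace_eq mod_simps\<close>)
  then show "continuous_map (prod_topology TQ TQ) TA c"
    by (rule continuous_prod_TQ)
  fix C D F assume "C \<in> carrier Q" "D \<in> carrier Q" "F \<in> carrier Q"
  then obtain g h k where gh: "C = \<pi> g" "D = \<pi> h" "F = \<pi> k"
    "g \<in> carrier S" "h \<in> carrier S" "k \<in> carrier S"
    by (auto simp: Q_carrier)
  have "[c (\<pi> h, \<pi> k) + c (\<pi> g, \<pi> (h \<otimes> k)) =
      (b k - b (h \<otimes> k) + b h) + (b (h \<otimes> k) - b (g \<otimes> (h \<otimes> k)) + b g)] (mod int p)"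
    using gh by (intro cong_add trivializes_cong[OF c(1)]) auto
  also have "(b k - b (h \<otimes> k) + b h) + (b (h \<otimes> k) - b (g \<otimes> (h \<otimes> k)) + b g) =
      (b k - b (g \<otimes> h \<otimes> k) + b (g \<otimes> h)) + (b h - b (g \<otimes> h) + b g)"
    using gh by (simp add: S.m_assoc)
  also have "[\<dots> = c (\<pi> (g \<otimes> h), \<pi> k) + c (\<pi> g, \<pi> h)] (mod int p)"
    using gh by (intro cong_sym[OF cong_add] trivializes_cong[OF c(1)]) auto
  finally show "c (D, F) \<otimes>\<^bsub>A\<^esub> c (C, D \<otimes>\<^bsub>Q\<^esub> F) = c (C \<otimes>\<^bsub>Q\<^esub> D, F) \<otimes>\<^bsub>A\<^esub> c (C, D)"
    using gh by (simp add: cong_def)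
qed

end


section \<open>Splitting of cocycles over the free profinite group, and the cohomology group\<close>

context free_quotient
begin

lemma cong_mod_int: "[x mod int p = x] (mod int p)"
  by (simp add: cong_def)

text \<open>The cocycle splits over \<open>S\<close>: the corresponding central extension of \<open>S\<close> is a profinite group,
  to which the basis of \<open>S\<close> lifts.\<close>

lemma trivializes_exists:
  assumes c: "c \<in> cocycles2 Q TQ A"
  shows "\<exists>b. trivializes c b"
proof -
  define cc where "cc s t = c (\<pi> s, \<pi> t)" for s t
  \<comment> \<open>The cocycle need not be normalized. Its values with one argument 1 all equal
    \<open>e\<close>, so the identity of the extension has first coordinate -e.\<close>
  define e where "e = cc \<one> \<one>"
  have c_cont: "continuous_map (prod_topology TQ TQ) TA c"
    and c_ext: "c \<in> carrier Q \<times> carrier Q \<rightarrow>\<^sub>E carrier A"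
    using c by (auto simp: cocycles2_def)
  have cc_A: "cc s t \<in> carrier A" if "s \<in> carrier S" "t \<in> carrier S" for s t
    using c_ext that by (auto simp: cc_def)
  have cc_cong: "[cc h k + cc g (h \<otimes> k) = cc (g \<otimes> h) k + cc g h] (mod int p)"
    if "g \<in> carrier S" "h \<in> carrier S" "k \<in> carrier S" for g h k
  proof -
    have *: "\<forall>g\<in>carrier Q. \<forall>h\<in>carrier Q. \<forall>k\<in>carrier Q.
        c (h, k) \<otimes>\<^bsub>A\<^esub> c (g, h \<otimes>\<^bsub>Q\<^esub> k) = c (g \<otimes>\<^bsub>Q\<^esub> h, k) \<otimes>\<^bsub>A\<^esub> c (g, h)"
      using c unfolding cocycles2_def by (elim CollectE conjE)
    have "c (\<pi> h, \<pi> k) \<otimes>\<^bsub>A\<^esub> c (\<pi> g, \<pi> h \<otimes>\<^bsub>Q\<^esub> \<pi> k) =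
        c (\<pi> g \<otimes>\<^bsub>Q\<^esub> \<pi> h, \<pi> k) \<otimes>\<^bsub>A\<^esub> c (\<pi> g, \<pi> h)"
      by (rule *[rule_format]) (use that in simp_all)
    then show ?thesis
      using that by (simp add: cc_def cong_def)
  qed
  have cc_1: "cc \<one> s = e" "cc s \<one> = e" if s: "s \<in> carrier S" for s
  proof -
    have "[cc \<one> s = e] (mod int p)"
      using cc_cong[of \<one> \<one> s] s
      by (simp only: e_def S.l_one S.one_closed cong_add_lcancel)
    then show "cc \<one> s = e"
      using cc_A s by (intro A_cong) (auto simp: e_def)
    have "[e = cc s \<one>] (mod int p)"
      using cc_cong[of s \<one> \<one>] s
      by (simp only: e_def S.r_one S.one_closed cong_add_rcancel)
    then show "cc s \<one> = e"
      using cc_A s by (intro A_cong[OF _ _ cong_sym]) (auto simp: e_def)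
  qed
  define EG :: "(int \<times> 'a) monoid" where
    "EG = \<lparr>carrier = carrier A \<times> carrier S,
      mult = (\<lambda>x y. ((fst x + fst y + cc (snd x) (snd y)) mod int p, snd x \<otimes> snd y)),
      one = ((- e) mod int p, \<one>)\<rparr>"
  define TE where "TE = prod_topology TA T"
  have EG_simps: "carrier EG = carrier A \<times> carrier S" "\<one>\<^bsub>EG\<^esub> = ((- e) mod int p, \<one>)"
    "\<And>x y. x \<otimes>\<^bsub>EG\<^esub> y = ((fst x + fst y + cc (snd x) (snd y)) mod int p, snd x \<otimes> snd y)"
    by (simp_all add: EG_def)
  have EG_group: "group EG"
  proof (rule groupI)
    show "x \<otimes>\<^bsub>EG\<^esub> y \<in> carrier EG" if "x \<in> carrier EG" "y \<in> carrier EG" for x y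
      using that by (auto simp: EG_simps)
    show "\<one>\<^bsub>EG\<^esub> \<in> carrier EG"
      by (simp add: EG_simps)
    show "x \<otimes>\<^bsub>EG\<^esub> y \<otimes>\<^bsub>EG\<^esub> z = x \<otimes>\<^bsub>EG\<^esub> (y \<otimes>\<^bsub>EG\<^esub> z)"
      if "x \<in> carrier EG" "y \<in> carrier EG" "z \<in> carrier EG" for x y z
    proof -
      obtain a s b t d u where xyz: "x = (a, s)" "y = (b, t)" "z = (d, u)"
        "s \<in> carrier S" "t \<in> carrier S" "u \<in> carrier S"
        using \<open>x \<in> carrier EG\<close> \<open>y \<in> carrier EG\<close> \<open>z \<in> carrier EG\<close> by (auto simp: EG_simps)
      have "[(a + b + cc s t) mod int p + d + cc (s \<otimes> t) u = (a + b + cc s t) + d + cc (s \<otimes> t) u] (mod int p)"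
        by (intro cong_add cong_mod_int cong_refl)
      also have "(a + b + cc s t) + d + cc (s \<otimes> t) u = a + b + d + (cc (s \<otimes> t) u + cc s t)"
        by simp
      also have "[\<dots> = a + b + d + (cc t u + cc s (t \<otimes> u))] (mod int p)"
        using xyz by (intro cong_add cong_sym[OF cc_cong] cong_refl)
      also have "a + b + d + (cc t u + cc s (t \<otimes> u)) = a + (b + d + cc t u) + cc s (t \<otimes> u)"
        by simp
      also have "[\<dots> = a + (b + d + cc t u) mod int p + cc s (t \<otimes> u)] (mod int p)"
        by (intro cong_add cong_sym[OF cong_mod_int] cong_refl)
      finally show ?thesis
        using xyz by (simp add: EG_simps S.m_assoc cong_def)
    qed
    fix x assume "x \<in> carrier EG"
    then obtain a s where x: "x = (a, s)" "a \<in> carrier A" "s \<in> carrier S"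
      by (auto simp: EG_simps)
    have "[(- e) mod int p + a + e = - e + a + e] (mod int p)"
      by (intro cong_add cong_mod_int cong_refl)
    then show "\<one>\<^bsub>EG\<^esub> \<otimes>\<^bsub>EG\<^esub> x = x"
      using x A_mod[of a] by (simp add: EG_simps cc_1 cong_def)
    let ?d = "- e - a - cc (inv s) s"
    have "[?d mod int p + a + cc (inv s) s = ?d + a + cc (inv s) s] (mod int p)"
      by (intro cong_add cong_mod_int cong_refl)
    then have "(?d mod int p, inv s) \<otimes>\<^bsub>EG\<^esub> x = \<one>\<^bsub>EG\<^esub>"
      using x by (simp add: EG_simps cong_def)
    then show "\<exists>y\<in>carrier EG. y \<otimes>\<^bsub>EG\<^esub> x = \<one>\<^bsub>EG\<^esub>"
      using x by (intro bexI[of _ "(?d mod int p, inv s)"]) (auto simp: EG_simps)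
  qed
  interpret EG: group EG by (rule EG_group)
  have topE: "topspace TE = carrier EG"
    by (simp add: TE_def EG_simps S.topspace_eq)
  have compE: "compact_space TE" and HausE: "Hausdorff_space TE"
    by (auto simp: TE_def compact_space_prod_topology Hausdorff_space_prod_topology S.compact S.Hausdorff
        compact_space_discrete_topology Hausdorff_space_discrete_topology A_carrier)
  have cf: "continuous_map TE TA fst" "continuous_map TE T snd"
    by (simp_all add: TE_def continuous_map_fst continuous_map_snd)
  have multE: "continuous_map (prod_topology TE TE) TE (\<lambda>(x, y). x \<otimes>\<^bsub>EG\<^esub> y)"
  proof -
    let ?Z = "prod_topology TE TE"
    have f: "continuous_map ?Z TA (\<lambda>z. fst (fst z))" "continuous_map ?Z TA (\<lambda>z. fst (snd z))"
      "continuous_map ?Z T (\<lambda>z. snd (fst z))" "continuous_map ?Z T (\<lambda>z. snd (snd z))"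
      using continuous_map_compose[OF continuous_map_fst cf(1)] continuous_map_compose[OF continuous_map_snd cf(1)]
        continuous_map_compose[OF continuous_map_fst cf(2)] continuous_map_compose[OF continuous_map_snd cf(2)]
      by (simp_all add: o_def)
    have "continuous_map ?Z (prod_topology TQ TQ) (\<lambda>z. (\<pi> (snd (fst z)), \<pi> (snd (snd z))))"
      using continuous_map_compose[OF f(3) continuous_\<pi>] continuous_map_compose[OF f(4) continuous_\<pi>]
      by (intro continuous_map_pairedI) (simp_all add: o_def)
    from continuous_map_compose[OF this c_cont]
    have ccc: "continuous_map ?Z TA (\<lambda>z. cc (snd (fst z)) (snd (snd z)))"
      by (simp add: o_def cc_def)
    have "continuous_map ?Z TA (\<lambda>z. (fst (fst z) + fst (snd z)) mod int p)"
      by (rule continuous_map_discrete2[OF f(1,2), where h = "\<lambda>x y. (x + y) mod int p"]) simp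
    from continuous_map_discrete2[OF this ccc, where h = "\<lambda>x y. (x + y) mod int p" and C = "carrier A"]
    have "continuous_map ?Z TA (\<lambda>z. (fst (fst z) + fst (snd z) + cc (snd (fst z)) (snd (snd z))) mod int p)"
      by (simp add: mod_simps)
    then have "continuous_map ?Z TE (\<lambda>z. ((fst (fst z) + fst (snd z) + cc (snd (fst z)) (snd (snd z))) mod int p,
        snd (fst z) \<otimes> snd (snd z)))"
      unfolding TE_def using S.continuous_map_mult[OF f(3,4), unfolded TE_def]
      by (intro continuous_map_pairedI)
    then show ?thesis
      unfolding case_prod_unfold EG_simps .
  qed
  have cont_lift: "continuous_map T TE (\<lambda>s. ((- e) mod int p, s))"
    unfolding TE_def by (intro continuous_map_pairedI) (auto simp: S.topspace_eq)
  have profE: "profinite_group EG TE"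
  proof unfold_locales
    show "continuous_map TE TE (\<lambda>x. inv\<^bsub>EG\<^esub> x)"
      by (rule continuous_inverse_if_compact[OF EG_group topE multE compE HausE])
    fix W assume W: "openin TE W" "\<one>\<^bsub>EG\<^esub> \<in> W"
    have "openin T {s \<in> topspace T. ((- e) mod int p, s) \<in> W}"
      by (rule openin_continuous_map_preimage[OF cont_lift W(1)])
    moreover have cont_cc: "continuous_map (prod_topology T T) TA (\<lambda>z. cc (fst z) (snd z))"
    proof -
      have "continuous_map (prod_topology T T) (prod_topology TQ TQ) (\<lambda>z. (\<pi> (fst z), \<pi> (snd z)))"
        using continuous_map_compose[OF continuous_map_fst continuous_\<pi>]
          continuous_map_compose[OF continuous_map_snd continuous_\<pi>]
        by (intro continuous_map_pairedI) (simp_all add: o_def)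
      from continuous_map_compose[OF this c_cont] show ?thesis
        by (simp add: o_def cc_def)
    qed
    \<comment> \<open>The cocycle is locally constant, hence equal to \<open>e\<close> near (1, 1).
      On a small open subgroup \<open>H\<close> the elements with first coordinate -e are then
      closed under multiplication, as -e - e + e = -e, which gives small open subgroups of the
      extension.\<close>
    have "(\<one>, \<one>) \<in> {z \<in> topspace (prod_topology T T). cc (fst z) (snd z) = e}"
      by (simp add: S.topspace_eq e_def)
    from continuous_map_discreteD[OF cont_cc, unfolded openin_prod_topology_alt, rule_format, OF this]
    obtain V V' where V: "openin T V" "openin T V'" "\<one> \<in> V" "\<one> \<in> V'"
      "V \<times> V' \<subseteq> {z \<in> topspace (prod_topology T T). cc (fst z) (snd z) = e}"
      by auto
    ultimately have "openin T ({s \<in> topspace T. ((- e) mod int p, s) \<in> W} \<inter> (V \<inter> V'))"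
      by (intro openin_Int)
    moreover have "\<one> \<in> {s \<in> topspace T. ((- e) mod int p, s) \<in> W} \<inter> (V \<inter> V')"
      using W(2) V by (simp add: EG_simps S.topspace_eq)
    ultimately obtain H where H: "subgroup H S" "openin T H"
      "H \<subseteq> {s \<in> topspace T. ((- e) mod int p, s) \<in> W} \<inter> (V \<inter> V')"
      using S.open_subgroup_base by metis
    have HS: "H \<subseteq> carrier S"
      using H(1) by (rule subgroup.subset)
    have cc_H: "cc s t = e" if "s \<in> H" "t \<in> H" for s t
      using that H(3) V(5) by fastforce
    let ?H = "{(- e) mod int p} \<times> H"
    have prod: "((- e) mod int p, s) \<otimes>\<^bsub>EG\<^esub> ((- e) mod int p, t) = ((- e) mod int p, s \<otimes> t)"
      if "s \<in> H" "t \<in> H" for s t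
    proof -
      have "[(- e) mod int p + (- e) mod int p + e = - e + - e + e] (mod int p)"
        by (intro cong_add cong_mod_int cong_refl)
      then show ?thesis
        using cc_H[OF that] by (simp add: EG_simps cong_def)
    qed
    have "subgroup ?H EG"
    proof (rule EG.subgroupI)
      show "?H \<subseteq> carrier EG"
        using HS by (auto simp: EG_simps)
      show "?H \<noteq> {}"
        using subgroup.one_closed[OF H(1)] by auto
      fix x assume "x \<in> ?H"
      then obtain s where s: "x = ((- e) mod int p, s)" "s \<in> H"
        by auto
      have si: "inv s \<in> H"
        using s(2) by (rule subgroup.m_inv_closed[OF H(1)])
      have "((- e) mod int p, inv s) \<otimes>\<^bsub>EG\<^esub> x = \<one>\<^bsub>EG\<^esub>"
        using prod[OF si s(2)] s HS by (auto simp: EG_simps)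
      then have "inv\<^bsub>EG\<^esub> x = ((- e) mod int p, inv s)"
        using s si HS by (intro EG.inv_equality) (auto simp: EG_simps)
      then show "inv\<^bsub>EG\<^esub> x \<in> ?H"
        using si by simp
      fix y assume "y \<in> ?H"
      then show "x \<otimes>\<^bsub>EG\<^esub> y \<in> ?H"
        using s prod subgroup.m_closed[OF H(1)] by auto
    qed
    moreover have "openin TE ?H"
      unfolding TE_def using H(2) by (auto simp: openin_prod_Times_iff)
    moreover have "?H \<subseteq> W"
      using H(3) by auto
    ultimately show "\<exists>H. subgroup H EG \<and> openin TE H \<and> H \<subseteq> W"
      by blast
  qed (use topE multE compE HausE in auto)
  \<comment> \<open>The first coordinate is that of the identity, so the lifted basis still
    converges to 1.\<close>
  let ?f = "\<lambda>x. ((- e) mod int p, x)"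
  have XS: "X \<subseteq> carrier S" and gen: "closed_subgroup_generated S T X = carrier S"
    and conv: "converges_to_one X S T (\<lambda>x. x)"
    using free by (auto simp: free_profinite_def)
  have "converges_to_one X EG TE ?f"
    unfolding converges_to_one_def
  proof (intro allI impI, elim conjE)
    fix N assume N: "N \<lhd> EG" "openin TE N"
    have "openin T {s \<in> topspace T. ?f s \<in> N}"
      by (rule openin_continuous_map_preimage[OF cont_lift N(2)])
    moreover have "\<one> \<in> {s \<in> topspace T. ?f s \<in> N}"
      using N(1) subgroup.one_closed[of N EG] by (simp add: normal_def S.topspace_eq EG_simps)
    ultimately obtain M where M: "M \<lhd> S" "openin T M" "M \<subseteq> {s \<in> topspace T. ?f s \<in> N}"
      using S.open_normal_subgroup_base by metis
    have "finite {x \<in> X. x \<notin> M}"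
      using conv M by (simp add: converges_to_one_def)
    then show "finite {x \<in> X. ?f x \<notin> N}"
      using M(3) by (auto elim!: rev_finite_subset)
  qed
  moreover have "?f \<in> X \<rightarrow> carrier EG"
    using XS by (auto simp: EG_simps)
  ultimately obtain \<Phi> where \<Phi>: "is_continuous_extension S T X EG TE ?f \<Phi>"
    using free_profinite_universal[OF free profE] by blast
  have \<Phi>_hom: "\<Phi> \<in> hom S EG" and \<Phi>_cont: "continuous_map T TE \<Phi>"
    and \<Phi>_X: "\<And>x. x \<in> X \<Longrightarrow> \<Phi> x = ?f x"
    using \<Phi> by (auto simp: is_continuous_extension_def)
  have \<Phi>_closed: "\<Phi> s \<in> carrier EG" if "s \<in> carrier S" for s
    using \<Phi>_hom that by (rule hom_in_carrier)
  \<comment> \<open>Both sides are continuous endomorphisms of \<open>S\<close> that fix the basis,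
    so \<Phi> is a homomorphic section of the extension.\<close>
  have "(\<lambda>s\<in>carrier S. snd (\<Phi> s)) = (\<lambda>s\<in>carrier S. s)"
  proof (rule continuous_extension_unique[OF S.profinite_group_axioms XS gen S.profinite_group_axioms])
    show "is_continuous_extension S T X S T (\<lambda>x. x) (\<lambda>s\<in>carrier S. snd (\<Phi> s))"
      unfolding is_continuous_extension_def
    proof (intro conjI ballI)
      show "(\<lambda>s\<in>carrier S. snd (\<Phi> s)) \<in> hom S S"
        using \<Phi>_closed hom_mult[OF \<Phi>_hom] by (intro homI) (auto simp: EG_simps mem_Times_iff)
      have "continuous_map T T (snd \<circ> \<Phi>)"
        using \<Phi>_cont cf(2) by (rule continuous_map_compose)
      then show "continuous_map T T (\<lambda>s\<in>carrier S. snd (\<Phi> s))"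
        by (rule continuous_map_eq) (simp add: S.topspace_eq)
    qed (use XS \<Phi>_X in auto)
    have "continuous_map T T (\<lambda>s\<in>carrier S. s)"
      by (rule continuous_map_eq[of T T "\<lambda>s. s"]) (auto simp: S.topspace_eq)
    then show "is_continuous_extension S T X S T (\<lambda>x. x) (\<lambda>s\<in>carrier S. s)"
      using XS by (auto simp: is_continuous_extension_def intro!: homI)
  qed
  then have snd_\<Phi>: "snd (\<Phi> s) = s" if "s \<in> carrier S" for s
    using that by (metis restrict_apply')
  \<comment> \<open>In the extension the cocycle is the defect of additivity of the first
    coordinate; the sign turns it into the coboundary in the convention used here.\<close>
  define b where "b s = (- fst (\<Phi> s)) mod int p" for s
  have "trivializes c b"
    unfolding trivializes_def
  proof (intro conjI ballI)
    have "continuous_map T TA (fst \<circ> \<Phi>)"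
      using \<Phi>_cont cf(1) by (rule continuous_map_compose)
    then have "continuous_map T TA (\<lambda>s. fst (\<Phi> s))"
      by (simp add: o_def)
    then show "continuous_map T TA b"
      unfolding b_def by (rule continuous_map_discrete1) simp
    fix g h assume gh: "g \<in> carrier S" "h \<in> carrier S"
    have "fst (\<Phi> (g \<otimes> h)) = (fst (\<Phi> g) + fst (\<Phi> h) + cc g h) mod int p"
      using hom_mult[OF \<Phi>_hom gh] gh by (simp add: EG_simps snd_\<Phi>)
    then have 1: "[fst (\<Phi> (g \<otimes> h)) = fst (\<Phi> g) + fst (\<Phi> h) + cc g h] (mod int p)"
      by (simp add: cong_def)
    have "[b h - b (g \<otimes> h) + b g = - fst (\<Phi> h) - (- fst (\<Phi> (g \<otimes> h))) + - fst (\<Phi> g)] (mod int p)"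
      unfolding b_def by (intro cong_add cong_diff cong_mod_int)
    also have "[- fst (\<Phi> h) - (- fst (\<Phi> (g \<otimes> h))) + - fst (\<Phi> g) =
        - fst (\<Phi> h) - (- (fst (\<Phi> g) + fst (\<Phi> h) + cc g h)) + - fst (\<Phi> g)] (mod int p)"
      using 1 by (intro cong_add cong_diff cong_refl) (simp only: cong_minus_minus_iff)
    also have "- fst (\<Phi> h) - (- (fst (\<Phi> g) + fst (\<Phi> h) + cc g h)) + - fst (\<Phi> g) = cc g h"
      by simp
    finally show "c (\<pi> g, \<pi> h) = (b h - b (g \<otimes> h) + b g) mod int p"
      using A_mod[OF cc_A[OF gh]] by (simp add: cc_def cong_def)
  qed
  then show ?thesis by blast
qed

section \<open>Cohomology classes and the inverse transgression on classes\<close>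

abbreviation CG :: "('a set \<times> 'a set \<Rightarrow> int) monoid" where "CG \<equiv> cocycle_group Q TQ A"

abbreviation B2 :: "('a set \<times> 'a set \<Rightarrow> int) set" where "B2 \<equiv> coboundaries2 Q TQ A"

lemma CG_simps: "carrier CG = cocycles2 Q TQ A"
  "c \<otimes>\<^bsub>CG\<^esub> c' = cochain_add (carrier Q \<times> carrier Q) A c c'"
  "\<one>\<^bsub>CG\<^esub> = (\<lambda>z\<in>carrier Q \<times> carrier Q. 0)"
  by (simp_all add: cocycle_group_def)

lemma cocycle_PiE: "c \<in> cocycles2 Q TQ A \<Longrightarrow> c \<in> carrier Q \<times> carrier Q \<rightarrow>\<^sub>E carrier A"
  by (simp add: cocycles2_def)

lemma trivializes_minus:
  assumes "trivializes c b"
  shows "trivializes (\<lambda>z\<in>carrier Q \<times> carrier Q. (- c z) mod int p) (\<lambda>g. (- b g) mod int p)"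
  unfolding trivializes_def
proof (intro conjI ballI)
  show "continuous_map T TA (\<lambda>g. (- b g) mod int p)"
    using assms by (intro continuous_map_discrete1[where h = "\<lambda>x. (- x) mod int p"]) (auto simp: trivializes_def)
  fix g h assume gh: "g \<in> carrier S" "h \<in> carrier S"
  have "[(- b h) mod int p - (- b (g \<otimes> h)) mod int p + (- b g) mod int p =
      - b h - (- b (g \<otimes> h)) + (- b g)] (mod int p)"
    by (intro cong_add cong_diff cong_mod_int)
  also have "- b h - (- b (g \<otimes> h)) + (- b g) = - (b h - b (g \<otimes> h) + b g)"
    by simp
  also have "[\<dots> = - c (\<pi> g, \<pi> h)] (mod int p)"
    using trivializes_cong[OF assms gh] by (simp only: cong_minus_minus_iff cong_sym_eq)
  finally show "(\<lambda>z\<in>carrier Q \<times> carrier Q. (- c z) mod int p) (\<pi> g, \<pi> h) =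
      ((- b h) mod int p - (- b (g \<otimes> h)) mod int p + (- b g) mod int p) mod int p"
    using gh by (simp add: cong_def)
qed

lemma trivializes_zero: "trivializes (\<lambda>z\<in>carrier Q \<times> carrier Q. 0) (\<lambda>g. 0)"
  using p_pos by (simp add: trivializes_def A_carrier)

text \<open>Every cocycle is trivialized over \<open>S\<close>, so closure under sums and negatives
  follows by adding and negating the trivializing cochains.\<close>

lemma CG_comm_group: "comm_group CG"
proof (rule comm_groupI)
  show "c \<otimes>\<^bsub>CG\<^esub> c' \<in> carrier CG" if cc: "c \<in> carrier CG" "c' \<in> carrier CG" for c c'
  proof -
    obtain b b' where b: "trivializes c b" "trivializes c' b'"
      using trivializes_exists cc unfolding CG_simps by blast
    show ?thesis
      unfolding CG_simps by (rule cocycle_if_trivializes[OF trivializes_add[OF b]]) (auto simp: cochain_add_def)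
  qed
  show "\<one>\<^bsub>CG\<^esub> \<in> carrier CG"
    unfolding CG_simps by (rule cocycle_if_trivializes[OF trivializes_zero]) (use p_pos in auto)
  fix c c' c'' assume c: "c \<in> carrier CG" "c' \<in> carrier CG" "c'' \<in> carrier CG"
  show "c \<otimes>\<^bsub>CG\<^esub> c' \<otimes>\<^bsub>CG\<^esub> c'' = c \<otimes>\<^bsub>CG\<^esub> (c' \<otimes>\<^bsub>CG\<^esub> c'')"
    by (auto simp: CG_simps cochain_add_def fun_eq_iff mod_simps add.assoc)
  show "c \<otimes>\<^bsub>CG\<^esub> c' = c' \<otimes>\<^bsub>CG\<^esub> c"
    by (auto simp: CG_simps cochain_add_def fun_eq_iff add.commute)
next
  fix c assume c: "c \<in> carrier CG"
  have cA: "c z \<in> carrier A" if "z \<in> carrier Q \<times> carrier Q" for z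
    using cocycle_PiE c that unfolding CG_simps by blast
  show "\<one>\<^bsub>CG\<^esub> \<otimes>\<^bsub>CG\<^esub> c = c"
  proof (rule extensionalityI[of _ "carrier Q \<times> carrier Q"])
    show "c \<in> extensional (carrier Q \<times> carrier Q)"
      using cocycle_PiE c unfolding CG_simps by (auto simp: PiE_def)
  qed (use cA A_mod in \<open>auto simp: CG_simps cochain_add_def\<close>)
  obtain b where b: "trivializes c b"
    using trivializes_exists c unfolding CG_simps by blast
  let ?d = "\<lambda>z\<in>carrier Q \<times> carrier Q. (- c z) mod int p"
  have "?d \<in> carrier CG"
    unfolding CG_simps by (rule cocycle_if_trivializes[OF trivializes_minus[OF b]]) auto
  moreover have "?d \<otimes>\<^bsub>CG\<^esub> c = \<one>\<^bsub>CG\<^esub>"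
    by (auto simp: CG_simps cochain_add_def fun_eq_iff mod_simps)
  ultimately show "\<exists>d\<in>carrier CG. d \<otimes>\<^bsub>CG\<^esub> c = \<one>\<^bsub>CG\<^esub>"
    by blast
qed

sublocale CG: comm_group CG
  by (rule CG_comm_group)

lemma B2_cocycle: "B2 \<subseteq> carrier CG"
proof
  fix c assume "c \<in> B2"
  then obtain \<beta> where \<beta>: "c = coboundary Q A \<beta>" "continuous_map TQ TA \<beta>"
    by (auto simp: coboundaries2_def)
  have "\<beta> C \<in> carrier A" if "C \<in> carrier Q" for C
    using that \<beta>(2) by (auto simp: continuous_map_def topspace_TQ)
  then have "c \<in> carrier Q \<times> carrier Q \<rightarrow>\<^sub>E carrier A"
    unfolding \<beta>(1) by (intro PiE_I) (auto simp: coboundary_eq coboundary_def[of Q A \<beta>])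
  then show "c \<in> carrier CG"
    unfolding CG_simps using cocycle_if_trivializes trivializes_coboundary[OF \<beta>(2)] \<beta>(1) by blast
qed

text \<open>The kernel of the inverse transgression consists of the coboundaries; this makes
  \<open>resid\<close> below both well defined and injective on classes.\<close>

lemma B2_iff:
  assumes "c \<in> carrier CG" "trivializes c b"
  shows "c \<in> B2 \<longleftrightarrow> (\<forall>m\<in>Ln. residual b m = 0)"
proof
  assume "c \<in> B2"
  then obtain \<beta> where \<beta>: "c = coboundary Q A \<beta>" "continuous_map TQ TA \<beta>"
    by (auto simp: coboundaries2_def)
  then have "trivializes c (\<lambda>g. \<beta> (\<pi> g))"
    using trivializes_coboundary by blast
  then show "\<forall>m\<in>Ln. residual b m = 0"
    using residual_unique[OF assms(2)] \<pi>_Ln by (simp add: residual_def)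
next
  assume "\<forall>m\<in>Ln. residual b m = 0"
  then show "c \<in> B2"
    using coboundary_if_residual_0[OF assms(2)] cocycle_PiE[of c] assms(1)
    by (auto simp: CG_simps PiE_def)
qed

lemma B2_subgroup: "subgroup B2 CG"
proof (rule CG.subgroupI[OF B2_cocycle])
  have one: "\<one>\<^bsub>CG\<^esub> \<in> B2"
    using B2_iff[of "\<one>\<^bsub>CG\<^esub>" "\<lambda>_. 0"] trivializes_zero by (simp add: CG_simps(3) residual_def)
      (metis CG.one_closed CG_simps(3))
  then show "B2 \<noteq> {}"
    by blast
  have mult: "c \<otimes>\<^bsub>CG\<^esub> c' \<in> B2 \<longleftrightarrow> c' \<in> B2" if c: "c \<in> B2" "c' \<in> carrier CG" for c c'
  proof -
    have cC: "c \<in> carrier CG"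
      using c B2_cocycle by blast
    then obtain b b' where b: "trivializes c b" "trivializes c' b'"
      using trivializes_exists c unfolding CG_simps by blast
    have "residual (\<lambda>g. (b g + b' g) mod int p) m = residual b' m" if "m \<in> Ln" for m
      using residual_add[of b b' m] B2_iff[OF cC b(1)] c(1) that by (simp add: residual_def cong_def)
    then show ?thesis
      using B2_iff[OF c(2) b(2)] B2_iff[OF CG.m_closed[OF cC c(2)], unfolded CG_simps(2), OF trivializes_add[OF b]]
      by (simp add: CG_simps(2))
  qed
  fix c assume c: "c \<in> B2"
  then have cC: "c \<in> carrier CG"
    using B2_cocycle by blast
  show "inv\<^bsub>CG\<^esub> c \<in> B2"
    using mult[OF c, of "inv\<^bsub>CG\<^esub> c"] cC one by simp
  show "c \<otimes>\<^bsub>CG\<^esub> c' \<in> B2" if "c' \<in> B2" for c'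
    using mult[OF c, of c'] that B2_cocycle by blast
qed

abbreviation H :: "('a set \<times> 'a set \<Rightarrow> int) set monoid" where "H \<equiv> H2 Q TQ A"

abbreviation cls :: "('a set \<times> 'a set \<Rightarrow> int) \<Rightarrow> ('a set \<times> 'a set \<Rightarrow> int) set" where
  "cls \<equiv> H2_class Q TQ A"

sublocale B2: normal B2 CG
  using CG.subgroup_imp_normal[OF B2_subgroup] .

sublocale H: comm_group H
  unfolding H2_def using CG.abelian_FactGroup[OF B2_subgroup] .

lemma cls_eq: "cls c = B2 #>\<^bsub>CG\<^esub> c"
  by (simp add: H2_class_def)

lemma H_carrier: "carrier H = cls ` carrier CG"
  by (auto simp: H2_def carrier_FactGroup cls_eq)

lemma cls_mult: "c \<in> carrier CG \<Longrightarrow> c' \<in> carrier CG \<Longrightarrow> cls c \<otimes>\<^bsub>H\<^esub> cls c' = cls (c \<otimes>\<^bsub>CG\<^esub> c')"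
  by (simp add: H2_def cls_eq B2.rcos_sum)

lemma H_one: "\<one>\<^bsub>H\<^esub> = B2"
  by (simp add: H2_def)

lemma H_exponent:
  assumes "C \<in> carrier H"
  shows "C [^]\<^bsub>H\<^esub> p = \<one>\<^bsub>H\<^esub>"
proof -
  obtain c where c: "c \<in> carrier CG" "C = cls c"
    using assms H_carrier by auto
  have pow: "(c [^]\<^bsub>CG\<^esub> q) z = (int q * c z) mod int p" if "z \<in> carrier Q \<times> carrier Q" for q :: nat and z
  proof (induction q)
    case 0
    then show ?case
      using that by (simp add: CG_simps)
  next
    case (Suc q)
    then show ?case
      using that by (simp add: CG_simps cochain_add_def algebra_simps mod_simps)
  qed
  have "c [^]\<^bsub>CG\<^esub> p = \<one>\<^bsub>CG\<^esub>"
  proof (rule extensionalityI[of _ "carrier Q \<times> carrier Q"])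
    have "c [^]\<^bsub>CG\<^esub> p \<in> cocycles2 Q TQ A"
      using CG.nat_pow_closed[OF c(1)] by (simp add: CG_simps)
    then show "c [^]\<^bsub>CG\<^esub> p \<in> extensional (carrier Q \<times> carrier Q)"
      using cocycle_PiE by (auto simp: PiE_def)
  qed (auto simp: pow CG_simps)
  then show ?thesis
    using c B2.FactGroup_pow[of c p] by (simp add: H2_def cls_eq CG.coset_mult_one B2_cocycle)
qed

text \<open>On \<open>Ln\<close> the value depends neither on the chosen cocycle nor on the chosen
  trivialization, by \<open>resid_cls\<close>.\<close>

definition resid :: "('a set \<times> 'a set \<Rightarrow> int) set \<Rightarrow> 'a \<Rightarrow> int" where
  "resid C m = residual (SOME b. trivializes (SOME c. c \<in> C) b) m"

lemma resid_cls:
  assumes c: "c \<in> carrier CG" "trivializes c b" and m: "m \<in> Ln"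
  shows "resid (cls c) m = residual b m"
proof -
  define c' where "c' = (SOME c'. c' \<in> cls c)"
  have "c \<in> cls c"
    unfolding cls_eq using CG.rcos_self[OF c(1) B2_subgroup] .
  then have "c' \<in> cls c"
    unfolding c'_def by (rule someI[of "\<lambda>c'. c' \<in> cls c"])
  then obtain d where d: "d \<in> B2" "c' = d \<otimes>\<^bsub>CG\<^esub> c"
    by (auto simp: cls_eq r_coset_def)
  have dC: "d \<in> carrier CG"
    using d(1) B2_cocycle by blast
  obtain b' where b': "trivializes d b'"
    using trivializes_exists dC unfolding CG_simps by blast
  have t: "trivializes c' (\<lambda>g. (b' g + b g) mod int p)"
    using trivializes_add[OF b' c(2)] d(2) by (simp add: CG_simps)
  have "residual (\<lambda>g. (b' g + b g) mod int p) m = residual b m"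
    using residual_add[of b' b m] B2_iff[OF dC b'] d(1) m by (simp add: residual_def cong_def)
  moreover have "resid (cls c) m = residual (\<lambda>g. (b' g + b g) mod int p) m"
    unfolding resid_def c'_def[symmetric] by (rule residual_unique[OF someI[of "trivializes c'", OF t] t m])
  ultimately show ?thesis
    by simp
qed

lemma H_cases:
  assumes "C \<in> carrier H"
  obtains c b where "c \<in> carrier CG" "trivializes c b" "C = cls c"
  using assms trivializes_exists unfolding H_carrier CG_simps by blast

lemma resid_mult:
  assumes "C \<in> carrier H" "D \<in> carrier H" "m \<in> Ln"
  shows "[resid (C \<otimes>\<^bsub>H\<^esub> D) m = resid C m + resid D m] (mod int p)"
proof -
  obtain c b where c: "c \<in> carrier CG" "trivializes c b" "C = cls c"
    using assms(1) by (rule H_cases)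
  obtain d b' where d: "d \<in> carrier CG" "trivializes d b'" "D = cls d"
    using assms(2) by (rule H_cases)
  have "trivializes (c \<otimes>\<^bsub>CG\<^esub> d) (\<lambda>g. (b g + b' g) mod int p)"
    unfolding CG_simps by (rule trivializes_add[OF c(2) d(2)])
  then have "resid (cls (c \<otimes>\<^bsub>CG\<^esub> d)) m = residual (\<lambda>g. (b g + b' g) mod int p) m"
    using c d assms(3) by (intro resid_cls) auto
  then show ?thesis
    using residual_add[of b b' m] c d assms(3) by (simp add: cls_mult resid_cls)
qed

lemma resid_eq_0:
  assumes C: "C \<in> carrier H" and 0: "\<And>m. m \<in> Ln \<Longrightarrow> resid C m = 0"
  shows "C = \<one>\<^bsub>H\<^esub>"
proof -
  obtain c b where c: "c \<in> carrier CG" "trivializes c b" "C = cls c"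
    using C by (rule H_cases)
  then have "c \<in> B2"
    using B2_iff[OF c(1,2)] 0 resid_cls[OF c(1,2)] by simp
  then show ?thesis
    using c B2.rcos_eq_self_iff by (simp add: H_one cls_eq)
qed

end


section \<open>The cohomology classes of words\<close>

context word_matrices
begin

abbreviation TM :: "(nat \<times> nat \<Rightarrow> int) topology" where "TM \<equiv> discrete_topology (carrier U)"

abbreviation UQ :: "(nat \<times> nat \<Rightarrow> int) set monoid" where "UQ \<equiv> p_quotient U TM p n"

abbreviation \<pi>U :: "(nat \<times> nat \<Rightarrow> int) \<Rightarrow> (nat \<times> nat \<Rightarrow> int) set" where
  "\<pi>U \<equiv> p_quotient_map U TM p n"

abbreviation TUQ :: "(nat \<times> nat \<Rightarrow> int) set topology" where "TUQ \<equiv> p_quotient_topology U TM p n"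

sublocale UL: normal "U.L n" U
  by (rule U.L_normal)

lemma UQ_eq: "UQ = U Mod U.L n" and \<pi>U_eq: "\<pi>U M = U.L n #>\<^bsub>U\<^esub> M"
  by (simp_all add: p_quotient_def p_quotient_map_def)

sublocale \<pi>U: group_hom U UQ \<pi>U
proof -
  have "\<pi>U = (\<lambda>M. U.L n #>\<^bsub>U\<^esub> M)"
    by (simp add: fun_eq_iff \<pi>U_eq)
  then have "\<pi>U \<in> hom U UQ"
    unfolding UQ_eq using UL.r_coset_hom_Mod by simp
  moreover have "group UQ"
    unfolding UQ_eq by (rule UL.factorgroup_is_group)
  ultimately show "group_hom U UQ \<pi>U"
    using U_group by (simp add: group_hom_def group_hom_axioms_def)
qed

lemma UQ_carrier: "carrier UQ = \<pi>U ` carrier U"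
  by (auto simp: UQ_eq \<pi>U_eq carrier_FactGroup)

lemma TUQ_eq: "TUQ = discrete_topology (carrier UQ)"
  unfolding topology_eq
  by (auto simp: p_quotient_topology_def openin_quotient_topology UQ_carrier)

text \<open>Literally the section chosen in \<open>extension_class\<close>, so that the class of the
  extension unfolds to the class of its factor set.\<close>

definition sec :: "(nat \<times> nat \<Rightarrow> int) set \<Rightarrow> nat \<times> nat \<Rightarrow> int" where
  "sec = (SOME \<sigma>. continuous_map TUQ TM \<sigma> \<and> (\<forall>C\<in>carrier UQ. \<pi>U (\<sigma> C) = C))"

lemma sec:
  assumes "C \<in> carrier UQ"
  shows "sec C \<in> carrier U" "\<pi>U (sec C) = C"
proof -
  have "\<forall>C\<in>carrier UQ. \<exists>M. M \<in> carrier U \<and> \<pi>U M = C"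
    by (auto simp: UQ_carrier)
  then obtain f where f: "\<And>C. C \<in> carrier UQ \<Longrightarrow> f C \<in> carrier U \<and> \<pi>U (f C) = C"
    by metis
  then have "continuous_map TUQ TM f \<and> (\<forall>C\<in>carrier UQ. \<pi>U (f C) = C)"
    by (auto simp: TUQ_eq)
  then have "\<exists>\<sigma>. continuous_map TUQ TM \<sigma> \<and> (\<forall>C\<in>carrier UQ. \<pi>U (\<sigma> C) = C)"
    by blast
  then have "continuous_map TUQ TM sec \<and> (\<forall>C\<in>carrier UQ. \<pi>U (sec C) = C)"
    unfolding sec_def by (rule someI_ex)
  then show "sec C \<in> carrier U" "\<pi>U (sec C) = C"
    using assms by (auto simp: TUQ_eq continuous_map_def)
qed

lemma same_coset:
  assumes "M \<in> carrier U" "M' \<in> carrier U" "\<pi>U M = \<pi>U M'"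
  shows "\<exists>a\<in>{0..<int p}. M = \<iota> a \<otimes>\<^bsub>U\<^esub> M'"
proof -
  have "M \<otimes>\<^bsub>U\<^esub> inv\<^bsub>U\<^esub> M' \<in> U.L n"
    using assms UL.rcos_eq_iff by (simp add: \<pi>U_eq)
  then obtain a where a: "a \<in> {0..<int p}" "M \<otimes>\<^bsub>U\<^esub> inv\<^bsub>U\<^esub> M' = \<iota> a"
    using U_L_n by blast
  have "M = M \<otimes>\<^bsub>U\<^esub> inv\<^bsub>U\<^esub> M' \<otimes>\<^bsub>U\<^esub> M'"
    using assms by (simp add: U_mon.m_assoc)
  then show ?thesis
    using a by auto
qed

lemma embedding_cancel:
  assumes "a \<in> {0..<int p}" "b \<in> {0..<int p}" "M \<in> carrier U" "\<iota> a \<otimes>\<^bsub>U\<^esub> M = \<iota> b \<otimes>\<^bsub>U\<^esub> M"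
  shows "a = b"
  using assms embedding_closed embedding_inj U.right_cancel by metis

text \<open>The coordinate of a matrix in its fibre relative to the section. It splits the factor
  set after pulling the extension back to the group \<open>U\<close> itself.\<close>

definition offset :: "(nat \<times> nat \<Rightarrow> int) \<Rightarrow> int" where
  "offset M = (SOME a. a \<in> {0..<int p} \<and> M = \<iota> a \<otimes>\<^bsub>U\<^esub> sec (\<pi>U M))"

lemma offset:
  assumes "M \<in> carrier U"
  shows "offset M \<in> {0..<int p}" "M = \<iota> (offset M) \<otimes>\<^bsub>U\<^esub> sec (\<pi>U M)"
proof -
  have "\<exists>a\<in>{0..<int p}. M = \<iota> a \<otimes>\<^bsub>U\<^esub> sec (\<pi>U M)"
    using assms sec by (intro same_coset) auto
  then have "\<exists>a. a \<in> {0..<int p} \<and> M = \<iota> a \<otimes>\<^bsub>U\<^esub> sec (\<pi>U M)"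
    by blast
  then have "offset M \<in> {0..<int p} \<and> M = \<iota> (offset M) \<otimes>\<^bsub>U\<^esub> sec (\<pi>U M)"
    unfolding offset_def by (rule someI_ex)
  then show "offset M \<in> {0..<int p}" "M = \<iota> (offset M) \<otimes>\<^bsub>U\<^esub> sec (\<pi>U M)"
    by auto
qed

abbreviation fset :: "(nat \<times> nat \<Rightarrow> int) set \<times> (nat \<times> nat \<Rightarrow> int) set \<Rightarrow> int" where
  "fset \<equiv> factor_set (integer_mod_group p) \<iota> U UQ sec"

lemma A_carrier': "carrier (integer_mod_group p) = {0..<int p}"
  using p by (simp add: carrier_integer_mod_group)

lemma fset_embedding:
  assumes "C \<in> carrier UQ" "D \<in> carrier UQ"
  shows "fset (C, D) \<in> {0..<int p}"
    and "\<iota> (fset (C, D)) \<otimes>\<^bsub>U\<^esub> sec (C \<otimes>\<^bsub>UQ\<^esub> D) = sec C \<otimes>\<^bsub>U\<^esub> sec D"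
proof -
  note s = sec[OF assms(1)] sec[OF assms(2)] sec[OF \<pi>U.H.m_closed[OF assms]]
  have "\<pi>U (sec C \<otimes>\<^bsub>U\<^esub> sec D) = \<pi>U (sec (C \<otimes>\<^bsub>UQ\<^esub> D))"
    using s by simp
  then obtain a where a: "a \<in> {0..<int p}" "sec C \<otimes>\<^bsub>U\<^esub> sec D = \<iota> a \<otimes>\<^bsub>U\<^esub> sec (C \<otimes>\<^bsub>UQ\<^esub> D)"
    using same_coset[of "sec C \<otimes>\<^bsub>U\<^esub> sec D" "sec (C \<otimes>\<^bsub>UQ\<^esub> D)"] s by auto
  have "sec C \<otimes>\<^bsub>U\<^esub> sec D \<otimes>\<^bsub>U\<^esub> inv\<^bsub>U\<^esub> (sec (C \<otimes>\<^bsub>UQ\<^esub> D)) = \<iota> a"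
    using a s embedding_closed[OF a(1)] by (simp add: U_mon.m_assoc)
  then have "fset (C, D) = (THE b. b \<in> {0..<int p} \<and> \<iota> b = \<iota> a)"
    using assms by (simp add: factor_set_def A_carrier')
  also have "\<dots> = a"
    using a(1) embedding_inj by (intro the_equality) auto
  finally show "fset (C, D) \<in> {0..<int p}"
    "\<iota> (fset (C, D)) \<otimes>\<^bsub>U\<^esub> sec (C \<otimes>\<^bsub>UQ\<^esub> D) = sec C \<otimes>\<^bsub>U\<^esub> sec D"
    using a by auto
qed

text \<open>The factors \<open>\<iota> a\<close> are central and can be collected on the left of the
  product of the sections. In terms of coboundaries, the factor set pulled back to \<open>U\<close>
  is the coboundary of minus \<open>offset\<close>.\<close>

lemma offset_mult:
  assumes M: "M \<in> carrier U" and M': "M' \<in> carrier U"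
  shows "[offset (M \<otimes>\<^bsub>U\<^esub> M') = offset M + offset M' + fset (\<pi>U M, \<pi>U M')] (mod int p)"
proof -
  let ?C = "\<pi>U M" and ?D = "\<pi>U M'"
  have CD: "?C \<in> carrier UQ" "?D \<in> carrier UQ"
    using M M' by auto
  define a b k where "a = offset M" and "b = offset M'" and "k = fset (?C, ?D)"
  have abk: "a \<in> {0..<int p}" "b \<in> {0..<int p}" "k \<in> {0..<int p}"
    using offset M M' fset_embedding CD by (auto simp: a_def b_def k_def)
  have s: "sec ?C \<in> carrier U" "sec ?D \<in> carrier U" "sec (?C \<otimes>\<^bsub>UQ\<^esub> ?D) \<in> carrier U"
    using sec CD by auto
  have i: "\<iota> a \<in> carrier U" "\<iota> b \<in> carrier U" "\<iota> k \<in> carrier U"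
    using abk embedding_closed by auto
  have p0: "0 < int p"
    using p by simp
  have "M \<otimes>\<^bsub>U\<^esub> M' = (\<iota> a \<otimes>\<^bsub>U\<^esub> sec ?C) \<otimes>\<^bsub>U\<^esub> (\<iota> b \<otimes>\<^bsub>U\<^esub> sec ?D)"
    using offset(2)[OF M] offset(2)[OF M'] by (simp only: a_def b_def)
  also have "\<dots> = \<iota> a \<otimes>\<^bsub>U\<^esub> (sec ?C \<otimes>\<^bsub>U\<^esub> \<iota> b) \<otimes>\<^bsub>U\<^esub> sec ?D"
    using s i by (simp add: U_mon.m_assoc)
  also have "\<dots> = \<iota> a \<otimes>\<^bsub>U\<^esub> (\<iota> b \<otimes>\<^bsub>U\<^esub> sec ?C) \<otimes>\<^bsub>U\<^esub> sec ?D"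
    by (simp only: embedding_central[OF abk(2) s(1)])
  also have "\<dots> = (\<iota> a \<otimes>\<^bsub>U\<^esub> \<iota> b) \<otimes>\<^bsub>U\<^esub> (sec ?C \<otimes>\<^bsub>U\<^esub> sec ?D)"
    using s i by (simp add: U_mon.m_assoc)
  also have "\<dots> = (\<iota> a \<otimes>\<^bsub>U\<^esub> \<iota> b) \<otimes>\<^bsub>U\<^esub> (\<iota> k \<otimes>\<^bsub>U\<^esub> sec (?C \<otimes>\<^bsub>UQ\<^esub> ?D))"
    using fset_embedding(2)[OF CD] by (simp only: k_def)
  also have "\<dots> = (\<iota> a \<otimes>\<^bsub>U\<^esub> \<iota> b \<otimes>\<^bsub>U\<^esub> \<iota> k) \<otimes>\<^bsub>U\<^esub> sec (?C \<otimes>\<^bsub>UQ\<^esub> ?D)"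
    using s i by (simp add: U_mon.m_assoc)
  also have "\<iota> a \<otimes>\<^bsub>U\<^esub> \<iota> b \<otimes>\<^bsub>U\<^esub> \<iota> k = \<iota> (((a + b) mod int p + k) mod int p)"
    using abk p0 by (simp add: embedding_add)
  finally have "\<iota> (((a + b) mod int p + k) mod int p) \<otimes>\<^bsub>U\<^esub> sec (?C \<otimes>\<^bsub>UQ\<^esub> ?D) =
      \<iota> (offset (M \<otimes>\<^bsub>U\<^esub> M')) \<otimes>\<^bsub>U\<^esub> sec (?C \<otimes>\<^bsub>UQ\<^esub> ?D)"
    using offset(2)[OF U_mult_closed[OF M M'], unfolded \<pi>U.hom_mult[OF M M']] by (rule trans[OF sym])
  then have "((a + b) mod int p + k) mod int p = offset (M \<otimes>\<^bsub>U\<^esub> M')"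
    using s(3) M M' offset(1)[of "M \<otimes>\<^bsub>U\<^esub> M'"] p0 by (intro embedding_cancel) auto
  then show ?thesis
    using offset(1)[OF U_mult_closed[OF M M']] by (simp add: a_def b_def k_def cong_def mod_simps)
qed

lemma offset_L:
  assumes M: "M \<in> U.L n" and a: "a \<in> {0..<int p}" "M = \<iota> a"
  shows "[offset M = a + offset \<one>\<^bsub>U\<^esub>] (mod int p)"
proof -
  have MU: "M \<in> carrier U"
    using M by simp
  have same: "\<pi>U M = \<pi>U \<one>\<^bsub>U\<^esub>"
    using M MU UL.rcos_eq_iff[of M "\<one>\<^bsub>U\<^esub>"] by (simp add: \<pi>U_eq)
  let ?s = "sec (\<pi>U \<one>\<^bsub>U\<^esub>)"
  have s: "?s \<in> carrier U"
    using sec by auto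
  have o: "offset M \<in> {0..<int p}" "offset \<one>\<^bsub>U\<^esub> \<in> {0..<int p}"
    using offset(1) MU by auto
  have "\<iota> (offset M) \<otimes>\<^bsub>U\<^esub> ?s = \<iota> a \<otimes>\<^bsub>U\<^esub> \<one>\<^bsub>U\<^esub>"
    using offset(2)[OF MU] a embedding_closed[OF a(1)] same by simp
  also have "\<dots> = \<iota> a \<otimes>\<^bsub>U\<^esub> (\<iota> (offset \<one>\<^bsub>U\<^esub>) \<otimes>\<^bsub>U\<^esub> ?s)"
    using offset(2)[of "\<one>\<^bsub>U\<^esub>"] by simp
  also have "\<dots> = \<iota> ((a + offset \<one>\<^bsub>U\<^esub>) mod int p) \<otimes>\<^bsub>U\<^esub> ?s"
    using o a s embedding_closed embedding_add U_mon.m_assoc by metis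
  finally have "offset M = (a + offset \<one>\<^bsub>U\<^esub>) mod int p"
    using o s p by (intro embedding_cancel) auto
  then show ?thesis
    by (simp add: cong_def)
qed

lemma word_extension_class_eq: "word_extension_class p n s = H2_class UQ TUQ (integer_mod_group p) fset"
  by (simp add: word_extension_class_def extension_class_def U_eq sec_def)

end

context free_quotient
begin

lemma resid_range: "resid C m \<in> {0..<int p}"
  using p_pos by (simp add: resid_def residual_def)

lemma resid_one: "m \<in> Ln \<Longrightarrow> resid \<one>\<^bsub>H\<^esub> m = 0"
proof -
  assume "m \<in> Ln"
  then have "[resid \<one>\<^bsub>H\<^esub> m + 0 = resid \<one>\<^bsub>H\<^esub> m + resid \<one>\<^bsub>H\<^esub> m] (mod int p)"
    using resid_mult[of "\<one>\<^bsub>H\<^esub>" "\<one>\<^bsub>H\<^esub>" m] by simp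
  then have "[0 = resid \<one>\<^bsub>H\<^esub> m] (mod int p)"
    by (simp only: cong_add_lcancel)
  then show ?thesis
    using resid_range[of "\<one>\<^bsub>H\<^esub>" m] by (simp add: cong_def)
qed

lemma H_eqI:
  assumes C: "C \<in> carrier H" "D \<in> carrier H" and eq: "\<And>m. m \<in> Ln \<Longrightarrow> resid C m = resid D m"
  shows "C = D"
proof -
  have "resid (C \<otimes>\<^bsub>H\<^esub> inv\<^bsub>H\<^esub> D) m = 0" if m: "m \<in> Ln" for m
  proof -
    have "[resid (D \<otimes>\<^bsub>H\<^esub> inv\<^bsub>H\<^esub> D) m = resid D m + resid (inv\<^bsub>H\<^esub> D) m] (mod int p)"
      using C m by (intro resid_mult) auto
    moreover have "[resid (C \<otimes>\<^bsub>H\<^esub> inv\<^bsub>H\<^esub> D) m = resid C m + resid (inv\<^bsub>H\<^esub> D) m] (mod int p)"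
      using C m by (intro resid_mult) auto
    ultimately have "[resid (C \<otimes>\<^bsub>H\<^esub> inv\<^bsub>H\<^esub> D) m = 0] (mod int p)"
      using eq[OF m] resid_one[OF m] C by (simp add: cong_def)
    then show ?thesis
      using resid_range[of "C \<otimes>\<^bsub>H\<^esub> inv\<^bsub>H\<^esub> D" m] by (simp add: cong_def)
  qed
  then have "C \<otimes>\<^bsub>H\<^esub> inv\<^bsub>H\<^esub> D = \<one>\<^bsub>H\<^esub>"
    using C by (intro resid_eq_0) auto
  then show ?thesis
    using C by (metis H.inv_closed H.inv_equality H.inv_inv)
qed

end

locale quotient_word = free_quotient S T X p n + word_representation X m S T p n s w
  for S :: "'a monoid" (structure) and T :: "'a topology" and X :: "'a set" and p n s :: nat
    and m :: int and w :: "'a list"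
begin

abbreviation \<rho>bar :: "'a set \<Rightarrow> (nat \<times> nat \<Rightarrow> int) set" where "\<rho>bar \<equiv> word_rep_bar p n S T X w"

lemma rho_bar: "g \<in> carrier S \<Longrightarrow> \<rho>bar (\<pi> g) = \<pi>U (\<rho> g)"
proof -
  assume g: "g \<in> carrier S"
  have "\<pi>U (\<rho> h) = \<pi>U (\<rho> g)" if h: "h \<in> \<pi> g" for h
  proof -
    obtain k where k: "k \<in> Ln" "h = k \<otimes> g"
      using h by (auto simp: \<pi>_eq r_coset_def)
    have kL: "\<rho> k \<in> U.L n"
      using rho_L k(1) by blast
    have "\<pi>U (\<rho> k) = \<one>\<^bsub>UQ\<^esub>"
      using kL UL.rcos_eq_self_iff[of "\<rho> k"] by (simp add: \<pi>U_eq UQ_eq)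
    then show ?thesis
      using k g by simp
  qed
  moreover have "g \<in> \<pi> g"
    using S.rcos_self[OF g Ln.is_subgroup] by (simp add: \<pi>_eq)
  ultimately have "(\<lambda>\<sigma>. \<pi>U (\<rho> \<sigma>)) ` \<pi> g = {\<pi>U (\<rho> g)}"
    by blast
  then show ?thesis
    by (simp add: word_rep_bar_def w(2) U_eq)
qed

definition pull :: "((nat \<times> nat \<Rightarrow> int) set \<times> (nat \<times> nat \<Rightarrow> int) set \<Rightarrow> int) \<Rightarrow> 'a set \<times> 'a set \<Rightarrow> int" where
  "pull c = (\<lambda>(C, D)\<in>carrier Q \<times> carrier Q. c (\<rho>bar C, \<rho>bar D))"

text \<open>Stated for every representative of the extension class, because the pull-back of a class
  is defined through all of its representatives.\<close>

lemma pull_trivializes: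
  assumes "c \<in> word_extension_class p n s"
  obtains b where "trivializes (pull c) b" "\<And>\<sigma>. \<sigma> \<in> Ln \<Longrightarrow> residual b \<sigma> = (- coef \<sigma>) mod int p"
    "pull c \<in> carrier CG"
proof -
  obtain d where d: "d \<in> coboundaries2 UQ TUQ A" "c = cochain_add (carrier UQ \<times> carrier UQ) A d fset"
    using assms by (auto simp: word_extension_class_eq H2_class_def r_coset_def cocycle_group_def)
  then obtain \<beta> where \<beta>: "d = coboundary UQ A \<beta>" "continuous_map TUQ TA \<beta>"
    by (auto simp: coboundaries2_def)
  have \<beta>A: "\<beta> C \<in> carrier A" if "C \<in> carrier UQ" for C
    using that \<beta>(2) by (auto simp: TUQ_eq)
  have c_eq: "[c (C, D) = (\<beta> D - \<beta> (C \<otimes>\<^bsub>UQ\<^esub> D) + \<beta> C) + fset (C, D)] (mod int p)"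
    if CD: "C \<in> carrier UQ" "D \<in> carrier UQ" for C D
  proof -
    have "inv\<^bsub>A\<^esub> (\<beta> (C \<otimes>\<^bsub>UQ\<^esub> D)) = (- \<beta> (C \<otimes>\<^bsub>UQ\<^esub> D)) mod int p"
      using CD by (intro inv_integer_mod_group \<beta>A) auto
    moreover have "[\<beta> D + (- \<beta> (C \<otimes>\<^bsub>UQ\<^esub> D)) mod int p + \<beta> C + fset (C, D) =
        \<beta> D + - \<beta> (C \<otimes>\<^bsub>UQ\<^esub> D) + \<beta> C + fset (C, D)] (mod int p)"
      by (intro cong_add cong_mod_int cong_refl)
    ultimately show ?thesis
      using CD d(2) \<beta>(1) by (simp add: cochain_add_def coboundary_def mod_simps cong_def)
  qed
  \<comment> \<open>The cochain \<beta> accounts for the coboundary by which \<open>c\<close>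
    differs from the factor set, and minus \<open>offset\<close> trivializes the factor set. The
    minus sign is the one in the transgression of word classes.\<close>
  define b where "b \<sigma> = (\<beta> (\<pi>U (\<rho> \<sigma>)) - offset (\<rho> \<sigma>)) mod int p" for \<sigma>
  have b_cong: "[b \<sigma> = \<beta> (\<pi>U (\<rho> \<sigma>)) - offset (\<rho> \<sigma>)] (mod int p)" for \<sigma>
    by (simp add: b_def cong_def)
  have triv: "trivializes (pull c) b"
    unfolding trivializes_def
  proof (intro conjI ballI)
    show "continuous_map T TA b"
      unfolding b_def
      by (rule continuous_map_discrete1[OF rho_continuous,
            where h = "\<lambda>M. (\<beta> (\<pi>U M) - offset M) mod int p"]) simp
    fix g h assume gh: "g \<in> carrier S" "h \<in> carrier S"
    let ?M = "\<rho> g" and ?N = "\<rho> h"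
    have MN: "?M \<in> carrier U" "?N \<in> carrier U"
      using gh by auto
    have MNQ: "\<pi>U ?M \<in> carrier UQ" "\<pi>U ?N \<in> carrier UQ"
      using MN by auto
    have "[b h - b (g \<otimes> h) + b g = (\<beta> (\<pi>U ?N) - offset ?N) -
        (\<beta> (\<pi>U ?M \<otimes>\<^bsub>UQ\<^esub> \<pi>U ?N) - offset (?M \<otimes>\<^bsub>U\<^esub> ?N)) + (\<beta> (\<pi>U ?M) - offset ?M)] (mod int p)"
      using gh MN b_cong[of h] b_cong[of g] b_cong[of "g \<otimes> h"] by (intro cong_add cong_diff) simp_all
    also have "[(\<beta> (\<pi>U ?N) - offset ?N) -
        (\<beta> (\<pi>U ?M \<otimes>\<^bsub>UQ\<^esub> \<pi>U ?N) - offset (?M \<otimes>\<^bsub>U\<^esub> ?N)) + (\<beta> (\<pi>U ?M) - offset ?M) =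
        (\<beta> (\<pi>U ?N) - offset ?N) -
        (\<beta> (\<pi>U ?M \<otimes>\<^bsub>UQ\<^esub> \<pi>U ?N) - (offset ?M + offset ?N + fset (\<pi>U ?M, \<pi>U ?N))) +
        (\<beta> (\<pi>U ?M) - offset ?M)] (mod int p)"
      by (intro cong_add cong_diff cong_refl offset_mult MN)
    also have "(\<beta> (\<pi>U ?N) - offset ?N) -
        (\<beta> (\<pi>U ?M \<otimes>\<^bsub>UQ\<^esub> \<pi>U ?N) - (offset ?M + offset ?N + fset (\<pi>U ?M, \<pi>U ?N))) +
        (\<beta> (\<pi>U ?M) - offset ?M) =
        (\<beta> (\<pi>U ?N) - \<beta> (\<pi>U ?M \<otimes>\<^bsub>UQ\<^esub> \<pi>U ?N) + \<beta> (\<pi>U ?M)) + fset (\<pi>U ?M, \<pi>U ?N)"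
      by simp
    also have "[\<dots> = c (\<pi>U ?M, \<pi>U ?N)] (mod int p)"
      using c_eq[OF MNQ] by (rule cong_sym)
    finally have "[b h - b (g \<otimes> h) + b g = pull c (\<pi> g, \<pi> h)] (mod int p)"
      using gh by (simp add: pull_def rho_bar)
    moreover have "pull c (\<pi> g, \<pi> h) mod int p = pull c (\<pi> g, \<pi> h)"
      using gh MNQ d(2) by (simp add: pull_def rho_bar cochain_add_def)
    ultimately show "pull c (\<pi> g, \<pi> h) = (b h - b (g \<otimes> h) + b g) mod int p"
      by (simp add: cong_def)
  qed
  moreover have "residual b \<sigma> = (- coef \<sigma>) mod int p" if \<sigma>: "\<sigma> \<in> Ln" for \<sigma>
  proof -
    have \<rho>\<sigma>: "\<rho> \<sigma> \<in> U.L n"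
      using rho_L \<sigma> by blast
    have o: "[offset (\<rho> \<sigma>) = coef \<sigma> + offset \<one>\<^bsub>U\<^esub>] (mod int p)"
      using offset_L[OF \<rho>\<sigma>] coef[OF \<sigma>] by blast
    have same: "\<pi>U (\<rho> \<sigma>) = \<pi>U \<one>\<^bsub>U\<^esub>"
      using \<rho>\<sigma> UL.rcos_eq_iff[of "\<rho> \<sigma>" "\<one>\<^bsub>U\<^esub>"] by (simp add: \<pi>U_eq)
    have "[b \<sigma> - b \<one> = (\<beta> (\<pi>U \<one>\<^bsub>U\<^esub>) - offset (\<rho> \<sigma>)) - (\<beta> (\<pi>U \<one>\<^bsub>U\<^esub>) - offset \<one>\<^bsub>U\<^esub>)] (mod int p)"
      using b_cong[of \<sigma>] b_cong[of \<one>] same by (intro cong_diff) simp_all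
    also have "[(\<beta> (\<pi>U \<one>\<^bsub>U\<^esub>) - offset (\<rho> \<sigma>)) - (\<beta> (\<pi>U \<one>\<^bsub>U\<^esub>) - offset \<one>\<^bsub>U\<^esub>) =
        (\<beta> (\<pi>U \<one>\<^bsub>U\<^esub>) - (coef \<sigma> + offset \<one>\<^bsub>U\<^esub>)) - (\<beta> (\<pi>U \<one>\<^bsub>U\<^esub>) - offset \<one>\<^bsub>U\<^esub>)] (mod int p)"
      by (intro cong_diff cong_refl o)
    finally show ?thesis
      by (simp add: residual_def cong_def)
  qed
  moreover have "pull c \<in> carrier CG"
    unfolding CG_simps
  proof (rule cocycle_if_trivializes[OF triv], rule PiE_I)
    fix z assume "z \<in> carrier Q \<times> carrier Q"
    then obtain g h where "z = (\<pi> g, \<pi> h)" "g \<in> carrier S" "h \<in> carrier S"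
      by (auto simp: Q_carrier)
    then show "pull c z \<in> carrier A"
      using triv by (auto simp: trivializes_def)
  qed (auto simp: pull_def)
  ultimately show thesis
    using that by blast
qed

lemma word_class:
  shows "word_class p n S T X w \<in> carrier H"
    and "\<And>\<sigma>. \<sigma> \<in> Ln \<Longrightarrow> resid (word_class p n S T X w) \<sigma> = (- coef \<sigma>) mod int p"
proof -
  have pull: "cls (pull c) \<in> carrier H" "\<And>\<sigma>. \<sigma> \<in> Ln \<Longrightarrow> resid (cls (pull c)) \<sigma> = (- coef \<sigma>) mod int p"
    if c: "c \<in> word_extension_class p n s" for c
  proof -
    obtain b where "trivializes (pull c) b" "\<And>\<sigma>. \<sigma> \<in> Ln \<Longrightarrow> residual b \<sigma> = (- coef \<sigma>) mod int p"
      "pull c \<in> carrier CG"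
      using c by (rule pull_trivializes) blast
    then show "cls (pull c) \<in> carrier H" "\<And>\<sigma>. \<sigma> \<in> Ln \<Longrightarrow> resid (cls (pull c)) \<sigma> = (- coef \<sigma>) mod int p"
      by (auto simp: H_carrier resid_cls)
  qed
  \<comment> \<open>The zero cochain yields a coboundary, so the extension class has at least one
    representative.\<close>
  let ?z = "\<lambda>_. 0 :: int"
  have "continuous_map TUQ TA ?z"
    using p_pos by (simp add: A_carrier)
  then have "coboundary UQ A ?z \<in> coboundaries2 UQ TUQ A"
    unfolding coboundaries2_def by blast
  then obtain c0 where c0: "c0 \<in> word_extension_class p n s"
    unfolding word_extension_class_eq H2_class_def r_coset_def by blast
  \<comment> \<open>The residuals do not depend on the representative and determine the class, so
    the image under pull-back is a singleton and \<open>the_elem\<close> in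
    \<open>H2_pullback\<close> returns its element.\<close>
  have "cls (pull c) = cls (pull c0)" if "c \<in> word_extension_class p n s" for c
    using pull[OF that] pull[OF c0] by (intro H_eqI) auto
  then have "(\<lambda>c. cls (pull c)) ` word_extension_class p n s = {cls (pull c0)}"
    using c0 by blast
  then have "word_class p n S T X w = cls (pull c0)"
    by (simp add: word_class_def H2_pullback_def w(2) pull_def)
  then show "word_class p n S T X w \<in> carrier H"
    "\<And>\<sigma>. \<sigma> \<in> Ln \<Longrightarrow> resid (word_class p n S T X w) \<sigma> = (- coef \<sigma>) mod int p"
    using pull[OF c0] by auto
qed

end


section \<open>Bases from triangular families of functionals\<close>

locale elementary_group = comm_group G for G :: "'g monoid" (structure) +
  fixes p :: nat
  assumes prime_p: "prime p" and exponent: "\<And>x. x \<in> carrier G \<Longrightarrow> x [^] p = \<one>"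
begin

lemma res_prime: "residues (int p)"
  using prime_p by unfold_locales (auto dest: prime_gt_1_nat)

lemma int_pow_mod:
  assumes "x \<in> carrier G"
  shows "x [^] (a mod int p) = x [^] (a :: int)"
proof -
  have "x [^] a = x [^] (int p * (a div int p) + a mod int p)"
    by simp
  also have "\<dots> = (x [^] int p) [^] (a div int p) \<otimes> x [^] (a mod int p)"
    using assms by (simp only: int_pow_mult int_pow_pow)
  also have "x [^] int p = \<one>"
    using exponent[OF assms] by (simp add: int_pow_int)
  finally show ?thesis
    using assms by simp
qed

lemma zmod_abelian_group: "abelian_group (zmod_module G)"
proof -
  have "comm_group (add_monoid (zmod_module G))"
    by (rule comm_groupI) (auto simp: zmod_module_def intro: m_assoc m_comm l_inv)
  then show ?thesis
    by (intro abelian_group.intro abelian_monoid.intro abelian_group_axioms.intro)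
      (simp_all add: comm_group_def)
qed

lemma zmod_module: "module (residue_ring (int p)) (zmod_module G)"
proof -
  interpret res: residues "int p" "residue_ring (int p)"
    using res_prime by simp_all
  show ?thesis
  proof (rule moduleI)
    show "cring (residue_ring (int p))"
      by (rule res.cring)
    show "abelian_group (zmod_module G)"
      by (rule zmod_abelian_group)
  next
    fix a b x
    assume x: "x \<in> carrier (zmod_module G)"
    then have xG: "x \<in> carrier G"
      by (simp add: zmod_module_def)
    show "(a \<oplus>\<^bsub>residue_ring (int p)\<^esub> b) \<odot>\<^bsub>zmod_module G\<^esub> x =
        a \<odot>\<^bsub>zmod_module G\<^esub> x \<oplus>\<^bsub>zmod_module G\<^esub> b \<odot>\<^bsub>zmod_module G\<^esub> x"
      using xG by (simp add: zmod_module_def res.res_add_eq int_pow_mod int_pow_mult)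
    show "(a \<otimes>\<^bsub>residue_ring (int p)\<^esub> b) \<odot>\<^bsub>zmod_module G\<^esub> x =
        a \<odot>\<^bsub>zmod_module G\<^esub> (b \<odot>\<^bsub>zmod_module G\<^esub> x)"
      using xG by (simp add: zmod_module_def res.res_mult_eq int_pow_mod int_pow_pow mult.commute)
    show "\<one>\<^bsub>residue_ring (int p)\<^esub> \<odot>\<^bsub>zmod_module G\<^esub> x = x"
      using xG by (simp add: zmod_module_def res.res_one_eq)
  qed (auto simp: zmod_module_def int_pow_distrib)
qed

lemma zmod_finsum: "finsum (zmod_module G) h F = finprod G h F"
  by (simp add: finsum_def finprod_def zmod_module_def)

lemma zmod_lincomb:
  "(\<Oplus>\<^bsub>zmod_module G\<^esub>i\<in>F. a i \<odot>\<^bsub>zmod_module G\<^esub> b i) = (\<Otimes>i\<in>F. b i [^] (a i :: int))"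
  unfolding zmod_finsum by (simp add: zmod_module_def)

end

text \<open>Triangularity is expressed without an order: every finite set has an index whose
  functional sees only its own vector. This covers both uses, where words are eliminated from the
  greatest and from the least one respectively.\<close>

locale functional_family = elementary_group G p for G :: "'g monoid" (structure) and p :: nat +
  fixes I :: "'i set" and b :: "'i \<Rightarrow> 'g" and f :: "'i \<Rightarrow> 'g \<Rightarrow> int"
  assumes b: "\<And>i. i \<in> I \<Longrightarrow> b i \<in> carrier G"
    and f_mult: "\<And>v x y. v \<in> I \<Longrightarrow> x \<in> carrier G \<Longrightarrow> y \<in> carrier G \<Longrightarrow>
      [f v (x \<otimes> y) = f v x + f v y] (mod int p)"
    and triangular: "\<And>F. finite F \<Longrightarrow> F \<subseteq> I \<Longrightarrow> F \<noteq> {} \<Longrightarrow>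
      \<exists>v\<in>F. \<not> int p dvd f v (b v) \<and> (\<forall>w\<in>F. w \<noteq> v \<longrightarrow> int p dvd f v (b w))"
begin

lemma f_one: "v \<in> I \<Longrightarrow> [f v \<one> = 0] (mod int p)"
proof -
  assume "v \<in> I"
  then have "[f v \<one> + 0 = f v \<one> + f v \<one>] (mod int p)"
    using f_mult[of v \<one> \<one>] by simp
  then show ?thesis
    by (simp only: cong_add_lcancel cong_sym_eq)
qed

lemma f_inv: "v \<in> I \<Longrightarrow> x \<in> carrier G \<Longrightarrow> [f v (inv x) = - f v x] (mod int p)"
proof -
  assume vx: "v \<in> I" "x \<in> carrier G"
  then have "[f v (x \<otimes> inv x) = f v x + f v (inv x)] (mod int p)"
    by (intro f_mult) auto
  then have "[f v x + f v (inv x) = 0] (mod int p)"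
    using f_one[OF vx(1)] vx by (metis cong_sym cong_trans r_inv)
  then have "[f v x + f v (inv x) - f v x = 0 - f v x] (mod int p)"
    by (intro cong_diff cong_refl)
  then show ?thesis
    by simp
qed

lemma f_nat_pow: "v \<in> I \<Longrightarrow> x \<in> carrier G \<Longrightarrow> [f v (x [^] (k::nat)) = int k * f v x] (mod int p)"
proof (induction k)
  case (Suc k)
  then have "[f v (x [^] k \<otimes> x) = f v (x [^] k) + f v x] (mod int p)"
    by (intro f_mult) auto
  also have "[f v (x [^] k) + f v x = int k * f v x + f v x] (mod int p)"
    using Suc by (intro cong_add) auto
  finally show ?case
    by (simp add: algebra_simps)
qed (simp add: f_one)

lemma f_pow:
  assumes "v \<in> I" "x \<in> carrier G" "0 \<le> k"
  shows "[f v (x [^] (k::int)) = k * f v x] (mod int p)"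
  using f_nat_pow[OF assms(1,2), of "nat k"] assms(3) by (simp add: pow_nat)

lemma f_finprod:
  assumes "v \<in> I" "finite F" "h \<in> F \<rightarrow> carrier G"
  shows "[f v (\<Otimes>i\<in>F. h i) = (\<Sum>i\<in>F. f v (h i))] (mod int p)"
  using assms(2,3)
proof (induction F rule: finite_induct)
  case (insert i F)
  then have h: "h i \<in> carrier G" "h \<in> F \<rightarrow> carrier G"
    by auto
  have "[f v (h i \<otimes> (\<Otimes>i\<in>F. h i)) = f v (h i) + f v (\<Otimes>i\<in>F. h i)] (mod int p)"
    using h assms(1) by (intro f_mult) auto
  also have "[f v (h i) + f v (\<Otimes>i\<in>F. h i) = f v (h i) + (\<Sum>i\<in>F. f v (h i))] (mod int p)"
    using insert h by (intro cong_add) auto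
  finally show ?case
    using insert h by simp
qed (simp add: f_one assms(1))

lemma f_lincomb:
  assumes "v \<in> I" "finite F" "F \<subseteq> I" "\<And>i. i \<in> F \<Longrightarrow> 0 \<le> a i"
  shows "[f v (\<Otimes>i\<in>F. b i [^] (a i :: int)) = (\<Sum>i\<in>F. a i * f v (b i))] (mod int p)"
proof -
  have bF: "b i \<in> carrier G" if "i \<in> F" for i
    using that assms(3) b by blast
  have "[f v (\<Otimes>i\<in>F. b i [^] a i) = (\<Sum>i\<in>F. f v (b i [^] a i))] (mod int p)"
    using assms bF by (intro f_finprod) auto
  also have "[(\<Sum>i\<in>F. f v (b i [^] a i)) = (\<Sum>i\<in>F. a i * f v (b i))] (mod int p)"
    using assms bF by (intro cong_sum f_pow) auto
  finally show ?thesis .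
qed

lemma residue_carrier: "carrier (residue_ring (int p)) = {0..<int p}"
proof -
  have "{0..int p - 1} = {0..<int p}"
    by auto
  then show ?thesis
    by (simp only: residues.res_carrier_eq[OF res_prime])
qed

text \<open>\<open>triangular\<close> is applied to the support of \<open>a\<close>; the functional
  of the index found there sees a single nonzero term of the relation.\<close>

lemma independent:
  assumes F: "finite F" "F \<subseteq> I" and a: "\<And>i. i \<in> F \<Longrightarrow> a i \<in> {0..<int p}"
    and one: "(\<Otimes>i\<in>F. b i [^] (a i :: int)) = \<one>"
  shows "\<forall>i\<in>F. a i = 0"
proof (rule ccontr)
  assume "\<not> (\<forall>i\<in>F. a i = 0)"
  then have "{i \<in> F. a i \<noteq> 0} \<noteq> {}"
    by auto
  then obtain v where v: "v \<in> F" "a v \<noteq> 0" "\<not> int p dvd f v (b v)"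
    "\<And>w. w \<in> F \<Longrightarrow> a w \<noteq> 0 \<Longrightarrow> w \<noteq> v \<Longrightarrow> int p dvd f v (b w)"
    using triangular[of "{i \<in> F. a i \<noteq> 0}"] F by auto
  have vI: "v \<in> I"
    using v F by blast
  have "[(\<Sum>i\<in>F. a i * f v (b i)) = 0] (mod int p)"
    using f_lincomb[OF vI F, of a] a f_one[OF vI] one by (auto intro: cong_trans cong_sym)
  moreover have "[(\<Sum>i\<in>F. a i * f v (b i)) = (\<Sum>i\<in>F. if i = v then a v * f v (b v) else 0)] (mod int p)"
  proof (rule cong_sum)
    fix i assume "i \<in> F"
    then show "[a i * f v (b i) = (if i = v then a v * f v (b v) else 0)] (mod int p)"
      using v(4)[of i] by (cases "a i = 0") (auto simp: cong_0_iff)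
  qed
  ultimately have "[a v * f v (b v) = 0] (mod int p)"
    using F(1) v(1) by (simp add: cong_def)
  then have "int p dvd a v * f v (b v)"
    by (simp add: cong_0_iff)
  then have "int p dvd a v"
    using prime_p v(3) by (simp add: prime_dvd_mult_iff)
  then show False
    using a[OF v(1)] v(2) zdvd_not_zless[of "a v" "int p"] by auto
qed

text \<open>Gaussian elimination: the functional of \<open>v\<close> determines the coefficient of
  \<open>v\<close>, and the induction hypothesis is applied to the remainder after dividing out that
  power of \<open>b v\<close>. The later coefficients do not disturb the equation for
  \<open>v\<close>, as its functional vanishes on the other vectors of \<open>F\<close>.\<close>

lemma solve:
  assumes "finite F" "F \<subseteq> I" "x \<in> carrier G"
  shows "\<exists>a. (\<forall>i\<in>F. a i \<in> {0..<int p}) \<and> (\<forall>v\<in>F. [f v x = (\<Sum>i\<in>F. a i * f v (b i))] (mod int p))"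
  using assms
proof (induction "card F" arbitrary: F x rule: less_induct)
  case (less F x)
  show ?case
  proof (cases "F = {}")
    case False
    then obtain v where v: "v \<in> F" "\<not> int p dvd f v (b v)"
      "\<And>w. w \<in> F \<Longrightarrow> w \<noteq> v \<Longrightarrow> int p dvd f v (b w)"
      using triangular less.prems by meson
    have vI: "v \<in> I" and bv: "b v \<in> carrier G"
      using v(1) less.prems b by auto
    have p0: "0 < int p"
      using prime_p prime_gt_0_nat by simp
    have "coprime (f v (b v)) (int p)"
      using prime_p v(2) by (metis coprime_commute prime_imp_coprime prime_int_nat_transfer nat_int prime_nat_int_transfer)
    \<comment> \<open>The inverse modulo p of the diagonal entry at \<open>v\<close>.\<close>
    then obtain c where c: "[f v (b v) * c = 1] (mod int p)"
      using cong_solve_coprime_int by blast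
    define k where "k = (f v x * c) mod int p"
    have k: "k \<in> {0..<int p}"
      using p0 by (simp add: k_def)
    have "[k * f v (b v) = (f v x * c) * f v (b v)] (mod int p)"
      by (simp add: k_def cong_def mod_mult_left_eq)
    also have "(f v x * c) * f v (b v) = f v x * (f v (b v) * c)"
      by simp
    also have "[f v x * (f v (b v) * c) = f v x * 1] (mod int p)"
      using c by (intro cong_mult cong_refl)
    finally have kv: "[k * f v (b v) = f v x] (mod int p)"
      by simp
    define x' where "x' = x \<otimes> inv (b v [^] k)"
    have x': "x' \<in> carrier G" "x = x' \<otimes> b v [^] k"
      using bv less.prems(3) by (auto simp: x'_def m_assoc)
    obtain a where a: "\<forall>i\<in>F - {v}. a i \<in> {0..<int p}"
      "\<forall>u\<in>F - {v}. [f u x' = (\<Sum>i\<in>F - {v}. a i * f u (b i))] (mod int p)"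
      using less.hyps[of "F - {v}" x'] v(1) less.prems x' card_Diff1_less[of F v] by auto
    define a' where "a' = a(v := k)"
    have sum: "(\<Sum>i\<in>F. a' i * f u (b i)) = k * f u (b v) + (\<Sum>i\<in>F - {v}. a i * f u (b i))" for u
      using less.prems(1) v(1) by (subst sum.remove[of _ v]) (auto simp: a'_def intro!: sum.cong)
    have "[f u x = (\<Sum>i\<in>F. a' i * f u (b i))] (mod int p)" if u: "u \<in> F" for u
    proof (cases "u = v")
      case True
      have "[(\<Sum>i\<in>F - {v}. a i * f v (b i)) = (\<Sum>i\<in>F - {v}. 0)] (mod int p)"
        using v(3) by (intro cong_sum) (auto simp: cong_0_iff)
      then have "[k * f v (b v) + (\<Sum>i\<in>F - {v}. a i * f v (b i)) = f v x + 0] (mod int p)"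
        using kv by (intro cong_add) auto
      then show ?thesis
        using True sum by (simp add: cong_sym)
    next
      case False
      have uI: "u \<in> I"
        using u less.prems by blast
      have "[f u x = f u x' + f u (b v [^] k)] (mod int p)"
        using f_mult[OF uI x'(1), of "b v [^] k"] bv x'(2) by simp
      also have "[f u x' + f u (b v [^] k) = (\<Sum>i\<in>F - {v}. a i * f u (b i)) + k * f u (b v)] (mod int p)"
        using a(2) u False f_pow[OF uI bv] k by (intro cong_add) auto
      finally show ?thesis
        using sum by (simp add: add.commute)
    qed
    moreover have "\<forall>i\<in>F. a' i \<in> {0..<int p}"
      using a(1) k by (auto simp: a'_def)
    ultimately show ?thesis
      by blast
  qed auto
qed

lemma module_basisI:
  assumes "\<And>x. x \<in> carrier G \<Longrightarrow>
    \<exists>F a. finite F \<and> F \<subseteq> I \<and> (\<forall>i\<in>F. a i \<in> {0..<int p}) \<and> x = (\<Otimes>i\<in>F. b i [^] (a i :: int))"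
  shows "module_basis (residue_ring (int p)) (zmod_module G) I b"
  unfolding module_basis_def
proof (intro conjI allI impI ballI zmod_module)
  show "b \<in> I \<rightarrow> carrier (zmod_module G)"
    using b by (auto simp: zmod_module_def)
  fix F :: "'i set" and a i
  assume *: "finite F \<and> F \<subseteq> I \<and> a \<in> F \<rightarrow> carrier (residue_ring (int p)) \<and>
      (\<Oplus>\<^bsub>zmod_module G\<^esub>i\<in>F. a i \<odot>\<^bsub>zmod_module G\<^esub> b i) = \<zero>\<^bsub>zmod_module G\<^esub>" "i \<in> F"
  then have "(\<Otimes>i\<in>F. b i [^] a i) = \<one>"
    unfolding zmod_lincomb by (simp add: zmod_module_def)
  then have "\<forall>i\<in>F. a i = 0"
    using * by (intro independent) (auto simp: residue_carrier)
  then show "a i = \<zero>\<^bsub>residue_ring (int p)\<^esub>"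
    using * residues.res_zero_eq[OF res_prime] by simp
next
  fix x assume "x \<in> carrier (zmod_module G)"
  then have "x \<in> carrier G"
    by (simp add: zmod_module_def)
  then obtain F a where "finite F" "F \<subseteq> I" "\<forall>i\<in>F. a i \<in> {0..<int p}" "x = (\<Otimes>i\<in>F. b i [^] (a i :: int))"
    using assms by blast
  then show "\<exists>F a. finite F \<and> F \<subseteq> I \<and> a \<in> F \<rightarrow> carrier (residue_ring (int p)) \<and>
      x = (\<Oplus>\<^bsub>zmod_module G\<^esub>i\<in>F. a i \<odot>\<^bsub>zmod_module G\<^esub> b i)"
    unfolding zmod_lincomb by (intro exI[of _ F] exI[of _ a]) (auto simp: residue_carrier)
qed

text \<open>The version for infinite index sets. On \<open>F\<close> the combination from
  \<open>solve\<close> has the same values as \<open>x\<close>; outside \<open>F\<close> the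
  functionals kill both \<open>x\<close> and all vectors of \<open>F\<close>. The quotient is then
  killed by every functional.\<close>

lemma basis_if_separating:
  assumes separating: "\<And>x. x \<in> carrier G \<Longrightarrow> (\<And>v. v \<in> I \<Longrightarrow> int p dvd f v x) \<Longrightarrow> x = \<one>"
    and finite_support: "\<And>x. x \<in> carrier G \<Longrightarrow> \<exists>F. finite F \<and> F \<subseteq> I \<and>
      (\<forall>v\<in>I - F. int p dvd f v x \<and> (\<forall>w\<in>F. int p dvd f v (b w)))"
  shows "module_basis (residue_ring (int p)) (zmod_module G) I b"
proof (rule module_basisI)
  fix x assume x: "x \<in> carrier G"
  then obtain F where F: "finite F" "F \<subseteq> I"
    "\<And>v. v \<in> I - F \<Longrightarrow> int p dvd f v x" "\<And>v w. v \<in> I - F \<Longrightarrow> w \<in> F \<Longrightarrow> int p dvd f v (b w)"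
    using finite_support by meson
  obtain a where a: "\<forall>i\<in>F. a i \<in> {0..<int p}"
    "\<forall>v\<in>F. [f v x = (\<Sum>i\<in>F. a i * f v (b i))] (mod int p)"
    using solve[OF F(1,2) x] by blast
  let ?y = "\<Otimes>i\<in>F. b i [^] a i"
  have y: "?y \<in> carrier G"
    using F(2) b by (intro finprod_closed) auto
  have "int p dvd f v (x \<otimes> inv ?y)" if v: "v \<in> I" for v
  proof -
    have fy: "[f v ?y = (\<Sum>i\<in>F. a i * f v (b i))] (mod int p)"
      using a(1) by (intro f_lincomb v F) auto
    have "[f v x = f v ?y] (mod int p)"
    proof (cases "v \<in> F")
      case True
      then show ?thesis
        using a(2) fy by (meson cong_sym cong_trans)
    next
      case False
      then have "[(\<Sum>i\<in>F. a i * f v (b i)) = (\<Sum>i\<in>F. 0)] (mod int p)"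
        using F(4)[of v] v by (intro cong_sum) (auto simp: cong_0_iff)
      moreover have "[f v x = 0] (mod int p)"
        using F(3)[of v] v False by (simp add: cong_0_iff)
      ultimately show ?thesis
        using fy by (simp add: cong_def)
    qed
    then have "[f v x + f v (inv ?y) = f v ?y + - f v ?y] (mod int p)"
      using f_inv[OF v y] by (intro cong_add)
    moreover have "[f v (x \<otimes> inv ?y) = f v x + f v (inv ?y)] (mod int p)"
      using v x y by (intro f_mult) auto
    ultimately show ?thesis
      by (simp add: cong_def mod_eq_0_iff_dvd)
  qed
  then have "x \<otimes> inv ?y = \<one>"
    using x y by (intro separating) auto
  then have "x = ?y"
    using x y by (metis inv_closed inv_equality inv_inv)
  then show "\<exists>F a. finite F \<and> F \<subseteq> I \<and> (\<forall>i\<in>F. a i \<in> {0..<int p}) \<and> x = (\<Otimes>i\<in>F. b i [^] (a i :: int))"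
    using F(1,2) a(1) by blast
qed

text \<open>Reduced coefficients make this set visibly finite for finite \<open>I\<close>, so that
  its preimage in \<open>Ln\<close> is a finite union of cosets and therefore closed.\<close>

definition lincombs :: "'g set" where
  "lincombs = (\<lambda>a. \<Otimes>i\<in>I. b i [^] (a i :: int)) ` (I \<rightarrow>\<^sub>E {0..<int p})"

lemma lincombI:
  assumes "x = (\<Otimes>i\<in>I. b i [^] (a i :: int))"
  shows "x \<in> lincombs"
proof -
  have "x = (\<Otimes>i\<in>I. b i [^] ((\<lambda>i\<in>I. a i mod int p) i))"
    unfolding assms using b by (intro finprod_cong') (auto simp: int_pow_mod)
  moreover have "(\<lambda>i\<in>I. a i mod int p) \<in> I \<rightarrow>\<^sub>E {0..<int p}"
    using prime_p prime_gt_0_nat by auto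
  ultimately show ?thesis
    unfolding lincombs_def by blast
qed

lemma subgroup_lincombs: "subgroup lincombs G"
proof (rule subgroupI)
  show "lincombs \<subseteq> carrier G"
    unfolding lincombs_def using b by (auto intro!: finprod_closed)
  have "\<one> \<in> lincombs"
    using b by (intro lincombI[of _ "\<lambda>_. 0"]) simp
  then show "lincombs \<noteq> {}"
    by blast
  fix x assume "x \<in> lincombs"
  then obtain a where a: "x = (\<Otimes>i\<in>I. b i [^] (a i :: int))"
    by (auto simp: lincombs_def)
  have xG: "x \<in> carrier G"
    unfolding a using b by (intro finprod_closed) auto
  have "x \<otimes> (\<Otimes>i\<in>I. b i [^] (- a i)) = (\<Otimes>i\<in>I. b i [^] a i \<otimes> b i [^] (- a i))"
    unfolding a using b by (intro finprod_multf[symmetric]) auto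
  also have "\<dots> = (\<Otimes>i\<in>I. \<one>)"
    using b by (intro finprod_cong') (auto simp flip: int_pow_mult)
  finally have "x \<otimes> (\<Otimes>i\<in>I. b i [^] (- a i)) = \<one>"
    by simp
  moreover have "(\<Otimes>i\<in>I. b i [^] (- a i)) \<in> carrier G"
    using b by (intro finprod_closed) auto
  ultimately have "inv x = (\<Otimes>i\<in>I. b i [^] (- a i))"
    using xG by (metis inv_equality m_comm)
  then show "inv x \<in> lincombs"
    by (rule lincombI)
  fix y assume "y \<in> lincombs"
  then obtain a' where a': "y = (\<Otimes>i\<in>I. b i [^] (a' i :: int))"
    by (auto simp: lincombs_def)
  have "x \<otimes> y = (\<Otimes>i\<in>I. b i [^] a i \<otimes> b i [^] a' i)"
    unfolding a a' using b by (intro finprod_multf[symmetric]) auto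
  also have "\<dots> = (\<Otimes>i\<in>I. b i [^] (a i + a' i))"
    using b by (intro finprod_cong') (auto simp: int_pow_mult)
  finally show "x \<otimes> y \<in> lincombs"
    by (rule lincombI)
qed

lemma b_lincombs:
  assumes "finite I" "j \<in> I"
  shows "b j \<in> lincombs"
proof (rule lincombI)
  have "(\<Otimes>i\<in>I. b i [^] ((if j = i then 1 else 0) :: int)) = (\<Otimes>i\<in>I. if j = i then b i else \<one>)"
    using b by (intro finprod_cong') auto
  also have "\<dots> = b j"
    using assms b by (intro finprod_singleton) auto
  finally show "b j = (\<Otimes>i\<in>I. b i [^] ((if j = i then 1 else 0) :: int))"
    by simp
qed

lemma finite_lincombs: "finite I \<Longrightarrow> finite lincombs"
  unfolding lincombs_def by (intro finite_imageI finite_PiE) auto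

lemma basis_if_spanning:
  assumes "finite I" "carrier G \<subseteq> lincombs"
  shows "module_basis (residue_ring (int p)) (zmod_module G) I b"
proof (rule module_basisI)
  fix x assume "x \<in> carrier G"
  then obtain a where "a \<in> I \<rightarrow>\<^sub>E {0..<int p}" "x = (\<Otimes>i\<in>I. b i [^] (a i :: int))"
    using assms(2) by (auto simp: lincombs_def)
  then show "\<exists>F a. finite F \<and> F \<subseteq> I \<and> (\<forall>i\<in>F. a i \<in> {0..<int p}) \<and> x = (\<Otimes>i\<in>F. b i [^] (a i :: int))"
    using assms(1) by (intro exI[of _ I] exI[of _ a]) auto
qed

end

lemma finite_has_greatest:
  assumes "finite F" "F \<noteq> {}"
    and trans: "\<And>x y z. R x y \<Longrightarrow> R y z \<Longrightarrow> R x z"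
    and total: "\<And>x y. x \<in> F \<Longrightarrow> y \<in> F \<Longrightarrow> x \<noteq> y \<Longrightarrow> R x y \<or> R y x"
  shows "\<exists>v\<in>F. \<forall>w\<in>F. w \<noteq> v \<longrightarrow> R w v"
  using assms(1,2,4)
proof (induction F rule: finite_ne_induct)
  case (insert x F)
  then obtain v where v: "v \<in> F" "\<forall>w\<in>F. w \<noteq> v \<longrightarrow> R w v"
    by auto
  have "x \<noteq> v"
    using v insert by auto
  then consider "R x v" | "R v x"
    using insert.prems[of x v] v by auto
  then show ?case
  proof cases
    case 1
    then show ?thesis
      using v by auto
  next
    case 2
    have "R w x" if "w \<in> F" for w
      using v(2) that 2 trans[of w v x] by (cases "w = v") auto
    then show ?thesis
      by auto
  qed
qed simp

section \<open>The two bases\<close>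

locale lyndon_quotient = free_quotient S T X p n + ordered_alphabet X r
  for S :: "'a monoid" (structure) and T :: "'a topology" and X :: "'a set" and p n :: nat
    and r :: "'a rel"
begin

sublocale GS: generating_series S T p X r
  using free by unfold_locales (auto simp: free_profinite_def)

abbreviation \<tau> :: "'a list \<Rightarrow> 'a" where "\<tau> \<equiv> lyndon_commutator S X r"

definition W :: "'a list set" where "W = {w. Lyn w \<and> length w \<le> n}"

definition gen :: "'a list \<Rightarrow> 'a" where "gen w = \<tau> w [^] (p ^ (n - length w))"

text \<open>This is \<open>coef\<close> of \<open>word_representation\<close>, restated because the
  modulus, a parameter of that locale, depends on the word.\<close>

definition cf :: "'a list \<Rightarrow> 'a \<Rightarrow> int" where
  "cf w \<sigma> = magnus_coeff (residue_ring (int p ^ Suc (n - length w))) S T X w \<sigma> div int p ^ (n - length w)"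

text \<open>Short words come first: the coefficient at \<open>w\<close> vanishes on the power of a
  longer \<tau>, as the Magnus series of the latter has no term of degree \<open>length w\<close>.
  Alphabetical order decides within one length.\<close>

definition length_less :: "'a list \<Rightarrow> 'a list \<Rightarrow> bool" where
  "length_less u v \<longleftrightarrow> length u < length v \<or> length u = length v \<and> u \<prec>\<^sub>w v"

lemma W_word: "w \<in> W \<Longrightarrow> w \<in> lists X \<and> w \<noteq> [] \<and> length w \<le> n \<and> Lyn w"
  by (auto simp: W_def lyndon_def)

lemma gen_Ln: "w \<in> W \<Longrightarrow> gen w \<in> Ln"
  using GS.tau_power_L[of w "n - length w"] by (simp add: W_def gen_def)

lemma word_locale:
  assumes "w \<in> W"
  shows "word_representation_lyndon X (int p ^ Suc (n - length w)) S T p n (length w) w r"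
    and "quotient_word S T X p n (length w) (int p ^ Suc (n - length w)) w"
proof -
  have "1 < int p ^ Suc (n - length w)"
    using prime_p by (intro one_less_power) (auto dest: prime_gt_1_nat)
  moreover have "1 \<le> length w"
    using W_word[OF assms] by (cases w) auto
  ultimately show "word_representation_lyndon X (int p ^ Suc (n - length w)) S T p n (length w) w r"
    "quotient_word S T X p n (length w) (int p ^ Suc (n - length w)) w"
    using W_word[OF assms] free prime_p n linear by unfold_locales simp_all
qed

lemma cf_facts:
  assumes w: "w \<in> W"
  shows "\<And>\<sigma> \<sigma>'. \<sigma> \<in> Ln \<Longrightarrow> \<sigma>' \<in> Ln \<Longrightarrow> cf w (\<sigma> \<otimes> \<sigma>') = (cf w \<sigma> + cf w \<sigma>') mod int p"
    and "\<And>\<sigma>. \<sigma> \<in> S.L (Suc n) \<Longrightarrow> cf w \<sigma> = 0"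
    and "\<And>v. v \<in> W \<Longrightarrow> length_less w v \<or> \<not> set v \<subseteq> set w \<Longrightarrow> cf w (gen v) = 0"
    and "cf w (gen w) = 1"
    and "word_class p n S T X w \<in> carrier H"
    and "\<And>\<sigma>. \<sigma> \<in> Ln \<Longrightarrow> resid (word_class p n S T X w) \<sigma> = (- cf w \<sigma>) mod int p"
proof -
  interpret R: word_representation_lyndon X "int p ^ Suc (n - length w)" S T p n "length w" w r
    using w by (rule word_locale)
  interpret C: quotient_word S T X p n "length w" "int p ^ Suc (n - length w)" w
    using w by (rule word_locale)
  have cf: "cf w \<sigma> = R.coef \<sigma>" for \<sigma>
    by (simp only: cf_def R.coef_def)
  show "cf w (\<sigma> \<otimes> \<sigma>') = (cf w \<sigma> + cf w \<sigma>') mod int p" if "\<sigma> \<in> Ln" "\<sigma>' \<in> Ln" for \<sigma> \<sigma>'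
    unfolding cf using that by (rule R.coef_mult)
  show "cf w \<sigma> = 0" if "\<sigma> \<in> S.L (Suc n)" for \<sigma>
    unfolding cf using that by (rule R.coef_Suc)
  show "cf w (gen v) = 0" if "v \<in> W" "length_less w v \<or> \<not> set v \<subseteq> set w" for v
    unfolding cf gen_def using that W_word[OF that(1)]
    by (intro R.coef_tau_power) (auto simp: length_less_def)
  show "cf w (gen w) = 1"
    unfolding cf gen_def using W_word[OF w] by (intro R.coef_tau_power) auto
  show "word_class p n S T X w \<in> carrier H"
    by (rule C.word_class)
  show "resid (word_class p n S T X w) \<sigma> = (- cf w \<sigma>) mod int p" if "\<sigma> \<in> Ln" for \<sigma>
    unfolding cf using that by (rule C.word_class)
qed

lemma length_less_trans: "length_less u v \<Longrightarrow> length_less v w \<Longrightarrow> length_less u w"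
  using word_less_trans by (auto simp: length_less_def)

lemma length_less_total: "u \<in> W \<Longrightarrow> v \<in> W \<Longrightarrow> u \<noteq> v \<Longrightarrow> length_less u v \<or> length_less v u"
  using word_less_total[of u v] W_word[of u] W_word[of v] by (auto simp: length_less_def)

lemma p_not_dvd: "\<not> int p dvd 1" "\<not> int p dvd (- 1) mod int p"
proof -
  have "1 < p"
    using prime_p by (rule prime_gt_1_nat)
  then show "\<not> int p dvd 1" "\<not> int p dvd (- 1) mod int p"
    by (auto simp: dvd_mod_iff)
qed

text \<open>The functionals evaluate residuals at the powers \<open>gen v\<close>. They separate
  classes because these powers generate \<open>Ln\<close> modulo \<open>S.L (Suc n)\<close>, and
  continuity of cochains gives finite support.\<close>

theorem cohomology_basis:
  "module_basis (residue_ring (int p)) (zmod_module H) W (word_class p n S T X)"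
proof -
  interpret F: functional_family H p W "word_class p n S T X" "\<lambda>v C. resid C (gen v)"
  proof unfold_locales
    show "prime p"
      by (rule prime_p)
    show "C [^]\<^bsub>H\<^esub> p = \<one>\<^bsub>H\<^esub>" if "C \<in> carrier H" for C
      using that by (rule H_exponent)
    show "word_class p n S T X w \<in> carrier H" if "w \<in> W" for w
      using that by (rule cf_facts)
    show "[resid (C \<otimes>\<^bsub>H\<^esub> D) (gen v) = resid C (gen v) + resid D (gen v)] (mod int p)"
      if "v \<in> W" "C \<in> carrier H" "D \<in> carrier H" for v C D
      using that gen_Ln by (intro resid_mult) auto
    fix F :: "'a list set" assume F: "finite F" "F \<subseteq> W" "F \<noteq> {}"
    \<comment> \<open>The greatest word: the classes of all smaller words vanish on its
      power.\<close>
    then obtain v where v: "v \<in> F" "\<forall>w\<in>F. w \<noteq> v \<longrightarrow> length_less w v"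
      using finite_has_greatest[of F length_less] length_less_trans length_less_total by blast
    have vW: "v \<in> W"
      using v F by blast
    have "int p dvd resid (word_class p n S T X w) (gen v)" if "w \<in> F" "w \<noteq> v" for w
      using that v F gen_Ln[OF vW] cf_facts(6)[of w "gen v"] cf_facts(3)[of w v] vW by auto
    moreover have "\<not> int p dvd resid (word_class p n S T X v) (gen v)"
      using cf_facts(6)[OF vW gen_Ln[OF vW]] cf_facts(4)[OF vW] p_not_dvd by simp
    ultimately show "\<exists>v\<in>F. \<not> int p dvd resid (word_class p n S T X v) (gen v) \<and>
        (\<forall>w\<in>F. w \<noteq> v \<longrightarrow> int p dvd resid (word_class p n S T X w) (gen v))"
      using v(1) by blast
  qed
  show ?thesis
  proof (rule F.basis_if_separating)
    fix C assume C: "C \<in> carrier H"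
    then obtain c b where c: "c \<in> carrier CG" "trivializes c b" "C = cls c"
      by (rule H_cases)
    have residC: "resid C m = residual b m" if "m \<in> Ln" for m
      using resid_cls[OF c(1,2) that] c(3) by simp
    show "C = \<one>\<^bsub>H\<^esub>" if 0: "\<And>v. v \<in> W \<Longrightarrow> int p dvd resid C (gen v)"
    proof (rule resid_eq_0[OF C])
      have "residual b (gen v) = 0" if v: "v \<in> W" for v
        using 0[OF v] residC[OF gen_Ln[OF v]] by (simp add: residual_def dvd_mod_iff mod_eq_0_iff_dvd)
      then have "\<tau> w [^] (p ^ (n - length w)) \<in> {m \<in> Ln. residual b m = 0}"
        if "Lyn w" "length w \<le> n" for w
        using that gen_Ln[of w] by (simp add: W_def gen_def)
      moreover have "1 \<le> n"
        using n by simp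
      \<comment> \<open>The kernel of the residual is a closed subgroup that contains
        \<open>S.L (Suc n)\<close> and all the powers, hence everything.\<close>
      ultimately have "Ln \<subseteq> {m \<in> Ln. residual b m = 0}"
        using GS.L_subset_if_tau_powers[OF _ subgroup_residual[OF c(2)] residual_L_Suc[OF c(2)]]
        by blast
      then show "resid C m = 0" if "m \<in> Ln" for m
        using residC[OF that] that by auto
    qed
    \<comment> \<open>The locally constant cochain \<open>b\<close> is constant on an open normal
      subgroup \<open>M\<close>, which contains all letters outside the finite set
      \<open>X0\<close>. A word with such a letter has its power in \<open>M\<close>, where the
      residual vanishes.\<close>
    have "openin T {s \<in> topspace T. b s = b \<one>}"
      using c(2) unfolding trivializes_def by (blast intro: continuous_map_discreteD)
    moreover have "\<one> \<in> {s \<in> topspace T. b s = b \<one>}"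
      by (simp add: S.topspace_eq)
    ultimately obtain M where M: "M \<lhd> S" "openin T M" "M \<subseteq> {s \<in> topspace T. b s = b \<one>}"
      using S.open_normal_subgroup_base by metis
    define X0 where "X0 = {x \<in> X. x \<notin> M}"
    have "finite X0"
      using free M unfolding X0_def by (auto simp: free_profinite_def converges_to_one_def)
    define F where "F = {w \<in> W. set w \<subseteq> X0}"
    have "finite F"
      by (rule finite_subset[OF _ finite_lists_length_le[OF \<open>finite X0\<close>, of n]]) (auto simp: F_def W_def)
    moreover have "int p dvd resid C (gen v) \<and> (\<forall>w\<in>F. int p dvd resid (word_class p n S T X w) (gen v))"
      if v: "v \<in> W - F" for v
    proof -
      have vW: "v \<in> W"
        using v by blast
      obtain x where x: "x \<in> set v" "x \<notin> X0"
        using v by (auto simp: F_def)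
      then have "x \<in> M"
        using W_word[OF vW] by (auto simp: X0_def)
      then have "\<tau> v \<in> M"
        using GS.tau_mem_normal[OF M(1) _ x(1)] W_word[OF vW] by blast
      moreover have "subgroup M S"
        using M(1) by (rule normal_imp_subgroup)
      ultimately have "\<tau> v [^] k \<in> M" for k :: nat
        by (induction k) (auto intro: subgroup.one_closed subgroup.m_closed)
      then have "gen v \<in> M"
        by (simp add: gen_def)
      then have "residual b (gen v) = 0"
        using M(3) by (auto simp: residual_def)
      then have "int p dvd resid C (gen v)"
        using residC[OF gen_Ln[OF vW]] by simp
      \<comment> \<open>A letter of \<open>v\<close> is missing from \<open>w\<close>, so the
        coefficient vanishes whatever the lengths of the two words are.\<close>
      moreover have "int p dvd resid (word_class p n S T X w) (gen v)" if w: "w \<in> F" for w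
      proof -
        have "w \<in> W" "\<not> set v \<subseteq> set w"
          using w x by (auto simp: F_def)
        then show ?thesis
          using cf_facts(6)[of w "gen v"] cf_facts(3)[of w v] vW gen_Ln[OF vW] by simp
      qed
      ultimately show ?thesis
        by blast
    qed
    ultimately show "\<exists>F. finite F \<and> F \<subseteq> W \<and> (\<forall>v\<in>W - F. int p dvd resid C (gen v) \<and>
        (\<forall>w\<in>F. int p dvd resid (word_class p n S T X w) (gen v)))"
      by (intro exI[of _ F]) (auto simp: F_def)
  qed
qed

section \<open>The graded piece as an elementary abelian p-group and its basis\<close>

abbreviation L' :: "'a set" where "L' \<equiv> S.L (Suc n)"

abbreviation Sn :: "'a monoid" where "Sn \<equiv> S\<lparr>carrier := Ln\<rparr>"

lemma L'_subset: "L' \<subseteq> Ln"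
  by (rule S.L_Suc_subset)

lemma Sn_group: "group Sn"
  using S.L_subgroup by (rule S.subgroup_imp_group)

lemma L'_normal: "L' \<lhd> Sn"
proof -
  interpret Sn: group Sn by (rule Sn_group)
  show ?thesis
  proof (rule Sn.normal_invI)
    show "subgroup L' Sn"
      using S.L_subgroup L'_subset by (intro S.subgroup_incl)
    show "x \<otimes>\<^bsub>Sn\<^esub> h \<otimes>\<^bsub>Sn\<^esub> inv\<^bsub>Sn\<^esub> x \<in> L'" if "x \<in> carrier Sn" "h \<in> L'" for x h
      using that S.L_conj[of x h "Suc n"] S.m_inv_consistent[OF S.L_subgroup] by simp
  qed
qed

abbreviation gr :: "'a set monoid" where "gr \<equiv> Sn Mod L'"

lemma gr_carrier: "carrier gr = (\<lambda>x. L' #> x) ` Ln"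
  by (auto simp: carrier_FactGroup r_coset_def)

lemma gr_mult: "x \<in> Ln \<Longrightarrow> y \<in> Ln \<Longrightarrow> (L' #> x) \<otimes>\<^bsub>gr\<^esub> (L' #> y) = L' #> (x \<otimes> y)"
  using normal.rcos_sum[OF L'_normal, of x y] by (simp add: r_coset_def)

lemma gr_group: "group gr"
  using L'_normal by (rule normal.factorgroup_is_group)

lemma gr_pow: "x \<in> Ln \<Longrightarrow> (L' #> x) [^]\<^bsub>gr\<^esub> (k::nat) = L' #> (x [^] k)"
proof (induction k)
  case 0
  have "L' #> \<one> = L'"
    by (rule S.coset_mult_one) (rule S.L_subset)
  then show ?case
    by simp
next
  case (Suc k)
  then show ?case
    using gr_mult[of "x [^] k" x] S.pow_L by simp
qed

lemma L'_coset: "x \<in> carrier S \<Longrightarrow> L' #> x = L' \<longleftrightarrow> x \<in> L'"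
  using normal.rcos_eq_self_iff[OF S.L_normal] .

lemma gr_elementary: "elementary_group gr p"
proof -
  interpret gr: group gr by (rule gr_group)
  have "C \<otimes>\<^bsub>gr\<^esub> D = D \<otimes>\<^bsub>gr\<^esub> C" if CD: "C \<in> carrier gr" "D \<in> carrier gr" for C D
  proof -
    obtain x y where xy: "C = L' #> x" "D = L' #> y" "x \<in> Ln" "y \<in> Ln"
      using CD unfolding gr_carrier by auto
    have c: "gcommutator S x y \<in> L'"
      using xy n by (intro S.comm_L_right) auto
    have xyS: "x \<in> carrier S" "y \<in> carrier S"
      using xy by auto
    have "L' #> (y \<otimes> x \<otimes> gcommutator S x y) = L' #> (y \<otimes> x \<otimes> \<one>)"
      using xyS c L'_coset S.coset_mult_one[OF S.L_subset]
      by (intro normal.rcos_mult_cong[OF S.L_normal]) auto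
    then show ?thesis
      using xy xyS gr_mult S.mult_swap_gcommutator[OF xyS] by simp
  qed
  then have "comm_group gr"
    by (rule gr.group_comm_groupI)
  moreover have "C [^]\<^bsub>gr\<^esub> p = \<one>\<^bsub>gr\<^esub>" if C: "C \<in> carrier gr" for C
  proof -
    obtain x where x: "C = L' #> x" "x \<in> Ln"
      using C unfolding gr_carrier by auto
    have "x [^] p \<in> L'"
      using x n by (intro S.pow_p_L) auto
    then show ?thesis
      using x gr_pow L'_coset[of "x [^] p"] by simp
  qed
  ultimately show ?thesis
    using prime_p by (simp add: elementary_group_def elementary_group_axioms_def)
qed

definition cf_coset :: "'a list \<Rightarrow> 'a set \<Rightarrow> int" where "cf_coset v C = cf v (SOME x. x \<in> C)"

lemma cf_range: "v \<in> W \<Longrightarrow> x \<in> Ln \<Longrightarrow> cf v x mod int p = cf v x"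
  using cf_facts(1)[of v \<one> x] cf_facts(2)[of v \<one>] by simp

lemma cf_coset:
  assumes "v \<in> W" "x \<in> Ln"
  shows "cf_coset v (L' #> x) = cf v x"
proof -
  define y where "y = (SOME y. y \<in> L' #> x)"
  have "x \<in> L' #> x"
    using assms S.rcos_self[OF _ S.L_subgroup] by simp
  then have "y \<in> L' #> x"
    unfolding y_def by (rule someI[of "\<lambda>y. y \<in> L' #> x"])
  then obtain l where l: "l \<in> L'" "y = l \<otimes> x"
    by (auto simp: r_coset_def)
  have "cf v y = (cf v l + cf v x) mod int p"
    using l L'_subset assms by (auto intro: cf_facts(1))
  then show ?thesis
    using cf_facts(2)[OF assms(1) l(1)] cf_range[OF assms] by (simp add: cf_coset_def y_def)
qed

text \<open>The same matrix with the roles exchanged: coefficients are now the functionals and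
  powers the vectors. Finiteness of \<open>X\<close> makes the set of words finite, and topological
  generation becomes spanning because the span is finite.\<close>

theorem graded_basis:
  assumes X: "finite X"
  shows "module_basis (residue_ring (int p)) (zmod_module gr) W (\<lambda>w. L' #> gen w)"
proof -
  interpret gr: elementary_group gr p by (rule gr_elementary)
  interpret F: functional_family gr p W "\<lambda>w. L' #> gen w" cf_coset
  proof unfold_locales
    show "L' #> gen w \<in> carrier gr" if "w \<in> W" for w
      using that gen_Ln unfolding gr_carrier by blast
    show "[cf_coset v (C \<otimes>\<^bsub>gr\<^esub> D) = cf_coset v C + cf_coset v D] (mod int p)"
      if v: "v \<in> W" and CD: "C \<in> carrier gr" "D \<in> carrier gr" for v C D
    proof -
      obtain x y where xy: "C = L' #> x" "D = L' #> y" "x \<in> Ln" "y \<in> Ln"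
        using CD unfolding gr_carrier by auto
      then have "cf_coset v (C \<otimes>\<^bsub>gr\<^esub> D) = cf v (x \<otimes> y)"
        using v gr_mult S.mult_L cf_coset by simp
      then show ?thesis
        using cf_facts(1)[OF v xy(3,4)] xy cf_coset[OF v] by (simp add: cong_def)
    qed
    fix F :: "'a list set" assume F: "finite F" "F \<subseteq> W" "F \<noteq> {}"
    \<comment> \<open>The least word this time: its coefficient vanishes on the powers of all larger
      words.\<close>
    then obtain v where v: "v \<in> F" "\<forall>w\<in>F. w \<noteq> v \<longrightarrow> length_less v w"
      using finite_has_greatest[of F "\<lambda>u v. length_less v u"] length_less_trans length_less_total by blast
    have vW: "v \<in> W"
      using v F by blast
    have "int p dvd cf_coset v (L' #> gen w)" if "w \<in> F" "w \<noteq> v" for w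
      using that v F cf_coset[OF vW gen_Ln] cf_facts(3)[OF vW, of w] by auto
    moreover have "\<not> int p dvd cf_coset v (L' #> gen v)"
      using cf_coset[OF vW gen_Ln[OF vW]] cf_facts(4)[OF vW] p_not_dvd by simp
    ultimately show "\<exists>v\<in>F. \<not> int p dvd cf_coset v (L' #> gen v) \<and>
        (\<forall>w\<in>F. w \<noteq> v \<longrightarrow> int p dvd cf_coset v (L' #> gen w))"
      using v(1) by blast
  qed
  have finW: "finite W"
    by (rule finite_subset[OF _ finite_lists_length_le[OF X, of n]]) (auto simp: W_def lyndon_def)
  define K where "K = {x \<in> Ln. L' #> x \<in> F.lincombs}"
  have "Ln \<subseteq> K"
  proof (rule GS.L_subset_if_tau_powers)
    show "1 \<le> n"
      using n by simp
    show "subgroup K S"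
    proof (rule S.subgroupI)
      have "L' #> \<one> \<in> F.lincombs"
        using subgroup.one_closed[OF F.subgroup_lincombs] L'_coset[of \<one>] by simp
      then have "\<one> \<in> K"
        by (simp add: K_def)
      then show "K \<noteq> {}"
        by blast
      fix x assume x: "x \<in> K"
      then have xL: "x \<in> Ln" "x \<in> carrier S" "inv x \<in> Ln"
        using S.inv_L by (auto simp: K_def)
      have "(L' #> inv x) \<otimes>\<^bsub>gr\<^esub> (L' #> x) = \<one>\<^bsub>gr\<^esub>"
        using gr_mult[OF xL(3,1)] xL(2) L'_coset[of \<one>] by simp
      moreover have "L' #> x \<in> carrier gr" "L' #> inv x \<in> carrier gr"
        using xL unfolding gr_carrier by blast+
      ultimately have "L' #> inv x = inv\<^bsub>gr\<^esub> (L' #> x)"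
        by (metis gr.inv_equality)
      then show "inv x \<in> K"
        using x xL subgroup.m_inv_closed[OF F.subgroup_lincombs] by (simp add: K_def)
      fix y assume y: "y \<in> K"
      then have "(L' #> x) \<otimes>\<^bsub>gr\<^esub> (L' #> y) \<in> F.lincombs"
        using x by (intro subgroup.m_closed[OF F.subgroup_lincombs]) (simp_all add: K_def)
      then show "x \<otimes> y \<in> K"
        using x y gr_mult[of x y] S.mult_L[of x n y] by (simp add: K_def del: mult_FactGroup)
    qed (auto simp: K_def)
    \<comment> \<open>Each fibre is a coset of the closed subgroup \<open>L'\<close>, and the
      preimage \<open>K\<close> of the span is a finite union of fibres.\<close>
    have "closedin T {x \<in> Ln. L' #> x = C}" if "C \<in> F.lincombs" for C
    proof -
      have "C \<in> carrier gr"
        using that subgroup.subset[OF F.subgroup_lincombs] by blast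
      then obtain y where y: "y \<in> Ln" "C = L' #> y"
        unfolding gr_carrier by auto
      have "L' #> x = C \<longleftrightarrow> x \<otimes> inv y \<in> L'" if "x \<in> Ln" for x
        unfolding y(2) using that y(1) by (intro normal.rcos_eq_iff[OF S.L_normal]) auto
      then have "{x \<in> Ln. L' #> x = C} = {x \<in> Ln. x \<otimes> inv y \<in> L'}"
        by (intro Collect_cong) blast
      moreover have "closedin T {x \<in> Ln. x \<otimes> inv y \<in> L'}"
        using y by (intro S.closedin_preimage_Int S.continuous_map_mult S.continuous_map_const_id S.L_closed) auto
      ultimately show ?thesis
        by simp
    qed
    then have "closedin T (\<Union>C\<in>F.lincombs. {x \<in> Ln. L' #> x = C})"
      using F.finite_lincombs[OF finW] by (intro closedin_Union) auto
    moreover have "(\<Union>C\<in>F.lincombs. {x \<in> Ln. L' #> x = C}) = K"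
      by (auto simp: K_def)
    ultimately show "closedin T K"
      by simp
    show "S.L (Suc n) \<subseteq> K"
    proof
      fix x assume x: "x \<in> L'"
      then have "L' #> x = \<one>\<^bsub>gr\<^esub>"
        using L'_coset[of x] by simp
      then show "x \<in> K"
        using x L'_subset subgroup.one_closed[OF F.subgroup_lincombs] by (auto simp: K_def)
    qed
    show "\<tau> w [^] (p ^ (n - length w)) \<in> K" if "Lyn w" "length w \<le> n" for w
      using that F.b_lincombs[OF finW, of w] gen_Ln[of w] by (simp add: K_def gen_def W_def)
  qed
  then have "carrier gr \<subseteq> F.lincombs"
    unfolding gr_carrier by (auto simp: K_def)
  then show ?thesis
    by (rule F.basis_if_spanning[OF finW])
qed

end

theorem theorem8p5:
  fixes S :: "'a monoid" and T :: "'a topology" and X :: "'a set" and r :: "'a rel"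
    and p n :: nat
  assumes "prime p"
    and "X \<noteq> {}" and "linear_order_on X r"
    and "free_profinite S T X"
    and "2 \<le> n"
  shows "module_basis (residue_ring (int p))
           (zmod_module (H2 (p_quotient S T p n) (p_quotient_topology S T p n) (integer_mod_group p)))
           {w. lyndon X r w \<and> length w \<le> n}
           (\<lambda>w. word_class p n S T X w) \<and>
         (finite X \<longrightarrow>
         module_basis (residue_ring (int p))
           (zmod_module (S\<lparr>carrier := lower_p_central S T p n\<rparr> Mod lower_p_central S T p (n + 1)))
           {w. lyndon X r w \<and> length w \<le> n}
           (\<lambda>w. lower_p_central S T p (n + 1) #>\<^bsub>S\<^esub>
                  (lyndon_commutator S X r w [^]\<^bsub>S\<^esub> (p ^ (n - length w)))))"
proof -
  interpret lyndon_quotient S T X p n r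
    using assms by unfold_locales
  show ?thesis
    using cohomology_basis graded_basis unfolding W_def gen_def by simp
qed

end
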